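(* Suppose that, with all notation as defined in the context, the following conditions hold. (Sampling) $\mathbb{C}[U_{i,n},U_{j,n}\mid\mathcal{X}_n,\mathcal{W}_n]=0$ for $i\neq j$, and $\max_{1\le i\le N_n}\#\mathcal{T}_{i,n}=O(1)$, where $\#\mathcal{T}_{i,n}$ is the cardinality of $\mathcal{T}_{i,n}$ and $\{\mathcal{T}_{i,n}:1\le i\le N_n\}$ is a partition of $\{1,\ldots,n\}$ such that $\{(U_{t,n},\mathbf{V}_{t,n}):t\in\mathcal{T}_{i,n}\}$ are independent over $i$ conditional on $\mathcal{W}_n$. (Design) $\mathbb{P}[\lambda_{\min}(\sum_{i=1}^n\mathbf{w}_{i,n}\mathbf{w}_{i,n}')>0]\to1$, $\limsup_{n\to\infty}K_n/n<1$, and $\mathcal{C}_n=O_p(1)$. (Approximations) $\chi_n=O(1)$, $\varrho_n+n(\varrho_n-\rho_n)+n\chi_n\varrho_n=o(1)$, and $\max_{1\le i\le n}\|\hat{\mathbf{v}}_{i,n}\|/\sqrt{n}=o_p(1)$. Then, as $n\to\infty$, $$\mathbf{\Omega}_n^{-1/2}\sqrt{n}(\hat{\boldsymbol{\beta}}_n-\boldsymbol{\beta})\to_d\mathcal{N}(\mathbf{0},\mathbf{I}),\qquad \mathbf{\Omega}_n=\hat{\mathbf{\Gamma}}_n^{-1}\mathbf{\Sigma}_n\hat{\mathbf{\Gamma}}_n^{-1},$$ where $\mathbf{\Sigma}_n=\frac1n\sum_{i=1}^n\hat{\mathbf{v}}_{i,n}\hat{\mathbf{v}}_{i,n}'\,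\mathbb{E}[U_{i,n}^2\mid\mathcal{X}_n,\mathcal{W}_n]$.
   Context: Model. For each $n$, $\{(y_{i,n},\mathbf{x}_{i,n}',\mathbf{w}_{i,n}'):1\le i\le n\}$ is generated by $$y_{i,n}=\boldsymbol{\beta}'\mathbf{x}_{i,n}+\boldsymbol{\gamma}_n'\mathbf{w}_{i,n}+u_{i,n},\qquad i=1,\ldots,n,$$ where $y_{i,n}$ is a scalar outcome, $\mathbf{x}_{i,n}$ is a random vector of fixed dimension $d$, $\mathbf{w}_{i,n}$ is a random vector of dimension $K_n$ (which may grow with $n$), and $u_{i,n}$ is an unobserved scalar error. All limits are as $n\to\infty$. $\|\cdot\|$ is the Euclidean norm, $\lambda_{\min}(\cdot)$ the minimum eigenvalue, $\mathbf{1}(\cdot)$ the indicator function, and $\mathbb{C}[\cdot,\cdot\mid\cdot]$ conditional covariance. Estimator. Let $M_{ij,n}=\mathbf{1}(i=j)-\mathbf{w}_{i,n}'(\sum_{k=1}^n\mathbf{w}_{k,n}\mathbf{w}_{k,n}')^{-1}\mathbf{w}_{j,n}$, $\hat{\mathbf{v}}_{i,n}=\sum_{j=1}^nM_{ij,n}\mathbf{x}_{j,n}$, $\hat{\mathbf{\Gamma}}_n=\frac1n\sum_{i=1}^n\hat{\mathbf{v}}_{i,n}\hat{\mathbf{v}}_{i,n}'$, and let $$\hat{\boldsymbol{\beta}}_n=\Big(\sum_{i=1}^n\hat{\mathbf{v}}_{i,n}\hat{\mathbf{v}}_{i,n}'\Big)^{-1}\Big(\sum_{i=1}^n\hat{\mathbf{v}}_{i,n}y_{i,n}\Big)$$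 be the OLS estimator of $\boldsymbol{\beta}$. The relevant moments and inverses are assumed to exist; sample statistics may be given arbitrary values on events, of probability tending to zero, where an inverse or square root fails to exist. Further quantities. $\mathcal{X}_n=(\mathbf{x}_{1,n},\ldots,\mathbf{x}_{n,n})$, and $\mathcal{W}_n$ is a collection of random variables satisfying $\mathbb{E}[\mathbf{w}_{i,n}\mid\mathcal{W}_n]=\mathbf{w}_{i,n}$. Define $$\varrho_n=\frac1n\sum_{i=1}^n\mathbb{E}[R_{i,n}^2],\quad R_{i,n}=\mathbb{E}[u_{i,n}\mid\mathcal{X}_n,\mathcal{W}_n],$$ $$\rho_n=\frac1n\sum_{i=1}^n\mathbb{E}[r_{i,n}^2],\quad r_{i,n}=\mathbb{E}[u_{i,n}\mid\mathcal{W}_n],$$ $$\chi_n=\frac1n\sum_{i=1}^n\mathbb{E}[\|\mathbf{Q}_{i,n}\|^2],\quad\mathbf{Q}_{i,n}=\mathbb{E}[\mathbf{v}_{i,n}\mid\mathcal{W}_n],$$ where $\mathbf{v}_{i,n}=\mathbf{x}_{i,n}-(\sum_{j=1}^n\mathbb{E}[\mathbf{x}_{j,n}\mathbf{w}_{j,n}'])(\sum_{j=1}^n\mathbb{E}[\mathbf{w}_{j,n}\mathbf{w}_{j,n}'])^{-1}\mathbf{w}_{i,n}$. Let $U_{i,n}=y_{i,n}-\mathbb{E}[y_{i,n}\mid\mathcal{X}_n,\mathcal{W}_n]$, $\mathbf{V}_{i,n}=\mathbf{x}_{i,n}-\mathbb{E}[\mathbf{x}_{i,n}\mid\mathcal{W}_n]$,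 $\tilde{\mathbf{V}}_{i,n}=\sum_{j=1}^nM_{ij,n}\mathbf{V}_{j,n}$, $\tilde{\mathbf{\Gamma}}_n=\frac1n\sum_{i=1}^n\tilde{\mathbf{V}}_{i,n}\tilde{\mathbf{V}}_{i,n}'$, and $$\mathcal{C}_n=\max_{1\le i\le n}\Big\{\mathbb{E}[U_{i,n}^4\mid\mathcal{X}_n,\mathcal{W}_n]+\mathbb{E}[\|\mathbf{V}_{i,n}\|^4\mid\mathcal{W}_n]+\frac{1}{\mathbb{E}[U_{i,n}^2\mid\mathcal{X}_n,\mathcal{W}_n]}\Big\}+\frac{1}{\lambda_{\min}(\mathbb{E}[\tilde{\mathbf{\Gamma}}_n\mid\mathcal{W}_n])}.$$ *)

theory Defs
  imports
    "HOL-Probability.Probability"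
    "HOL-Library.Landau_Symbols"
    "Jordan_Normal_Form.Gauss_Jordan_Elimination"
    "Jordan_Normal_Form.Spectral_Radius"
begin

text \<open>
  Vectors and matrices whose dimension is fixed along the sequence have types \<open>real ^ 'd\<close> and
  \<open>real ^ 'd ^ 'd\<close>; those of dimension \<open>K\<close> growing with the sample size have the types
  \<open>real Matrix.vec\<close> and \<open>real Matrix.mat\<close>.  The infix symbols that the two developments
  share are kept for the former.
\<close>

no_notation vec_index (infixl "$" 100)
no_notation scalar_prod (infix "\<bullet>" 70)


subsection \<open>Linear algebra\<close>

definition lambda_min :: "real ^ 'd ^ 'd \<Rightarrow> real" where
  "lambda_min A = Min {l. \<exists>v. v \<noteq> 0 \<and> A *v v = l *\<^sub>R v}"

definition lambda_min_mat :: "real Matrix.mat \<Rightarrow> real" where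
  "lambda_min_mat A = Min (spectrum A)"

text \<open>The value at singular matrices is an arbitrary convention.\<close>

definition mat_inv :: "real Matrix.mat \<Rightarrow> real Matrix.mat" where
  "mat_inv A = (case mat_inverse A of Some B \<Rightarrow> B | None \<Rightarrow> 0\<^sub>m (dim_row A) (dim_col A))"

definition outer :: "real ^ 'd \<Rightarrow> real ^ 'd ^ 'd" where
  "outer v = (\<chi> a b. v $ a * v $ b)"

definition psd :: "real ^ 'd ^ 'd \<Rightarrow> bool" where
  "psd A \<longleftrightarrow> Finite_Cartesian_Product.transpose A = A \<and> (\<forall>v. 0 \<le> v \<bullet> (A *v v))"

definition psd_sqrt :: "real ^ 'd ^ 'd \<Rightarrow> real ^ 'd ^ 'd" where
  "psd_sqrt A = (THE S. psd S \<and> S ** S = A)"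

definition inv_sqrt :: "real ^ 'd ^ 'd \<Rightarrow> real ^ 'd ^ 'd" where
  "inv_sqrt A = matrix_inv (psd_sqrt A)"


subsection \<open>Conditioning\<close>

text \<open>The \<open>\<sigma>\<close>-algebra generated by a collection of random variables.\<close>

definition generated_algebra :: "'a measure \<Rightarrow> ('a \<Rightarrow> real) set \<Rightarrow> 'a measure" where
  "generated_algebra M S =
     sigma (space M) (\<Union>f\<in>S. sets (vimage_algebra (space M) f borel))"

definition cond_exp_vec ::
    "'a measure \<Rightarrow> 'a measure \<Rightarrow> ('a \<Rightarrow> real ^ 'd) \<Rightarrow> 'a \<Rightarrow> real ^ 'd" where
  "cond_exp_vec M F f \<omega> = (\<chi> a. real_cond_exp M F (\<lambda>\<omega>. f \<omega> $ a) \<omega>)"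

definition cond_exp_mat ::
    "'a measure \<Rightarrow> 'a measure \<Rightarrow> ('a \<Rightarrow> real ^ 'd ^ 'd) \<Rightarrow> 'a \<Rightarrow> real ^ 'd ^ 'd" where
  "cond_exp_mat M F f \<omega> = (\<chi> a b. real_cond_exp M F (\<lambda>\<omega>. f \<omega> $ a $ b) \<omega>)"

definition cond_cov ::
    "'a measure \<Rightarrow> 'a measure \<Rightarrow> ('a \<Rightarrow> real) \<Rightarrow> ('a \<Rightarrow> real) \<Rightarrow> 'a \<Rightarrow> real" where
  "cond_cov M F f g =
     real_cond_exp M F (\<lambda>\<omega>. (f \<omega> - real_cond_exp M F f \<omega>) * (g \<omega> - real_cond_exp M F g \<omega>))"

text \<open>Conditional version of \<^const>\<open>prob_space.indep_sets\<close>.\<close>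

definition cond_indep_sets ::
    "'a measure \<Rightarrow> 'a measure \<Rightarrow> ('i \<Rightarrow> 'a set set) \<Rightarrow> 'i set \<Rightarrow> bool" where
  "cond_indep_sets M F H I \<longleftrightarrow> (\<forall>i\<in>I. H i \<subseteq> sets M) \<and>
     (\<forall>J\<subseteq>I. J \<noteq> {} \<longrightarrow> finite J \<longrightarrow> (\<forall>A\<in>Pi J H. AE \<omega> in M.
        real_cond_exp M F (indicator (\<Inter>j\<in>J. A j)) \<omega> =
        (\<Prod>j\<in>J. real_cond_exp M F (indicator (A j)) \<omega>)))"


subsection \<open>Modes of convergence\<close>

text \<open>The probability space is allowed to vary along the sequence.\<close>

definition bounded_in_prob :: "(nat \<Rightarrow> 'a measure) \<Rightarrow> (nat \<Rightarrow> 'a \<Rightarrow> ennreal) \<Rightarrow> bool" where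
  "bounded_in_prob M Z \<longleftrightarrow> (\<forall>\<epsilon>>0. \<exists>B::real. \<forall>\<^sub>F n in sequentially.
     measure (M n) {\<omega> \<in> space (M n). Z n \<omega> > ennreal B} < \<epsilon>)"

definition vanishes_in_prob :: "(nat \<Rightarrow> 'a measure) \<Rightarrow> (nat \<Rightarrow> 'a \<Rightarrow> real) \<Rightarrow> bool" where
  "vanishes_in_prob M Z \<longleftrightarrow> (\<forall>\<epsilon>>0.
     (\<lambda>n. measure (M n) {\<omega> \<in> space (M n). \<bar>Z n \<omega>\<bar> > \<epsilon>}) \<longlonglongrightarrow> 0)"

definition weak_conv_vec ::
    "(nat \<Rightarrow> 'b::euclidean_space measure) \<Rightarrow> 'b measure \<Rightarrow> bool" where
  "weak_conv_vec \<mu> \<nu> \<longleftrightarrow> (\<forall>f::'b \<Rightarrow> real. continuous_on UNIV f \<longrightarrow> bounded (range f) \<longrightarrow>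
     (\<lambda>n. integral\<^sup>L (\<mu> n) f) \<longlonglongrightarrow> integral\<^sup>L \<nu> f)"

definition std_normal_vec :: "(real ^ 'd) measure" where
  "std_normal_vec = density lborel (\<lambda>z. ennreal (\<Prod>a\<in>UNIV. std_normal_density (z $ a)))"


subsection \<open>Regression with many covariates\<close>

text \<open>
  In what follows \<open>n\<close> is fixed: the sample is \<open>y i\<close>, \<open>x i\<close>, \<open>w i\<close> with
  \<open>1 \<le> i \<le> n\<close>, and \<open>Ws\<close> is the collection of random variables on which the
  covariates \<open>w\<close> are conditioned.  Applied to \<open>x\<close>, \<open>partial_out\<close> below yields the
  residuals \<open>v_hat\<close>; applied to \<open>V_err\<close>, it yields \<open>V_tilde\<close>.  \<open>rho_XW\<close> and \<open>rho_W\<close> are the mean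
  squares of \<open>E[u i | X, W]\<close> and of \<open>E[u i | W]\<close>.
\<close>

definition gram ::
    "nat \<Rightarrow> nat \<Rightarrow> (nat \<Rightarrow> 'a \<Rightarrow> real Matrix.vec) \<Rightarrow> 'a \<Rightarrow> real Matrix.mat" where
  "gram n K w \<omega> = Matrix.mat K K
     (\<lambda>(k, l). \<Sum>i=1..n. vec_index (w i \<omega>) k * vec_index (w i \<omega>) l)"

definition annihilator ::
    "nat \<Rightarrow> nat \<Rightarrow> (nat \<Rightarrow> 'a \<Rightarrow> real Matrix.vec) \<Rightarrow> nat \<Rightarrow> nat \<Rightarrow> 'a \<Rightarrow> real" where
  "annihilator n K w i j \<omega> =
     of_bool (i = j) - scalar_prod (w i \<omega>) (mat_inv (gram n K w \<omega>) *\<^sub>v w j \<omega>)"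

definition partial_out ::
    "nat \<Rightarrow> nat \<Rightarrow> (nat \<Rightarrow> 'a \<Rightarrow> real Matrix.vec) \<Rightarrow> (nat \<Rightarrow> 'a \<Rightarrow> real ^ 'd)
     \<Rightarrow> nat \<Rightarrow> 'a \<Rightarrow> real ^ 'd" where
  "partial_out n K w z i \<omega> = (\<Sum>j=1..n. annihilator n K w i j \<omega> *\<^sub>R z j \<omega>)"

definition Gamma_hat ::
    "nat \<Rightarrow> nat \<Rightarrow> (nat \<Rightarrow> 'a \<Rightarrow> real Matrix.vec) \<Rightarrow> (nat \<Rightarrow> 'a \<Rightarrow> real ^ 'd)
     \<Rightarrow> 'a \<Rightarrow> real ^ 'd ^ 'd" where
  "Gamma_hat n K w x \<omega> = (1 / real n) *\<^sub>R (\<Sum>i=1..n. outer (partial_out n K w x i \<omega>))"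

definition beta_hat ::
    "nat \<Rightarrow> nat \<Rightarrow> (nat \<Rightarrow> 'a \<Rightarrow> real Matrix.vec) \<Rightarrow> (nat \<Rightarrow> 'a \<Rightarrow> real ^ 'd)
     \<Rightarrow> (nat \<Rightarrow> 'a \<Rightarrow> real) \<Rightarrow> 'a \<Rightarrow> real ^ 'd" where
  "beta_hat n K w x y \<omega> =
     matrix_inv (\<Sum>i=1..n. outer (partial_out n K w x i \<omega>)) *v
       (\<Sum>i=1..n. y i \<omega> *\<^sub>R partial_out n K w x i \<omega>)"

definition W_algebra :: "'a measure \<Rightarrow> ('a \<Rightarrow> real) set \<Rightarrow> 'a measure" where
  "W_algebra M Ws = generated_algebra M Ws"

definition XW_algebra ::
    "'a measure \<Rightarrow> ('a \<Rightarrow> real) set \<Rightarrow> nat \<Rightarrow> (nat \<Rightarrow> 'a \<Rightarrow> real ^ 'd) \<Rightarrow> 'a measure" where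
  "XW_algebra M Ws n x = generated_algebra M ({\<lambda>\<omega>. x i \<omega> $ a | i a. i \<in> {1..n}} \<union> Ws)"

definition rho_XW ::
    "'a measure \<Rightarrow> ('a \<Rightarrow> real) set \<Rightarrow> nat \<Rightarrow> (nat \<Rightarrow> 'a \<Rightarrow> real ^ 'd)
     \<Rightarrow> (nat \<Rightarrow> 'a \<Rightarrow> real) \<Rightarrow> real" where
  "rho_XW M Ws n x u = (1 / real n) *
     (\<Sum>i=1..n. \<integral>\<omega>. (real_cond_exp M (XW_algebra M Ws n x) (u i) \<omega>)\<^sup>2 \<partial>M)"

definition rho_W ::
    "'a measure \<Rightarrow> ('a \<Rightarrow> real) set \<Rightarrow> nat \<Rightarrow> (nat \<Rightarrow> 'a \<Rightarrow> real) \<Rightarrow> real" where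
  "rho_W M Ws n u = (1 / real n) *
     (\<Sum>i=1..n. \<integral>\<omega>. (real_cond_exp M (W_algebra M Ws) (u i) \<omega>)\<^sup>2 \<partial>M)"

definition pop_gram ::
    "'a measure \<Rightarrow> nat \<Rightarrow> nat \<Rightarrow> (nat \<Rightarrow> 'a \<Rightarrow> real Matrix.vec) \<Rightarrow> real Matrix.mat" where
  "pop_gram M n K w = Matrix.mat K K
     (\<lambda>(k, l). \<Sum>j=1..n. \<integral>\<omega>. vec_index (w j \<omega>) k * vec_index (w j \<omega>) l \<partial>M)"

text \<open>
  The population cross moment of \<open>x\<close> and \<open>w\<close> has \<open>CARD('d)\<close> rows and \<open>K\<close> columns; it is
  handled row by row.
\<close>

definition pop_cross ::
    "'a measure \<Rightarrow> nat \<Rightarrow> nat \<Rightarrow> (nat \<Rightarrow> 'a \<Rightarrow> real Matrix.vec) \<Rightarrow> (nat \<Rightarrow> 'a \<Rightarrow> real ^ 'd)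
     \<Rightarrow> 'd \<Rightarrow> real Matrix.vec" where
  "pop_cross M n K w x a = Matrix.vec K
     (\<lambda>k. \<Sum>j=1..n. \<integral>\<omega>. x j \<omega> $ a * vec_index (w j \<omega>) k \<partial>M)"

definition pop_resid ::
    "'a measure \<Rightarrow> nat \<Rightarrow> nat \<Rightarrow> (nat \<Rightarrow> 'a \<Rightarrow> real Matrix.vec) \<Rightarrow> (nat \<Rightarrow> 'a \<Rightarrow> real ^ 'd)
     \<Rightarrow> nat \<Rightarrow> 'a \<Rightarrow> real ^ 'd" where
  "pop_resid M n K w x i \<omega> = x i \<omega> -
     (\<chi> a. scalar_prod (pop_cross M n K w x a) (mat_inv (pop_gram M n K w) *\<^sub>v w i \<omega>))"

definition chi_W ::
    "'a measure \<Rightarrow> ('a \<Rightarrow> real) set \<Rightarrow> nat \<Rightarrow> nat \<Rightarrow> (nat \<Rightarrow> 'a \<Rightarrow> real Matrix.vec)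
     \<Rightarrow> (nat \<Rightarrow> 'a \<Rightarrow> real ^ 'd) \<Rightarrow> real" where
  "chi_W M Ws n K w x = (1 / real n) *
     (\<Sum>i=1..n. \<integral>\<omega>. (norm (cond_exp_vec M (W_algebra M Ws) (pop_resid M n K w x i) \<omega>))\<^sup>2 \<partial>M)"

definition U_err ::
    "'a measure \<Rightarrow> ('a \<Rightarrow> real) set \<Rightarrow> nat \<Rightarrow> (nat \<Rightarrow> 'a \<Rightarrow> real ^ 'd) \<Rightarrow> (nat \<Rightarrow> 'a \<Rightarrow> real)
     \<Rightarrow> nat \<Rightarrow> 'a \<Rightarrow> real" where
  "U_err M Ws n x y i \<omega> = y i \<omega> - real_cond_exp M (XW_algebra M Ws n x) (y i) \<omega>"

definition V_err ::
    "'a measure \<Rightarrow> ('a \<Rightarrow> real) set \<Rightarrow> (nat \<Rightarrow> 'a \<Rightarrow> real ^ 'd) \<Rightarrow> nat \<Rightarrow> 'a \<Rightarrow> real ^ 'd" where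
  "V_err M Ws x i \<omega> = x i \<omega> - cond_exp_vec M (W_algebra M Ws) (x i) \<omega>"

definition Gamma_tilde ::
    "'a measure \<Rightarrow> ('a \<Rightarrow> real) set \<Rightarrow> nat \<Rightarrow> nat \<Rightarrow> (nat \<Rightarrow> 'a \<Rightarrow> real Matrix.vec)
     \<Rightarrow> (nat \<Rightarrow> 'a \<Rightarrow> real ^ 'd) \<Rightarrow> 'a \<Rightarrow> real ^ 'd ^ 'd" where
  "Gamma_tilde M Ws n K w x \<omega> =
     (1 / real n) *\<^sub>R (\<Sum>i=1..n. outer (partial_out n K w (V_err M Ws x) i \<omega>))"

text \<open>
  Extended-valued, with conditional expectations of nonnegative variables, so that an infinite
  conditional moment and the reciprocal of zero both count as \<open>\<infinity>\<close>.  A negative minimum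
  eigenvalue, which has probability zero, is mapped to zero by \<^const>\<open>ennreal\<close>.
\<close>

definition C_bound ::
    "'a measure \<Rightarrow> ('a \<Rightarrow> real) set \<Rightarrow> nat \<Rightarrow> nat \<Rightarrow> (nat \<Rightarrow> 'a \<Rightarrow> real Matrix.vec)
     \<Rightarrow> (nat \<Rightarrow> 'a \<Rightarrow> real ^ 'd) \<Rightarrow> (nat \<Rightarrow> 'a \<Rightarrow> real) \<Rightarrow> 'a \<Rightarrow> ennreal" where
  "C_bound M Ws n K w x y \<omega> =
     (MAX i\<in>{1..n}.
        nn_cond_exp M (XW_algebra M Ws n x) (\<lambda>\<omega>. ennreal (U_err M Ws n x y i \<omega> ^ 4)) \<omega>
        + nn_cond_exp M (W_algebra M Ws) (\<lambda>\<omega>. ennreal (norm (V_err M Ws x i \<omega>) ^ 4)) \<omega>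
        + inverse (nn_cond_exp M (XW_algebra M Ws n x)
                     (\<lambda>\<omega>. ennreal ((U_err M Ws n x y i \<omega>)\<^sup>2)) \<omega>))
     + inverse (ennreal (lambda_min
         (cond_exp_mat M (W_algebra M Ws) (Gamma_tilde M Ws n K w x) \<omega>)))"

definition Sigma_n ::
    "'a measure \<Rightarrow> ('a \<Rightarrow> real) set \<Rightarrow> nat \<Rightarrow> nat \<Rightarrow> (nat \<Rightarrow> 'a \<Rightarrow> real Matrix.vec)
     \<Rightarrow> (nat \<Rightarrow> 'a \<Rightarrow> real ^ 'd) \<Rightarrow> (nat \<Rightarrow> 'a \<Rightarrow> real) \<Rightarrow> 'a \<Rightarrow> real ^ 'd ^ 'd" where
  "Sigma_n M Ws n K w x y \<omega> = (1 / real n) *\<^sub>R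
     (\<Sum>i=1..n. real_cond_exp M (XW_algebra M Ws n x) (\<lambda>\<omega>. (U_err M Ws n x y i \<omega>)\<^sup>2) \<omega>
                *\<^sub>R outer (partial_out n K w x i \<omega>))"

definition Omega_n ::
    "'a measure \<Rightarrow> ('a \<Rightarrow> real) set \<Rightarrow> nat \<Rightarrow> nat \<Rightarrow> (nat \<Rightarrow> 'a \<Rightarrow> real Matrix.vec)
     \<Rightarrow> (nat \<Rightarrow> 'a \<Rightarrow> real ^ 'd) \<Rightarrow> (nat \<Rightarrow> 'a \<Rightarrow> real) \<Rightarrow> 'a \<Rightarrow> real ^ 'd ^ 'd" where
  "Omega_n M Ws n K w x y \<omega> =
     matrix_inv (Gamma_hat n K w x \<omega>) ** Sigma_n M Ws n K w x y \<omega> **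
       matrix_inv (Gamma_hat n K w x \<omega>)"

text \<open>The events determined by \<open>(U t, V t)\<close> for \<open>t \<in> T\<close>.\<close>

definition cluster_events ::
    "'a measure \<Rightarrow> ('a \<Rightarrow> real) set \<Rightarrow> nat \<Rightarrow> (nat \<Rightarrow> 'a \<Rightarrow> real ^ 'd) \<Rightarrow> (nat \<Rightarrow> 'a \<Rightarrow> real)
     \<Rightarrow> nat set \<Rightarrow> 'a set set" where
  "cluster_events M Ws n x y T = sets (generated_algebra M
     ({U_err M Ws n x y t | t. t \<in> T} \<union> {\<lambda>\<omega>. V_err M Ws x t \<omega> $ a | t a. t \<in> T}))"

end

theory Submission
  imports Defs
begin

text \<open>
  Fix \<open>n\<close>, write \<open>F\<close> for the \<open>\<sigma>\<close>-algebra of \<open>X\<close> and \<open>W\<close>, and decompose \<open>u = U + R\<close> with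
  \<open>E[U | F] = 0\<close> and \<open>R = E[u | F]\<close>.  Where the Gram matrix of the covariates is regular the
  annihilator removes them, so \<open>sqrt n (beta_hat - \<beta>)\<close> is the inverse of \<open>Gamma_hat\<close> applied to
  the score \<open>n^(-1/2) \<Sum> v_hat i * u i\<close>.  The residuals \<open>v_hat\<close> are known given \<open>F\<close>, and \<open>Sigma_n\<close> is the
  conditional covariance matrix of the part of the score that carries \<open>U\<close>.  The matrix
  \<open>A = Omega_n^(-1/2) Gamma_hat^(-1)\<close> satisfies \<open>A Sigma_n A' = I\<close> (\<open>inv_sqrt_sandwich\<close>); for each \<open>t\<close> the
  statistic \<open>Z\<close> of the theorem therefore obeys \<open>t \<bullet> Z = \<Sum> c i * U i + remainder\<close>, where the weights
  \<open>c i\<close> are known given \<open>F\<close>, the conditional variance \<open>\<Sum> (c i)^2 E[(U i)^2 | F]\<close> is exactly \<open>t \<bullet> t\<close>, and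
  \<open>max |c i|\<close> is at most a constant times \<open>max |v_hat i| / sqrt n\<close>, which is small.

  Conditionally on \<open>F\<close> this is a sum of independent cluster contributions that are uniformly
  small, so it is asymptotically normal.  Regular conditional distributions are avoided by
  comparing characteristic functions directly (\<open>conditional_char_telescoping\<close>): the contributions
  of the clusters are replaced one after the other by their Gaussian factors, and each
  replacement only involves the mean and variance of one cluster given the \<open>\<sigma>\<close>-algebra of \<open>W\<close>,
  the \<open>V\<close> of that cluster and the complete data of all the other clusters.  By conditional
  independence these moments are the moments given \<open>F\<close> (\<open>integral_within_cluster\<close>).  The outcome is a
  bound for every \<open>n\<close> (\<open>conditional_clt\<close>).

  Two facts remain.  The matrix \<open>Gamma_hat\<close> must stay away from singularity.  Writing
  \<open>E[x i | W]\<close> as \<open>Q i\<close> plus a linear function of \<open>w i\<close> gives \<open>v_hat = Vt + Qt\<close>, where \<open>Vt\<close> and \<open>Qt\<close> arise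
  from \<open>V\<close> and \<open>Q\<close> by applying the annihilator.  The part of \<open>Gamma_hat\<close> quadratic in \<open>Vt\<close> is a
  quadratic form in clustered noise with projection weights and has conditional variance of order
  \<open>1 / n\<close> (\<open>quadratic_form_concentration\<close>); the cross term is of the same order, and the part quadratic in
  \<open>Qt\<close> is nonnegative.  And the remainder \<open>n^(-1/2) \<Sum> v_hat i * R i\<close> must vanish: it splits into
  \<open>Qt\<close> against \<open>R\<close>, \<open>Vt\<close> against \<open>R - E[u | W]\<close>, and \<open>Vt\<close> against \<open>E[u | W]\<close>, whose first absolute moments are
  at most of the orders \<open>sqrt (n chi_W rho_XW)\<close>, \<open>sqrt (n (rho_XW - rho_W))\<close> and \<open>sqrt rho_W\<close>
  (\<open>remainder_bound\<close>): this is where the three approximation rates come from.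

  Together these bound the distance between the characteristic function of the statistic and that of
  the standard normal distribution (\<open>characteristic_function_error\<close>), and the continuity theorem
  \<open>levy_continuity_vec\<close> turns its convergence to zero into weak convergence.
\<close>

hide_const (open) VectorSpace.subspace LinearCombinations.module.span VectorSpace.vectorspace.dim
  Matrix.orthogonal Matrix.mat List.transpose Determinants.det

section \<open>Symmetric matrices, their square roots, and measurability\<close>

text \<open>
  The first-order condition at \<open>s = 0\<close> in a form that needs no derivative: it is used for the
  maximizer of a Rayleigh quotient and for the zeros of a positive semidefinite form.
\<close>

lemma quadratic_bound_imp_zero:
  fixes c k :: real
  assumes "\<And>s. 2 * s * c \<le> s\<^sup>2 * k"
  shows "c = 0"
proof (rule ccontr)
  assume "c \<noteq> 0"
  define s where "s = c / (\<bar>k\<bar> + 1)"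
  have "s\<^sup>2 * k \<le> s\<^sup>2 * (\<bar>k\<bar> + 1)" by (intro mult_left_mono) auto
  also have "\<dots> = s * c" by (simp add: s_def power2_eq_square field_simps add_nonneg_eq_0_iff)
  finally have "2 * s * c \<le> s * c" using assms[of s] by linarith
  hence "s * c \<le> 0" by linarith
  moreover have "s * c > 0" using \<open>c \<noteq> 0\<close> by (auto simp: s_def zero_less_mult_iff zero_less_divide_iff divide_less_0_iff add_nonneg_pos)
  ultimately show False by simp
qed

lemma symmetric_inner:
  fixes A :: "real ^ 'n ^ 'n"
  assumes "transpose A = A"
  shows "v \<bullet> (A *v w) = (A *v v) \<bullet> w"
  using assms by (metis dot_lmul_matrix vector_transpose_matrix)

text \<open>
  A maximizer of the Rayleigh quotient over the unit sphere of an invariant subspace is an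
  eigenvector: its residual \<open>w = A b - m b\<close> lies in the subspace, and moving from \<open>b\<close> in the direction
  \<open>w\<close> would otherwise increase the quotient to first order.
\<close>

lemma symmetric_eigenvector_in_subspace:
  fixes A :: "real ^ 'n ^ 'n"
  assumes sym: "transpose A = A" and W: "subspace W"
    and inv: "\<And>v. v \<in> W \<Longrightarrow> A *v v \<in> W" and ne: "W \<noteq> {0}"
  obtains b where "b \<in> W" "norm b = 1" "A *v b = (b \<bullet> (A *v b)) *\<^sub>R b"
proof -
  obtain v0 where v0: "v0 \<in> W" "v0 \<noteq> 0" using ne W subspace_0 by blast
  let ?S = "sphere 0 1 \<inter> W"
  have "compact ?S" using closed_subspace[OF W] by (intro compact_Int_closed) auto
  moreover have "v0 /\<^sub>R norm v0 \<in> ?S" using v0 W by (auto simp: subspace_scale)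
  hence "?S \<noteq> {}" by blast
  moreover have "continuous_on ?S (\<lambda>v. v \<bullet> (A *v v))"
    by (intro continuous_intros matrix_vector_mult_linear_continuous_on)
  ultimately obtain b where b: "b \<in> ?S" "\<And>v. v \<in> ?S \<Longrightarrow> v \<bullet> (A *v v) \<le> b \<bullet> (A *v b)"
    using continuous_attains_sup by (metis (no_types, lifting))
  define m where "m = b \<bullet> (A *v b)"
  have nb: "norm b = 1" "b \<in> W" using b by auto
  have bb: "b \<bullet> b = 1" using nb by (simp add: norm_eq_1)
  have le: "v \<bullet> (A *v v) \<le> m * (v \<bullet> v)" if "v \<in> W" for v
  proof (cases "v = 0")
    case False
    have "v /\<^sub>R norm v \<in> ?S" using False that W by (auto simp: subspace_scale)
    from b(2)[OF this] have "(v \<bullet> (A *v v)) / (norm v)\<^sup>2 \<le> m"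
      by (simp add: m_def matrix_vector_mult_scaleR power2_eq_square field_simps)
    thus ?thesis using False by (simp add: field_simps power2_norm_eq_inner)
  qed simp
  define w where "w = A *v b - m *\<^sub>R b"
  have wW: "w \<in> W" using nb W inv by (auto simp: w_def subspace_diff subspace_scale)
  have bw: "b \<bullet> w = 0" using bb by (simp add: w_def inner_diff_right m_def)
  hence wb: "w \<bullet> b = 0" by (simp add: inner_commute)
  have c: "w \<bullet> (A *v b) = w \<bullet> w"
    using wb by (simp add: w_def inner_diff_right)
  have "w \<bullet> w = 0"
  proof (rule quadratic_bound_imp_zero)
    fix s :: real
    have "b + s *\<^sub>R w \<in> W" using nb wW W by (auto simp: subspace_add subspace_scale)
    from le[OF this] show "2 * s * (w \<bullet> w) \<le> s\<^sup>2 * (m * (w \<bullet> w) - w \<bullet> (A *v w))"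
      using wb c symmetric_inner[OF sym, of b w]
      by (simp add: matrix_vector_right_distrib matrix_vector_mult_scaleR inner_add_left inner_add_right
          m_def[symmetric] bb inner_commute power2_eq_square algebra_simps)
  qed
  hence "A *v b = m *\<^sub>R b" by (simp add: w_def)
  thus ?thesis using that nb m_def by blast
qed

text \<open>
  The spectral theorem, by induction on the dimension: split off one eigenvector; symmetry makes
  its orthogonal complement invariant.
\<close>

lemma symmetric_eigenbasis_subspace:
  fixes A :: "real ^ 'n ^ 'n"
  assumes sym: "transpose A = A" and W: "subspace W"
    and inv: "\<And>v. v \<in> W \<Longrightarrow> A *v v \<in> W"
  shows "\<exists>B. pairwise orthogonal B \<and> (\<forall>b\<in>B. norm b = 1) \<and> span B = W \<and>
    (\<forall>b\<in>B. A *v b = (b \<bullet> (A *v b)) *\<^sub>R b)"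
  using W inv
proof (induction "dim W" arbitrary: W rule: less_induct)
  case less
  show ?case
  proof (cases "W = {0}")
    case True
    thus ?thesis by (intro exI[of _ "{}"]) auto
  next
    case False
    then obtain b where b: "b \<in> W" "norm b = 1" "A *v b = (b \<bullet> (A *v b)) *\<^sub>R b"
      using symmetric_eigenvector_in_subspace[OF sym less.prems(1,2)] by blast
    have bb: "b \<bullet> b = 1" using b by (simp add: norm_eq_1)
    let ?W = "W \<inter> {v. b \<bullet> v = 0}"
    have sW: "subspace ?W" by (intro subspace_inter less.prems(1) subspace_hyperplane)
    have "b \<notin> ?W" using bb by simp
    hence "?W \<subset> W" using b(1) by blast
    hence "span ?W \<subset> span W" using sW less.prems(1) by (simp add: span_eq_iff[THEN iffD2])
    hence d: "dim ?W < dim W" by (rule dim_psubset)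
    have iW: "A *v v \<in> ?W" if "v \<in> ?W" for v
    proof -
      have "b \<bullet> (A *v v) = (A *v b) \<bullet> v" by (rule symmetric_inner[OF sym])
      also have "\<dots> = 0" using that by (subst b(3)) simp
      finally show ?thesis using that less.prems(2) by auto
    qed
    from less.hyps[OF d sW iW] obtain B where B: "pairwise orthogonal B" "\<forall>b\<in>B. norm b = 1"
      "span B = ?W" "\<forall>b\<in>B. A *v b = (b \<bullet> (A *v b)) *\<^sub>R b" by blast
    have BW: "B \<subseteq> ?W" using B(3) span_superset by blast
    have "span (insert b B) = W"
    proof
      show "span (insert b B) \<subseteq> W" using BW b(1) less.prems(1) by (intro span_minimal) auto
      show "W \<subseteq> span (insert b B)"
      proof
        fix v assume v: "v \<in> W"
        have "v - (b \<bullet> v) *\<^sub>R b \<in> ?W"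
          using v b(1) less.prems(1) bb by (auto simp: subspace_diff subspace_scale inner_diff_right)
        hence "v - (b \<bullet> v) *\<^sub>R b \<in> span B" using B(3) by simp
        thus "v \<in> span (insert b B)" by (subst span_insert) blast
      qed
    qed
    moreover have "pairwise orthogonal (insert b B)"
      using B(1) BW by (auto simp: pairwise_insert Linear_Algebra.orthogonal_def inner_commute)
    ultimately show ?thesis using B b by (intro exI[of _ "insert b B"]) auto
  qed
qed

definition orthonormal_eigenbasis :: "real ^ 'n ^ 'n \<Rightarrow> (real ^ 'n) set \<Rightarrow> (real ^ 'n \<Rightarrow> real) \<Rightarrow> bool" where
  "orthonormal_eigenbasis A B l \<longleftrightarrow> finite B \<and> pairwise orthogonal B \<and>
     (\<forall>b\<in>B. b \<bullet> b = 1 \<and> A *v b = l b *\<^sub>R b) \<and> (\<forall>v. (\<Sum>b\<in>B. (b \<bullet> v) *\<^sub>R b) = v)"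

lemma symmetric_eigenbasis:
  fixes A :: "real ^ 'n ^ 'n"
  assumes sym: "transpose A = A"
  obtains B l where "orthonormal_eigenbasis A B l"
proof -
  obtain B where B: "pairwise orthogonal B" "\<forall>b\<in>B. norm b = 1"
      "span B = UNIV" "\<forall>b\<in>B. A *v b = (b \<bullet> (A *v b)) *\<^sub>R b"
    using symmetric_eigenbasis_subspace[OF sym, of UNIV] by auto
  have f: "finite B" using B(1) by (simp add: pairwise_orthogonal_imp_finite)
  have "(\<Sum>b\<in>B. (b \<bullet> v) *\<^sub>R b) = v" for v
    using orthonormal_basis_expand[OF B(1) _ _ f, of v] B by (simp add: inner_commute)
  hence "orthonormal_eigenbasis A B (\<lambda>b. b \<bullet> (A *v b))"
    using B f by (auto simp: orthonormal_eigenbasis_def norm_eq_1)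
  thus ?thesis by (rule that)
qed

lemma eigenbasis_expansions:
  fixes A :: "real ^ 'n ^ 'n"
  assumes B: "orthonormal_eigenbasis A B l"
  shows "A *v v = (\<Sum>b\<in>B. (l b * (b \<bullet> v)) *\<^sub>R b)"
    and "v \<bullet> (A *v v) = (\<Sum>b\<in>B. l b * (b \<bullet> v)\<^sup>2)"
    and "v \<bullet> v = (\<Sum>b\<in>B. (b \<bullet> v)\<^sup>2)"
proof -
  have e: "(\<Sum>b\<in>B. (b \<bullet> v) *\<^sub>R b) = v" using B by (simp add: orthonormal_eigenbasis_def)
  have "A *v v = A *v (\<Sum>b\<in>B. (b \<bullet> v) *\<^sub>R b)" by (simp add: e)
  also have "\<dots> = (\<Sum>b\<in>B. A *v ((b \<bullet> v) *\<^sub>R b))"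
    by (simp add: linear_sum[OF matrix_vector_mul_linear])
  also have "\<dots> = (\<Sum>b\<in>B. (l b * (b \<bullet> v)) *\<^sub>R b)"
    using B by (intro sum.cong)
      (simp_all add: orthonormal_eigenbasis_def matrix_vector_mult_scaleR mult.commute)
  finally show 1: "A *v v = (\<Sum>b\<in>B. (l b * (b \<bullet> v)) *\<^sub>R b)" .
  show "v \<bullet> (A *v v) = (\<Sum>b\<in>B. l b * (b \<bullet> v)\<^sup>2)"
    unfolding 1 by (simp add: inner_sum_right power2_eq_square inner_commute mult_ac)
  have "v \<bullet> v = v \<bullet> (\<Sum>b\<in>B. (b \<bullet> v) *\<^sub>R b)" by (simp add: e)
  thus "v \<bullet> v = (\<Sum>b\<in>B. (b \<bullet> v)\<^sup>2)"
    by (simp add: inner_sum_right power2_eq_square inner_commute)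
qed

text \<open>
  In an eigenbasis the quadratic form is a weighted sum of squares and the spectrum is the set of
  its weights, so the least eigenvalue is the best constant in the lower bound.
\<close>

lemma lambda_min_bounds:
  fixes A :: "real ^ 'n ^ 'n"
  assumes sym: "transpose A = A"
  shows "lambda_min A * (v \<bullet> v) \<le> v \<bullet> (A *v v)"
    and "(\<And>v. c * (v \<bullet> v) \<le> v \<bullet> (A *v v)) \<Longrightarrow> c \<le> lambda_min A"
proof -
  obtain B l where e: "orthonormal_eigenbasis A B l" using symmetric_eigenbasis[OF sym] .
  have B: "finite B" "\<And>b c. b \<in> B \<Longrightarrow> c \<in> B \<Longrightarrow> b \<noteq> c \<Longrightarrow> b \<bullet> c = 0"
    "\<And>b. b \<in> B \<Longrightarrow> b \<bullet> b = 1" "\<And>b. b \<in> B \<Longrightarrow> A *v b = l b *\<^sub>R b"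
    using e by (auto simp: orthonormal_eigenbasis_def pairwise_def Linear_Algebra.orthogonal_def)
  note q = eigenbasis_expansions[OF e]
  have "B \<noteq> {}"
  proof
    assume "B = {}"
    hence "(1::real^'n) = 0" using e by (metis orthonormal_eigenbasis_def sum.empty)
    thus False by simp
  qed
  have E: "{k. \<exists>v. v \<noteq> 0 \<and> A *v v = k *\<^sub>R v} = l ` B"
  proof (intro equalityI subsetI)
    fix k assume "k \<in> {k. \<exists>v. v \<noteq> 0 \<and> A *v v = k *\<^sub>R v}"
    then obtain v where v: "v \<noteq> 0" "A *v v = k *\<^sub>R v" by auto
    have ev: "(\<Sum>b\<in>B. (b \<bullet> v) *\<^sub>R b) = v" using e by (simp add: orthonormal_eigenbasis_def)
    obtain b where b: "b \<in> B" "b \<bullet> v \<noteq> 0"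
    proof (rule ccontr)
      assume "\<not> thesis"
      hence "\<forall>b\<in>B. b \<bullet> v = 0" using that by blast
      hence "(\<Sum>b\<in>B. (b \<bullet> v) *\<^sub>R b) = 0" by simp
      thus False using ev v(1) by simp
    qed
    have "k * (b \<bullet> v) = b \<bullet> (A *v v)" by (simp add: v)
    also have "\<dots> = l b * (b \<bullet> v)" by (subst symmetric_inner[OF sym]) (simp add: B(4) b)
    finally show "k \<in> l ` B" using b by auto
  next
    fix k assume "k \<in> l ` B"
    then obtain b where b: "b \<in> B" "k = l b" by blast
    moreover have "b \<noteq> 0" using B(3)[OF b(1)] by auto
    ultimately show "k \<in> {k. \<exists>v. v \<noteq> 0 \<and> A *v v = k *\<^sub>R v}" using B(4)[OF b(1)] by blast
  qed
  have lm: "lambda_min A = Min (l ` B)" by (simp add: lambda_min_def E)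
  have "lambda_min A * (v \<bullet> v) = (\<Sum>b\<in>B. Min (l ` B) * (b \<bullet> v)\<^sup>2)"
    by (simp add: lm q(3) sum_distrib_left)
  also have "\<dots> \<le> v \<bullet> (A *v v)"
    unfolding q(2) using B(1) by (intro sum_mono mult_right_mono) auto
  finally show "lambda_min A * (v \<bullet> v) \<le> v \<bullet> (A *v v)" .
  assume c: "\<And>v. c * (v \<bullet> v) \<le> v \<bullet> (A *v v)"
  have "c \<le> l b" if "b \<in> B" for b using c[of b] B(3,4) that by simp
  thus "c \<le> lambda_min A" unfolding lm using B(1) \<open>B \<noteq> {}\<close> by simp
qed

text \<open>
  All later statements about the least eigenvalue go through this description, which avoids
  eigenvectors.
\<close>

lemma lambda_min_ge_iff:
  fixes A :: "real ^ 'n ^ 'n"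
  assumes sym: "transpose A = A"
  shows "c \<le> lambda_min A \<longleftrightarrow> (\<forall>v. c * (v \<bullet> v) \<le> v \<bullet> (A *v v))"
  using lambda_min_bounds[OF sym] by (meson inner_ge_zero mult_right_mono order_trans)

text \<open>
  Take square roots of the eigenvalues in an eigenbasis.
\<close>

lemma psd_sqrt_exists:
  fixes A :: "real ^ 'n ^ 'n"
  assumes A: "psd A"
  shows "\<exists>S. psd S \<and> S ** S = A"
proof -
  have sym: "transpose A = A" using A by (simp add: psd_def)
  obtain B l where e: "orthonormal_eigenbasis A B l" using symmetric_eigenbasis[OF sym] .
  have B: "finite B" "\<And>b c. b \<in> B \<Longrightarrow> c \<in> B \<Longrightarrow> b \<noteq> c \<Longrightarrow> b \<bullet> c = 0"
    "\<And>b. b \<in> B \<Longrightarrow> b \<bullet> b = 1" "\<And>b. b \<in> B \<Longrightarrow> A *v b = l b *\<^sub>R b"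
    using e by (auto simp: orthonormal_eigenbasis_def pairwise_def Linear_Algebra.orthogonal_def)
  note q = eigenbasis_expansions[OF e]
  have l0: "l b \<ge> 0" if "b \<in> B" for b
  proof -
    have "0 \<le> b \<bullet> (A *v b)" using A by (simp add: psd_def)
    thus ?thesis using B that by simp
  qed
  define f where "f v = (\<Sum>b\<in>B. (sqrt (l b) * (b \<bullet> v)) *\<^sub>R b)" for v
  have lf: "linear f" unfolding f_def
    by (intro linearI) (simp_all add: inner_add_right distrib_left scaleR_add_left sum.distrib scaleR_sum_right mult_ac)
  define S where "S = matrix f"
  have Sv: "S *v v = f v" for v using lf by (simp add: S_def)
  have fb: "b \<bullet> f v = sqrt (l b) * (b \<bullet> v)" if "b \<in> B" for b v
  proof -
    have "b \<bullet> f v = (\<Sum>c\<in>B. if c = b then sqrt (l b) * (b \<bullet> v) else 0)"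
      unfolding f_def inner_sum_right
      by (intro sum.cong) (use B(2,3) that in auto)
    thus ?thesis using B(1) that by simp
  qed
  have "(S ** S) *v v = A *v v" for v
  proof -
    have "(S ** S) *v v = f (f v)" by (simp add: matrix_vector_mul_assoc[symmetric] Sv)
    also have "\<dots> = (\<Sum>b\<in>B. (l b * (b \<bullet> v)) *\<^sub>R b)"
      unfolding f_def[of "f v"] by (intro sum.cong) (use l0 in \<open>auto simp: fb mult.assoc[symmetric]\<close>)
    finally show ?thesis by (simp add: q(1))
  qed
  hence 1: "S ** S = A" by (simp add: matrix_eq)
  have 2: "u \<bullet> (S *v v) = (S *v u) \<bullet> v" for u v
    by (simp add: Sv f_def inner_sum_right inner_sum_left inner_commute mult_ac)
  have "u \<bullet> (transpose S *v v) = u \<bullet> (S *v v)" for u v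
    using 2[of u v] by (metis dot_lmul_matrix inner_commute vector_transpose_matrix matrix_vector_mul_assoc transpose_matrix_vector)
  hence "transpose S *v v = S *v v" for v by (metis vector_eq_ldot)
  hence 3: "transpose S = S" by (simp add: matrix_eq)
  have "0 \<le> v \<bullet> (S *v v)" for v
    unfolding Sv f_def inner_sum_right
    by (intro sum_nonneg) (use l0 in \<open>simp add: inner_commute mult.assoc\<close>)
  thus ?thesis using 1 3 by (auto simp: psd_def)
qed

lemma psd_zero_form:
  fixes A :: "real ^ 'n ^ 'n"
  assumes A: "psd A" and v: "v \<bullet> (A *v v) = 0"
  shows "A *v v = 0"
proof -
  have sym: "transpose A = A" using A by (simp add: psd_def)
  have "(A *v v) \<bullet> (A *v v) = 0"
  proof -
    let ?w = "A *v v"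
    have "- (?w \<bullet> ?w) = 0"
    proof (rule quadratic_bound_imp_zero)
      fix s :: real
      have "0 \<le> (v + s *\<^sub>R ?w) \<bullet> (A *v (v + s *\<^sub>R ?w))" using A by (simp add: psd_def)
      thus "2 * s * - (?w \<bullet> ?w) \<le> s\<^sup>2 * (?w \<bullet> (A *v ?w))"
        using v symmetric_inner[OF sym, of v ?w]
        by (simp add: matrix_vector_right_distrib matrix_vector_mult_scaleR inner_add_left inner_add_right
            power2_eq_square algebra_simps)
    qed
    thus ?thesis by simp
  qed
  thus ?thesis by simp
qed

text \<open>
  If \<open>S^2 = T^2\<close> then \<open>S (S - T) + (S - T) T = 0\<close>.  Evaluated at an eigenvector of \<open>D = S - T\<close> with
  nonzero eigenvalue, this forces the nonnegative numbers \<open>b \<bullet> S b\<close> and \<open>b \<bullet> T b\<close> to vanish, hence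
  \<open>D b = 0\<close>, a contradiction.
\<close>

lemma psd_sqrt_unique:
  fixes S T :: "real ^ 'n ^ 'n"
  assumes S: "psd S" and T: "psd T" and eq: "S ** S = T ** T"
  shows "S = T"
proof -
  define D where "D = S - T"
  have tr: "transpose (A - B) = transpose A - transpose B"
    for A B :: "real^'n^'n"
    by (vector Finite_Cartesian_Product.transpose_def)
  have symD: "transpose D = D" using S T by (simp add: D_def tr psd_def)
  obtain B l where e: "orthonormal_eigenbasis D B l" using symmetric_eigenbasis[OF symD] .
  have B: "finite B" "\<And>b c. b \<in> B \<Longrightarrow> c \<in> B \<Longrightarrow> b \<noteq> c \<Longrightarrow> b \<bullet> c = 0"
    "\<And>b. b \<in> B \<Longrightarrow> b \<bullet> b = 1" "\<And>b. b \<in> B \<Longrightarrow> D *v b = l b *\<^sub>R b"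
    using e by (auto simp: orthonormal_eigenbasis_def pairwise_def Linear_Algebra.orthogonal_def)
  note q = eigenbasis_expansions[OF e]
  have "D *v b = 0" if b: "b \<in> B" for b
  proof (rule ccontr)
    assume "D *v b \<noteq> 0"
    hence l: "l b \<noteq> 0" using B(4)[OF b] by auto
    have "S ** D + D ** T = S ** S - T ** T"
      by (vector D_def matrix_matrix_mult_def algebra_simps sum_subtractf)
    hence "(S ** D + D ** T) *v b = 0" using eq by simp
    hence "b \<bullet> (S *v (D *v b)) + b \<bullet> (D *v (T *v b)) = 0"
      by (metis inner_add_right inner_zero_right matrix_vector_mul_assoc matrix_vector_mult_add_rdistrib)
    also have "b \<bullet> (D *v (T *v b)) = (D *v b) \<bullet> (T *v b)" by (rule symmetric_inner[OF symD])
    finally have "l b * (b \<bullet> (S *v b) + b \<bullet> (T *v b)) = 0"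
      using B(4)[OF b] by (simp add: matrix_vector_mult_scaleR distrib_left)
    moreover have "0 \<le> b \<bullet> (S *v b)" "0 \<le> b \<bullet> (T *v b)" using S T by (auto simp: psd_def)
    ultimately have "b \<bullet> (S *v b) = 0" "b \<bullet> (T *v b) = 0" using l by auto
    hence "S *v b = 0" "T *v b = 0" using psd_zero_form S T by auto
    hence "D *v b = 0" by (simp add: D_def matrix_vector_mult_diff_rdistrib)
    thus False using \<open>D *v b \<noteq> 0\<close> by simp
  qed
  hence "l b = 0" if "b \<in> B" for b using B(3,4) that by (metis inner_zero_left scale_eq_0_iff zero_neq_one)
  hence "D *v v = 0 *v v" for v by (simp add: q(1))
  hence "D = 0" by (subst matrix_eq) simp
  thus ?thesis by (simp add: D_def)
qed

lemma psd_sqrt_works: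
  assumes "psd A"
  shows "psd (psd_sqrt A)" "psd_sqrt A ** psd_sqrt A = A"
proof -
  have "\<exists>!S. psd S \<and> S ** S = A" using psd_sqrt_exists[OF assms] psd_sqrt_unique by metis
  from theI'[OF this] show "psd (psd_sqrt A)" "psd_sqrt A ** psd_sqrt A = A"
    by (auto simp: psd_sqrt_def)
qed

lemma borel_measurable_vec_components:
  fixes f :: "'a \<Rightarrow> ('b::euclidean_space) ^ 'n"
  assumes "\<And>i. (\<lambda>x. f x $ i) \<in> borel_measurable M"
  shows "f \<in> borel_measurable M"
proof (subst borel_measurable_euclidean_space, intro ballI)
  fix b :: "'b ^ 'n" assume "b \<in> Basis"
  then obtain i u where "b = axis i u" unfolding Basis_vec_def by blast
  thus "(\<lambda>x. f x \<bullet> b) \<in> borel_measurable M" using assms[of i] by (simp add: inner_axis)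
qed

lemma borel_measurable_vec_nth:
  fixes f :: "'a \<Rightarrow> ('b::euclidean_space) ^ 'n"
  assumes "f \<in> borel_measurable M"
  shows "(\<lambda>x. f x $ i) \<in> borel_measurable M"
  by (rule borel_measurable_continuous_on[OF _ assms]) (intro continuous_intros)

lemma borel_measurable_mat_mult:
  fixes f :: "'a \<Rightarrow> real ^ 'n ^ 'n"
  assumes "f \<in> borel_measurable M" "g \<in> borel_measurable M"
  shows "(\<lambda>x. f x ** g x) \<in> borel_measurable M"
  using assms unfolding matrix_matrix_mult_def
  by (intro borel_measurable_vec_components) (auto intro!: borel_measurable_sum borel_measurable_times borel_measurable_vec_nth)

lemma borel_measurable_mat_vec_mult:
  fixes f :: "'a \<Rightarrow> real ^ 'n ^ 'n"
  assumes "f \<in> borel_measurable M" "g \<in> borel_measurable M"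
  shows "(\<lambda>x. f x *v g x) \<in> borel_measurable M"
  using assms unfolding matrix_vector_mult_def
  by (intro borel_measurable_vec_components) (auto intro!: borel_measurable_sum borel_measurable_times borel_measurable_vec_nth)

lemma borel_measurable_det:
  fixes f :: "'a \<Rightarrow> real ^ 'n ^ 'n"
  assumes "f \<in> borel_measurable M"
  shows "(\<lambda>x. Determinants.det (f x)) \<in> borel_measurable M"
  using assms unfolding Determinants.det_def
  by (auto intro!: borel_measurable_sum borel_measurable_times borel_measurable_prod borel_measurable_vec_nth)

lemma matrix_inv_right_left:
  fixes A :: "real ^ 'n ^ 'n"
  assumes "invertible A"
  shows matrix_inv_right: "A ** matrix_inv A = mat 1"
    and matrix_inv_left: "matrix_inv A ** A = mat 1"
  using someI_ex[OF assms[unfolded invertible_def]] by (auto simp: matrix_inv_def)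

text \<open>
  Cramer's rule gives the entries of the inverse as measurable functions where the determinant is
  nonzero; elsewhere \<^const>\<open>matrix_inv\<close> picks one and the same matrix every time.
\<close>

lemma borel_measurable_matrix_inv:
  fixes f :: "'a \<Rightarrow> real ^ 'n ^ 'n"
  assumes f: "f \<in> borel_measurable M"
  shows "(\<lambda>x. matrix_inv (f x)) \<in> borel_measurable M"
proof -
  define c :: "real ^ 'n ^ 'n" where "c = (SOME B. False)"
  define D :: "'n \<Rightarrow> 'n \<Rightarrow> real ^ 'n ^ 'n \<Rightarrow> real" where
    "D i j A = Determinants.det (\<chi> k l. if l = i then axis j 1 $ k else A $ k $ l)" for i j A
  have eq: "matrix_inv A $ i $ j = (if Determinants.det A \<noteq> 0 then D i j A / Determinants.det A else c $ i $ j)"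
    for A i j
  proof (cases "Determinants.det A = 0")
    case True
    hence "\<not> invertible A" by (simp add: invertible_det_nz)
    hence "(\<lambda>B. A ** B = mat 1 \<and> B ** A = mat 1) = (\<lambda>B. False)"
      by (auto simp: invertible_def)
    hence "matrix_inv A = c" by (simp add: matrix_inv_def c_def)
    thus ?thesis using True by simp
  next
    case False
    hence "A ** matrix_inv A = mat 1" by (simp add: invertible_det_nz matrix_inv_right)
    hence "A *v (matrix_inv A *v axis j 1) = axis j 1" by (simp add: matrix_vector_mul_assoc)
    hence "matrix_inv A *v axis j 1 = (\<chi> k. D k j A / Determinants.det A)"
      using cramer[OF False] by (simp add: D_def)
    moreover have "(matrix_inv A *v axis j 1) $ i = matrix_inv A $ i $ j"
      by (simp add: matrix_vector_mult_basis column_def)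
    ultimately show ?thesis using False by simp
  qed
  have D: "(\<lambda>x. D i j (f x)) \<in> borel_measurable M" for i j
    unfolding D_def
  proof (rule borel_measurable_det, intro borel_measurable_vec_components)
    fix k l
    show "(\<lambda>x. (\<chi> k l. if l = i then axis j 1 $ k else f x $ k $ l) $ k $ l) \<in> borel_measurable M"
      using f by (cases "l = i") (auto intro!: borel_measurable_vec_nth)
  qed
  have det: "(\<lambda>x. Determinants.det (f x)) \<in> borel_measurable M" by (rule borel_measurable_det[OF f])
  show ?thesis
  proof (intro borel_measurable_vec_components)
    fix i j
    note D[measurable] det[measurable]
    show "(\<lambda>x. matrix_inv (f x) $ i $ j) \<in> borel_measurable M" unfolding eq by measurable
  qed
qed

lemma transpose_eqI:
  fixes A :: "real ^ 'n ^ 'n"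
  shows "(\<And>i j. A $ i $ j = A $ j $ i) \<Longrightarrow> transpose A = A"
  by (simp add: Finite_Cartesian_Product.transpose_def vec_eq_iff)

lemma psd_transpose_nth: "psd A \<Longrightarrow> A $ i $ j = A $ j $ i"
  unfolding psd_def Finite_Cartesian_Product.transpose_def by (metis vec_lambda_beta)

lemma psd_square:
  assumes "psd S" shows "psd (S ** S)"
proof -
  have sym: "transpose S = S" using assms by (simp add: psd_def)
  have "v \<bullet> ((S ** S) *v v) = (S *v v) \<bullet> (S *v v)" for v
    by (simp add: matrix_vector_mul_assoc[symmetric] symmetric_inner[OF sym, of v])
  thus ?thesis using sym by (simp add: psd_def matrix_transpose_mul)
qed

lemma psd_sqrt_square:
  assumes "psd S" shows "psd_sqrt (S ** S) = S"
  using psd_sqrt_works[OF psd_square[OF assms]] assms by (auto intro: psd_sqrt_unique)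

lemma closed_psd: "closed {A :: real ^ 'n ^ 'n. psd A}"
proof -
  have e: "{A :: real ^ 'n ^ 'n. psd A} =
    (\<Inter>i j. {A. A $ i $ j = A $ j $ i}) \<inter> (\<Inter>v. {A. 0 \<le> v \<bullet> (A *v v)})"
    using psd_transpose_nth by (auto simp: psd_def intro!: transpose_eqI)
  have c: "continuous_on UNIV (\<lambda>A :: real ^ 'n ^ 'n. v \<bullet> (A *v v))" for v
    unfolding matrix_vector_mult_def inner_vec_def by (auto intro!: continuous_intros)
  show ?thesis unfolding e
    by (intro closed_Int closed_INT ballI closed_Collect_eq closed_Collect_le continuous_intros c)
qed

text \<open>
  The graph of the square root over the positive semidefinite matrices in a ball is closed, being cut
  out by \<open>S S = A\<close>, and the square roots stay in a compact ball because the trace controls the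
  Frobenius norm; a map with closed graph into a compact set is continuous.
\<close>

lemma continuous_on_psd_sqrt: "continuous_on {A :: real ^ 'n ^ 'n. psd A} psd_sqrt"
proof -
  have bd: "norm (psd_sqrt A) \<le> real CARD('n) * norm A + 1" if A: "psd A" for A :: "real ^ 'n ^ 'n"
  proof -
    let ?S = "psd_sqrt A"
    note S = psd_sqrt_works[OF A]
    have sym: "?S $ i $ j = ?S $ j $ i" for i j
      using S(1) psd_transpose_nth by blast
    have "(norm ?S)\<^sup>2 = (\<Sum>i\<in>UNIV. (?S ** ?S) $ i $ i)"
      unfolding power2_norm_eq_inner inner_vec_def matrix_matrix_mult_def
      by (auto intro!: sum.cong simp: sym[symmetric])
    also have "\<dots> = (\<Sum>i\<in>UNIV. A $ i $ i)" by (simp add: S(2))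
    also have "\<dots> \<le> (\<Sum>i\<in>(UNIV::'n set). norm A)"
    proof (rule sum_mono)
      fix i
      have "\<bar>A $ i $ i\<bar> \<le> norm (A $ i)" by (rule component_le_norm_cart)
      also have "\<dots> \<le> norm A" by (rule Finite_Cartesian_Product.norm_nth_le)
      finally show "A $ i $ i \<le> norm A" by simp
    qed
    finally have 1: "(norm ?S)\<^sup>2 \<le> real CARD('n) * norm A" by simp
    show ?thesis
    proof (cases "norm ?S \<le> 1")
      case True thus ?thesis by (simp add: add_increasing)
    next
      case False
      hence "norm ?S * 1 \<le> norm ?S * norm ?S" by (intro mult_left_mono) auto
      hence "norm ?S \<le> (norm ?S)\<^sup>2" by (simp add: power2_eq_square)
      thus ?thesis using 1 by linarith
    qed
  qed
  have c: "continuous_on ({A :: real ^ 'n ^ 'n. psd A} \<inter> cball 0 r) psd_sqrt" for r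
  proof (rule continuous_from_closed_graph)
    show "compact (cball (0 :: real ^ 'n ^ 'n) (real CARD('n) * r + 1))" by simp
    have "norm (psd_sqrt A) \<le> real CARD('n) * r + 1" if "psd A" "norm A \<le> r" for A :: "real ^ 'n ^ 'n"
      using bd[OF that(1)] mult_left_mono[OF that(2) of_nat_0_le_iff[of "CARD('n)"]] by (rule order_trans[OF _ add_right_mono])
    thus "psd_sqrt \<in> {A :: real ^ 'n ^ 'n. psd A} \<inter> cball 0 r \<rightarrow> cball 0 (real CARD('n) * r + 1)" by auto
    have g: "(\<lambda>A. (A, psd_sqrt A)) ` ({A :: real ^ 'n ^ 'n. psd A} \<inter> cball 0 r) =
      ((Collect psd \<inter> cball 0 r) \<times> Collect psd) \<inter> {p. snd p ** snd p = fst p}"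
      using psd_sqrt_works by (auto simp: image_iff psd_square psd_sqrt_square)
    have "closed {p :: (real ^ 'n ^ 'n) \<times> (real ^ 'n ^ 'n). snd p ** snd p = fst p}"
      unfolding matrix_matrix_mult_def
      by (intro closed_Collect_eq continuous_on_vec_lambda continuous_intros)
    thus "closed ((\<lambda>A. (A, psd_sqrt A)) ` ({A :: real ^ 'n ^ 'n. psd A} \<inter> cball 0 r))"
      unfolding g using closed_psd by (intro closed_Int closed_Times) auto
  qed
  show ?thesis unfolding continuous_on_sequentially comp_def
  proof (intro allI impI ballI, elim conjE)
    fix X and A :: "real ^ 'n ^ 'n" assume X: "A \<in> {A. psd A}" "\<forall>n. X n \<in> {A. psd A}" "X \<longlonglongrightarrow> A"
    then obtain r where r: "\<And>n. norm (X n) \<le> r" using convergent_imp_bounded by (metis bounded_iff rangeI)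
    have A: "norm A \<le> r" by (rule Lim_bounded[OF tendsto_norm[OF X(3)], of 0]) (use r in auto)
    from c[of r] show "(\<lambda>n. psd_sqrt (X n)) \<longlonglongrightarrow> psd_sqrt A"
      unfolding continuous_on_sequentially comp_def using X r A by auto
  qed
qed

text \<open>
  Off the closed set of positive semidefinite matrices the defining description has no solution, so
  \<^const>\<open>psd_sqrt\<close> is constant there.
\<close>

lemma borel_measurable_psd_sqrt: "(psd_sqrt :: real ^ 'n ^ 'n \<Rightarrow> _) \<in> borel_measurable borel"
proof -
  define c :: "real ^ 'n ^ 'n" where "c = (THE S. False)"
  have "psd_sqrt A = c" if "\<not> psd A" for A :: "real ^ 'n ^ 'n"
  proof -
    have "(\<lambda>S. psd S \<and> S ** S = A) = (\<lambda>S. False)" using psd_square that by auto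
    thus ?thesis by (simp add: psd_sqrt_def c_def)
  qed
  hence e: "psd_sqrt = (\<lambda>A :: real ^ 'n ^ 'n. if A \<in> Collect psd then psd_sqrt A else c)" by auto
  show ?thesis
    by (subst e, rule borel_measurable_continuous_on_if)
      (use closed_psd[THEN borel_closed] continuous_on_psd_sqrt in auto)
qed

lemma borel_measurable_inv_sqrt:
  assumes "f \<in> borel_measurable M"
  shows "(\<lambda>x. inv_sqrt (f x)) \<in> borel_measurable M"
  unfolding inv_sqrt_def
  by (intro borel_measurable_matrix_inv measurable_compose[OF assms borel_measurable_psd_sqrt])

text \<open>
  Superlevel sets of the least eigenvalue are intersections of closed half-spaces of matrices.  The
  intersection over all vectors is uncountable, but closedness survives it.
\<close>

lemma borel_measurable_lambda_min_symmetric: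
  fixes f :: "'a \<Rightarrow> real ^ 'n ^ 'n"
  assumes f: "f \<in> borel_measurable M" and sym: "\<And>x. transpose (f x) = f x"
  shows "(\<lambda>x. lambda_min (f x)) \<in> borel_measurable M"
proof (subst borel_measurable_iff_ge, intro allI)
  fix c
  have "closed (\<Inter>v. {A :: real ^ 'n ^ 'n. c * (v \<bullet> v) \<le> v \<bullet> (A *v v)})"
    unfolding matrix_vector_mult_def inner_vec_def by (intro closed_INT ballI closed_Collect_le continuous_intros)
  hence "f -` (\<Inter>v. {A :: real ^ 'n ^ 'n. c * (v \<bullet> v) \<le> v \<bullet> (A *v v)}) \<inter> space M \<in> sets M"
    using f by (intro measurable_sets[OF f]) auto
  moreover have "{w \<in> space M. c \<le> lambda_min (f w)} =
      f -` (\<Inter>v. {A :: real ^ 'n ^ 'n. c * (v \<bullet> v) \<le> v \<bullet> (A *v v)}) \<inter> space M"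
    by (auto simp: lambda_min_ge_iff[OF sym])
  ultimately show "{w \<in> space M. c \<le> lambda_min (f w)} \<in> sets M" by simp
qed

lemma pos_def_invertible:
  fixes A :: "real ^ 'n ^ 'n"
  assumes "\<And>v. d * (v \<bullet> v) \<le> v \<bullet> (A *v v)" "d > 0"
  shows "invertible A"
  unfolding invertible_left_inverse matrix_left_invertible_ker
proof (intro allI impI)
  fix v assume "A *v v = 0"
  hence "d * (v \<bullet> v) \<le> 0" using assms(1)[of v] by simp
  hence "v \<bullet> v \<le> 0" using assms(2) by (simp add: mult_le_0_iff)
  thus "v = 0" using inner_gt_zero_iff[of v] by (metis not_le)
qed

lemma symmetric_matrix_inv:
  fixes A :: "real ^ 'n ^ 'n"
  assumes sym: "transpose A = A" and inv: "invertible A"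
  shows "transpose (matrix_inv A) = matrix_inv A"
proof -
  let ?B = "matrix_inv A" and ?C = "transpose (matrix_inv A)"
  have 1: "A ** ?B = mat 1" using inv by (simp add: matrix_inv_right)
  hence "transpose (A ** ?B) = mat 1" by (simp add: transpose_mat)
  hence "?C ** A = mat 1" by (simp add: matrix_transpose_mul sym)
  hence "?C ** (A ** ?B) = ?B" by (simp add: matrix_mul_assoc)
  thus ?thesis by (simp add: 1)
qed

text \<open>
  With \<open>G\<close> in the role of \<open>Gamma_hat\<close> and \<open>S\<close> in that of \<open>Sigma_n\<close>, the matrix \<open>A\<close> studentizes the score:
  \<open>A S A' = I\<close>, read as an identity of quadratic forms.  The second claim then bounds \<open>A\<close> through the
  lower bound on \<open>S\<close>.
\<close>

lemma inv_sqrt_sandwich: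
  fixes G S :: "real ^ 'n ^ 'n"
  assumes G: "transpose G = G" "invertible G"
    and S: "transpose S = S" "\<And>v. s * (v \<bullet> v) \<le> v \<bullet> (S *v v)" "s > 0"
  defines "A \<equiv> inv_sqrt (matrix_inv G ** S ** matrix_inv G) ** matrix_inv G"
  shows "(t v* A) \<bullet> (S *v (t v* A)) = t \<bullet> t" and "s * ((t v* A) \<bullet> (t v* A)) \<le> t \<bullet> t"
proof -
  let ?H = "matrix_inv G" and ?O = "matrix_inv G ** S ** matrix_inv G"
  have Hs: "transpose ?H = ?H" by (rule symmetric_matrix_inv[OF G])
  have Os: "transpose ?O = ?O" by (simp add: matrix_transpose_mul Hs S matrix_mul_assoc)
  have Of: "v \<bullet> (?O *v v) = (?H *v v) \<bullet> (S *v (?H *v v))" for v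
    by (simp add: matrix_vector_mul_assoc[symmetric] symmetric_inner[OF Hs, of v])
  have O0: "0 \<le> v \<bullet> (?O *v v)" for v
    unfolding Of using S(2)[of "?H *v v"] S(3) by (meson inner_ge_zero mult_nonneg_nonneg less_imp_le order_trans)
  have psd: "psd ?O" using Os O0 by (simp add: psd_def)
  let ?R = "psd_sqrt ?O"
  note R = psd_sqrt_works[OF psd]
  have Hi: "invertible ?H" using G(2) by (metis invertible_def matrix_inv_left matrix_inv_right)
  have Si: "invertible S" by (rule pos_def_invertible[OF S(2,3)])
  have "invertible ?O" by (intro invertible_mult Hi Si)
  hence "invertible (?R ** ?R)" by (simp add: R(2))
  hence Ri: "invertible ?R" by (simp add: invertible_det_nz det_mul)
  have Rs: "transpose (matrix_inv ?R) = matrix_inv ?R"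
    using R(1) by (intro symmetric_matrix_inv Ri) (simp add: psd_def)
  have tA: "t v* A = ?H *v (matrix_inv ?R *v t)"
    by (simp add: A_def inv_sqrt_def transpose_matrix_vector[symmetric] matrix_transpose_mul Hs Rs matrix_vector_mul_assoc)
  have "(t v* A) \<bullet> (S *v (t v* A)) = (matrix_inv ?R *v t) \<bullet> (?O *v (matrix_inv ?R *v t))"
    unfolding tA Of ..
  also have "\<dots> = (matrix_inv ?R *v t) \<bullet> (?R *v (?R *v (matrix_inv ?R *v t)))"
    using R(2) by (simp only: matrix_vector_mul_assoc matrix_mul_assoc)
  also have "?R *v (matrix_inv ?R *v t) = t"
    using Ri by (simp add: matrix_vector_mul_assoc matrix_inv_right)
  also have "(matrix_inv ?R *v t) \<bullet> (?R *v t) = t \<bullet> (matrix_inv ?R *v (?R *v t))"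
    by (simp add: symmetric_inner[OF Rs, of t])
  also have "\<dots> = t \<bullet> t" using Ri by (simp add: matrix_vector_mul_assoc matrix_inv_left)
  finally show 1: "(t v* A) \<bullet> (S *v (t v* A)) = t \<bullet> t" .
  show "s * ((t v* A) \<bullet> (t v* A)) \<le> t \<bullet> t" using S(2)[of "t v* A"] 1 by simp
qed

section \<open>The annihilator matrix of the covariates\<close>

lemma gram_carrier: "gram n K w \<omega> \<in> carrier_mat K K"
  by (simp add: gram_def)

text \<open>
  The default value at singular matrices keeps the annihilator well behaved: with the zero matrix as
  inverse it becomes the identity, which is still a symmetric projection.  The representation by the
  adjugate yields measurability.
\<close>

lemma mat_inv_cases:
  fixes A :: "real Matrix.mat"
  assumes A: "A \<in> carrier_mat K K"
  shows "det A = 0 \<Longrightarrow> mat_inv A = 0\<^sub>m K K"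
    and "det A \<noteq> 0 \<Longrightarrow> mat_inv A = (1 / det A) \<cdot>\<^sub>m adj_mat A"
    and "det A \<noteq> 0 \<Longrightarrow> A * mat_inv A = 1\<^sub>m K"
    and "mat_inv A \<in> carrier_mat K K"
proof -
  have dims: "dim_row A = K" "dim_col A = K" using A by auto
  have inv: "A * B = 1\<^sub>m K" "B * A = 1\<^sub>m K" "B \<in> carrier_mat K K" "mat_inv A = B" if "mat_inverse A = Some B" for B
    using mat_inverse(2)[OF A that] that by (auto simp: mat_inv_def)
  have n: "det A = 0" "mat_inv A = 0\<^sub>m K K" if "mat_inverse A = None"
  proof -
    show "det A = 0" using mat_inverse(1)[OF A that, of "()"] det_non_zero_imp_unit[OF A, of "()"] by blast
    show "mat_inv A = 0\<^sub>m K K" using that dims by (simp add: mat_inv_def)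
  qed
  show "mat_inv A = 0\<^sub>m K K" if d: "det A = 0"
  proof (cases "mat_inverse A")
    case (Some B)
    have "det A * det B = 1"
      using det_mult[OF A inv(3)[OF Some]] inv(1)[OF Some] by simp
    thus ?thesis using d by simp
  qed (use n in auto)
  show m: "A * mat_inv A = 1\<^sub>m K" if "det A \<noteq> 0"
    using n that inv by (cases "mat_inverse A") auto
  show c: "mat_inv A \<in> carrier_mat K K"
    using n inv by (cases "mat_inverse A") auto
  show "mat_inv A = (1 / det A) \<cdot>\<^sub>m adj_mat A" if d: "det A \<noteq> 0"
  proof -
    note adj = adj_mat[OF A]
    have "adj_mat A = adj_mat A * (A * mat_inv A)" using m[OF d] adj(1) by simp
    also have "\<dots> = (adj_mat A * A) * mat_inv A" using adj(1) A c by (simp add: assoc_mult_mat)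
    also have "\<dots> = det A \<cdot>\<^sub>m mat_inv A"
      unfolding adj(3) using c by (subst mult_smult_assoc_mat[OF one_carrier_mat c]) simp
    finally have "(1 / det A) \<cdot>\<^sub>m adj_mat A = (1 / det A) \<cdot>\<^sub>m (det A \<cdot>\<^sub>m mat_inv A)" by simp
    also have "\<dots> = mat_inv A" using d c by (intro eq_matI) auto
    finally show ?thesis by simp
  qed
qed

text \<open>
  A singular matrix has the eigenvalue zero.  Only \<open>K > 0\<close> is covered, since for \<open>K = 0\<close> the spectrum
  is empty and its minimum is unspecified.
\<close>

lemma det_gram_nonzero:
  assumes "0 < lambda_min_mat (gram n K w \<omega>)" "K > 0"
  shows "det (gram n K w \<omega>) \<noteq> 0"
proof
  let ?G = "gram n K w \<omega>"
  assume "det ?G = 0"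
  then obtain v where v: "v \<in> carrier_vec K" "v \<noteq> 0\<^sub>v K" "?G *\<^sub>v v = 0\<^sub>v K"
    using det_0_iff_vec_prod_zero_field[OF gram_carrier[of n K w \<omega>]] by auto
  have dr: "dim_row ?G = K" using gram_carrier[of n K w \<omega>] by (rule carrier_matD)
  have "0 \<cdot>\<^sub>v v = 0\<^sub>v K" using v(1) by auto
  hence "eigenvector ?G v 0" unfolding eigenvector_def dr using v by simp
  hence "0 \<in> spectrum ?G" by (auto simp: spectrum_def eigenvalue_def)
  hence "Min (spectrum ?G) \<le> 0" using card_finite_spectrum(1)[OF gram_carrier] by (intro Min_le) auto
  thus False using assms by (simp add: lambda_min_mat_def)
qed

lemma det_gram_zero_dim: "det (gram n 0 w \<omega>) \<noteq> 0"
  by (simp add: Determinant.det_def gram_def)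

context
  fixes n K :: nat and w :: "nat \<Rightarrow> 'a \<Rightarrow> real Matrix.vec" and \<omega> :: 'a
  assumes w: "\<And>i. i \<in> {1..n} \<Longrightarrow> w i \<omega> \<in> carrier_vec K"
begin

lemma gram_bilinear:
  assumes a: "a \<in> carrier_vec K" and b: "b \<in> carrier_vec K"
  shows "(\<Sum>j=1..n. scalar_prod a (w j \<omega>) * scalar_prod (w j \<omega>) b) = scalar_prod a (gram n K w \<omega> *\<^sub>v b)"
proof -
  have d: "dim_vec (w j \<omega>) = K" if "j \<in> {1..n}" for j using w[OF that] by simp
  have "scalar_prod a (gram n K w \<omega> *\<^sub>v b) =
    (\<Sum>k<K. vec_index a k * (\<Sum>l<K. (\<Sum>j=1..n. vec_index (w j \<omega>) k * vec_index (w j \<omega>) l) * vec_index b l))"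
    using b by (simp add: scalar_prod_def gram_def atLeast0LessThan)
  also have "\<dots> = (\<Sum>k<K. \<Sum>l<K. \<Sum>j=1..n. vec_index a k * (vec_index (w j \<omega>) k * vec_index (w j \<omega>) l * vec_index b l))"
    by (simp only: sum_distrib_left sum_distrib_right)
  also have "\<dots> = (\<Sum>j=1..n. \<Sum>k<K. \<Sum>l<K. vec_index a k * (vec_index (w j \<omega>) k * vec_index (w j \<omega>) l * vec_index b l))"
    by (subst (2) sum.swap, subst sum.swap, rule refl)
  also have "\<dots> = (\<Sum>j=1..n. scalar_prod a (w j \<omega>) * scalar_prod (w j \<omega>) b)"
  proof (rule sum.cong[OF refl])
    fix j assume j: "j \<in> {1..n}"
    show "(\<Sum>k<K. \<Sum>l<K. vec_index a k * (vec_index (w j \<omega>) k * vec_index (w j \<omega>) l * vec_index b l))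
      = scalar_prod a (w j \<omega>) * scalar_prod (w j \<omega>) b"
      using b d[OF j] by (simp add: scalar_prod_def sum_product mult_ac atLeast0LessThan)
  qed
  finally show ?thesis by simp
qed

lemma gram_symmetric:
  assumes a: "a \<in> carrier_vec K" and b: "b \<in> carrier_vec K"
  shows "scalar_prod a (gram n K w \<omega> *\<^sub>v b) = scalar_prod (gram n K w \<omega> *\<^sub>v a) b"
proof -
  have "scalar_prod (gram n K w \<omega> *\<^sub>v a) b = scalar_prod b (gram n K w \<omega> *\<^sub>v a)"
    using a b gram_carrier[of n K w \<omega>] by (intro comm_scalar_prod[of _ K]) auto
  also have "\<dots> = (\<Sum>j=1..n. scalar_prod b (w j \<omega>) * scalar_prod (w j \<omega>) a)" by (rule gram_bilinear[OF b a, symmetric])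
  also have "\<dots> = (\<Sum>j=1..n. scalar_prod a (w j \<omega>) * scalar_prod (w j \<omega>) b)"
    by (intro sum.cong refl) (use a b w in \<open>simp add: comm_scalar_prod[of _ K] mult.commute\<close>)
  finally show ?thesis by (simp only: gram_bilinear[OF a b])
qed

text \<open>
  Symmetry and idempotence hold at every sample point, also where the Gram matrix is singular;
  only the annihilation of the covariates needs its regularity.
\<close>

lemma annihilator_properties:
  shows annihilator_symmetric: "i \<in> {1..n} \<Longrightarrow> j \<in> {1..n} \<Longrightarrow> annihilator n K w i j \<omega> = annihilator n K w j i \<omega>"
    and annihilator_idempotent: "i \<in> {1..n} \<Longrightarrow> k \<in> {1..n} \<Longrightarrow>
      (\<Sum>j=1..n. annihilator n K w i j \<omega> * annihilator n K w j k \<omega>) = annihilator n K w i k \<omega>"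
    and annihilator_covariates: "det (gram n K w \<omega>) \<noteq> 0 \<Longrightarrow> i \<in> {1..n} \<Longrightarrow> b \<in> carrier_vec K \<Longrightarrow>
      (\<Sum>j=1..n. annihilator n K w i j \<omega> * scalar_prod b (w j \<omega>)) = 0"
proof -
  let ?G = "gram n K w \<omega>" and ?B = "mat_inv (gram n K w \<omega>)"
  note G = gram_carrier[of n K w \<omega>] and B = mat_inv_cases[OF gram_carrier[of n K w \<omega>]]
  define c where "c i = ?B *\<^sub>v w i \<omega>" for i
  define p where "p i j = scalar_prod (w i \<omega>) (c j)" for i j
  have m: "annihilator n K w i j \<omega> = of_bool (i = j) - p i j" for i j by (simp add: annihilator_def p_def c_def)
  have ci: "c i \<in> carrier_vec K" if "i \<in> {1..n}" for i using that w B(4) by (auto simp: c_def)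
  have z: "p i j = 0" if "det ?G = 0" "i \<in> {1..n}" "j \<in> {1..n}" for i j
    using that w[of i] w[of j] by (simp add: p_def c_def B(1) scalar_prod_def)
  have Gc: "?G *\<^sub>v c i = w i \<omega>" if "det ?G \<noteq> 0" "i \<in> {1..n}" for i
    using that w[of i] B(3)[OF that(1)] B(4) G by (simp add: c_def assoc_mult_mat_vec[symmetric, of _ K K _ K])
  have psym: "p i j = p j i" if ij: "i \<in> {1..n}" "j \<in> {1..n}" for i j
  proof (cases "det ?G = 0")
    case False
    have "p i j = scalar_prod (?G *\<^sub>v c i) (c j)" by (simp add: p_def Gc[OF False ij(1)])
    also have "\<dots> = scalar_prod (c i) (w j \<omega>)"
      by (simp add: gram_symmetric[OF ci ci, OF ij, symmetric] Gc[OF False ij(2)])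
    also have "\<dots> = p j i" unfolding p_def using w ci ij by (intro comm_scalar_prod) auto
    finally show ?thesis .
  qed (use z ij in auto)
  have pp: "(\<Sum>j=1..n. scalar_prod b (w j \<omega>) * p j k) = scalar_prod b (w k \<omega>)"
    if "det ?G \<noteq> 0" "b \<in> carrier_vec K" "k \<in> {1..n}" for b k
    unfolding p_def by (simp only: gram_bilinear[OF that(2) ci[OF that(3)]] Gc[OF that(1,3)])
  show "annihilator n K w i j \<omega> = annihilator n K w j i \<omega>" if "i \<in> {1..n}" "j \<in> {1..n}" for i j
    using psym[OF that] by (auto simp: m)
  have d1: "(\<Sum>j=1..n. of_bool (i = j) * f j) = f i" if "i \<in> {1..n}" for i and f :: "nat \<Rightarrow> real"
    using that by (simp add: of_bool_def if_distrib[of "\<lambda>x. x * _"] cong: if_cong)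
  have d2: "(\<Sum>j=1..n. f j * of_bool (j = i)) = f i" if "i \<in> {1..n}" for i and f :: "nat \<Rightarrow> real"
    using that by (simp add: of_bool_def if_distrib cong: if_cong)
  show "(\<Sum>j=1..n. annihilator n K w i j \<omega> * annihilator n K w j k \<omega>) = annihilator n K w i k \<omega>"
    if ik: "i \<in> {1..n}" "k \<in> {1..n}" for i k
  proof -
    have "(\<Sum>j=1..n. p i j * p j k) = p i k"
    proof (cases "det ?G = 0")
      case True thus ?thesis using z ik by simp
    next
      case False
      have "(\<Sum>j=1..n. p i j * p j k) = (\<Sum>j=1..n. scalar_prod (c i) (w j \<omega>) * p j k)"
        using psym ik w ci by (intro sum.cong refl) (simp add: p_def comm_scalar_prod[of _ K])
      also have "\<dots> = scalar_prod (c i) (w k \<omega>)" by (rule pp[OF False ci ik(2)]) (rule ik(1))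
      also have "\<dots> = p k i" unfolding p_def using w ci ik by (intro comm_scalar_prod) auto
      finally show ?thesis using psym ik by simp
    qed
    thus ?thesis using d1[OF ik(1), of "\<lambda>j. of_bool (j = k)"] d1[OF ik(1), of "\<lambda>j. p j k"] d2[OF ik(2), of "p i"]
      by (simp add: m left_diff_distrib right_diff_distrib sum_subtractf)
  qed
  show "(\<Sum>j=1..n. annihilator n K w i j \<omega> * scalar_prod b (w j \<omega>)) = 0"
    if d: "det ?G \<noteq> 0" and i: "i \<in> {1..n}" and b: "b \<in> carrier_vec K" for i b
  proof -
    have "(\<Sum>j=1..n. p i j * scalar_prod b (w j \<omega>)) = (\<Sum>j=1..n. scalar_prod b (w j \<omega>) * p j i)"
      using psym i by (intro sum.cong refl) simp
    also have "\<dots> = scalar_prod b (w i \<omega>)" by (rule pp[OF d b i])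
    finally show ?thesis using d1[OF i, of "\<lambda>j. scalar_prod b (w j \<omega>)"]
      by (simp add: m left_diff_distrib sum_subtractf)
  qed
qed

end

lemma borel_measurable_mat_det:
  fixes A :: "'a \<Rightarrow> real Matrix.mat"
  assumes "\<And>x. x \<in> space M \<Longrightarrow> A x \<in> carrier_mat K K"
    and "\<And>k l. k < K \<Longrightarrow> l < K \<Longrightarrow> (\<lambda>x. A x $$ (k, l)) \<in> borel_measurable M"
  shows "(\<lambda>x. det (A x)) \<in> borel_measurable M"
proof -
  have "(\<lambda>x. \<Sum>p\<in>{p. p permutes {0..<K}}. signof p * (\<Prod>i=0..<K. A x $$ (i, p i))) \<in> borel_measurable M"
  proof (intro borel_measurable_sum borel_measurable_times borel_measurable_const borel_measurable_prod assms(2))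
    fix p i assume "p \<in> {p. p permutes {0..<K}}" "i \<in> {0..<K}"
    thus "i < K" "p i < K" using permutes_in_image[of p "{0..<K}" i] by auto
  qed
  thus ?thesis using det_def'[OF assms(1)] by (simp cong: measurable_cong)
qed

text \<open>
  Entries of the inverse are quotients of determinants by the adjugate formula, and zero at singular
  matrices.
\<close>

lemma borel_measurable_mat_inv_entry:
  fixes A :: "'a \<Rightarrow> real Matrix.mat"
  assumes A: "\<And>x. x \<in> space M \<Longrightarrow> A x \<in> carrier_mat K K"
    and m: "\<And>k l. k < K \<Longrightarrow> l < K \<Longrightarrow> (\<lambda>x. A x $$ (k, l)) \<in> borel_measurable M"
    and kl: "k < K" "l < K"
  shows "(\<lambda>x. mat_inv (A x) $$ (k, l)) \<in> borel_measurable M"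
proof -
  have d[measurable]: "(\<lambda>x. det (A x)) \<in> borel_measurable M" by (rule borel_measurable_mat_det[OF A m])
  have c[measurable]: "(\<lambda>x. det (mat_delete (A x) l k)) \<in> borel_measurable M"
  proof (rule borel_measurable_mat_det[of _ _ "K - 1"])
    show "mat_delete (A x) l k \<in> carrier_mat (K - 1) (K - 1)" if "x \<in> space M" for x
      using A[OF that] by (intro mat_delete_carrier)
    fix i j assume ij: "i < K - 1" "j < K - 1"
    have "mat_delete (A x) l k $$ (i, j) = A x $$ (insert_index l i, insert_index k j)" if "x \<in> space M" for x
      using ij A[OF that] kl by (subst mat_delete_index) auto
    moreover have "(\<lambda>x. A x $$ (insert_index l i, insert_index k j)) \<in> borel_measurable M"
      using ij by (intro m) (auto simp: insert_index_def)
    ultimately show "(\<lambda>x. mat_delete (A x) l k $$ (i, j)) \<in> borel_measurable M" by (simp cong: measurable_cong)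
  qed
  have "mat_inv (A x) $$ (k, l) = (if det (A x) = 0 then 0
     else (1 / det (A x)) * ((- 1) ^ (l + k) * det (mat_delete (A x) l k)))" if x: "x \<in> space M" for x
    using mat_inv_cases[OF A[OF x]] A[OF x] kl by (auto simp: adj_mat_def cofactor_def)
  hence "(\<lambda>x. mat_inv (A x) $$ (k, l)) \<in> borel_measurable M \<longleftrightarrow> (\<lambda>x. if det (A x) = 0 then 0
     else (1 / det (A x)) * ((- 1) ^ (l + k) * det (mat_delete (A x) l k))) \<in> borel_measurable M"
    by (intro measurable_cong)
  thus ?thesis by simp
qed

lemma
  assumes w: "\<And>i x. i \<in> {1..n} \<Longrightarrow> x \<in> space M \<Longrightarrow> w i x \<in> carrier_vec K"
    and m: "\<And>i k. i \<in> {1..n} \<Longrightarrow> k < K \<Longrightarrow> (\<lambda>x. vec_index (w i x) k) \<in> borel_measurable M"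
  shows borel_measurable_annihilator: "i \<in> {1..n} \<Longrightarrow> j \<in> {1..n} \<Longrightarrow> annihilator n K w i j \<in> borel_measurable M"
    and borel_measurable_det_gram: "(\<lambda>x. det (gram n K w x)) \<in> borel_measurable M"
proof -
  have g: "(\<lambda>x. gram n K w x $$ (k, l)) \<in> borel_measurable M" if "k < K" "l < K" for k l
    using that m by (auto simp: gram_def)
  note gc = gram_carrier[of n K w]
  show "(\<lambda>x. det (gram n K w x)) \<in> borel_measurable M"
    by (rule borel_measurable_mat_det[OF gc g])
  assume ij: "i \<in> {1..n}" "j \<in> {1..n}"
  have e: "annihilator n K w i j x = of_bool (i = j) -
     (\<Sum>k<K. vec_index (w i x) k * (\<Sum>l<K. mat_inv (gram n K w x) $$ (k, l) * vec_index (w j x) l))"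
    if x: "x \<in> space M" for x
  proof -
    have "dim_vec (w i x) = K" "dim_vec (w j x) = K" using w[OF _ x] ij by auto
    moreover have "dim_row (mat_inv (gram n K w x)) = K" "dim_col (mat_inv (gram n K w x)) = K"
      using mat_inv_cases(4)[OF gc, of x] by simp_all
    ultimately show ?thesis
      by (simp add: annihilator_def scalar_prod_def atLeast0LessThan)
  qed
  have "(\<lambda>x. of_bool (i = j) -
     (\<Sum>k<K. vec_index (w i x) k * (\<Sum>l<K. mat_inv (gram n K w x) $$ (k, l) * vec_index (w j x) l))) \<in> borel_measurable M"
    using m ij borel_measurable_mat_inv_entry[OF gc g]
    by (intro borel_measurable_diff borel_measurable_const borel_measurable_sum borel_measurable_times) auto
  thus "annihilator n K w i j \<in> borel_measurable M" by (subst measurable_cong[OF e])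
qed

section \<open>Conditional expectations under conditional independence\<close>

lemma (in prob_space) subalgebra_sigma_finite:
  assumes "subalgebra M F" shows "sigma_finite_subalgebra M F"
  by (rule finite_measure_subalgebra_is_sigma_finite)
    (simp add: assms finite_measure_subalgebra_def finite_measure_subalgebra_axioms_def finite_measure_axioms)

text \<open>
  Dynkin's lemma for the class of events on which two integrable variables have equal integrals.
\<close>

lemma integral_eq_on_generated:
  fixes f g :: "'a \<Rightarrow> real"
  assumes P: "Int_stable P" "P \<subseteq> sets M" "space M \<in> P"
    and f: "integrable M f" and g: "integrable M g"
    and eq: "\<And>A. A \<in> P \<Longrightarrow> (\<integral>x\<in>A. f x \<partial>M) = (\<integral>x\<in>A. g x \<partial>M)"
    and A: "A \<in> sigma_sets (space M) P"
  shows "(\<integral>x\<in>A. f x \<partial>M) = (\<integral>x\<in>A. g x \<partial>M)"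
proof -
  have Pp: "P \<subseteq> Pow (space M)" using P(2) sets.space_closed by blast
  have sub: "sigma_sets (space M) P \<subseteq> sets M" using P(2) by (rule sets.sigma_sets_subset)
  have si: "set_integrable M A f" "set_integrable M A g" if "A \<in> sets M" for A
    using integrable_mult_indicator[OF that f] integrable_mult_indicator[OF that g] unfolding set_integrable_def by auto
  show ?thesis using P(1) Pp A
  proof (induction rule: sigma_sets_induct_disjoint)
    case (basic A) thus ?case by (rule eq)
  next
    case empty show ?case by (simp add: set_lebesgue_integral_def)
  next
    case (compl A)
    hence A: "A \<in> sets M" using sub by blast
    have "(\<integral>x\<in>space M - A. h x \<partial>M) = (\<integral>x\<in>space M. h x \<partial>M) - (\<integral>x\<in>A. h x \<partial>M)" if "integrable M h" for h :: "'a \<Rightarrow> real"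
    proof -
      have "(\<integral>x\<in>space M - A. h x \<partial>M) = (\<integral>x. indicator (space M) x * h x - indicator A x * h x \<partial>M)"
        unfolding set_lebesgue_integral_def using sets.sets_into_space[OF A]
        by (intro Bochner_Integration.integral_cong) (auto simp: indicator_def)
      also have "\<dots> = (\<integral>x\<in>space M. h x \<partial>M) - (\<integral>x\<in>A. h x \<partial>M)"
        unfolding set_lebesgue_integral_def
        using integrable_mult_indicator[OF sets.top that] integrable_mult_indicator[OF A that]
        by (simp add: Bochner_Integration.integral_diff)
      finally show ?thesis .
    qed
    thus ?case using compl eq[OF P(3)] f g by simp
  next
    case (union A)
    hence A: "A i \<in> sets M" for i using sub by (auto simp: range_subsetD)
    have "(\<integral>x\<in>(\<Union>i. A i). h x \<partial>M) = (\<Sum>i. (\<integral>x\<in>A i. h x \<partial>M))" if "integrable M h" for h :: "'a \<Rightarrow> real"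
    proof (rule lebesgue_integral_countable_add)
      show "set_integrable M (\<Union>(range A)) h"
        unfolding set_integrable_def using A by (intro integrable_mult_indicator that) auto
    qed (use A union(1) in \<open>auto simp: disjoint_family_on_def\<close>)
    thus ?case using union f g by simp
  qed
qed

text \<open>
  To identify a conditional expectation, test it on an intersection-stable generator.
\<close>

lemma (in prob_space) real_cond_exp_eq_on_generated:
  fixes f g :: "'a \<Rightarrow> real"
  assumes F: "subalgebra M F" "sets F \<subseteq> sigma_sets (space M) P"
    and P: "Int_stable P" "P \<subseteq> sets M" "space M \<in> P"
    and f: "integrable M f" and g: "integrable M g" "g \<in> borel_measurable F"
    and eq: "\<And>A. A \<in> P \<Longrightarrow> (\<integral>x\<in>A. f x \<partial>M) = (\<integral>x\<in>A. g x \<partial>M)"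
  shows "AE x in M. real_cond_exp M F f x = g x"
proof -
  interpret F: sigma_finite_subalgebra M F by (rule subalgebra_sigma_finite[OF F(1)])
  show ?thesis
    by (rule F.real_cond_exp_charact[OF _ f g])
      (rule integral_eq_on_generated[OF P f g(1) eq], use F(2) in auto)
qed

text \<open>
  The generator, stable under intersections if \<open>A\<close> and \<open>B\<close> are, of the join of the \<open>\<sigma>\<close>-algebras
  generated by \<open>A\<close> and by \<open>B\<close>.
\<close>

definition meets :: "'a set set \<Rightarrow> 'a set set \<Rightarrow> 'a set set" where
  "meets A B = {a \<inter> b | a b. a \<in> A \<and> b \<in> B}"

lemma Int_stable_meets:
  assumes "Int_stable A" "Int_stable B" shows "Int_stable (meets A B)"
proof (rule Int_stableI)
  fix x y assume "x \<in> meets A B" "y \<in> meets A B"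
  then obtain a b a' b' where h: "x = a \<inter> b" "y = a' \<inter> b'" "a \<in> A" "b \<in> B" "a' \<in> A" "b' \<in> B"
    by (auto simp: meets_def)
  have "x \<inter> y = (a \<inter> a') \<inter> (b \<inter> b')" using h by auto
  moreover have "a \<inter> a' \<in> A" "b \<inter> b' \<in> B" using assms h by (auto simp: Int_stable_def)
  ultimately show "x \<inter> y \<in> meets A B" unfolding meets_def by blast
qed

lemma meets_superset:
  assumes "A \<subseteq> Pow X" "B \<subseteq> Pow X" "X \<in> A" "X \<in> B"
  shows "A \<subseteq> meets A B" "B \<subseteq> meets A B" "X \<in> meets A B" "meets A B \<subseteq> Pow X"
proof -
  show "A \<subseteq> meets A B"
  proof
    fix a assume "a \<in> A"
    moreover from this have "a = a \<inter> X" using assms(1) by auto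
    ultimately show "a \<in> meets A B" using assms(4) unfolding meets_def by blast
  qed
  thus "X \<in> meets A B" using assms(3) by blast
  show "B \<subseteq> meets A B"
  proof
    fix a assume "a \<in> B"
    moreover from this have "a = X \<inter> a" using assms(2) by auto
    ultimately show "a \<in> meets A B" using assms(3) unfolding meets_def by blast
  qed
  show "meets A B \<subseteq> Pow X" using assms(1) by (auto simp: meets_def)
qed

lemma meets_sets: "A \<subseteq> sets M \<Longrightarrow> B \<subseteq> sets M \<Longrightarrow> meets A B \<subseteq> sets M"
  by (auto simp: meets_def)

lemma sets_Int_stable: "Int_stable (sets M)"
  by (auto simp: Int_stable_def)

text \<open>
  If the events of \<open>H\<close> are conditionally independent of the \<open>\<sigma>\<close>-algebra \<open>E\<close> given \<open>W\<close>, then adding them to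
  any \<open>S\<close> between \<open>W\<close> and \<open>E\<close> does not change the conditional expectation of an \<open>E\<close>-measurable variable:
  on \<open>d \<inter> h\<close> with \<open>d \<in> S\<close> and \<open>h \<in> H\<close> the indicator of \<open>h\<close> may be replaced by \<open>P(h | W)\<close>, which is known
  given \<open>S\<close>, and put back after \<open>Y\<close> has been replaced by \<open>E[Y | S]\<close>.  The hypothesis \<open>indep\<close> is only asked on
  generators.
\<close>

lemma (in prob_space) cond_exp_extend_independent:
  assumes W: "subalgebra M W" and S: "subalgebra M S" and E: "subalgebra M E" and G: "subalgebra M G"
    and WS: "sets W \<subseteq> sets S" and SE: "sets S \<subseteq> sets E"
    and PE: "Int_stable PE" "PE \<subseteq> sets M" "space M \<in> PE" "sets E \<subseteq> sigma_sets (space M) PE"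
    and H: "Int_stable H" "H \<subseteq> sets M" "space M \<in> H"
    and GS: "sets S \<subseteq> sets G" "sets G \<subseteq> sigma_sets (space M) (meets (sets S) H)"
    and indep: "\<And>h e. h \<in> H \<Longrightarrow> e \<in> PE \<Longrightarrow>
      prob (h \<inter> e) = (\<integral>x\<in>e. real_cond_exp M W (indicator h) x \<partial>M)"
    and Y: "integrable M Y" "Y \<in> borel_measurable E"
  shows "AE x in M. real_cond_exp M G Y x = real_cond_exp M S Y x"
proof -
  interpret W: sigma_finite_subalgebra M W by (rule subalgebra_sigma_finite[OF W])
  interpret S: sigma_finite_subalgebra M S by (rule subalgebra_sigma_finite[OF S])
  interpret E: sigma_finite_subalgebra M E by (rule subalgebra_sigma_finite[OF E])
  interpret G: sigma_finite_subalgebra M G by (rule subalgebra_sigma_finite[OF G])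
  have sp: "space W = space M" "space S = space M" "space E = space M" "space G = space M"
    using W S E G by (auto simp: subalgebra_def)
  have SM: "sets S \<subseteq> sets M" using S by (simp add: subalgebra_def)
  have mSE: "f \<in> borel_measurable E" if "f \<in> borel_measurable S" for f :: "'a \<Rightarrow> real"
    using that SE sp by (intro measurable_from_subalg[of E S]) (auto simp: subalgebra_def)
  have mWS: "f \<in> borel_measurable S" if "f \<in> borel_measurable W" for f :: "'a \<Rightarrow> real"
    using that WS sp by (intro measurable_from_subalg[of S W]) (auto simp: subalgebra_def)
  have mSG: "f \<in> borel_measurable G" if "f \<in> borel_measurable S" for f :: "'a \<Rightarrow> real"
    using that GS sp by (intro measurable_from_subalg[of G S]) (auto simp: subalgebra_def)
  let ?c = "\<lambda>h. real_cond_exp M W (indicator h)"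
  have ind: "integrable M (indicator h :: 'a \<Rightarrow> real)" if "h \<in> H" for h
    using that H(2) by (intro integrable_real_indicator) (auto simp: emeasure_eq_measure)
  have ci: "integrable M (?c h)" if "h \<in> H" for h
    by (rule W.real_cond_exp_int(1)[OF ind[OF that]])
  have 1: "AE x in M. real_cond_exp M E (indicator h) x = ?c h x" if h: "h \<in> H" for h
  proof (rule real_cond_exp_eq_on_generated[OF E PE(4) PE(1-3)])
    show "integrable M (indicator h :: 'a \<Rightarrow> real)" by (rule ind[OF h])
    show "integrable M (?c h)" by (rule ci[OF h])
    show "?c h \<in> borel_measurable E" by (intro mSE mWS) simp
    fix e assume e: "e \<in> PE"
    have "(\<integral>x\<in>e. indicator h x \<partial>M) = prob (h \<inter> e)"
      using h e H(2) PE(2) unfolding set_lebesgue_integral_def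
      by (subst Int_commute) (simp add: indicator_inter_arith[symmetric] subset_iff sets.Int)
    thus "(\<integral>x\<in>e. indicator h x \<partial>M) = (\<integral>x\<in>e. ?c h x \<partial>M)" using indep[OF h e] by simp
  qed
  have 2: "(\<integral>x. indicator h x * Z x \<partial>M) = (\<integral>x. ?c h x * Z x \<partial>M)"
    if h: "h \<in> H" and Z: "integrable M Z" "Z \<in> borel_measurable E" for h Z
  proof -
    have hM[measurable]: "h \<in> sets M" using h H(2) by auto
    have [measurable]: "Z \<in> borel_measurable M" using Z(1) by auto
    have i: "integrable M (\<lambda>x. Z x * indicator h x)"
      using integrable_mult_indicator[OF hM Z(1)] by (simp add: mult.commute)
    have "(\<integral>x. indicator h x * Z x \<partial>M) = (\<integral>x. Z x * real_cond_exp M E (indicator h) x \<partial>M)"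
      using E.real_cond_exp_intg(2)[OF i Z(2)] by (simp add: mult.commute)
    also have "\<dots> = (\<integral>x. ?c h x * Z x \<partial>M)"
      by (rule integral_cong_AE) (use 1[OF h] in \<open>auto simp: mult.commute\<close>)
    finally show ?thesis .
  qed
  show ?thesis
  proof (rule real_cond_exp_eq_on_generated[OF G GS(2)])
    show "Int_stable (meets (sets S) H)" by (intro Int_stable_meets H sets_Int_stable)
    show "meets (sets S) H \<subseteq> sets M" by (intro meets_sets H SM)
    show "space M \<in> meets (sets S) H"
      using H(3) sp(2) sets.top[of S] unfolding meets_def by (metis (mono_tags, lifting) Int_absorb mem_Collect_eq)
    show "integrable M Y" by fact
    show i: "integrable M (real_cond_exp M S Y)" by (rule S.real_cond_exp_int[OF Y(1)])
    show "real_cond_exp M S Y \<in> borel_measurable G" by (intro mSG) simp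
    fix A assume "A \<in> meets (sets S) H"
    then obtain d h where A: "A = d \<inter> h" and d: "d \<in> sets S" and h: "h \<in> H" by (auto simp: meets_def)
    have dM: "d \<in> sets M" using d SM by auto
    have hM: "h \<in> sets M" using h H(2) by auto
    have [measurable]: "(indicator d :: 'a \<Rightarrow> real) \<in> borel_measurable S" using d by simp
    have [measurable]: "(indicator d :: 'a \<Rightarrow> real) \<in> borel_measurable E" using d SE by auto
    have [measurable]: "Y \<in> borel_measurable M" using Y by auto
    have Yi: "integrable M (\<lambda>x. indicator d x * Y x)" using integrable_mult_indicator[OF dM Y(1)] by simp
    have Si: "integrable M (\<lambda>x. indicator d x * real_cond_exp M S Y x)" using integrable_mult_indicator[OF dM i] by simp
    have hS: "?c h \<in> borel_measurable S" by (intro mWS) simp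
    have b: "AE x in M. 0 \<le> ?c h x \<and> ?c h x \<le> 1"
    proof -
      have "AE x in M. ?c h x \<ge> 0" by (rule W.real_cond_exp_pos) (use hM in auto)
      moreover have "AE x in M. ?c h x \<le> 1" by (rule W.real_cond_exp_le_c[OF ind[OF h]]) (auto simp: indicator_def)
      ultimately show ?thesis by auto
    qed
    have ii: "integrable M (\<lambda>x. ?c h x * indicator d x * Y x)"
    proof (rule Bochner_Integration.integrable_bound[OF Y(1)])
      show "AE x in M. norm (?c h x * indicator d x * Y x) \<le> norm (Y x)"
        using b by eventually_elim (auto simp: abs_mult mult_left_le_one_le indicator_def)
    qed (use dM in measurable)
    have "(\<integral>x\<in>A. Y x \<partial>M) = (\<integral>x. indicator h x * (indicator d x * Y x) \<partial>M)"
      unfolding A set_lebesgue_integral_def by (intro Bochner_Integration.integral_cong) (auto simp: indicator_def)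
    also have "\<dots> = (\<integral>x. ?c h x * (indicator d x * Y x) \<partial>M)"
      by (rule 2[OF h Yi]) (use Y in measurable)
    also have "\<dots> = (\<integral>x. (?c h x * indicator d x) * Y x \<partial>M)" by (simp only: mult.assoc)
    also have "\<dots> = (\<integral>x. (?c h x * indicator d x) * real_cond_exp M S Y x \<partial>M)"
      by (rule S.real_cond_exp_intg(2)[OF ii, symmetric]) (use hS in measurable)
    also have "\<dots> = (\<integral>x. ?c h x * (indicator d x * real_cond_exp M S Y x) \<partial>M)" by (simp only: mult.assoc)
    also have "\<dots> = (\<integral>x. indicator h x * (indicator d x * real_cond_exp M S Y x) \<partial>M)"
      by (intro 2[OF h Si, symmetric] mSE borel_measurable_times) (simp_all add: d borel_measurable_indicator)
    also have "\<dots> = (\<integral>x\<in>A. real_cond_exp M S Y x \<partial>M)"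
      unfolding A set_lebesgue_integral_def by (intro Bochner_Integration.integral_cong) (auto simp: indicator_def)
    finally show "(\<integral>x\<in>A. Y x \<partial>M) = (\<integral>x\<in>A. real_cond_exp M S Y x \<partial>M)" .
  qed
qed

lemma sets_sigma_meets_superset:
  assumes "A \<subseteq> Pow X" "B \<subseteq> Pow X" "X \<in> A" "X \<in> B"
  shows "A \<subseteq> sets (sigma X (meets A B))" "B \<subseteq> sets (sigma X (meets A B))"
  using meets_superset[OF assms] by (auto simp: sets_measure_of)

lemma subalgebra_sigma_meets:
  assumes "A \<subseteq> sets M" "B \<subseteq> sets M" shows "subalgebra M (sigma (space M) (meets A B))"
proof -
  have "meets A B \<subseteq> sets M" using meets_sets[OF assms] .
  moreover from this have "meets A B \<subseteq> Pow (space M)" using sets.space_closed by blast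
  ultimately show ?thesis by (simp add: subalgebra_def space_measure_of sets_measure_of sets.sigma_sets_subset)
qed

text \<open>
  The \<open>\<sigma>\<close>-algebra \<open>Cl j\<close> carries the data of cluster \<open>j\<close>.
\<close>

locale cond_indep_clusters = prob_space +
  fixes W :: "'a measure" and I :: "'i set" and Cl :: "'i \<Rightarrow> 'a measure"
  assumes subalgebra_W: "subalgebra M W"
    and finite_I: "finite I"
    and subalgebra_Cl: "\<And>j. j \<in> I \<Longrightarrow> subalgebra M (Cl j)"
    and cond_indep: "cond_indep_sets M W (\<lambda>j. sets (Cl j)) I"
begin

text \<open>
  The join of \<open>W\<close> and the data of cluster \<open>j\<close>.
\<close>

definition inside :: "'i \<Rightarrow> 'a measure" where
  "inside j = sigma (space M) (meets (sets W) (sets (Cl j)))"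

text \<open>
  Events determined by the other clusters.  They are only required to be intersections of one
  event per cluster: such intersections generate the joint \<open>\<sigma>\<close>-algebra and are what conditional
  independence speaks about.  Intersecting with the whole space covers the case that there is no
  other cluster.
\<close>

definition outside :: "'i \<Rightarrow> 'a set set" where
  "outside j = {space M \<inter> (\<Inter>l\<in>I - {j}. A l) | A. A \<in> (\<Pi> l\<in>I - {j}. sets (Cl l))}"

text \<open>
  The \<open>\<sigma>\<close>-algebra \<open>S\<close> enlarged by the data of all clusters except \<open>j\<close>.
\<close>

definition with_outside :: "'a measure \<Rightarrow> 'i \<Rightarrow> 'a measure" where
  "with_outside S j = sigma (space M) (meets (sets S) (outside j))"

sublocale W: sigma_finite_subalgebra M W
  by (rule subalgebra_sigma_finite[OF subalgebra_W])

lemma space_W [simp]: "space W = space M"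
  using subalgebra_W by (simp add: subalgebra_def)

lemma space_Cl: "j \<in> I \<Longrightarrow> space (Cl j) = space M"
  using subalgebra_Cl by (simp add: subalgebra_def)

lemma sets_W: "sets W \<subseteq> sets M"
  using subalgebra_W by (simp add: subalgebra_def)

lemma sets_Cl: "j \<in> I \<Longrightarrow> sets (Cl j) \<subseteq> sets M"
  using subalgebra_Cl by (simp add: subalgebra_def)

lemma outside_sets: "outside j \<subseteq> sets M"
proof
  fix x assume "x \<in> outside j"
  then obtain A where A: "x = space M \<inter> (\<Inter>l\<in>I - {j}. A l)" "A \<in> (\<Pi> l\<in>I - {j}. sets (Cl l))"
    by (auto simp: outside_def)
  show "x \<in> sets M"
  proof (cases "I - {j} = {}")
    case True thus ?thesis using A(1) unfolding True by simp
  next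
    case False
    have "A l \<in> sets M" if "l \<in> I - {j}" for l using A(2) that sets_Cl by auto
    thus ?thesis using A(1) finite_I False by (auto intro!: sets.Int sets.finite_INT)
  qed
qed

lemma space_in_outside: "space M \<in> outside j"
proof -
  have "space M = space M \<inter> (\<Inter>l\<in>I - {j}. space M)" by auto
  moreover have "(\<lambda>_. space M) \<in> (\<Pi> l\<in>I - {j}. sets (Cl l))"
    using sets.top[of "Cl l" for l] space_Cl by (metis (no_types, lifting) DiffD1 Pi_I)
  ultimately show ?thesis unfolding outside_def by blast
qed

lemma Int_stable_outside: "Int_stable (outside j)"
proof (rule Int_stableI)
  fix x y assume "x \<in> outside j" "y \<in> outside j"
  then obtain A B where A: "x = space M \<inter> (\<Inter>l\<in>I - {j}. A l)" "A \<in> (\<Pi> l\<in>I - {j}. sets (Cl l))"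
    and B: "y = space M \<inter> (\<Inter>l\<in>I - {j}. B l)" "B \<in> (\<Pi> l\<in>I - {j}. sets (Cl l))"
    by (auto simp: outside_def)
  have "x \<inter> y = space M \<inter> (\<Inter>l\<in>I - {j}. A l \<inter> B l)" using A B by auto
  moreover have "(\<lambda>l. A l \<inter> B l) \<in> (\<Pi> l\<in>I - {j}. sets (Cl l))" using A(2) B(2) by auto
  ultimately show "x \<inter> y \<in> outside j" unfolding outside_def by blast
qed

lemma sets_Cl_subset_outside:
  assumes l: "l \<in> I" "l \<noteq> j" shows "sets (Cl l) \<subseteq> outside j"
proof
  fix a assume a: "a \<in> sets (Cl l)"
  define A where "A = (\<lambda>k. if k = l then a else space M)"
  have "a \<subseteq> space M" using a sets.sets_into_space[of a "Cl l"] space_Cl[OF l(1)] by auto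
  hence "a = space M \<inter> (\<Inter>k\<in>I - {j}. A k)" using l by (auto simp: A_def split: if_splits)
  moreover have "A \<in> (\<Pi> k\<in>I - {j}. sets (Cl k))"
    using a sets.top[of "Cl k" for k] space_Cl by (auto simp: A_def Pi_def split: if_splits) (metis sets.top)
  ultimately show "a \<in> outside j" unfolding outside_def by blast
qed

lemma subalgebra_inside: "j \<in> I \<Longrightarrow> subalgebra M (inside j)"
  unfolding inside_def by (intro subalgebra_sigma_meets sets_W sets_Cl)

lemma space_inside [simp]: "space (inside j) = space M"
  by (simp add: inside_def space_measure_of_conv)

lemma space_with_outside [simp]: "space (with_outside S j) = space M"
  by (simp add: with_outside_def space_measure_of_conv)

lemma sets_inside_superset:
  assumes "j \<in> I" shows "sets W \<subseteq> sets (inside j)" "sets (Cl j) \<subseteq> sets (inside j)"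
proof -
  have "sets W \<subseteq> Pow (space M)" "sets (Cl j) \<subseteq> Pow (space M)" "space M \<in> sets W" "space M \<in> sets (Cl j)"
    using sets.space_closed[of W] sets.space_closed[of "Cl j"] sets.top[of W] sets.top[of "Cl j"] space_Cl[OF assms] by auto
  from sets_sigma_meets_superset[OF this] show "sets W \<subseteq> sets (inside j)" "sets (Cl j) \<subseteq> sets (inside j)"
    unfolding inside_def by auto
qed

lemma subalgebra_with_outside:
  assumes "subalgebra M S" shows "subalgebra M (with_outside S j)"
  unfolding with_outside_def using assms by (intro subalgebra_sigma_meets outside_sets) (simp add: subalgebra_def)

lemma sets_with_outside_superset:
  assumes S: "subalgebra M S"
  shows "sets S \<subseteq> sets (with_outside S j)" "outside j \<subseteq> sets (with_outside S j)"
proof -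
  have sp: "space S = space M" using S by (simp add: subalgebra_def)
  have "sets S \<subseteq> Pow (space M)" "outside j \<subseteq> Pow (space M)" "space M \<in> sets S"
    using sets.space_closed[of S] outside_sets[of j] sets.space_closed[of M] sets.top[of S] unfolding sp by auto
  from sets_sigma_meets_superset[OF this space_in_outside]
  show "sets S \<subseteq> sets (with_outside S j)" "outside j \<subseteq> sets (with_outside S j)"
    unfolding with_outside_def by auto
qed

lemma measurable_with_outside:
  assumes S: "subalgebra M S"
  shows "f \<in> measurable S N \<Longrightarrow> f \<in> measurable (with_outside S j) N"
    and "l \<in> I \<Longrightarrow> l \<noteq> j \<Longrightarrow> f \<in> measurable (Cl l) N \<Longrightarrow> f \<in> measurable (with_outside S j) N"
proof -
  have "subalgebra (with_outside S j) S"
    using S sets_with_outside_superset[OF S] by (simp add: subalgebra_def)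
  thus "f \<in> measurable S N \<Longrightarrow> f \<in> measurable (with_outside S j) N" by (rule measurable_from_subalg)
  assume l: "l \<in> I" "l \<noteq> j"
  have "subalgebra (with_outside S j) (Cl l)"
    using sets_Cl_subset_outside[OF l] sets_with_outside_superset(2)[OF S, of j] space_Cl[OF l(1)]
    by (auto simp: subalgebra_def)
  thus "f \<in> measurable (Cl l) N \<Longrightarrow> f \<in> measurable (with_outside S j) N" by (rule measurable_from_subalg)
qed

text \<open>
  Conditional independence in the integrated form that \<open>cond_exp_extend_independent\<close> asks for: the
  product formulas for all clusters and for all clusters but \<open>j\<close> together give \<open>P(h \<inter> a | W) = P(h | W) P(a | W)\<close>.
\<close>

lemma cond_prob_outside_within:
  assumes j: "j \<in> I" and h: "h \<in> outside j" and e: "e \<in> meets (sets W) (sets (Cl j))"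
  shows "prob (h \<inter> e) = (\<integral>x\<in>e. real_cond_exp M W (indicator h) x \<partial>M)"
proof -
  obtain A where A: "h = space M \<inter> (\<Inter>l\<in>I - {j}. A l)" "A \<in> (\<Pi> l\<in>I - {j}. sets (Cl l))"
    using h by (auto simp: outside_def)
  obtain c a where e: "e = c \<inter> a" and c: "c \<in> sets W" and a: "a \<in> sets (Cl j)"
    using e by (auto simp: meets_def)
  have hM[measurable]: "h \<in> sets M" using h outside_sets by auto
  have cM[measurable]: "c \<in> sets M" using c sets_W by auto
  have aM[measurable]: "a \<in> sets M" using a sets_Cl[OF j] by auto
  have [measurable]: "(indicator c :: 'a \<Rightarrow> real) \<in> borel_measurable W" using c by simp
  have ii: "integrable M (indicator x :: 'a \<Rightarrow> real)" if "x \<in> sets M" for x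
    using that by (intro integrable_real_indicator) (auto simp: emeasure_eq_measure)
  have ind: "\<forall>J\<subseteq>I. J \<noteq> {} \<longrightarrow> finite J \<longrightarrow> (\<forall>A\<in>Pi J (\<lambda>j. sets (Cl j)). AE \<omega> in M.
        real_cond_exp M W (indicator (\<Inter>j\<in>J. A j)) \<omega> = (\<Prod>j\<in>J. real_cond_exp M W (indicator (A j)) \<omega>))"
    using cond_indep by (simp add: cond_indep_sets_def)
  have 1: "AE x in M. real_cond_exp M W (indicator h) x = (\<Prod>l\<in>I-{j}. real_cond_exp M W (indicator (A l)) x)"
  proof (cases "I - {j} = {}")
    case True
    hence hs: "h = space M" using A(1) unfolding True by simp
    have "AE x in M. real_cond_exp M W (indicator (space M)) x = indicator (space M) x"
      by (rule W.real_cond_exp_F_meas[OF ii[OF sets.top]]) (metis borel_measurable_indicator sets.top space_W)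
    moreover have "AE x in M. indicator (space M) x = (1::real)" by (rule AE_I2) simp
    ultimately show ?thesis unfolding True hs by auto
  next
    case False
    then obtain l0 where l0: "l0 \<in> I - {j}" by blast
    hence "A l0 \<subseteq> space M" using A(2) sets_Cl sets.sets_into_space[of "A l0" M] by blast
    hence "h = (\<Inter>l\<in>I - {j}. A l)" using A(1) l0 by auto
    thus ?thesis using ind[rule_format, of "I - {j}" A] False finite_I A(2) by auto
  qed
  define A' where "A' = A(j := a)"
  have A': "A' \<in> Pi I (\<lambda>j. sets (Cl j))" using A(2) a by (auto simp: A'_def Pi_def)
  have ha: "h \<inter> a = (\<Inter>l\<in>I. A' l)"
  proof -
    have "(\<Inter>l\<in>I. A' l) = a \<inter> (\<Inter>l\<in>I - {j}. A l)" using j by (auto simp: A'_def split: if_splits)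
    moreover have "a \<subseteq> space M" using aM sets.sets_into_space by blast
    ultimately show ?thesis using A(1) by auto
  qed
  have "AE x in M. real_cond_exp M W (indicator (h \<inter> a)) x = (\<Prod>l\<in>I. real_cond_exp M W (indicator (A' l)) x)"
    unfolding ha using ind[rule_format, of I A'] j finite_I A' by auto
  moreover have "(\<Prod>l\<in>I. real_cond_exp M W (indicator (A' l)) x) =
      real_cond_exp M W (indicator a) x * (\<Prod>l\<in>I-{j}. real_cond_exp M W (indicator (A l)) x)" for x
    using j finite_I by (simp add: prod.remove A'_def)
  ultimately have 2: "AE x in M. real_cond_exp M W (indicator (h \<inter> a)) x =
      real_cond_exp M W (indicator h) x * real_cond_exp M W (indicator a) x"
    using 1 by auto
  have b: "AE x in M. 0 \<le> real_cond_exp M W (indicator h) x \<and> real_cond_exp M W (indicator h) x \<le> 1"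
  proof -
    have "AE x in M. real_cond_exp M W (indicator h) x \<ge> 0" by (rule W.real_cond_exp_pos) auto
    moreover have "AE x in M. real_cond_exp M W (indicator h) x \<le> 1"
      by (rule W.real_cond_exp_le_c[OF ii[OF hM]]) (auto simp: indicator_def)
    ultimately show ?thesis by auto
  qed
  have i1: "integrable M (\<lambda>x. (indicator c x * real_cond_exp M W (indicator h) x) * indicator a x)"
  proof (rule Bochner_Integration.integrable_bound[of _ "\<lambda>_. 1::real"])
    show "AE x in M. norm (indicat_real c x * real_cond_exp M W (indicator h) x * indicator a x) \<le> norm (1::real)"
      using b by eventually_elim (auto simp: indicator_def)
  qed auto
  have "prob (h \<inter> e) = (\<integral>x. indicator c x * indicator (h \<inter> a) x \<partial>M)"
    unfolding e by (simp add: indicator_inter_arith[symmetric] Int_ac)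
  also have "\<dots> = (\<integral>x. indicator c x * real_cond_exp M W (indicator (h \<inter> a)) x \<partial>M)"
    by (rule W.real_cond_exp_intg(2)[symmetric]) (auto simp: indicator_inter_arith[symmetric] ii)
  also have "\<dots> = (\<integral>x. (indicator c x * real_cond_exp M W (indicator h) x) * real_cond_exp M W (indicator a) x \<partial>M)"
    by (rule integral_cong_AE) (use 2 in \<open>auto simp: mult.assoc\<close>)
  also have "\<dots> = (\<integral>x. (indicator c x * real_cond_exp M W (indicator h) x) * indicator a x \<partial>M)"
    by (rule W.real_cond_exp_intg(2)[OF i1]) auto
  also have "\<dots> = (\<integral>x\<in>e. real_cond_exp M W (indicator h) x \<partial>M)"
    unfolding e set_lebesgue_integral_def by (intro Bochner_Integration.integral_cong) (auto simp: indicator_def)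
  finally show ?thesis .
qed

lemma cond_exp_with_outside:
  assumes j: "j \<in> I" and S: "subalgebra M S" "sets W \<subseteq> sets S" "sets S \<subseteq> sets (inside j)"
    and Y: "integrable M Y" "Y \<in> borel_measurable (inside j)"
  shows "AE x in M. real_cond_exp M (with_outside S j) Y x = real_cond_exp M S Y x"
proof (rule cond_exp_extend_independent[OF subalgebra_W S(1) subalgebra_inside[OF j]
      subalgebra_with_outside[OF S(1)] S(2,3) _ _ _ _ Int_stable_outside[of j] outside_sets[of j] space_in_outside[of j]
      sets_with_outside_superset(1)[OF S(1)] _ cond_prob_outside_within[OF j] Y])
  let ?m = "meets (sets W) (sets (Cl j))"
  show "Int_stable ?m" by (intro Int_stable_meets sets_Int_stable)
  show m: "?m \<subseteq> sets M" by (intro meets_sets sets_W sets_Cl j)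
  have mp: "?m \<subseteq> Pow (space M)" using m sets.space_closed by blast
  show "space M \<in> ?m" using sets.top[of W] sets.top[of "Cl j"] space_Cl[OF j] unfolding meets_def by auto
  show "sets (inside j) \<subseteq> sigma_sets (space M) ?m" unfolding inside_def using mp by (simp add: sets_measure_of)
  have "meets (sets S) (outside j) \<subseteq> Pow (space M)"
    using meets_sets[of "sets S" M "outside j"] S(1) outside_sets sets.space_closed[of M] by (auto simp: subalgebra_def)
  thus "sets (with_outside S j) \<subseteq> sigma_sets (space M) (meets (sets S) (outside j))"
    unfolding with_outside_def by (simp add: sets_measure_of)
qed

text \<open>
  The form in which conditional independence is applied: against a factor that is known from \<open>S\<close> and
  the other clusters, a variable of cluster \<open>j\<close> acts like its conditional expectation given \<open>S\<close>.
\<close>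

lemma integral_mult_outside:
  assumes j: "j \<in> I" and S: "subalgebra M S" "sets W \<subseteq> sets S" "sets S \<subseteq> sets (inside j)"
    and Y: "integrable M Y" "Y \<in> borel_measurable (inside j)"
    and P: "P \<in> borel_measurable (with_outside S j)" "integrable M (\<lambda>x. P x * Y x)"
  shows "(\<integral>x. P x * Y x \<partial>M) = (\<integral>x. P x * real_cond_exp M S Y x \<partial>M)"
proof -
  interpret G: sigma_finite_subalgebra M "with_outside S j"
    by (rule subalgebra_sigma_finite[OF subalgebra_with_outside[OF S(1)]])
  interpret S: sigma_finite_subalgebra M S by (rule subalgebra_sigma_finite[OF S(1)])
  have YM: "Y \<in> borel_measurable M" using Y(1) by auto
  have PM[measurable]: "P \<in> borel_measurable M"
    by (rule measurable_from_subalg[OF subalgebra_with_outside[OF S(1)] P(1)])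
  have "(\<integral>x. P x * Y x \<partial>M) = (\<integral>x. P x * real_cond_exp M (with_outside S j) Y x \<partial>M)"
    by (rule G.real_cond_exp_intg(2)[OF P(2,1) YM, symmetric])
  also have "\<dots> = (\<integral>x. P x * real_cond_exp M S Y x \<partial>M)"
    by (rule integral_cong_AE) (use cond_exp_with_outside[OF j S Y] in auto)
  finally show ?thesis .
qed

text \<open>
  Conditioning on any \<open>\<sigma>\<close>-algebra between \<open>S\<close> and \<open>S\<close> joined with the other clusters amounts to
  conditioning on \<open>S\<close>, by the tower property.
\<close>

lemma cond_exp_between:
  assumes j: "j \<in> I" and S: "subalgebra M S" "sets W \<subseteq> sets S" "sets S \<subseteq> sets (inside j)"
    and F: "subalgebra M F" "sets S \<subseteq> sets F" "sets F \<subseteq> sets (with_outside S j)"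
    and Y: "integrable M Y" "Y \<in> borel_measurable (inside j)"
  shows "AE x in M. real_cond_exp M F Y x = real_cond_exp M S Y x"
proof -
  interpret F: sigma_finite_subalgebra M F by (rule subalgebra_sigma_finite[OF F(1)])
  interpret S: sigma_finite_subalgebra M S by (rule subalgebra_sigma_finite[OF S(1)])
  have sp: "space S = space M" "space F = space M" using S F by (auto simp: subalgebra_def)
  let ?G = "with_outside S j"
  have "AE x in M. real_cond_exp M F (real_cond_exp M ?G Y) x = real_cond_exp M F Y x"
    by (rule F.real_cond_exp_nested_subalg[OF subalgebra_with_outside[OF S(1)] _ Y(1)])
      (use F(3) sp in \<open>simp add: subalgebra_def\<close>)
  moreover have "AE x in M. real_cond_exp M F (real_cond_exp M ?G Y) x = real_cond_exp M F (real_cond_exp M S Y) x"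
    by (rule F.real_cond_exp_cong[OF cond_exp_with_outside[OF j S Y]]) auto
  moreover have "AE x in M. real_cond_exp M F (real_cond_exp M S Y) x = real_cond_exp M S Y x"
  proof (rule F.real_cond_exp_F_meas)
    show "integrable M (real_cond_exp M S Y)" by (rule S.real_cond_exp_int(1)[OF Y(1)])
    have "subalgebra F S" using F(2) sp by (simp add: subalgebra_def)
    thus "real_cond_exp M S Y \<in> borel_measurable F" by (rule measurable_from_subalg) simp
  qed
  ultimately show ?thesis by auto
qed

end

section \<open>A conditional central limit bound for characteristic functions\<close>

text \<open>
  Trades the third moment in the Taylor remainder for moments of even order, with a free parameter
  \<open>\<eta>\<close> that is later the bound on the weights.
\<close>

lemma cube_le_square_fourth:
  fixes x \<eta> :: real
  assumes "\<eta> > 0"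
  shows "\<bar>x\<bar> ^ 3 \<le> \<eta> * x\<^sup>2 + x ^ 4 / \<eta>"
proof -
  have "0 \<le> (\<eta> - \<bar>x\<bar>)\<^sup>2 + \<eta> * \<bar>x\<bar>" using assms by simp
  hence "\<eta> * \<bar>x\<bar> \<le> \<eta>\<^sup>2 + x\<^sup>2" by (simp add: power2_eq_square algebra_simps)
  hence "\<bar>x\<bar> \<le> \<eta> + x\<^sup>2 / \<eta>" using assms by (simp add: field_simps power2_eq_square)
  hence "\<bar>x\<bar> * x\<^sup>2 \<le> (\<eta> + x\<^sup>2 / \<eta>) * x\<^sup>2" by (intro mult_right_mono) auto
  also have "(\<eta> + x\<^sup>2 / \<eta>) * x\<^sup>2 = \<eta> * x\<^sup>2 + x ^ 4 / \<eta>" by (simp add: algebra_simps power2_eq_square power4_eq_xxxx)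
  finally show ?thesis by (simp add: power3_eq_cube power2_eq_square abs_mult_self_eq mult.assoc)
qed

lemma iexp_quadratic_approx:
  "cmod (iexp x - (1 + \<i> * x - x\<^sup>2 / 2)) \<le> \<bar>x\<bar> ^ 3"
proof -
  have "cmod (iexp x - (\<Sum>k\<le>2. (\<i> * x) ^ k / fact k)) \<le> \<bar>x\<bar> ^ (Suc 2) / fact (Suc 2)" by (rule iexp_approx1)
  also have "(\<Sum>k\<le>2. (\<i> * complex_of_real x) ^ k / fact k) = 1 + \<i> * x - x\<^sup>2 / 2"
    by (simp add: numeral_2_eq_2 power2_eq_square field_simps)
  also have "\<bar>x\<bar> ^ (Suc 2) / fact (Suc 2) = \<bar>x\<bar> ^ 3 / 6" by (simp add: fact_numeral eval_nat_numeral)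
  also have "\<dots> \<le> \<bar>x\<bar> ^ 3" using zero_le_power[OF abs_ge_zero, of x 3] by linarith
  finally show ?thesis .
qed

lemma exp_neg_linear_approx:
  fixes s :: real
  assumes "s \<ge> 0"
  shows "\<bar>exp (- s / 2) - (1 - s / 2)\<bar> \<le> s\<^sup>2"
proof (cases "s = 0")
  case False
  obtain t where t: "\<bar>t\<bar> \<le> \<bar>- s / 2\<bar>" "exp (- s / 2) = (\<Sum>m<2. (- s / 2) ^ m / fact m) + exp t / fact 2 * (- s / 2) ^ 2"
    using Maclaurin_exp_le[of "- s / 2" 2] by blast
  have lo: "1 - s / 2 \<le> exp (- s / 2)" using exp_ge_add_one_self[of "- s / 2"] by simp
  have "exp (s / 2) \<ge> 1 + s / 2" by (rule exp_ge_add_one_self)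
  hence "exp (- s / 2) \<le> 1 / (1 + s / 2)" using assms by (simp add: exp_minus inverse_eq_divide frac_le)
  also have "\<dots> \<le> 1 - s / 2 + s\<^sup>2" using assms by (simp add: field_simps power2_eq_square add_pos_nonneg)
  finally show ?thesis using lo by simp
qed simp

text \<open>
  One replacement.  The expansions of \<open>e^(i \<xi>)\<close> and of \<open>e^(-s / 2)\<close> agree up to second order once the first
  moment of \<open>\<xi>\<close> against \<open>P\<close> vanishes and the second equals that of \<open>s\<close>; the real and imaginary parts of \<open>P\<close>
  are treated separately because conditional expectations are real.
\<close>

lemma (in prob_space) conditional_char_step:
  fixes P :: "'a \<Rightarrow> complex" and \<xi> s :: "'a \<Rightarrow> real"
  assumes P[measurable]: "P \<in> borel_measurable M" "\<And>x. cmod (P x) \<le> 1"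
    and m[measurable]: "\<xi> \<in> borel_measurable M" "s \<in> borel_measurable M"
    and i: "integrable M (\<lambda>x. \<xi> x ^ 4)" "integrable M (\<lambda>x. (s x)\<^sup>2)" and s: "\<And>x. s x \<ge> 0"
    and o1: "(\<integral>x. Re (P x) * \<xi> x \<partial>M) = 0" "(\<integral>x. Im (P x) * \<xi> x \<partial>M) = 0"
    and o2: "(\<integral>x. Re (P x) * (\<xi> x)\<^sup>2 \<partial>M) = (\<integral>x. Re (P x) * s x \<partial>M)"
            "(\<integral>x. Im (P x) * (\<xi> x)\<^sup>2 \<partial>M) = (\<integral>x. Im (P x) * s x \<partial>M)"
    and \<eta>: "\<eta> > 0"
  shows "cmod (\<integral>x. P x * (iexp (\<xi> x) - exp (- s x / 2)) \<partial>M)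
     \<le> \<eta> * (\<integral>x. (\<xi> x)\<^sup>2 \<partial>M) + (\<integral>x. \<xi> x ^ 4 \<partial>M) / \<eta> + (\<integral>x. (s x)\<^sup>2 \<partial>M)"
proof -
  have i2: "integrable M (\<lambda>x. (\<xi> x)\<^sup>2)"
    using square_integrable_imp_integrable[of "\<lambda>x. (\<xi> x)\<^sup>2"] i(1) by simp
  have i1: "integrable M \<xi>" by (rule square_integrable_imp_integrable[OF m(1) i2])
  have isx: "integrable M s" by (rule square_integrable_imp_integrable[OF m(2) i(2)])
  have Pi: "integrable M (\<lambda>x. P x * complex_of_real (f x))" if "integrable M f" for f :: "'a \<Rightarrow> real"
  proof (rule Bochner_Integration.integrable_bound[OF that])
    show "AE x in M. norm (P x * complex_of_real (f x)) \<le> norm (f x)"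
      by (rule AE_I2) (simp add: norm_mult P(2) mult_left_le_one_le)
  qed (use that in measurable)
  have cI: "(\<integral>x. P x * complex_of_real (f x) \<partial>M) =
      complex_of_real (\<integral>x. Re (P x) * f x \<partial>M) + \<i> * complex_of_real (\<integral>x. Im (P x) * f x \<partial>M)"
    if "integrable M f" for f :: "'a \<Rightarrow> real"
    by (rule complex_eqI) (simp_all add: integral_Re[OF Pi[OF that], symmetric] integral_Im[OF Pi[OF that], symmetric])
  have z1: "(\<integral>x. P x * complex_of_real (\<xi> x) \<partial>M) = 0" by (simp add: cI[OF i1] o1)
  have z2: "(\<integral>x. P x * complex_of_real ((\<xi> x)\<^sup>2) \<partial>M) = (\<integral>x. P x * complex_of_real (s x) \<partial>M)"
    by (simp only: cI[OF i2] cI[OF isx] o2)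
  define r where "r x = (iexp (\<xi> x) - (1 + \<i> * \<xi> x - (\<xi> x)\<^sup>2 / 2)) - complex_of_real (exp (- s x / 2) - (1 - s x / 2))" for x
  have r: "cmod (r x) \<le> \<eta> * (\<xi> x)\<^sup>2 + \<xi> x ^ 4 / \<eta> + (s x)\<^sup>2" for x
  proof -
    have "cmod (r x) \<le> \<bar>\<xi> x\<bar> ^ 3 + (s x)\<^sup>2"
      unfolding r_def
      by (rule order_trans[OF norm_triangle_ineq4] add_mono iexp_quadratic_approx)+
        (use exp_neg_linear_approx[OF s[of x]] in \<open>simp only: norm_of_real\<close>)
    thus ?thesis using cube_le_square_fourth[OF \<eta>, of "\<xi> x"] by linarith
  qed
  have [measurable]: "r \<in> borel_measurable M" unfolding r_def by measurable
  have ib: "integrable M (\<lambda>x. \<eta> * (\<xi> x)\<^sup>2 + \<xi> x ^ 4 / \<eta> + (s x)\<^sup>2)" using i i2 by simp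
  have ir: "integrable M (\<lambda>x. P x * r x)"
  proof (rule Bochner_Integration.integrable_bound[OF ib])
    have "cmod (P x * r x) \<le> cmod (r x)" for x using P(2)[of x] by (simp add: norm_mult mult_left_le_one_le)
    thus "AE x in M. norm (P x * r x) \<le> norm (\<eta> * (\<xi> x)\<^sup>2 + \<xi> x ^ 4 / \<eta> + (s x)\<^sup>2)"
      using r by (intro AE_I2) (smt (verit) real_norm_def)
  qed measurable
  have "(\<integral>x. P x * (iexp (\<xi> x) - exp (- s x / 2)) \<partial>M) =
     (\<integral>x. \<i> * (P x * complex_of_real (\<xi> x)) - (P x * complex_of_real ((\<xi> x)\<^sup>2) - P x * complex_of_real (s x)) / 2 + P x * r x \<partial>M)"
    by (intro Bochner_Integration.integral_cong) (auto simp: r_def field_simps)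
  also have "\<dots> = (\<integral>x. P x * r x \<partial>M)"
    using Pi[OF i1] Pi[OF i2] Pi[OF isx] ir z1 z2 by simp
  finally have "cmod (\<integral>x. P x * (iexp (\<xi> x) - exp (- s x / 2)) \<partial>M) = cmod (\<integral>x. P x * r x \<partial>M)" by simp
  also have "\<dots> \<le> (\<integral>x. \<eta> * (\<xi> x)\<^sup>2 + \<xi> x ^ 4 / \<eta> + (s x)\<^sup>2 \<partial>M)"
  proof (rule order_trans[OF integral_norm_bound], rule integral_mono[OF integrable_norm[OF ir] ib])
    fix x
    show "cmod (P x * r x) \<le> \<eta> * (\<xi> x)\<^sup>2 + \<xi> x ^ 4 / \<eta> + (s x)\<^sup>2"
      using r[of x] mult_left_le_one_le[OF norm_ge_zero[of "r x"] norm_ge_zero P(2)[of x]] by (simp add: norm_mult)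
  qed
  also have "\<dots> = \<eta> * (\<integral>x. (\<xi> x)\<^sup>2 \<partial>M) + (\<integral>x. \<xi> x ^ 4 \<partial>M) / \<eta> + (\<integral>x. (s x)\<^sup>2 \<partial>M)"
    using i i2 by simp
  finally show ?thesis .
qed

text \<open>
  Lindeberg's replacement argument.  In the induction, \<open>Q\<close> collects the factors already treated on the
  left and \<open>B J\<close> the Gaussian factors still to come, so that in the step for \<open>k\<close> both are measurable
  for \<open>G k\<close>.  No independence is assumed: the hypothesis \<open>orth\<close> says that given \<open>G k\<close> the summand \<open>\<xi> k\<close> has
  mean zero and variance \<open>s k\<close>, where \<open>s k\<close> itself may be random.
\<close>

lemma (in prob_space) conditional_char_telescoping:
  fixes \<xi> s :: "'i \<Rightarrow> 'a \<Rightarrow> real" and G :: "'i \<Rightarrow> 'a measure"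
  assumes fin: "finite I" and G: "\<And>j. j \<in> I \<Longrightarrow> subalgebra M (G j)"
    and \<xi>G: "\<And>j l. j \<in> I \<Longrightarrow> l \<in> I \<Longrightarrow> l \<noteq> j \<Longrightarrow> \<xi> l \<in> borel_measurable (G j)"
    and sG: "\<And>j l. j \<in> I \<Longrightarrow> l \<in> I \<Longrightarrow> s l \<in> borel_measurable (G j)"
    and \<xi>M: "\<And>j. j \<in> I \<Longrightarrow> \<xi> j \<in> borel_measurable M"
    and i: "\<And>j. j \<in> I \<Longrightarrow> integrable M (\<lambda>x. \<xi> j x ^ 4)" "\<And>j. j \<in> I \<Longrightarrow> integrable M (\<lambda>x. (s j x)\<^sup>2)"
    and s: "\<And>j x. s j x \<ge> 0"
    and orth: "\<And>j p. j \<in> I \<Longrightarrow> p \<in> borel_measurable (G j) \<Longrightarrow> (\<And>x. \<bar>p x\<bar> \<le> 1) \<Longrightarrow>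
        (\<integral>x. p x * \<xi> j x \<partial>M) = 0 \<and> (\<integral>x. p x * (\<xi> j x)\<^sup>2 \<partial>M) = (\<integral>x. p x * s j x \<partial>M)"
    and \<eta>: "\<eta> > 0"
  shows "cmod (\<integral>x. iexp (\<Sum>j\<in>I. \<xi> j x) - exp (- (\<Sum>j\<in>I. s j x) / 2) \<partial>M)
     \<le> (\<Sum>j\<in>I. \<eta> * (\<integral>x. (\<xi> j x)\<^sup>2 \<partial>M) + (\<integral>x. \<xi> j x ^ 4 \<partial>M) / \<eta> + (\<integral>x. (s j x)\<^sup>2 \<partial>M))"
proof -
  define e where "e j = \<eta> * (\<integral>x. (\<xi> j x)\<^sup>2 \<partial>M) + (\<integral>x. \<xi> j x ^ 4 \<partial>M) / \<eta> + (\<integral>x. (s j x)\<^sup>2 \<partial>M)" for j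
  define A where "A J x = (\<Prod>j\<in>J. iexp (\<xi> j x))" for J x
  define B where "B J x = (\<Prod>j\<in>J. complex_of_real (exp (- s j x / 2)))" for J x
  have A1: "cmod (A J x) \<le> 1" for J x unfolding A_def by (simp add: prod_norm[symmetric])
  have B1: "cmod (B J x) \<le> 1" for J x unfolding B_def prod_norm[symmetric]
    by (intro prod_le_1) (use s in auto)
  have "cmod (\<integral>x. Q x * (A J x - B J x) \<partial>M) \<le> (\<Sum>j\<in>J. e j)"
    if "J \<subseteq> I" "Q \<in> borel_measurable M" "\<And>j. j \<in> J \<Longrightarrow> Q \<in> borel_measurable (G j)" "\<And>x. cmod (Q x) \<le> 1" for J Q
  proof -
    have "finite J" using that(1) fin finite_subset by blast
    thus ?thesis using that
    proof (induction J arbitrary: Q rule: finite_induct)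
      case empty thus ?case by (simp add: A_def B_def)
    next
      case (insert k J)
      note ih = insert.IH and kJ = insert.hyps and Q = insert.prems
      have k: "k \<in> I" and J: "J \<subseteq> I" using Q(1) by auto
      have [measurable]: "Q \<in> borel_measurable M" by (rule Q(2))
      have \<xi>m[measurable]: "\<xi> j \<in> borel_measurable M" if "j \<in> I" for j using \<xi>M that .
      have sm: "s j \<in> borel_measurable M" if "j \<in> I" for j using measurable_from_subalg[OF G sG] that by blast
      have AM[measurable]: "A J \<in> borel_measurable M" unfolding A_def using J \<xi>m
        by (intro borel_measurable_prod measurable_compose[OF _ borel_measurable_exp] borel_measurable_times borel_measurable_const borel_measurable_of_real) auto
      have BM[measurable]: "B J \<in> borel_measurable M" unfolding B_def using J sm
        by (intro borel_measurable_prod borel_measurable_of_real measurable_compose[OF _ borel_measurable_exp] borel_measurable_divide borel_measurable_uminus borel_measurable_const) auto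
      have BG: "B J \<in> borel_measurable (G k)" unfolding B_def using J sG k
        by (intro borel_measurable_prod borel_measurable_of_real measurable_compose[OF _ borel_measurable_exp] borel_measurable_divide borel_measurable_uminus borel_measurable_const) auto
      have [measurable]: "\<xi> k \<in> borel_measurable M" "s k \<in> borel_measurable M" using \<xi>m sm k by auto
      have n1: "cmod (Q x * iexp (\<xi> k x)) \<le> 1" for x using Q(4)[of x] by (simp add: norm_mult)
      have n2: "cmod (Q x * B J x) \<le> 1" for x using Q(4)[of x] B1[of J x] by (simp add: norm_mult mult_le_one)
      have 1: "cmod (\<integral>x. (Q x * iexp (\<xi> k x)) * (A J x - B J x) \<partial>M) \<le> (\<Sum>j\<in>J. e j)"
      proof (rule ih[OF J])
        fix j assume j: "j \<in> J"
        have "\<xi> k \<in> borel_measurable (G j)" using \<xi>G[of j k] j J k kJ by auto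
        moreover have "Q \<in> borel_measurable (G j)" using Q(3) j by auto
        ultimately show "(\<lambda>x. Q x * iexp (\<xi> k x)) \<in> borel_measurable (G j)" by measurable
      qed (use n1 in auto)
      have QB: "(\<lambda>x. Q x * B J x) \<in> borel_measurable (G k)" using BG Q(3) by auto
      have re: "(\<lambda>x. Re (Q x * B J x)) \<in> borel_measurable (G k)" "\<And>x. \<bar>Re (Q x * B J x)\<bar> \<le> 1"
        using QB n2 abs_Re_le_cmod by (auto intro: order_trans simp del: times_complex.sel)
      have im: "(\<lambda>x. Im (Q x * B J x)) \<in> borel_measurable (G k)" "\<And>x. \<bar>Im (Q x * B J x)\<bar> \<le> 1"
        using QB n2 abs_Im_le_cmod by (auto intro: order_trans simp del: times_complex.sel)
      have 2: "cmod (\<integral>x. (Q x * B J x) * (iexp (\<xi> k x) - exp (- s k x / 2)) \<partial>M) \<le> e k"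
        unfolding e_def
        by (rule conditional_char_step) (use orth[OF k re] orth[OF k im] i k s \<eta> n2 in auto)
      have ii: "integrable M (\<lambda>x. f x)" if [measurable]: "f \<in> borel_measurable M" and "\<And>x. cmod (f x) \<le> 2" for f
        by (rule integrable_const_bound[where B = 2]) (use that in auto)
      have i1: "integrable M (\<lambda>x. (Q x * iexp (\<xi> k x)) * (A J x - B J x))"
      proof (rule ii)
        fix x
        have "cmod ((Q x * iexp (\<xi> k x)) * (A J x - B J x)) \<le> 1 * 2"
          unfolding norm_mult[of "Q x * iexp (\<xi> k x)"] using n1[of x] norm_triangle_ineq4[of "A J x" "B J x"] A1[of J x] B1[of J x]
          by (intro mult_mono) auto
        thus "cmod ((Q x * iexp (\<xi> k x)) * (A J x - B J x)) \<le> 2" by simp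
      qed measurable
      have i2: "integrable M (\<lambda>x. (Q x * B J x) * (iexp (\<xi> k x) - exp (- s k x / 2)))"
      proof (rule ii)
        fix x
        have "exp (- s k x / 2) \<le> 1" using s[of k x] by simp
        hence "cmod (iexp (\<xi> k x) - exp (- s k x / 2)) \<le> 2"
          using norm_triangle_ineq4[of "iexp (\<xi> k x)" "complex_of_real (exp (- s k x / 2))"]
          by (simp only: norm_exp_i_times norm_of_real abs_exp_cancel)
        hence "cmod ((Q x * B J x) * (iexp (\<xi> k x) - exp (- s k x / 2))) \<le> 1 * 2"
          unfolding norm_mult[of "Q x * B J x"] using n2[of x] by (intro mult_mono) auto
        thus "cmod ((Q x * B J x) * (iexp (\<xi> k x) - exp (- s k x / 2))) \<le> 2" by simp
      qed measurable
      have "(\<integral>x. Q x * (A (insert k J) x - B (insert k J) x) \<partial>M) =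
        (\<integral>x. (Q x * iexp (\<xi> k x)) * (A J x - B J x) + (Q x * B J x) * (iexp (\<xi> k x) - exp (- s k x / 2)) \<partial>M)"
        using kJ by (intro Bochner_Integration.integral_cong) (auto simp: A_def B_def algebra_simps)
      also have "\<dots> = (\<integral>x. (Q x * iexp (\<xi> k x)) * (A J x - B J x) \<partial>M) + (\<integral>x. (Q x * B J x) * (iexp (\<xi> k x) - exp (- s k x / 2)) \<partial>M)"
        by (rule Bochner_Integration.integral_add[OF i1 i2])
      finally show ?case using 1 2 kJ
        by (simp only: sum.insert) (rule order_trans[OF norm_triangle_ineq], simp)
    qed
  qed
  from this[of I "\<lambda>_. 1"] have "cmod (\<integral>x. (A I x - B I x) \<partial>M) \<le> (\<Sum>j\<in>I. e j)" by simp
  moreover have "A I x = iexp (\<Sum>j\<in>I. \<xi> j x)" for x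
    unfolding A_def using fin by (simp add: exp_sum sum_distrib_left)
  moreover have "B I x = exp (- (\<Sum>j\<in>I. s j x) / 2)" for x
    unfolding B_def using fin by (simp add: exp_sum[symmetric] sum_negf sum_divide_distrib flip: of_real_prod)
  ultimately show ?thesis by (simp add: e_def)
qed

section \<open>The continuity theorem for random vectors\<close>

lemma inj_axis_one: "inj (\<lambda>a::'d::finite. axis a (1::real))"
  by (auto simp: inj_on_def axis_eq_axis)

lemma Basis_real_vec: "(Basis :: (real ^ 'd) set) = range (\<lambda>a. axis a 1)"
  by (auto simp: Basis_vec_def)

text \<open>
  Lebesgue measure on \<open>real ^ 'd\<close> is an image of the product measure indexed by its basis; reindexing
  by coordinates gives Fubini's theorem for products of functions of single coordinates.
\<close>

lemma integral_lborel_prod_components: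
  fixes g :: "'d::finite \<Rightarrow> real \<Rightarrow> 'b::{real_normed_field,banach,second_countable_topology}"
  assumes g: "\<And>a. integrable lborel (g a)"
  shows "integrable lborel (\<lambda>z::real^'d. \<Prod>a\<in>UNIV. g a (z $ a))"
    and "(\<integral>z. (\<Prod>a\<in>UNIV. g a (z $ a)) \<partial>(lborel :: (real^'d) measure)) = (\<Prod>a\<in>UNIV. integral\<^sup>L lborel (g a))"
proof -
  let ?L = "\<Pi>\<^sub>M b\<in>(Basis :: (real^'d) set). (lborel :: real measure)"
  interpret product_sigma_finite "\<lambda>b::real^'d. lborel :: real measure" by standard
  define T where "T f = (\<Sum>b\<in>Basis. f b *\<^sub>R b)" for f :: "real^'d \<Rightarrow> real"
  define ix where "ix = inv_into UNIV (\<lambda>a::'d. axis a (1::real))"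
  have ix: "ix (axis a 1) = a" for a unfolding ix_def by (rule inv_f_f[OF inj_axis_one])
  have T[measurable]: "T \<in> ?L \<rightarrow>\<^sub>M borel" unfolding T_def by measurable
  have Tc: "T f $ a = f (axis a 1)" for f a
  proof -
    have "T f $ a = T f \<bullet> axis a 1" by (simp add: inner_axis)
    also have "\<dots> = f (axis a 1)" unfolding T_def
      by (subst inner_sum_left_Basis) (auto simp: Basis_real_vec)
    finally show ?thesis .
  qed
  have L: "(lborel :: (real^'d) measure) = distr ?L borel T" by (subst lborel_eq) (simp add: T_def[abs_def])
  have gm[measurable]: "g a \<in> borel_measurable borel" for a using g[of a] by auto
  have m: "(\<lambda>z::real^'d. \<Prod>a\<in>UNIV. g a (z $ a)) \<in> borel_measurable borel"
    by (intro borel_measurable_prod measurable_compose[OF _ gm] borel_measurable_continuous_onI continuous_intros)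
  have e: "(\<Prod>a\<in>UNIV. g a (T f $ a)) = (\<Prod>b\<in>Basis. g (ix b) (f b))" for f
    unfolding Tc Basis_real_vec by (subst prod.reindex[OF inj_axis_one]) (simp add: ix)
  have "integrable ?L (\<lambda>f. \<Prod>b\<in>Basis. g (ix b) (f b))"
    by (rule product_integrable_prod) (auto intro: g)
  thus "integrable lborel (\<lambda>z::real^'d. \<Prod>a\<in>UNIV. g a (z $ a))"
    unfolding L by (subst integrable_distr_eq[OF T m]) (simp add: e)
  have "(\<integral>z. (\<Prod>a\<in>UNIV. g a (z $ a)) \<partial>(lborel :: (real^'d) measure)) = (\<integral>f. (\<Prod>b\<in>Basis. g (ix b) (f b)) \<partial>?L)"
    unfolding L by (subst integral_distr[OF T m]) (simp add: e)
  also have "\<dots> = (\<Prod>b\<in>(Basis :: (real^'d) set). integral\<^sup>L lborel (g (ix b)))"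
    by (rule product_integral_prod) (auto intro: g)
  also have "\<dots> = (\<Prod>a\<in>UNIV. integral\<^sup>L lborel (g a))"
    unfolding Basis_real_vec by (subst prod.reindex[OF inj_axis_one]) (simp add: ix)
  finally show "(\<integral>z. (\<Prod>a\<in>UNIV. g a (z $ a)) \<partial>(lborel :: (real^'d) measure)) = (\<Prod>a\<in>UNIV. integral\<^sup>L lborel (g a))" .
qed

definition gauss_density :: "real ^ 'd \<Rightarrow> real" where
  "gauss_density z = (\<Prod>a\<in>UNIV. std_normal_density (z $ a))"

lemma gauss_density_nonneg: "0 \<le> gauss_density z"
  unfolding gauss_density_def by (intro prod_nonneg) simp

lemma measurable_gauss_density[measurable]: "gauss_density \<in> borel_measurable borel"
  unfolding gauss_density_def[abs_def]
  by (intro borel_measurable_prod measurable_compose[OF _ borel_measurable_normal_density] borel_measurable_continuous_onI continuous_intros)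

lemma std_normal_vec_alt: "std_normal_vec = density lborel (\<lambda>z. ennreal (gauss_density z))"
  by (simp add: std_normal_vec_def gauss_density_def)

lemma sets_std_normal_vec [simp, measurable_cong]: "sets std_normal_vec = sets borel"
  and space_std_normal_vec [simp]: "space std_normal_vec = UNIV"
  by (simp_all add: std_normal_vec_def)

lemma integral_std_normal_vec:
  fixes f :: "real ^ 'd \<Rightarrow> 'b::{banach, second_countable_topology}"
  assumes "f \<in> borel_measurable borel"
  shows "(\<integral>z. f z \<partial>std_normal_vec) = (\<integral>z. gauss_density z *\<^sub>R f z \<partial>lborel)"
  unfolding std_normal_vec_alt using assms by (subst integral_density) (auto simp: gauss_density_nonneg)

lemma integrable_gauss_density: "integrable lborel gauss_density"
  and integral_gauss_density: "(\<integral>z. gauss_density z \<partial>lborel) = 1"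
proof -
  have "integrable lborel (std_normal_density)" "(\<integral>x. std_normal_density x \<partial>lborel) = 1"
    by (auto intro: integrable_normal_density integral_normal_density)
  thus "integrable lborel gauss_density" "(\<integral>z. gauss_density z \<partial>lborel) = 1"
    unfolding gauss_density_def[abs_def] using integral_lborel_prod_components[of "\<lambda>_. std_normal_density"] by auto
qed

lemma prob_space_std_normal_vec: "prob_space (std_normal_vec :: (real ^ 'd) measure)"
proof
  let ?\<gamma> = "std_normal_vec :: (real ^ 'd) measure"
  have "emeasure ?\<gamma> (space ?\<gamma>) = (\<integral>\<^sup>+z. ennreal (gauss_density (z :: real ^ 'd)) \<partial>lborel)"
    unfolding std_normal_vec_alt by (subst emeasure_density) auto
  also have "\<dots> = 1"
    using integrable_gauss_density integral_gauss_density
    by (subst nn_integral_eq_integral) (auto simp: gauss_density_nonneg)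
  finally show "emeasure ?\<gamma> (space ?\<gamma>) = 1" .
qed

lemma char_std_normal_vec:
  "(CLINT z|std_normal_vec. iexp (t \<bullet> z)) = complex_of_real (exp (- (t \<bullet> t) / 2))"
proof -
  have i: "integrable lborel (\<lambda>x. complex_of_real (std_normal_density x) * iexp (t $ a * x))" for a
  proof (rule Bochner_Integration.integrable_bound)
    show "integrable lborel std_normal_density" by (auto intro: integrable_normal_density)
  qed (auto simp: norm_mult)
  have c: "(CLINT x|lborel. complex_of_real (std_normal_density x) * iexp (t $ a * x)) = complex_of_real (exp (- (t $ a)\<^sup>2 / 2))" for a
    using fun_cong[OF char_std_normal_distribution, of "t $ a"]
    by (simp add: char_def integral_density scaleR_conv_of_real)
  have "(CLINT z|std_normal_vec. iexp (t \<bullet> z)) = (CLINT z|lborel. gauss_density z *\<^sub>R iexp (t \<bullet> z))"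
    by (rule integral_std_normal_vec) measurable
  also have "\<dots> = (CLINT z|lborel. (\<Prod>a\<in>UNIV. complex_of_real (std_normal_density (z $ a)) * iexp (t $ a * (z $ a))))"
    by (intro Bochner_Integration.integral_cong refl)
      (simp add: gauss_density_def scaleR_conv_of_real prod.distrib inner_vec_def exp_sum sum_distrib_left)
  also have "\<dots> = (\<Prod>a\<in>UNIV. complex_of_real (exp (- (t $ a)\<^sup>2 / 2)))"
    by (simp only: integral_lborel_prod_components(2)[OF i] c)
  also have "\<dots> = complex_of_real (exp (- (t \<bullet> t) / 2))"
    by (simp add: inner_vec_def exp_sum[symmetric] sum_negf sum_divide_distrib power2_eq_square flip: of_real_prod)
  finally show ?thesis .
qed

definition gauss_const :: "'d::finite itself \<Rightarrow> real" where
  "gauss_const _ = (1 / sqrt (2 * pi)) ^ CARD('d)"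

lemma gauss_density_eq: "gauss_density (z :: real ^ 'd) = gauss_const TYPE('d) * exp (- (z \<bullet> z) / 2)"
  unfolding gauss_density_def std_normal_density_def gauss_const_def prod.distrib
  by (simp add: inner_vec_def exp_sum[symmetric] sum_negf sum_divide_distrib power2_eq_square)

lemma gauss_density_le: "gauss_density (z :: real ^ 'd) \<le> gauss_const TYPE('d)"
proof -
  have "gauss_const TYPE('d) * exp (- (z \<bullet> z) / 2) \<le> gauss_const TYPE('d) * 1"
    by (intro mult_left_mono) (auto simp: gauss_const_def)
  thus ?thesis by (simp add: gauss_density_eq)
qed

text \<open>
  The Gaussian density is a multiple of its own Fourier transform, which makes convolutions with it
  accessible to characteristic functions.
\<close>

lemma gauss_density_fourier:
  "complex_of_real (gauss_density (z :: real ^ 'd)) = gauss_const TYPE('d) * (CLINT t|std_normal_vec. iexp (z \<bullet> t))"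
  by (simp add: char_std_normal_vec gauss_density_eq)

context
  fixes \<mu> :: "(real ^ 'd) measure"
  assumes prob: "prob_space \<mu>" and sets\<mu>[measurable_cong]: "sets \<mu> = sets borel"
begin

interpretation \<mu>: prob_space \<mu> by (rule prob)
interpretation \<gamma>: prob_space "std_normal_vec :: (real ^ 'd) measure" by (rule prob_space_std_normal_vec)

lemma space\<mu>: "space \<mu> = UNIV"
  using sets_eq_imp_space_eq[OF sets\<mu>] by simp

text \<open>
  The density of \<open>\<mu>\<close> smoothed by Gaussian noise of scale \<open>\<sigma>\<close>, expressed through the characteristic
  function of \<open>\<mu>\<close>: insert the Fourier representation and exchange the integrals.
\<close>

lemma smoothed_density_fourier:
  "complex_of_real (\<integral>x. gauss_density ((1 / \<sigma>) *\<^sub>R (a - x)) \<partial>\<mu>) =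
   gauss_const TYPE('d) * (CLINT t|std_normal_vec. iexp ((1 / \<sigma>) * (a \<bullet> t)) * (CLINT x|\<mu>. iexp (((- 1 / \<sigma>) *\<^sub>R t) \<bullet> x)))"
proof -
  interpret P: pair_prob_space "std_normal_vec :: (real ^ 'd) measure" \<mu> ..
  have e: "iexp (((1 / \<sigma>) *\<^sub>R (a - x)) \<bullet> t) = iexp ((1 / \<sigma>) * (a \<bullet> t)) * iexp (((- 1 / \<sigma>) *\<^sub>R t) \<bullet> x)" for x t
    by (simp add: exp_add[symmetric] inner_diff_left algebra_simps inner_commute diff_divide_distrib)
  have "integrable (std_normal_vec \<Otimes>\<^sub>M \<mu>) (\<lambda>(t, x). iexp (((1 / \<sigma>) *\<^sub>R (a - x)) \<bullet> t))"
  proof (rule P.integrable_const_bound[where B = 1])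
    show "(\<lambda>(t, x). iexp (((1 / \<sigma>) *\<^sub>R (a - x)) \<bullet> t)) \<in> borel_measurable (std_normal_vec \<Otimes>\<^sub>M \<mu>)" by measurable
  qed (auto intro!: AE_I2)
  note F = P.Fubini_integral[OF this]
  have "complex_of_real (\<integral>x. gauss_density ((1 / \<sigma>) *\<^sub>R (a - x)) \<partial>\<mu>)
      = (CLINT x|\<mu>. complex_of_real (gauss_density ((1 / \<sigma>) *\<^sub>R (a - x))))" by simp
  also have "\<dots> = (CLINT x|\<mu>. gauss_const TYPE('d) * (CLINT t|std_normal_vec. iexp (((1 / \<sigma>) *\<^sub>R (a - x)) \<bullet> t)))"
    unfolding gauss_density_fourier ..
  also have "\<dots> = gauss_const TYPE('d) * (CLINT x|\<mu>. (CLINT t|std_normal_vec. iexp (((1 / \<sigma>) *\<^sub>R (a - x)) \<bullet> t)))"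
    by (rule integral_mult_right_zero)
  also have "(CLINT x|\<mu>. (CLINT t|std_normal_vec. iexp (((1 / \<sigma>) *\<^sub>R (a - x)) \<bullet> t)))
      = (CLINT t|std_normal_vec. (CLINT x|\<mu>. iexp (((1 / \<sigma>) *\<^sub>R (a - x)) \<bullet> t)))" by (rule F)
  also have "\<dots> = (CLINT t|std_normal_vec. iexp ((1 / \<sigma>) * (a \<bullet> t)) * (CLINT x|\<mu>. iexp (((- 1 / \<sigma>) *\<^sub>R t) \<bullet> x)))"
    unfolding e by (simp only: integral_mult_right_zero)
  finally show ?thesis .
qed

text \<open>
  Substituting \<open>a = x + \<sigma> z\<close> moves the Gaussian noise from the argument of \<open>f\<close> to a kernel.
\<close>

lemma smoothed_integral:
  fixes f :: "real ^ 'd \<Rightarrow> real"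
  assumes f: "integrable lborel f" and \<sigma>: "\<sigma> > 0"
  shows "(\<integral>x. (\<integral>z. f (x + \<sigma> *\<^sub>R z) \<partial>std_normal_vec) \<partial>\<mu>) =
    (\<integral>a. f a * (\<integral>x. gauss_density ((1 / \<sigma>) *\<^sub>R (a - x)) \<partial>\<mu>) \<partial>lborel) / \<sigma> ^ CARD('d)"
proof -
  have fm[measurable]: "f \<in> borel_measurable borel" using f by auto
  interpret P: pair_sigma_finite "lborel :: (real ^ 'd) measure" \<mu> ..
  have shift: "(\<integral>z. f (x + \<sigma> *\<^sub>R z) \<partial>std_normal_vec) = (\<integral>a. f a * gauss_density ((1 / \<sigma>) *\<^sub>R (a - x)) \<partial>lborel) / \<sigma> ^ CARD('d)" for x
  proof -
    have L: "lborel = density (distr lborel borel (\<lambda>z. x + \<sigma> *\<^sub>R z)) (\<lambda>_. \<bar>\<sigma>\<bar> ^ DIM(real ^ 'd))"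
      using lborel_affine[of \<sigma> x] \<sigma> by simp
    have "(\<integral>a. f a * gauss_density ((1 / \<sigma>) *\<^sub>R (a - x)) \<partial>lborel)
       = (\<integral>a. \<bar>\<sigma>\<bar> ^ DIM(real ^ 'd) *\<^sub>R (f a * gauss_density ((1 / \<sigma>) *\<^sub>R (a - x))) \<partial>distr lborel borel (\<lambda>z. x + \<sigma> *\<^sub>R z))"
      by (subst L, subst integral_density) auto
    also have "\<dots> = (\<integral>z. \<sigma> ^ CARD('d) * (f (x + \<sigma> *\<^sub>R z) * gauss_density z) \<partial>lborel)"
      using \<sigma> by (subst integral_distr) auto
    also have "\<dots> = \<sigma> ^ CARD('d) * (\<integral>z. f (x + \<sigma> *\<^sub>R z) \<partial>std_normal_vec)"
      by (subst integral_std_normal_vec) (auto simp: mult.commute)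
    finally show ?thesis using \<sigma> by simp
  qed
  have int: "integrable (lborel \<Otimes>\<^sub>M \<mu>) (\<lambda>(a, x). f a * gauss_density ((1 / \<sigma>) *\<^sub>R (a - x)))"
  proof (rule P.Fubini_integrable)
    show "(\<lambda>(a, x). f a * gauss_density ((1 / \<sigma>) *\<^sub>R (a - x))) \<in> borel_measurable (lborel \<Otimes>\<^sub>M \<mu>)" by measurable
    have b: "norm (f a * gauss_density ((1 / \<sigma>) *\<^sub>R (a - x))) \<le> \<bar>f a\<bar> * gauss_const TYPE('d)" for a x
      using gauss_density_le[of "(1 / \<sigma>) *\<^sub>R (a - x)"] gauss_density_nonneg[of "(1 / \<sigma>) *\<^sub>R (a - x)"]
      by (simp add: abs_mult mult_left_mono)
    have i: "integrable \<mu> (\<lambda>x. f a * gauss_density ((1 / \<sigma>) *\<^sub>R (a - x)))" for a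
      by (rule \<mu>.integrable_const_bound[OF AE_I2[OF b]]) measurable
    show "AE a in lborel. integrable \<mu> (\<lambda>y. case (a, y) of (a, x) \<Rightarrow> f a * gauss_density ((1 / \<sigma>) *\<^sub>R (a - x)))"
      using i by simp
    show "integrable lborel (\<lambda>a. \<integral>y. norm (case (a, y) of (a, x) \<Rightarrow> f a * gauss_density ((1 / \<sigma>) *\<^sub>R (a - x))) \<partial>\<mu>)"
    proof (rule Bochner_Integration.integrable_bound)
      show "integrable lborel (\<lambda>a. \<bar>f a\<bar> * gauss_const TYPE('d))" using f by simp
      show "AE a in lborel. norm (\<integral>y. norm (case (a, y) of (a, x) \<Rightarrow> f a * gauss_density ((1 / \<sigma>) *\<^sub>R (a - x))) \<partial>\<mu>)
          \<le> norm (\<bar>f a\<bar> * gauss_const TYPE('d))"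
      proof (rule AE_I2)
        fix a
        have "(\<integral>y. norm (f a * gauss_density ((1 / \<sigma>) *\<^sub>R (a - y))) \<partial>\<mu>) \<le> (\<integral>y. \<bar>f a\<bar> * gauss_const TYPE('d) \<partial>\<mu>)"
          by (rule integral_mono[OF integrable_norm[OF i] _ b]) simp
        thus "norm (\<integral>y. norm (case (a, y) of (a, x) \<Rightarrow> f a * gauss_density ((1 / \<sigma>) *\<^sub>R (a - x))) \<partial>\<mu>)
          \<le> norm (\<bar>f a\<bar> * gauss_const TYPE('d))" by (simp add: \<mu>.prob_space)
      qed
    qed measurable
  qed
  have "(\<integral>x. (\<integral>z. f (x + \<sigma> *\<^sub>R z) \<partial>std_normal_vec) \<partial>\<mu>)
      = (\<integral>x. (\<integral>a. f a * gauss_density ((1 / \<sigma>) *\<^sub>R (a - x)) \<partial>lborel) \<partial>\<mu>) / \<sigma> ^ CARD('d)"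
    unfolding shift by simp
  also have "(\<integral>x. (\<integral>a. f a * gauss_density ((1 / \<sigma>) *\<^sub>R (a - x)) \<partial>lborel) \<partial>\<mu>)
      = (\<integral>a. (\<integral>x. f a * gauss_density ((1 / \<sigma>) *\<^sub>R (a - x)) \<partial>\<mu>) \<partial>lborel)"
    by (rule P.Fubini_integral[OF int])
  finally show ?thesis by simp
qed

end

text \<open>
  Pointwise convergence of characteristic functions passes through two dominated convergences: first to
  the smoothed densities, where everything is bounded by one, then to their integrals against the
  integrable \<open>f\<close>.
\<close>

lemma char_convergence_smoothed:
  fixes \<mu> :: "nat \<Rightarrow> (real ^ 'd) measure" and f :: "real ^ 'd \<Rightarrow> real"
  assumes \<mu>: "\<And>n. prob_space (\<mu> n)" "\<And>n. sets (\<mu> n) = sets borel"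
    and \<nu>: "prob_space \<nu>" "sets \<nu> = sets borel"
    and conv: "\<And>t. (\<lambda>n. CLINT x|\<mu> n. iexp (t \<bullet> x)) \<longlonglongrightarrow> (CLINT x|\<nu>. iexp (t \<bullet> x))"
    and f: "integrable lborel f" and \<sigma>: "\<sigma> > 0"
  shows "(\<lambda>n. \<integral>x. (\<integral>z. f (x + \<sigma> *\<^sub>R z) \<partial>std_normal_vec) \<partial>\<mu> n) \<longlonglongrightarrow> (\<integral>x. (\<integral>z. f (x + \<sigma> *\<^sub>R z) \<partial>std_normal_vec) \<partial>\<nu>)"
proof -
  interpret \<gamma>: prob_space "std_normal_vec :: (real ^ 'd) measure" by (rule prob_space_std_normal_vec)
  have fm[measurable]: "f \<in> borel_measurable borel" using f by auto
  define h where "h m a = (\<integral>x. gauss_density ((1 / \<sigma>) *\<^sub>R (a - x)) \<partial>m)" for m :: "(real ^ 'd) measure" and a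
  have phi_m: "(\<lambda>t. CLINT x|m. iexp (((- 1 / \<sigma>) *\<^sub>R t) \<bullet> x)) \<in> borel_measurable borel"
    and phi_b: "cmod (CLINT x|m. iexp (t \<bullet> x)) \<le> 1"
    and h_m: "h m \<in> borel_measurable borel" and h_b: "\<bar>h m a\<bar> \<le> gauss_const TYPE('d)"
    if m: "prob_space m" "sets m = sets borel" for m :: "(real ^ 'd) measure" and t a
  proof -
    interpret m: prob_space m by (rule m)
    note m(2)[measurable_cong]
    show "(\<lambda>t. CLINT x|m. iexp (((- 1 / \<sigma>) *\<^sub>R t) \<bullet> x)) \<in> borel_measurable borel" by measurable
    show "h m \<in> borel_measurable borel" unfolding h_def[abs_def] by measurable
    have "cmod (CLINT x|m. iexp (t \<bullet> x)) \<le> (\<integral>x. cmod (iexp (t \<bullet> x)) \<partial>m)" by (rule integral_norm_bound)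
    thus "cmod (CLINT x|m. iexp (t \<bullet> x)) \<le> 1" by (simp add: m.prob_space)
    have i: "integrable m (\<lambda>x. gauss_density ((1 / \<sigma>) *\<^sub>R (a - x)))"
      by (rule m.integrable_const_bound[where B = "gauss_const TYPE('d)"])
        (auto intro!: AE_I2 simp: gauss_density_nonneg gauss_density_le)
    have "h m a \<le> (\<integral>x. gauss_const TYPE('d) \<partial>m)" unfolding h_def
      by (rule integral_mono[OF i]) (auto simp: gauss_density_le)
    moreover have "h m a \<ge> 0" unfolding h_def by (intro integral_nonneg_AE AE_I2 gauss_density_nonneg)
    ultimately show "\<bar>h m a\<bar> \<le> gauss_const TYPE('d)" by (simp add: m.prob_space)
  qed
  have hc: "(\<lambda>n. h (\<mu> n) a) \<longlonglongrightarrow> h \<nu> a" for a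
  proof -
    have "(\<lambda>n. CLINT t|std_normal_vec. iexp ((1 / \<sigma>) * (a \<bullet> t)) * (CLINT x|\<mu> n. iexp (((- 1 / \<sigma>) *\<^sub>R t) \<bullet> x)))
       \<longlonglongrightarrow> (CLINT t|std_normal_vec. iexp ((1 / \<sigma>) * (a \<bullet> t)) * (CLINT x|\<nu>. iexp (((- 1 / \<sigma>) *\<^sub>R t) \<bullet> x)))"
    proof (rule integral_dominated_convergence[where w = "\<lambda>_. 1"])
      show "(\<lambda>t. iexp ((1 / \<sigma>) * (a \<bullet> t)) * (CLINT x|\<nu>. iexp (((- 1 / \<sigma>) *\<^sub>R t) \<bullet> x))) \<in> borel_measurable std_normal_vec"
        using phi_m[OF \<nu>] by measurable
      show "(\<lambda>t. iexp ((1 / \<sigma>) * (a \<bullet> t)) * (CLINT x|\<mu> n. iexp (((- 1 / \<sigma>) *\<^sub>R t) \<bullet> x))) \<in> borel_measurable std_normal_vec" for n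
        using phi_m[OF \<mu>, of n] by measurable
      show "AE t in std_normal_vec. (\<lambda>n. iexp ((1 / \<sigma>) * (a \<bullet> t)) * (CLINT x|\<mu> n. iexp (((- 1 / \<sigma>) *\<^sub>R t) \<bullet> x)))
         \<longlonglongrightarrow> iexp ((1 / \<sigma>) * (a \<bullet> t)) * (CLINT x|\<nu>. iexp (((- 1 / \<sigma>) *\<^sub>R t) \<bullet> x))"
        by (intro AE_I2 tendsto_mult tendsto_const conv)
      show "AE t in std_normal_vec. norm (iexp ((1 / \<sigma>) * (a \<bullet> t)) * (CLINT x|\<mu> n. iexp (((- 1 / \<sigma>) *\<^sub>R t) \<bullet> x))) \<le> 1" for n
        using phi_b[OF \<mu>, of n] by (intro AE_I2) (simp only: norm_mult norm_exp_i_times mult_1)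
    qed auto
    hence "(\<lambda>n. complex_of_real (h (\<mu> n) a)) \<longlonglongrightarrow> complex_of_real (h \<nu> a)"
      unfolding h_def smoothed_density_fourier[OF \<mu>] smoothed_density_fourier[OF \<nu>] by (intro tendsto_mult tendsto_const)
    thus ?thesis by (simp only: tendsto_of_real_iff)
  qed
  have "(\<lambda>n. \<integral>a. f a * h (\<mu> n) a \<partial>lborel) \<longlonglongrightarrow> (\<integral>a. f a * h \<nu> a \<partial>lborel)"
  proof (rule integral_dominated_convergence[where w = "\<lambda>a. \<bar>f a\<bar> * gauss_const TYPE('d)"])
    show "(\<lambda>a. f a * h \<nu> a) \<in> borel_measurable lborel" using h_m[OF \<nu>] by measurable
    show "(\<lambda>a. f a * h (\<mu> n) a) \<in> borel_measurable lborel" for n using h_m[OF \<mu>, of n] by measurable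
    show "AE a in lborel. (\<lambda>n. f a * h (\<mu> n) a) \<longlonglongrightarrow> f a * h \<nu> a" by (intro AE_I2 tendsto_intros hc)
    show "AE a in lborel. norm (f a * h (\<mu> n) a) \<le> \<bar>f a\<bar> * gauss_const TYPE('d)" for n
      using h_b[OF \<mu>, of n] by (intro AE_I2) (simp add: abs_mult mult_left_mono)
  qed (use f in auto)
  thus ?thesis
    unfolding smoothed_integral[OF \<mu> f \<sigma>] smoothed_integral[OF \<nu> f \<sigma>] h_def
    using \<sigma> by (intro tendsto_divide tendsto_const) auto
qed

text \<open>
  A continuous function of compact support is uniformly continuous, and Gaussian noise of small scale
  moves its argument by more than the modulus \<open>d\<close> only with small probability.
\<close>

lemma smoothing_uniformly_close:
  fixes f :: "real ^ 'd \<Rightarrow> real"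
  assumes f: "continuous_on UNIV f" "\<And>x. norm x > R \<Longrightarrow> f x = 0" and \<epsilon>: "\<epsilon> > 0"
  obtains \<sigma> where "\<sigma> > 0" "\<And>x. \<bar>(\<integral>z. f (x + \<sigma> *\<^sub>R z) \<partial>std_normal_vec) - f x\<bar> \<le> \<epsilon>"
proof -
  let ?\<gamma> = "std_normal_vec :: (real ^ 'd) measure"
  interpret \<gamma>: prob_space ?\<gamma> by (rule prob_space_std_normal_vec)
  have fm[measurable]: "f \<in> borel_measurable borel" using f(1) by (rule borel_measurable_continuous_onI)
  have c: "continuous_on (cball 0 (R + 1)) f" using f(1) continuous_on_subset by blast
  have "bounded (f ` cball 0 (R + 1))" using c by (intro compact_imp_bounded compact_continuous_image) auto
  then obtain B0 where B0: "\<And>x. x \<in> cball 0 (R + 1) \<Longrightarrow> \<bar>f x\<bar> \<le> B0"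
    unfolding bounded_iff real_norm_def by blast
  define B where "B = max B0 0"
  have B: "\<bar>f x\<bar> \<le> B" for x
    using B0[of x] f(2)[of x] unfolding B_def by (cases "norm x \<le> R + 1") auto
  have B00: "B \<ge> 0" by (simp add: B_def)
  have "uniformly_continuous_on (cball 0 (R + 1)) f" by (rule compact_uniformly_continuous[OF c]) simp
  then obtain d0 where d0: "d0 > 0" "\<And>x y. x \<in> cball 0 (R + 1) \<Longrightarrow> y \<in> cball 0 (R + 1) \<Longrightarrow> dist y x < d0 \<Longrightarrow> dist (f y) (f x) < \<epsilon> / 2"
    unfolding uniformly_continuous_on_def using \<epsilon> half_gt_zero by metis
  define d where "d = min d0 1"
  have d: "d > 0" "\<And>x y. norm y < d \<Longrightarrow> \<bar>f (x + y) - f x\<bar> \<le> \<epsilon> / 2"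
  proof -
    show "d > 0" using d0 by (simp add: d_def)
    fix x y :: "real ^ 'd" assume y: "norm y < d"
    show "\<bar>f (x + y) - f x\<bar> \<le> \<epsilon> / 2"
    proof (cases "x \<in> cball 0 (R + 1) \<and> x + y \<in> cball 0 (R + 1)")
      case True
      thus ?thesis using d0(2)[of x "x + y"] y by (simp add: dist_norm d_def)
    next
      case False
      have "norm x \<le> norm (x + y) + norm y" "norm (x + y) \<le> norm x + norm y"
        using norm_triangle_ineq4[of "x + y" y] norm_triangle_ineq[of x y] by auto
      hence "norm x > R" "norm (x + y) > R" using False y unfolding d_def by auto
      thus ?thesis using f(2) \<epsilon> by simp
    qed
  qed
  have "(\<lambda>n. measure ?\<gamma> {z \<in> space ?\<gamma>. norm z \<ge> real n}) \<longlonglongrightarrow> measure ?\<gamma> (\<Inter>n. {z \<in> space ?\<gamma>. norm z \<ge> real n})"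
    by (rule \<gamma>.finite_Lim_measure_decseq) (auto simp: decseq_def)
  moreover have "(\<Inter>n. {z \<in> space ?\<gamma>. norm z \<ge> real n}) = {}"
    by (auto, meson not_le reals_Archimedean2)
  ultimately have "(\<lambda>n. measure ?\<gamma> {z \<in> space ?\<gamma>. norm z \<ge> real n}) \<longlonglongrightarrow> 0" by simp
  moreover have "\<epsilon> / (4 * B + 1) > 0" using \<epsilon> B00 by simp
  ultimately have "\<forall>\<^sub>F n in sequentially. measure ?\<gamma> {z \<in> space ?\<gamma>. norm z \<ge> real n} < \<epsilon> / (4 * B + 1)"
    by (rule order_tendstoD)
  then obtain n0 where n0: "\<And>n. n \<ge> n0 \<Longrightarrow> measure ?\<gamma> {z \<in> space ?\<gamma>. norm z \<ge> real n} < \<epsilon> / (4 * B + 1)"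
    unfolding eventually_sequentially by blast
  define n where "n = Suc n0"
  have n: "measure ?\<gamma> {z \<in> space ?\<gamma>. norm z \<ge> real n} < \<epsilon> / (4 * B + 1)" "n > 0" using n0[of n] by (auto simp: n_def)
  define A where "A = {z \<in> space ?\<gamma>. norm z \<ge> real n}"
  have A[measurable]: "A \<in> sets ?\<gamma>" unfolding A_def by measurable
  \<comment> \<open>Noise of norm below \<open>n\<close> then moves the argument by less than the modulus \<open>d\<close>.\<close>
  define \<sigma> where "\<sigma> = d / real n"
  have \<sigma>: "\<sigma> > 0" using d(1) n(2) by (simp add: \<sigma>_def)
  have "\<bar>(\<integral>z. f (x + \<sigma> *\<^sub>R z) \<partial>?\<gamma>) - f x\<bar> \<le> \<epsilon>" for x
  proof -
    have i: "integrable ?\<gamma> (\<lambda>z. f (x + \<sigma> *\<^sub>R z))"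
      by (rule \<gamma>.integrable_const_bound[where B = B]) (auto intro!: AE_I2 B)
    have p: "\<bar>f (x + \<sigma> *\<^sub>R z) - f x\<bar> \<le> \<epsilon> / 2 + 2 * B * indicator A z" for z
    proof (cases "z \<in> A")
      case True
      have "\<bar>f (x + \<sigma> *\<^sub>R z) - f x\<bar> \<le> 2 * B" using B[of x] B[of "x + \<sigma> *\<^sub>R z"] by linarith
      thus ?thesis using True \<epsilon> by simp
    next
      case False
      hence "norm z < real n" by (simp add: A_def)
      hence "norm (\<sigma> *\<^sub>R z) < d" using d(1) n(2) by (simp add: \<sigma>_def field_simps)
      thus ?thesis using d(2)[of "\<sigma> *\<^sub>R z" x] False by simp
    qed
    have "(\<integral>z. f (x + \<sigma> *\<^sub>R z) \<partial>?\<gamma>) - f x = (\<integral>z. f (x + \<sigma> *\<^sub>R z) - f x \<partial>?\<gamma>)"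
      using i \<gamma>.prob_space by (subst Bochner_Integration.integral_diff) auto
    also have "\<bar>\<dots>\<bar> \<le> (\<integral>z. \<bar>f (x + \<sigma> *\<^sub>R z) - f x\<bar> \<partial>?\<gamma>)" by (rule integral_abs_bound)
    also have "\<dots> \<le> (\<integral>z. \<epsilon> / 2 + 2 * B * indicator A z \<partial>?\<gamma>)"
    proof (rule integral_mono)
      show "integrable ?\<gamma> (\<lambda>z. \<bar>f (x + \<sigma> *\<^sub>R z) - f x\<bar>)" using i by simp
      show "integrable ?\<gamma> (\<lambda>z. \<epsilon> / 2 + 2 * B * indicator A z)"
        using A by (intro Bochner_Integration.integrable_add integrable_mult_right integrable_real_indicator)
          (auto simp: \<gamma>.emeasure_eq_measure)
    qed (rule p)
    also have "\<dots> = \<epsilon> / 2 + 2 * B * measure ?\<gamma> A"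
      using \<gamma>.prob_space A by (subst Bochner_Integration.integral_add) (auto simp: \<gamma>.emeasure_eq_measure)
    also have "2 * B * measure ?\<gamma> A \<le> 2 * B * (\<epsilon> / (4 * B + 1))"
      using n(1) B00 by (intro mult_left_mono) (auto simp: A_def)
    also have "2 * B * (\<epsilon> / (4 * B + 1)) \<le> \<epsilon> / 2" using B00 \<epsilon> by (simp add: field_simps)
    finally show ?thesis by simp
  qed
  thus ?thesis using that \<sigma> by blast
qed

text \<open>
  For compactly supported test functions, smoothing costs an error that is uniform over all measures.
  A bounded test function is multiplied by a cutoff; the mass beyond the cutoff is small for the
  limit, hence for late members of the sequence, because the cutoff is itself a test function of
  compact support.  Tightness thus needs no separate argument.
\<close>

theorem levy_continuity_vec:
  fixes \<mu> :: "nat \<Rightarrow> (real ^ 'd) measure"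
  assumes \<mu>: "\<And>n. prob_space (\<mu> n)" "\<And>n. sets (\<mu> n) = sets borel"
    and \<nu>: "prob_space \<nu>" "sets \<nu> = sets borel"
    and conv: "\<And>t. (\<lambda>n. CLINT x|\<mu> n. iexp (t \<bullet> x)) \<longlonglongrightarrow> (CLINT x|\<nu>. iexp (t \<bullet> x))"
  shows "weak_conv_vec \<mu> \<nu>"
proof -
  have ib: "integrable m f" if m: "prob_space m" "sets m = sets borel" and f: "continuous_on UNIV f" "\<And>x. \<bar>f x\<bar> \<le> B"
    for m :: "(real ^ 'd) measure" and f and B :: real
  proof -
    interpret prob_space m by (rule m)
    note m(2)[measurable_cong]
    have [measurable]: "f \<in> borel_measurable borel" using f(1) by (rule borel_measurable_continuous_onI)
    show ?thesis by (rule integrable_const_bound[where B = B]) (auto intro!: AE_I2 f(2))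
  qed
  have compact_case: "(\<lambda>n. integral\<^sup>L (\<mu> n) f) \<longlonglongrightarrow> integral\<^sup>L \<nu> f"
    if f: "continuous_on UNIV f" "\<And>x. norm x > R \<Longrightarrow> f x = 0" "\<And>x. \<bar>f x\<bar> \<le> B" for f :: "real ^ 'd \<Rightarrow> real" and R B
  proof (rule LIMSEQ_I)
    fix r :: real assume r: "r > 0"
    have fm[measurable]: "f \<in> borel_measurable borel" using f(1) by (rule borel_measurable_continuous_onI)
    obtain \<sigma> where \<sigma>: "\<sigma> > 0" "\<And>x. \<bar>(\<integral>z. f (x + \<sigma> *\<^sub>R z) \<partial>std_normal_vec) - f x\<bar> \<le> r / 4"
      by (rule smoothing_uniformly_close[where f = f and R = R and \<epsilon> = "r / 4"]) (use f(1,2) r in auto)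
    define g where "g x = (\<integral>z. f (x + \<sigma> *\<^sub>R z) \<partial>std_normal_vec)" for x
    interpret \<gamma>: prob_space "std_normal_vec :: (real ^ 'd) measure" by (rule prob_space_std_normal_vec)
    have gm[measurable]: "g \<in> borel_measurable borel" unfolding g_def[abs_def] by measurable
    have gf: "\<bar>g x - f x\<bar> \<le> r / 4" for x unfolding g_def by (rule \<sigma>(2))
    have close: "\<bar>integral\<^sup>L m g - integral\<^sup>L m f\<bar> \<le> r / 4" if m: "prob_space m" "sets m = sets borel" for m :: "(real ^ 'd) measure"
    proof -
      interpret m: prob_space m by (rule m)
      note m(2)[measurable_cong]
      have i1: "integrable m f" by (rule ib[OF m f(1,3)])
      have i2: "integrable m g"
        by (rule m.integrable_const_bound[where B = "B + r / 4"])
          (use gf f(3) in \<open>auto intro!: AE_I2 simp: abs_le_iff, (smt (verit))+\<close>)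
      have "\<bar>integral\<^sup>L m g - integral\<^sup>L m f\<bar> = \<bar>\<integral>x. g x - f x \<partial>m\<bar>" using i1 i2 by simp
      also have "\<dots> \<le> (\<integral>x. \<bar>g x - f x\<bar> \<partial>m)" by (rule integral_abs_bound)
      also have "\<dots> \<le> (\<integral>x. r / 4 \<partial>m)" using i1 i2 gf by (intro integral_mono) auto
      finally show ?thesis by (simp add: m.prob_space)
    qed
    have "f = (\<lambda>x. indicator (cball 0 R) x *\<^sub>R f x)" using f(2) by (auto simp: indicator_def fun_eq_iff not_le)
    moreover have "continuous_on (cball 0 R) f" using f(1) continuous_on_subset by blast
    ultimately have "integrable lborel f" using borel_integrable_compact[of "cball 0 R" f] by simp
    from char_convergence_smoothed[OF \<mu> \<nu> conv this \<sigma>(1)]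
    have "(\<lambda>n. integral\<^sup>L (\<mu> n) g) \<longlonglongrightarrow> integral\<^sup>L \<nu> g" by (simp add: g_def[abs_def])
    from LIMSEQ_D[OF this, of "r / 4"] r obtain N where N: "\<And>n. n \<ge> N \<Longrightarrow> \<bar>integral\<^sup>L (\<mu> n) g - integral\<^sup>L \<nu> g\<bar> < r / 4"
      by auto
    show "\<exists>N. \<forall>n\<ge>N. norm (integral\<^sup>L (\<mu> n) f - integral\<^sup>L \<nu> f) < r"
    proof (intro exI allI impI)
      fix n assume "n \<ge> N"
      from N[OF this] close[OF \<mu>, of n] close[OF \<nu>] r show "norm (integral\<^sup>L (\<mu> n) f - integral\<^sup>L \<nu> f) < r"
        unfolding real_norm_def by linarith
    qed
  qed
  show ?thesis unfolding weak_conv_vec_def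
  proof (intro allI impI)
    fix f :: "real ^ 'd \<Rightarrow> real" assume f: "continuous_on UNIV f" "bounded (range f)"
    obtain B where B: "B > 0" "\<And>x. \<bar>f x\<bar> \<le> B" using f(2) unfolding bounded_pos by auto
    \<comment> \<open>A cutoff: one on the ball of radius \<open>R\<close>, zero beyond \<open>R + 1\<close>.\<close>
    define k where "k R x = max 0 (min 1 (R + 1 - norm x))" for R :: real and x :: "real ^ 'd"
    have kc: "continuous_on UNIV (k R)" for R unfolding k_def by (intro continuous_intros)
    have k01: "0 \<le> k R x" "k R x \<le> 1" "\<bar>k R x\<bar> \<le> 1" for R x by (auto simp: k_def)
    have k0: "k R x = 0" if "norm x > R + 1" for R x using that by (auto simp: k_def)
    interpret \<nu>: prob_space \<nu> by (rule \<nu>)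
    have "(\<lambda>n. integral\<^sup>L \<nu> (k (real n))) \<longlonglongrightarrow> (\<integral>x. 1 \<partial>\<nu>)"
    proof (rule integral_dominated_convergence[where w = "\<lambda>_. 1"])
      note \<nu>(2)[measurable_cong]
      show "k (real n) \<in> borel_measurable \<nu>" for n
        using borel_measurable_continuous_onI[OF kc, of "real n"] by measurable
      show "AE x in \<nu>. (\<lambda>n. k (real n) x) \<longlonglongrightarrow> 1"
      proof (rule AE_I2, rule tendsto_eventually)
        fix x :: "real ^ 'd"
        show "\<forall>\<^sub>F n in sequentially. k (real n) x = 1"
          using eventually_ge_at_top[of "nat \<lceil>norm x\<rceil>"]
          by eventually_elim (auto simp: k_def nat_le_iff ceiling_le_iff)
      qed
    qed (auto intro!: AE_I2 k01)
    hence k1: "(\<lambda>n. integral\<^sup>L \<nu> (k (real n))) \<longlonglongrightarrow> 1" by (simp add: \<nu>.prob_space)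
    have trunc: "\<bar>integral\<^sup>L m f - (\<integral>x. f x * k R x \<partial>m)\<bar> \<le> B * (1 - integral\<^sup>L m (k R))"
      if m: "prob_space m" "sets m = sets borel" for m :: "(real ^ 'd) measure" and R
    proof -
      interpret m: prob_space m by (rule m)
      have i: "integrable m f" "integrable m (k R)" by (rule ib[OF m f(1) B(2)], rule ib[OF m kc k01(3)])
      have fk: "\<bar>f x * k R x\<bar> \<le> B" for x
        using mult_mono[OF B(2)[of x] k01(3)[of R x]] B(1) by (simp add: abs_mult)
      have i2: "integrable m (\<lambda>x. f x * k R x)"
        by (rule ib[OF m _ fk]) (intro continuous_intros f(1) kc)
      have "\<bar>integral\<^sup>L m f - (\<integral>x. f x * k R x \<partial>m)\<bar> = \<bar>\<integral>x. f x * (1 - k R x) \<partial>m\<bar>"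
        using i i2 by (simp add: right_diff_distrib)
      also have "\<dots> \<le> (\<integral>x. \<bar>f x * (1 - k R x)\<bar> \<partial>m)" by (rule integral_abs_bound)
      also have "\<dots> \<le> (\<integral>x. B * (1 - k R x) \<partial>m)"
      proof (rule integral_mono)
        show "integrable m (\<lambda>x. \<bar>f x * (1 - k R x)\<bar>)" using i i2 by (simp add: right_diff_distrib)
        show "integrable m (\<lambda>x. B * (1 - k R x))" using i by simp
        show "\<bar>f x * (1 - k R x)\<bar> \<le> B * (1 - k R x)" for x
          using mult_right_mono[OF B(2)[of x], of "1 - k R x"] k01[where R = R and x = x] by (simp add: abs_mult)
      qed
      also have "\<dots> = B * (1 - integral\<^sup>L m (k R))" using i by (simp add: m.prob_space)
      finally show ?thesis .
    qed
    show "(\<lambda>n. integral\<^sup>L (\<mu> n) f) \<longlonglongrightarrow> integral\<^sup>L \<nu> f"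
    proof (rule LIMSEQ_I)
      fix r :: real assume r: "r > 0"
      have "r / (6 * B) > 0" using r B by simp
      from LIMSEQ_D[OF k1 this] obtain R' where R': "\<bar>integral\<^sup>L \<nu> (k (real R')) - 1\<bar> < r / (6 * B)" by auto
      define R where "R = real R'"
      have R: "B * (1 - integral\<^sup>L \<nu> (k R)) < r / 6"
      proof -
        have "1 - integral\<^sup>L \<nu> (k R) < r / (6 * B)" using R' unfolding R_def by linarith
        hence "B * (1 - integral\<^sup>L \<nu> (k R)) < B * (r / (6 * B))" using B(1) by (rule mult_strict_left_mono)
        thus ?thesis using B(1) by simp
      qed
      have fkc: "continuous_on UNIV (\<lambda>x. f x * k R x)" by (intro continuous_intros f(1) kc)
      have fkb: "\<bar>f x * k R x\<bar> \<le> B" for x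
        using mult_mono[OF B(2)[of x] k01(3)[of R x]] B(1) by (simp add: abs_mult)
      have c1: "(\<lambda>n. integral\<^sup>L (\<mu> n) (k R)) \<longlonglongrightarrow> integral\<^sup>L \<nu> (k R)"
        by (rule compact_case[OF kc k0 k01(3)])
      have c2: "(\<lambda>n. \<integral>x. f x * k R x \<partial>\<mu> n) \<longlonglongrightarrow> (\<integral>x. f x * k R x \<partial>\<nu>)"
        by (rule compact_case[OF fkc _ fkb, of "R + 1"]) (simp add: k0)
      have "(\<lambda>n. B * (1 - integral\<^sup>L (\<mu> n) (k R))) \<longlonglongrightarrow> B * (1 - integral\<^sup>L \<nu> (k R))"
        by (intro tendsto_intros c1)
      hence e1: "\<forall>\<^sub>F n in sequentially. B * (1 - integral\<^sup>L (\<mu> n) (k R)) < r / 6" using R by (rule order_tendstoD)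
      have e2: "\<forall>\<^sub>F n in sequentially. \<bar>(\<integral>x. f x * k R x \<partial>\<mu> n) - (\<integral>x. f x * k R x \<partial>\<nu>)\<bar> < r / 6"
        using tendstoD[OF c2, of "r / 6"] r by (simp add: dist_real_def)
      have "\<forall>\<^sub>F n in sequentially. norm (integral\<^sup>L (\<mu> n) f - integral\<^sup>L \<nu> f) < r"
        using e1 e2
      proof eventually_elim
        case (elim n)
        thus ?case using trunc[OF \<mu>, of n R] trunc[OF \<nu>, of R] R r unfolding real_norm_def by linarith
      qed
      thus "\<exists>N. \<forall>n\<ge>N. norm (integral\<^sup>L (\<mu> n) f - integral\<^sup>L \<nu> f) < r" unfolding eventually_sequentially .
    qed
  qed
qed

section \<open>Linear and quadratic forms in clustered noise\<close>

lemma square_integrable_product: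
  fixes f g :: "'a \<Rightarrow> real"
  assumes [measurable]: "f \<in> borel_measurable M" "g \<in> borel_measurable M"
    and "integrable M (\<lambda>x. (f x)\<^sup>2)" "integrable M (\<lambda>x. (g x)\<^sup>2)"
  shows "integrable M (\<lambda>x. f x * g x)"
proof (rule Bochner_Integration.integrable_bound)
  show "integrable M (\<lambda>x. (f x)\<^sup>2 + (g x)\<^sup>2)" using assms by simp
  have "\<bar>a * b\<bar> \<le> a\<^sup>2 + b\<^sup>2" for a b :: real
  proof -
    have "0 \<le> (\<bar>a\<bar> - \<bar>b\<bar>)\<^sup>2" "0 \<le> \<bar>a\<bar> * \<bar>b\<bar>" by simp_all
    thus ?thesis unfolding power2_diff power2_abs abs_mult by linarith
  qed
  thus "AE x in M. norm (f x * g x) \<le> norm ((f x)\<^sup>2 + (g x)\<^sup>2)"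
    by (intro AE_I2) (simp add: order_trans[OF _ abs_ge_self])
qed measurable

lemma sum_squared_le:
  fixes f :: "'i \<Rightarrow> real"
  assumes "finite A" "card A \<le> L"
  shows "(\<Sum>i\<in>A. f i)\<^sup>2 \<le> real L * (\<Sum>i\<in>A. (f i)\<^sup>2)"
proof -
  have "(\<Sum>i\<in>A. f i)\<^sup>2 = (\<Sum>i\<in>A. 1 * f i)\<^sup>2" by simp
  also have "\<dots> \<le> (\<Sum>i\<in>A. 1\<^sup>2) * (\<Sum>i\<in>A. (f i)\<^sup>2)" by (rule Cauchy_Schwarz_ineq_sum)
  also have "\<dots> \<le> real L * (\<Sum>i\<in>A. (f i)\<^sup>2)"
    using assms by (intro mult_right_mono) (auto intro: sum_nonneg)
  finally show ?thesis .
qed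

lemma square_integrable_sum:
  fixes f :: "'i \<Rightarrow> 'a \<Rightarrow> real"
  assumes "finite A" "\<And>i. i \<in> A \<Longrightarrow> f i \<in> borel_measurable M" "\<And>i. i \<in> A \<Longrightarrow> integrable M (\<lambda>x. (f i x)\<^sup>2)"
  shows "integrable M (\<lambda>x. (\<Sum>i\<in>A. f i x)\<^sup>2)"
proof (rule Bochner_Integration.integrable_bound)
  show "integrable M (\<lambda>x. real (card A) * (\<Sum>i\<in>A. (f i x)\<^sup>2))" using assms by auto
  show "(\<lambda>x. (\<Sum>i\<in>A. f i x)\<^sup>2) \<in> borel_measurable M" using assms by auto
  show "AE x in M. norm ((\<Sum>i\<in>A. f i x)\<^sup>2) \<le> norm (real (card A) * (\<Sum>i\<in>A. (f i x)\<^sup>2))"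
    by (intro AE_I2) (simp add: order_trans[OF sum_squared_le[OF assms(1) order_refl]] sum_nonneg)
qed

lemma integral_square_orthogonal_sum:
  fixes Y :: "'i \<Rightarrow> 'a \<Rightarrow> real"
  assumes "finite I" and m: "\<And>k. k \<in> I \<Longrightarrow> Y k \<in> borel_measurable M"
    and i: "\<And>k. k \<in> I \<Longrightarrow> integrable M (\<lambda>x. (Y k x)\<^sup>2)"
    and o: "\<And>k l. k \<in> I \<Longrightarrow> l \<in> I \<Longrightarrow> k \<noteq> l \<Longrightarrow> (\<integral>x. Y k x * Y l x \<partial>M) = 0"
  shows "(\<integral>x. (\<Sum>k\<in>I. Y k x)\<^sup>2 \<partial>M) = (\<Sum>k\<in>I. \<integral>x. (Y k x)\<^sup>2 \<partial>M)"
proof -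
  have ii: "integrable M (\<lambda>x. Y k x * Y l x)" if "k \<in> I" "l \<in> I" for k l
    using that m i by (intro square_integrable_product) auto
  have "(\<integral>x. (\<Sum>k\<in>I. Y k x)\<^sup>2 \<partial>M) = (\<integral>x. (\<Sum>k\<in>I. \<Sum>l\<in>I. Y k x * Y l x) \<partial>M)"
    by (simp add: power2_eq_square sum_product)
  also have "\<dots> = (\<Sum>k\<in>I. \<Sum>l\<in>I. \<integral>x. Y k x * Y l x \<partial>M)"
    using ii by (simp add: Bochner_Integration.integral_sum)
  also have "\<dots> = (\<Sum>k\<in>I. \<Sum>l\<in>I. if l = k then \<integral>x. (Y k x)\<^sup>2 \<partial>M else 0)"
    using o by (intro sum.cong refl) (auto simp: power2_eq_square)
  also have "\<dots> = (\<Sum>k\<in>I. \<integral>x. (Y k x)\<^sup>2 \<partial>M)" using assms(1) by simp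
  finally show ?thesis .
qed

text \<open>
  Links the extended-valued conditional moments, which may be infinite, to real ones where the latter
  exist.
\<close>

lemma (in sigma_finite_subalgebra) nn_cond_exp_eq_real_cond_exp:
  assumes Y: "integrable M Y" "\<And>x. Y x \<ge> 0"
  shows "AE x in M. nn_cond_exp M F (\<lambda>x. ennreal (Y x)) x = ennreal (real_cond_exp M F Y x)"
proof -
  have pos: "AE x in M. real_cond_exp M F Y x \<ge> 0"
    using Y by (intro real_cond_exp_pos) auto
  have "AE x in M. ennreal (real_cond_exp M F Y x) = nn_cond_exp M F (\<lambda>x. ennreal (Y x)) x"
  proof (rule nn_cond_exp_charact)
    fix A assume A: "A \<in> sets F"
    hence AM[measurable]: "A \<in> sets M" using subalg by (auto simp: subalgebra_def)
    note iY = integrable_mult_indicator[OF AM Y(1)]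
    note ic = integrable_mult_indicator[OF AM real_cond_exp_int(1)[OF Y(1)]]
    have "(\<integral>\<^sup>+x\<in>A. ennreal (Y x) \<partial>M) = (\<integral>\<^sup>+x. ennreal (indicator A x *\<^sub>R Y x) \<partial>M)"
      by (intro nn_integral_cong) (auto simp: indicator_def)
    also have "\<dots> = ennreal (\<integral>x\<in>A. Y x \<partial>M)" unfolding set_lebesgue_integral_def
      using Y(2) by (intro nn_integral_eq_integral[OF iY]) auto
    also have "(\<integral>x\<in>A. Y x \<partial>M) = (\<integral>x\<in>A. real_cond_exp M F Y x \<partial>M)" by (rule real_cond_exp_intA[OF Y(1) A])
    also have "ennreal \<dots> = (\<integral>\<^sup>+x. ennreal (indicator A x *\<^sub>R real_cond_exp M F Y x) \<partial>M)"
      unfolding set_lebesgue_integral_def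
      by (rule nn_integral_eq_integral[OF ic, symmetric]) (use pos in \<open>auto simp: indicator_def\<close>)
    also have "\<dots> = (\<integral>\<^sup>+x\<in>A. ennreal (real_cond_exp M F Y x) \<partial>M)"
      by (intro nn_integral_cong) (auto simp: indicator_def)
    finally show "(\<integral>\<^sup>+x\<in>A. ennreal (Y x) \<partial>M) = (\<integral>\<^sup>+x\<in>A. ennreal (real_cond_exp M F Y x) \<partial>M)" .
  qed (use Y in auto)
  thus ?thesis by auto
qed

lemma integrable_of_nn_integral_le:
  fixes f :: "'a \<Rightarrow> real"
  assumes "f \<in> borel_measurable M" "\<And>x. f x \<ge> 0" "(\<integral>\<^sup>+x. ennreal (f x) \<partial>M) \<le> ennreal c" "c \<ge> 0"
  shows "integrable M f" "(\<integral>x. f x \<partial>M) \<le> c"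
proof -
  show i: "integrable M f"
    using assms by (intro integrableI_nonneg) (auto intro: le_less_trans)
  have "ennreal (\<integral>x. f x \<partial>M) \<le> ennreal c" using assms nn_integral_eq_integral[OF i] by auto
  thus "(\<integral>x. f x \<partial>M) \<le> c" using assms(4) by simp
qed

lemma (in sigma_finite_subalgebra) nn_cond_exp_square_le_fourth:
  assumes [measurable]: "f \<in> borel_measurable M"
  shows "AE x in M. nn_cond_exp M F (\<lambda>x. ennreal ((f x)\<^sup>2)) x \<le> 1 + nn_cond_exp M F (\<lambda>x. ennreal (f x ^ 4)) x"
proof -
  have "(a::real)\<^sup>2 \<le> 1 + a ^ 4" for a
  proof -
    have "0 \<le> (a\<^sup>2 - 1)\<^sup>2 + a\<^sup>2" by simp
    thus ?thesis by (simp add: power2_eq_square power4_eq_xxxx algebra_simps)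
  qed
  hence "ennreal ((f x)\<^sup>2) \<le> ennreal (1 + f x ^ 4)" for x by (rule ennreal_leI)
  moreover have "ennreal (1 + f x ^ 4) = 1 + ennreal (f x ^ 4)" for x by (subst ennreal_plus) auto
  ultimately have le: "ennreal ((f x)\<^sup>2) \<le> 1 + ennreal (f x ^ 4)" for x by metis
  have "AE x in M. nn_cond_exp M F (\<lambda>x. ennreal ((f x)\<^sup>2)) x \<le> nn_cond_exp M F (\<lambda>x. 1 + ennreal (f x ^ 4)) x"
    by (rule nn_cond_exp_mono) (use le in auto)
  moreover have "AE x in M. nn_cond_exp M F (\<lambda>x. 1) x + nn_cond_exp M F (\<lambda>x. ennreal (f x ^ 4)) x = nn_cond_exp M F (\<lambda>x. 1 + ennreal (f x ^ 4)) x"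
    by (rule nn_cond_exp_sum) auto
  moreover have "AE x in M. 1 = nn_cond_exp M F (\<lambda>x. 1) x" by (rule nn_cond_exp_F_meas) auto
  ultimately show ?thesis
  proof eventually_elim
    case (elim x)
    thus ?case using elim(3)[symmetric] by simp
  qed
qed

text \<open>
  Clusters of bounded size partition the index set \<open>{1..n}\<close>.  The clusters are indexed by numbers, so that
  they can be revealed in order.
\<close>

locale clustered_noise = cond_indep_clusters M W I Cl
  for M :: "'a measure" and W and I :: "nat set" and Cl +
  fixes T :: "nat \<Rightarrow> nat set" and n L :: nat
  assumes T_union: "(\<Union>k\<in>I. T k) = {1..n}"
    and T_disjoint: "\<And>k l. k \<in> I \<Longrightarrow> l \<in> I \<Longrightarrow> k \<noteq> l \<Longrightarrow> T k \<inter> T l = {}"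
    and T_card: "\<And>k. k \<in> I \<Longrightarrow> card (T k) \<le> L"
begin

lemma T_finite: "k \<in> I \<Longrightarrow> finite (T k)"
  using T_union by (metis finite_atLeastAtMost finite_subset UN_upper)

lemma T_subset: "k \<in> I \<Longrightarrow> t \<in> T k \<Longrightarrow> t \<in> {1..n}"
  using T_union by blast

lemma sum_over_clusters: "(\<Sum>t=1..n. f t) = (\<Sum>k\<in>I. \<Sum>t\<in>T k. f t)" for f :: "nat \<Rightarrow> real"
  unfolding T_union[symmetric] using finite_I T_finite T_disjoint
  by (intro sum.UNION_disjoint) auto

abbreviation others :: "nat \<Rightarrow> 'a measure" where "others k \<equiv> with_outside W k"

lemma measurable_others_M: "f \<in> borel_measurable (others k) \<Longrightarrow> f \<in> borel_measurable M"
  by (rule measurable_from_subalg[OF subalgebra_with_outside[OF subalgebra_W]])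

lemma measurable_inside_M: "k \<in> I \<Longrightarrow> f \<in> borel_measurable (inside k) \<Longrightarrow> f \<in> borel_measurable M"
  by (rule measurable_from_subalg[OF subalgebra_inside])

lemma measurable_W_M: "f \<in> borel_measurable W \<Longrightarrow> f \<in> borel_measurable M"
  by (rule measurable_from_subalg[OF subalgebra_W])

lemma measurable_W_others: "f \<in> borel_measurable W \<Longrightarrow> f \<in> borel_measurable (others k)"
  by (rule measurable_with_outside(1)[OF subalgebra_W])

lemma measurable_W_inside: "k \<in> I \<Longrightarrow> f \<in> borel_measurable W \<Longrightarrow> f \<in> borel_measurable (inside k)"
  by (rule measurable_from_subalg[of _ W]) (use sets_inside_superset in \<open>auto simp: subalgebra_def\<close>)

lemma measurable_Cl_inside: "k \<in> I \<Longrightarrow> f \<in> borel_measurable (Cl k) \<Longrightarrow> f \<in> borel_measurable (inside k)"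
  by (rule measurable_from_subalg[of _ "Cl k"]) (use sets_inside_superset space_Cl in \<open>auto simp: subalgebra_def\<close>)

lemma measurable_inside_others:
  assumes kl: "l \<in> I" "l \<noteq> k" and f: "f \<in> borel_measurable (inside l)"
  shows "f \<in> borel_measurable (others k)"
proof -
  have "sets W \<subseteq> sets (others k)" "sets (Cl l) \<subseteq> sets (others k)"
    using sets_with_outside_superset[OF subalgebra_W] sets_Cl_subset_outside[OF kl] by blast+
  hence "meets (sets W) (sets (Cl l)) \<subseteq> sets (others k)" by (intro meets_sets)
  hence "sets (inside l) \<subseteq> sets (others k)"
    unfolding inside_def using sets.sigma_sets_subset[of _ "others k"] sets.space_closed[of "others k"]
    by (subst sets_measure_of) auto
  hence "subalgebra (others k) (inside l)" by (simp add: subalgebra_def)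
  thus ?thesis using f by (rule measurable_from_subalg)
qed

text \<open>
  A variable of cluster \<open>k\<close> with conditional mean zero given \<open>W\<close> is orthogonal to everything known from \<open>W\<close>
  and the other clusters.
\<close>

lemma orthogonal_to_others:
  assumes k: "k \<in> I" and Y: "integrable M Y" "Y \<in> borel_measurable (inside k)"
    and Y0: "AE x in M. real_cond_exp M W Y x = 0"
    and P: "P \<in> borel_measurable (others k)" "integrable M (\<lambda>x. P x * Y x)"
  shows "(\<integral>x. P x * Y x \<partial>M) = 0"
proof -
  have "(\<integral>x. P x * Y x \<partial>M) = (\<integral>x. P x * real_cond_exp M W Y x \<partial>M)"
    by (rule integral_mult_outside[OF k subalgebra_W order_refl sets_inside_superset(1)[OF k] Y P])
  also have "\<dots> = (\<integral>x. 0 \<partial>M)"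
    by (rule integral_cong_AE) (use Y0 measurable_others_M[OF P(1)] in auto)
  finally show ?thesis by simp
qed

text \<open>
  A conditional moment bound given \<open>W\<close> persists when the other clusters are added to the conditioning, so
  it may be used against random coefficients.
\<close>

lemma cond_bound_others:
  assumes k: "k \<in> I" and Y: "Y \<in> borel_measurable (inside k)" "\<And>x. Y x \<ge> 0"
    and b: "AE x in M. nn_cond_exp M W (\<lambda>x. ennreal (Y x)) x \<le> ennreal b"
  shows "integrable M Y"
    and "c \<in> borel_measurable (others k) \<Longrightarrow> (\<integral>\<^sup>+x. c x * ennreal (Y x) \<partial>M) \<le> ennreal b * (\<integral>\<^sup>+x. c x \<partial>M)"
proof -
  note YM[measurable] = measurable_inside_M[OF k Y(1)]
  have "(\<integral>\<^sup>+x. ennreal (Y x) \<partial>M) = (\<integral>\<^sup>+x. 1 * nn_cond_exp M W (\<lambda>x. ennreal (Y x)) x \<partial>M)"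
    by (subst W.nn_cond_exp_intg) auto
  also have "\<dots> \<le> (\<integral>\<^sup>+x. ennreal b \<partial>M)" by (rule nn_integral_mono_AE) (use b in auto)
  also have "\<dots> < \<infinity>" by (simp add: emeasure_space_1)
  finally show Yi: "integrable M Y" using Y(2) by (intro integrableI_nonneg) auto
  assume c: "c \<in> borel_measurable (others k)"
  interpret G: sigma_finite_subalgebra M "others k"
    by (rule subalgebra_sigma_finite[OF subalgebra_with_outside[OF subalgebra_W]])
  have cM[measurable]: "c \<in> borel_measurable M" by (rule measurable_from_subalg[OF subalgebra_with_outside[OF subalgebra_W] c])
  have "AE x in M. nn_cond_exp M (others k) (\<lambda>x. ennreal (Y x)) x \<le> ennreal b"
    using G.nn_cond_exp_eq_real_cond_exp[OF Yi Y(2)] W.nn_cond_exp_eq_real_cond_exp[OF Yi Y(2)] b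
      cond_exp_with_outside[OF k subalgebra_W order_refl sets_inside_superset(1)[OF k] Yi Y(1)]
    by auto
  hence "(\<integral>\<^sup>+x. c x * nn_cond_exp M (others k) (\<lambda>x. ennreal (Y x)) x \<partial>M) \<le> (\<integral>\<^sup>+x. c x * ennreal b \<partial>M)"
    by (intro nn_integral_mono_AE) (auto elim!: eventually_mono intro: mult_left_mono)
  also have "\<dots> = ennreal b * (\<integral>\<^sup>+x. c x \<partial>M)" by (subst nn_integral_multc) (auto simp: mult.commute)
  finally show "(\<integral>\<^sup>+x. c x * ennreal (Y x) \<partial>M) \<le> ennreal b * (\<integral>\<^sup>+x. c x \<partial>M)"
    by (subst (asm) G.nn_cond_exp_intg[OF c]) auto
qed

lemma cond_bound_others_real:
  assumes k: "k \<in> I" and Y: "Y \<in> borel_measurable (inside k)" "\<And>x. Y x \<ge> 0"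
    and b: "AE x in M. nn_cond_exp M W (\<lambda>x. ennreal (Y x)) x \<le> ennreal b" "b \<ge> 0"
    and c: "c \<in> borel_measurable (others k)" "\<And>x. c x \<ge> 0" "integrable M c"
  shows "integrable M (\<lambda>x. c x * Y x)" "(\<integral>x. c x * Y x \<partial>M) \<le> b * (\<integral>x. c x \<partial>M)"
proof -
  note [measurable] = measurable_inside_M[OF k Y(1)] measurable_others_M[OF c(1)]
  have "(\<integral>\<^sup>+x. ennreal (c x * Y x) \<partial>M) = (\<integral>\<^sup>+x. ennreal (c x) * ennreal (Y x) \<partial>M)"
    using c(2) Y(2) by (simp add: ennreal_mult)
  also have "\<dots> \<le> ennreal b * (\<integral>\<^sup>+x. ennreal (c x) \<partial>M)"
    by (rule cond_bound_others(2)[OF k Y b(1)]) (use c(1) in auto)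
  also have "\<dots> = ennreal (b * (\<integral>x. c x \<partial>M))"
    using c b(2) by (simp add: nn_integral_eq_integral ennreal_mult)
  finally have *: "(\<integral>\<^sup>+x. ennreal (c x * Y x) \<partial>M) \<le> ennreal (b * (\<integral>x. c x \<partial>M))" .
  have "b * (\<integral>x. c x \<partial>M) \<ge> 0" using b c by simp
  from integrable_of_nn_integral_le[OF _ _ * this] c Y
  show "integrable M (\<lambda>x. c x * Y x)" "(\<integral>x. c x * Y x \<partial>M) \<le> b * (\<integral>x. c x \<partial>M)" by auto
qed

text \<open>
  Mean zero and bounded fourth moment conditionally on \<open>W\<close>.  The bound is required almost everywhere; for
  regressors it is achieved by multiplication with the indicator of an event in \<open>W\<close>.
\<close>

definition noise :: "real \<Rightarrow> (nat \<Rightarrow> 'a \<Rightarrow> real) \<Rightarrow> bool" where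
  "noise B q \<longleftrightarrow> B \<ge> 0 \<and> (\<forall>k\<in>I. \<forall>t\<in>T k. q t \<in> borel_measurable (inside k) \<and>
     (AE x in M. real_cond_exp M W (q t) x = 0) \<and>
     (AE x in M. nn_cond_exp M W (\<lambda>x. ennreal (q t x ^ 4)) x \<le> ennreal B))"

lemma noiseD:
  assumes q: "noise B q" and k: "k \<in> I" "t \<in> T k"
  shows "q t \<in> borel_measurable (inside k)" "q t \<in> borel_measurable M" "integrable M (q t)"
    "integrable M (\<lambda>x. q t x ^ 4)" "integrable M (\<lambda>x. (q t x)\<^sup>2)"
    "AE x in M. real_cond_exp M W (q t) x = 0"
    "AE x in M. nn_cond_exp M W (\<lambda>x. ennreal (q t x ^ 4)) x \<le> ennreal B"
    "AE x in M. nn_cond_exp M W (\<lambda>x. ennreal ((q t x)\<^sup>2)) x \<le> ennreal (1 + B)" "B \<ge> 0"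
proof -
  show m: "q t \<in> borel_measurable (inside k)" and "AE x in M. real_cond_exp M W (q t) x = 0"
    and b: "AE x in M. nn_cond_exp M W (\<lambda>x. ennreal (q t x ^ 4)) x \<le> ennreal B" and B: "B \<ge> 0"
    using q k by (auto simp: noise_def)
  show mM[measurable]: "q t \<in> borel_measurable M" by (rule measurable_inside_M[OF k(1) m])
  show i4: "integrable M (\<lambda>x. q t x ^ 4)"
    by (rule cond_bound_others(1)[OF k(1) _ _ b]) (use m in auto)
  show i2: "integrable M (\<lambda>x. (q t x)\<^sup>2)"
    using square_integrable_imp_integrable[of "\<lambda>x. (q t x)\<^sup>2"] i4 by simp
  show "integrable M (q t)" by (rule square_integrable_imp_integrable[OF mM i2])
  show "AE x in M. nn_cond_exp M W (\<lambda>x. ennreal ((q t x)\<^sup>2)) x \<le> ennreal (1 + B)"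
    using W.nn_cond_exp_square_le_fourth[OF mM] b
  proof eventually_elim
    case (elim x)
    have "nn_cond_exp M W (\<lambda>x. ennreal ((q t x)\<^sup>2)) x \<le> 1 + nn_cond_exp M W (\<lambda>x. ennreal (q t x ^ 4)) x"
      by (rule elim(1))
    also have "\<dots> \<le> 1 + ennreal B" using elim(2) by (intro add_left_mono)
    also have "1 + ennreal B = ennreal (1 + B)" using B by (subst ennreal_plus) auto
    finally show ?case .
  qed
qed

lemma noise_scaled_square:
  assumes q: "noise B q" and k: "k \<in> I" "t \<in> T k"
    and c: "c \<in> borel_measurable (others k)" "integrable M (\<lambda>x. (c x)\<^sup>2)"
  shows "integrable M (\<lambda>x. (c x * q t x)\<^sup>2)" "(\<integral>x. (c x * q t x)\<^sup>2 \<partial>M) \<le> (1 + B) * (\<integral>x. (c x)\<^sup>2 \<partial>M)"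
proof -
  have "integrable M (\<lambda>x. (c x)\<^sup>2 * (q t x)\<^sup>2) \<and> (\<integral>x. (c x)\<^sup>2 * (q t x)\<^sup>2 \<partial>M) \<le> (1 + B) * (\<integral>x. (c x)\<^sup>2 \<partial>M)"
    using cond_bound_others_real[OF k(1), of "\<lambda>x. (q t x)\<^sup>2" "1 + B" "\<lambda>x. (c x)\<^sup>2"] noiseD[OF q k] c by auto
  thus "integrable M (\<lambda>x. (c x * q t x)\<^sup>2)" "(\<integral>x. (c x * q t x)\<^sup>2 \<partial>M) \<le> (1 + B) * (\<integral>x. (c x)\<^sup>2 \<partial>M)"
    by (auto simp: power_mult_distrib)
qed

lemma cluster_linear_square:
  assumes q: "noise B q" and k: "k \<in> I"
    and c: "\<And>t. t \<in> T k \<Longrightarrow> c t \<in> borel_measurable (others k)" "\<And>t. t \<in> T k \<Longrightarrow> integrable M (\<lambda>x. (c t x)\<^sup>2)"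
  shows "(\<lambda>x. \<Sum>t\<in>T k. c t x * q t x) \<in> borel_measurable M"
    and "integrable M (\<lambda>x. (\<Sum>t\<in>T k. c t x * q t x)\<^sup>2)"
    and "(\<integral>x. (\<Sum>t\<in>T k. c t x * q t x)\<^sup>2 \<partial>M) \<le> real L * (1 + B) * (\<Sum>t\<in>T k. \<integral>x. (c t x)\<^sup>2 \<partial>M)"
proof -
  have m: "(\<lambda>x. c t x * q t x) \<in> borel_measurable M" if "t \<in> T k" for t
    using noiseD(2)[OF q k that] measurable_others_M[OF c(1)[OF that]] by auto
  show "(\<lambda>x. \<Sum>t\<in>T k. c t x * q t x) \<in> borel_measurable M" using m by auto
  note s = noise_scaled_square[OF q k _ c]
  show i: "integrable M (\<lambda>x. (\<Sum>t\<in>T k. c t x * q t x)\<^sup>2)"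
    by (intro square_integrable_sum T_finite k m s)
  have "(\<integral>x. (\<Sum>t\<in>T k. c t x * q t x)\<^sup>2 \<partial>M) \<le> (\<integral>x. real L * (\<Sum>t\<in>T k. (c t x * q t x)\<^sup>2) \<partial>M)"
    using i s(1) by (intro integral_mono sum_squared_le T_finite T_card k) auto
  also have "\<dots> = real L * (\<Sum>t\<in>T k. \<integral>x. (c t x * q t x)\<^sup>2 \<partial>M)" using s(1) by simp
  also have "\<dots> \<le> real L * (\<Sum>t\<in>T k. (1 + B) * (\<integral>x. (c t x)\<^sup>2 \<partial>M))"
    using s(2) by (intro mult_left_mono sum_mono) auto
  finally show "(\<integral>x. (\<Sum>t\<in>T k. c t x * q t x)\<^sup>2 \<partial>M) \<le> real L * (1 + B) * (\<Sum>t\<in>T k. \<integral>x. (c t x)\<^sup>2 \<partial>M)"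
    by (simp add: sum_distrib_left mult.assoc)
qed

text \<open>
  Cluster sums are orthogonal if the coefficients that belong to cluster \<open>k\<close> and to the clusters before it
  do not involve the data of cluster \<open>k\<close>: in a product of two cluster sums the later one is then a
  martingale difference.
\<close>

lemma martingale_linear_square:
  assumes q: "noise B q"
    and c: "\<And>k t. k \<in> I \<Longrightarrow> t \<in> T k \<Longrightarrow> c t \<in> borel_measurable (others k)"
      "\<And>k t. k \<in> I \<Longrightarrow> t \<in> T k \<Longrightarrow> integrable M (\<lambda>x. (c t x)\<^sup>2)"
    and adapted: "\<And>k l t. k \<in> I \<Longrightarrow> l \<in> I \<Longrightarrow> l < k \<Longrightarrow> t \<in> T l \<Longrightarrow> c t \<in> borel_measurable (others k)"
  shows "(\<lambda>x. \<Sum>t=1..n. c t x * q t x) \<in> borel_measurable M"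
    "integrable M (\<lambda>x. (\<Sum>t=1..n. c t x * q t x)\<^sup>2)"
    "(\<integral>x. (\<Sum>t=1..n. c t x * q t x)\<^sup>2 \<partial>M) \<le> real L * (1 + B) * (\<Sum>t=1..n. \<integral>x. (c t x)\<^sup>2 \<partial>M)"
proof -
  define Y where "Y k x = (\<Sum>t\<in>T k. c t x * q t x)" for k x
  note cl = cluster_linear_square[OF q _ c]
  have Ym: "Y k \<in> borel_measurable M" and Yi: "integrable M (\<lambda>x. (Y k x)\<^sup>2)"
    and Yb: "(\<integral>x. (Y k x)\<^sup>2 \<partial>M) \<le> real L * (1 + B) * (\<Sum>t\<in>T k. \<integral>x. (c t x)\<^sup>2 \<partial>M)" if "k \<in> I" for k
    unfolding Y_def[abs_def] using cl[OF that that _ that] by auto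
  have s: "(\<Sum>t=1..n. c t x * q t x) = (\<Sum>k\<in>I. Y k x)" for x unfolding Y_def by (rule sum_over_clusters)
  have lt: "(\<integral>x. Y l x * Y k x \<partial>M) = 0" if kl: "k \<in> I" "l \<in> I" "l < k" for k l
  proof -
    have Yl: "Y l \<in> borel_measurable (others k)"
      unfolding Y_def[abs_def] using adapted[OF kl] measurable_inside_others[OF kl(2), of k] noiseD(1)[OF q kl(2)] kl(3)
      by (intro borel_measurable_sum borel_measurable_times) auto
    have e: "Y l x * Y k x = (\<Sum>t\<in>T k. (Y l x * c t x) * q t x)" for x
      by (simp add: Y_def[of k] sum_distrib_left mult.assoc)
    have i: "integrable M (\<lambda>x. (Y l x * c t x) * q t x)" if t: "t \<in> T k" for t
      unfolding mult.assoc
      using Ym[OF kl(2)] Yi[OF kl(2)] noise_scaled_square(1)[OF q kl(1) t c(1,2), OF kl(1) t kl(1) t]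
        measurable_others_M[OF c(1)[OF kl(1) t]] noiseD(2)[OF q kl(1) t]
      by (intro square_integrable_product) auto
    have "(\<integral>x. Y l x * Y k x \<partial>M) = (\<Sum>t\<in>T k. \<integral>x. (Y l x * c t x) * q t x \<partial>M)"
      unfolding e using i by (rule Bochner_Integration.integral_sum)
    also have "\<dots> = 0"
    proof (rule sum.neutral, rule ballI)
      fix t assume t: "t \<in> T k"
      show "(\<integral>x. (Y l x * c t x) * q t x \<partial>M) = 0"
        by (rule orthogonal_to_others[OF kl(1) noiseD(3,1,6)[OF q kl(1) t] _ i[OF t]])
          (use Yl c(1)[OF kl(1) t] in auto)
    qed
    finally show ?thesis .
  qed
  show "(\<lambda>x. \<Sum>t=1..n. c t x * q t x) \<in> borel_measurable M" unfolding s using Ym by auto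
  show "integrable M (\<lambda>x. (\<Sum>t=1..n. c t x * q t x)\<^sup>2)" unfolding s
    by (intro square_integrable_sum finite_I Ym Yi)
  have "(\<integral>x. (\<Sum>t=1..n. c t x * q t x)\<^sup>2 \<partial>M) = (\<Sum>k\<in>I. \<integral>x. (Y k x)\<^sup>2 \<partial>M)"
    unfolding s
  proof (rule integral_square_orthogonal_sum[OF finite_I Ym Yi])
    fix k l assume "k \<in> I" "l \<in> I" "k \<noteq> l"
    thus "(\<integral>x. Y k x * Y l x \<partial>M) = 0" using lt[of k l] lt[of l k] by (cases "l < k") (auto simp: mult.commute)
  qed
  also have "\<dots> \<le> (\<Sum>k\<in>I. real L * (1 + B) * (\<Sum>t\<in>T k. \<integral>x. (c t x)\<^sup>2 \<partial>M))" by (intro sum_mono Yb)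
  also have "\<dots> = real L * (1 + B) * (\<Sum>t=1..n. \<integral>x. (c t x)\<^sup>2 \<partial>M)"
    by (simp only: sum_over_clusters sum_distrib_left)
  finally show "(\<integral>x. (\<Sum>t=1..n. c t x * q t x)\<^sup>2 \<partial>M) \<le> real L * (1 + B) * (\<Sum>t=1..n. \<integral>x. (c t x)\<^sup>2 \<partial>M)" .
qed

lemma linear_square:
  assumes q: "noise B q"
    and c: "\<And>t. t \<in> {1..n} \<Longrightarrow> c t \<in> borel_measurable W" "\<And>t. t \<in> {1..n} \<Longrightarrow> integrable M (\<lambda>x. (c t x)\<^sup>2)"
  shows "integrable M (\<lambda>x. (\<Sum>t=1..n. c t x * q t x)\<^sup>2)"
    "(\<integral>x. (\<Sum>t=1..n. c t x * q t x)\<^sup>2 \<partial>M) \<le> real L * (1 + B) * (\<Sum>t=1..n. \<integral>x. (c t x)\<^sup>2 \<partial>M)"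
  using martingale_linear_square[OF q, of c] c measurable_W_others T_subset by blast+

lemma martingale_linear_mean_zero:
  assumes q: "noise B q"
    and c: "\<And>k t. k \<in> I \<Longrightarrow> t \<in> T k \<Longrightarrow> c t \<in> borel_measurable (others k)"
      "\<And>k t. k \<in> I \<Longrightarrow> t \<in> T k \<Longrightarrow> integrable M (\<lambda>x. (c t x)\<^sup>2)"
    and A: "A \<in> sets W"
  shows "(\<integral>x. indicator A x * (\<Sum>t=1..n. c t x * q t x) \<partial>M) = 0"
proof -
  have Ao: "(indicator A :: 'a \<Rightarrow> real) \<in> borel_measurable (others k)" for k
    using A by (intro measurable_W_others) auto
  have AM: "A \<in> sets M" using A sets_W by auto
  have i: "integrable M (\<lambda>x. indicator A x * c t x * q t x)" if k: "k \<in> I" "t \<in> T k" for k t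
  proof -
    have "integrable M (\<lambda>x. c t x * q t x)"
      using square_integrable_imp_integrable[OF _ noise_scaled_square(1)[OF q k c(1,2)[OF k]]]
        measurable_others_M[OF c(1)[OF k]] noiseD(2)[OF q k] by simp
    from integrable_mult_indicator[OF AM this] show ?thesis by (simp add: mult.assoc)
  qed
  have "(\<integral>x. indicator A x * (\<Sum>t=1..n. c t x * q t x) \<partial>M)
      = (\<integral>x. (\<Sum>k\<in>I. \<Sum>t\<in>T k. indicator A x * c t x * q t x) \<partial>M)"
    by (simp only: sum_over_clusters sum_distrib_left mult.assoc)
  also have "\<dots> = (\<Sum>k\<in>I. \<Sum>t\<in>T k. \<integral>x. indicator A x * c t x * q t x \<partial>M)"
    using i by (simp add: Bochner_Integration.integral_sum)
  also have "\<dots> = 0"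
  proof (intro sum.neutral ballI)
    fix k t assume k: "k \<in> I" "t \<in> T k"
    show "(\<integral>x. indicator A x * c t x * q t x \<partial>M) = 0"
      by (rule orthogonal_to_others[OF k(1) noiseD(3,1,6)[OF q k] _ i[OF k]])
        (use Ao c(1)[OF k] in auto)
  qed
  finally show ?thesis .
qed

definition cluster_of :: "nat \<Rightarrow> nat" where
  "cluster_of t = (THE k. k \<in> I \<and> t \<in> T k)"

lemma cluster_of_eq: "k \<in> I \<Longrightarrow> t \<in> T k \<Longrightarrow> cluster_of t = k"
  unfolding cluster_of_def using T_disjoint by (intro the_equality) blast+

lemma cluster_of_mem: "t \<in> {1..n} \<Longrightarrow> cluster_of t \<in> I \<and> t \<in> T (cluster_of t)"
  using T_union cluster_of_eq by (metis UN_E)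

text \<open>
  The part of the matrix \<open>m\<close> strictly below the block diagonal of the clusters.
\<close>

definition earlier :: "(nat \<Rightarrow> nat \<Rightarrow> 'a \<Rightarrow> real) \<Rightarrow> nat \<Rightarrow> nat \<Rightarrow> 'a \<Rightarrow> real" where
  "earlier m t s x = (if cluster_of s < cluster_of t then m t s x else 0)"

text \<open>
  The strictly triangular part of a quadratic form is a linear form in \<open>p\<close> with coefficients
  \<open>a t = \<Sum> m t s * q s\<close> that only involve earlier clusters, so the martingale bound applies twice,
  first to the outer sum and then to the coefficients.
\<close>

lemma offdiagonal_form:
  assumes p: "noise B p" and q: "noise B q"
    and m: "\<And>t s. t \<in> {1..n} \<Longrightarrow> s \<in> {1..n} \<Longrightarrow> m t s \<in> borel_measurable W"
      "\<And>t s x. t \<in> {1..n} \<Longrightarrow> s \<in> {1..n} \<Longrightarrow> \<bar>m t s x\<bar> \<le> 1"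
  defines "a \<equiv> \<lambda>t x. \<Sum>s=1..n. earlier m t s x * q s x"
  shows "(\<lambda>x. \<Sum>t=1..n. a t x * p t x) \<in> borel_measurable M"
    and "integrable M (\<lambda>x. (\<Sum>t=1..n. a t x * p t x)\<^sup>2)"
    and "(\<integral>x. (\<Sum>t=1..n. a t x * p t x)\<^sup>2 \<partial>M) \<le> (real L * (1 + B))\<^sup>2 * (\<Sum>t=1..n. \<Sum>s=1..n. \<integral>x. (m t s x)\<^sup>2 \<partial>M)"
    and "A \<in> sets W \<Longrightarrow> (\<integral>x. indicator A x * (\<Sum>t=1..n. a t x * p t x) \<partial>M) = 0"
proof -
  have B: "B \<ge> 0" using p by (simp add: noise_def)
  have mi: "integrable M (\<lambda>x. (m t s x)\<^sup>2)" if "t \<in> {1..n}" "s \<in> {1..n}" for t s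
    by (rule integrable_const_bound[where B = 1])
      (use m that measurable_W_M[OF m(1)[OF that]] in \<open>auto intro!: AE_I2 simp: abs_square_le_1\<close>)
  have eW: "earlier m t s \<in> borel_measurable W" if "t \<in> {1..n}" "s \<in> {1..n}" for t s
    using m(1)[OF that] unfolding earlier_def[abs_def] by auto
  have ei: "integrable M (\<lambda>x. (earlier m t s x)\<^sup>2)" and eb: "(\<integral>x. (earlier m t s x)\<^sup>2 \<partial>M) \<le> (\<integral>x. (m t s x)\<^sup>2 \<partial>M)"
    if "t \<in> {1..n}" "s \<in> {1..n}" for t s
    using mi[OF that] by (cases "cluster_of s < cluster_of t"; simp add: earlier_def[abs_def])+
  have ai: "integrable M (\<lambda>x. (a t x)\<^sup>2)"
    and ab: "(\<integral>x. (a t x)\<^sup>2 \<partial>M) \<le> real L * (1 + B) * (\<Sum>s=1..n. \<integral>x. (m t s x)\<^sup>2 \<partial>M)" if t: "t \<in> {1..n}" for t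
  proof -
    note ls = linear_square[OF q eW[OF t] ei[OF t]]
    show "integrable M (\<lambda>x. (a t x)\<^sup>2)" unfolding a_def by (rule ls(1))
    have "(\<integral>x. (a t x)\<^sup>2 \<partial>M) \<le> real L * (1 + B) * (\<Sum>s=1..n. \<integral>x. (earlier m t s x)\<^sup>2 \<partial>M)"
      unfolding a_def by (rule ls(2))
    also have "\<dots> \<le> real L * (1 + B) * (\<Sum>s=1..n. \<integral>x. (m t s x)\<^sup>2 \<partial>M)"
      using B by (intro mult_left_mono sum_mono eb t) auto
    finally show "(\<integral>x. (a t x)\<^sup>2 \<partial>M) \<le> real L * (1 + B) * (\<Sum>s=1..n. \<integral>x. (m t s x)\<^sup>2 \<partial>M)" .
  qed
  have am: "a t \<in> borel_measurable (others k)" if k: "k \<in> I" "l \<in> I" "l \<le> k" "t \<in> T l" for k l t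
    unfolding a_def
  proof (rule borel_measurable_sum)
    fix s assume s: "s \<in> {1..n}"
    have t: "t \<in> {1..n}" using T_subset k by blast
    show "(\<lambda>x. earlier m t s x * q s x) \<in> borel_measurable (others k)"
    proof (cases "cluster_of s < cluster_of t")
      case True
      hence ne: "cluster_of s \<noteq> k" using cluster_of_eq[OF k(2,4)] k(3) by simp
      have "q s \<in> borel_measurable (others k)"
        using measurable_inside_others[OF _ ne] cluster_of_mem[OF s] noiseD(1)[OF q] by blast
      thus ?thesis using measurable_W_others[OF eW[OF t s]] by auto
    qed (simp add: earlier_def)
  qed
  note ml = martingale_linear_square[OF p am[OF _ _ order_refl] ai[OF T_subset] am[OF _ _ less_imp_le]]
  show "(\<lambda>x. \<Sum>t=1..n. a t x * p t x) \<in> borel_measurable M" "integrable M (\<lambda>x. (\<Sum>t=1..n. a t x * p t x)\<^sup>2)"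
    by (rule ml; assumption)+
  have "(\<integral>x. (\<Sum>t=1..n. a t x * p t x)\<^sup>2 \<partial>M) \<le> real L * (1 + B) * (\<Sum>t=1..n. \<integral>x. (a t x)\<^sup>2 \<partial>M)"
    by (rule ml; assumption)
  also have "\<dots> \<le> real L * (1 + B) * (\<Sum>t=1..n. real L * (1 + B) * (\<Sum>s=1..n. \<integral>x. (m t s x)\<^sup>2 \<partial>M))"
    using B by (intro mult_left_mono sum_mono ab) auto
  also have "\<dots> = (real L * (1 + B))\<^sup>2 * (\<Sum>t=1..n. \<Sum>s=1..n. \<integral>x. (m t s x)\<^sup>2 \<partial>M)"
    by (simp add: sum_distrib_left power2_eq_square mult.assoc)
  finally show "(\<integral>x. (\<Sum>t=1..n. a t x * p t x)\<^sup>2 \<partial>M) \<le> (real L * (1 + B))\<^sup>2 * (\<Sum>t=1..n. \<Sum>s=1..n. \<integral>x. (m t s x)\<^sup>2 \<partial>M)" .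
  show "A \<in> sets W \<Longrightarrow> (\<integral>x. indicator A x * (\<Sum>t=1..n. a t x * p t x) \<partial>M) = 0"
    by (rule martingale_linear_mean_zero[OF p am[OF _ _ order_refl] ai[OF T_subset]])
qed

text \<open>
  Products within a cluster, centred at their conditional mean.  Fourth moments of the factors bound
  second moments of the product, and Jensen's inequality bounds those of the centring.
\<close>

lemma cross_moment:
  assumes p: "noise B p" and q: "noise B q" and k: "k \<in> I" "t \<in> T k" "s \<in> T k"
    and m: "m \<in> borel_measurable W" "\<And>x. \<bar>m x\<bar> \<le> 1"
  defines "u \<equiv> \<lambda>x. p t x * q s x - real_cond_exp M W (\<lambda>x. p t x * q s x) x"
  shows "integrable M (\<lambda>x. p t x * q s x)" "integrable M u" "u \<in> borel_measurable (inside k)"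
    "AE x in M. real_cond_exp M W u x = 0"
    "integrable M (\<lambda>x. (m x * u x)\<^sup>2)" "(\<integral>x. (m x * u x)\<^sup>2 \<partial>M) \<le> 8 * B * (\<integral>x. (m x)\<^sup>2 \<partial>M)"
proof -
  note P = noiseD[OF p k(1,2)] and Q = noiseD[OF q k(1,3)]
  note [measurable] = P(2) Q(2) measurable_W_M[OF m(1)]
  let ?e = "real_cond_exp M W (\<lambda>x. p t x * q s x)"
  show i1: "integrable M (\<lambda>x. p t x * q s x)" by (intro square_integrable_product P Q)
  have le: "(p t x * q s x)\<^sup>2 \<le> p t x ^ 4 + q s x ^ 4" for x
  proof -
    have "0 \<le> ((p t x)\<^sup>2 - (q s x)\<^sup>2)\<^sup>2" "0 \<le> p t x ^ 4" "0 \<le> q s x ^ 4" by simp_all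
    thus ?thesis by (simp add: power2_eq_square power4_eq_xxxx algebra_simps)
  qed
  have i2: "integrable M (\<lambda>x. (p t x * q s x)\<^sup>2)"
    by (rule Bochner_Integration.integrable_bound[OF Bochner_Integration.integrable_add[OF P(4) Q(4)]])
      (use le in \<open>auto intro!: AE_I2\<close>)
  have cx: "convex_on UNIV (\<lambda>x::real. x\<^sup>2)" by (rule convex_power2)
  have ie: "integrable M (\<lambda>x. (?e x)\<^sup>2)"
    by (rule W.integrable_convex_cond_exp[OF i1 _ _ i2 cx]) auto
  have je: "AE x in M. (?e x)\<^sup>2 \<le> real_cond_exp M W (\<lambda>x. (p t x * q s x)\<^sup>2) x"
    by (rule W.real_cond_exp_jensens_inequality(2)[OF i1 _ _ i2 cx]) auto
  show iu: "integrable M u" unfolding u_def using i1 W.real_cond_exp_int(1)[OF i1] by simp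
  show "u \<in> borel_measurable (inside k)" unfolding u_def
    using P(1) Q(1) measurable_W_inside[OF k(1), of ?e] by simp
  show "AE x in M. real_cond_exp M W u x = 0"
  proof -
    have "AE x in M. real_cond_exp M W u x = ?e x - real_cond_exp M W ?e x"
      unfolding u_def by (rule W.real_cond_exp_diff[OF i1 W.real_cond_exp_int(1)[OF i1]])
    moreover have "AE x in M. real_cond_exp M W ?e x = ?e x"
      by (rule W.real_cond_exp_F_meas[OF W.real_cond_exp_int(1)[OF i1]]) simp
    ultimately show ?thesis by auto
  qed
  have um: "u \<in> borel_measurable M" unfolding u_def by simp
  have m1: "(m x)\<^sup>2 \<le> 1" for x using m(2)[of x] by (simp add: abs_square_le_1)
  have im: "integrable M (\<lambda>x. (m x)\<^sup>2)"
    by (rule integrable_const_bound[where B = 1]) (use m1 in \<open>auto intro!: AE_I2\<close>)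
  have mul: "integrable M (\<lambda>x. (m x)\<^sup>2 * f x)" if "integrable M f" for f
    by (rule Bochner_Integration.integrable_bound[OF that])
      (use that m1 in \<open>auto intro!: AE_I2 simp: abs_mult mult_left_le_one_le\<close>)
  note i3 = mul[OF i2] and i4 = mul[OF ie]
  have "(\<integral>x. (m x)\<^sup>2 * (?e x)\<^sup>2 \<partial>M) \<le> (\<integral>x. (m x)\<^sup>2 * real_cond_exp M W (\<lambda>x. (p t x * q s x)\<^sup>2) x \<partial>M)"
    by (rule integral_mono_AE[OF i4 mul[OF W.real_cond_exp_int(1)[OF i2]]])
      (use je in \<open>auto elim!: eventually_mono intro: mult_left_mono\<close>)
  also have "\<dots> = (\<integral>x. (m x)\<^sup>2 * (p t x * q s x)\<^sup>2 \<partial>M)"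
    by (rule W.real_cond_exp_intg(2)[OF i3]) (use m in auto)
  finally have b1: "(\<integral>x. (m x)\<^sup>2 * (?e x)\<^sup>2 \<partial>M) \<le> (\<integral>x. (m x)\<^sup>2 * (p t x * q s x)\<^sup>2 \<partial>M)" .
  have mo: "(\<lambda>x. (m x)\<^sup>2) \<in> borel_measurable (others k)" using measurable_W_others[OF m(1)] by simp
  have "(\<integral>x. (m x)\<^sup>2 * (p t x * q s x)\<^sup>2 \<partial>M) \<le> (\<integral>x. (m x)\<^sup>2 * p t x ^ 4 + (m x)\<^sup>2 * q s x ^ 4 \<partial>M)"
    using mul[OF P(4)] mul[OF Q(4)] i3 mult_left_mono[OF le, of "(m x)\<^sup>2" x for x]
    by (intro integral_mono) (auto simp: distrib_left)
  also have "\<dots> = (\<integral>x. (m x)\<^sup>2 * p t x ^ 4 \<partial>M) + (\<integral>x. (m x)\<^sup>2 * q s x ^ 4 \<partial>M)"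
    using mul[OF P(4)] mul[OF Q(4)] by simp
  also have "\<dots> \<le> B * (\<integral>x. (m x)\<^sup>2 \<partial>M) + B * (\<integral>x. (m x)\<^sup>2 \<partial>M)"
    by (intro add_mono cond_bound_others_real(2)[OF k(1)]) (use P Q mo im in auto)
  finally have b2: "(\<integral>x. (m x)\<^sup>2 * (p t x * q s x)\<^sup>2 \<partial>M) \<le> 2 * B * (\<integral>x. (m x)\<^sup>2 \<partial>M)" by simp
  have ule: "(m x * u x)\<^sup>2 \<le> 2 * ((m x)\<^sup>2 * (p t x * q s x)\<^sup>2) + 2 * ((m x)\<^sup>2 * (?e x)\<^sup>2)" for x
  proof -
    have "0 \<le> (p t x * q s x + ?e x)\<^sup>2" by simp
    hence "(u x)\<^sup>2 \<le> 2 * (p t x * q s x)\<^sup>2 + 2 * (?e x)\<^sup>2" unfolding u_def power2_sum power2_diff by linarith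
    from mult_left_mono[OF this, of "(m x)\<^sup>2"] show ?thesis by (simp add: power_mult_distrib algebra_simps)
  qed
  have ib: "integrable M (\<lambda>x. 2 * ((m x)\<^sup>2 * (p t x * q s x)\<^sup>2) + 2 * ((m x)\<^sup>2 * (?e x)\<^sup>2))" using i3 i4 by simp
  show imu: "integrable M (\<lambda>x. (m x * u x)\<^sup>2)"
    by (rule Bochner_Integration.integrable_bound[OF ib])
      (use ule um in \<open>auto intro!: AE_I2 simp del: power_mult_distrib intro: order_trans[OF _ abs_ge_self]\<close>)
  have "(\<integral>x. (m x * u x)\<^sup>2 \<partial>M) \<le> (\<integral>x. 2 * ((m x)\<^sup>2 * (p t x * q s x)\<^sup>2) + 2 * ((m x)\<^sup>2 * (?e x)\<^sup>2) \<partial>M)"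
    by (rule integral_mono[OF imu ib ule])
  also have "\<dots> = 2 * (\<integral>x. (m x)\<^sup>2 * (p t x * q s x)\<^sup>2 \<partial>M) + 2 * (\<integral>x. (m x)\<^sup>2 * (?e x)\<^sup>2 \<partial>M)" using i3 i4 by simp
  also have "\<dots> \<le> 8 * B * (\<integral>x. (m x)\<^sup>2 \<partial>M)" using b1 b2 by linarith
  finally show "(\<integral>x. (m x * u x)\<^sup>2 \<partial>M) \<le> 8 * B * (\<integral>x. (m x)\<^sup>2 \<partial>M)" .
qed

text \<open>
  The block-diagonal part, centred: a sum of orthogonal cluster contributions with at most \<open>L^2\<close>
  terms each.
\<close>

lemma diagonal_form:
  assumes p: "noise B p" and q: "noise B q"
    and m: "\<And>t s. t \<in> {1..n} \<Longrightarrow> s \<in> {1..n} \<Longrightarrow> m t s \<in> borel_measurable W"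
      "\<And>t s x. t \<in> {1..n} \<Longrightarrow> s \<in> {1..n} \<Longrightarrow> \<bar>m t s x\<bar> \<le> 1"
  defines "u \<equiv> \<lambda>t s x. p t x * q s x - real_cond_exp M W (\<lambda>x. p t x * q s x) x"
  defines "D \<equiv> \<lambda>x. \<Sum>k\<in>I. \<Sum>t\<in>T k. \<Sum>s\<in>T k. m t s x * u t s x"
  shows "D \<in> borel_measurable M" "integrable M (\<lambda>x. (D x)\<^sup>2)"
    and "(\<integral>x. (D x)\<^sup>2 \<partial>M) \<le> (real L)\<^sup>2 * (8 * B) * (\<Sum>t=1..n. \<Sum>s=1..n. \<integral>x. (m t s x)\<^sup>2 \<partial>M)"
    and "A \<in> sets W \<Longrightarrow> (\<integral>x. indicator A x * D x \<partial>M) = 0"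
proof -
  have B: "B \<ge> 0" using p by (simp add: noise_def)
  define Y where "Y k x = (\<Sum>(t, s)\<in>T k \<times> T k. m t s x * u t s x)" for k x
  have D: "D x = (\<Sum>k\<in>I. Y k x)" for x
    unfolding D_def Y_def by (simp add: sum.cartesian_product)
  have mk: "m t s \<in> borel_measurable W" "\<bar>m t s x\<bar> \<le> 1" if "k \<in> I" "t \<in> T k" "s \<in> T k" for k t s x
    using m T_subset that by blast+
  have cm: "integrable M (\<lambda>x. p t x * q s x)" "integrable M (u t s)" "u t s \<in> borel_measurable (inside k)"
    "AE x in M. real_cond_exp M W (u t s) x = 0" "integrable M (\<lambda>x. (m t s x * u t s x)\<^sup>2)"
    "(\<integral>x. (m t s x * u t s x)\<^sup>2 \<partial>M) \<le> 8 * B * (\<integral>x. (m t s x)\<^sup>2 \<partial>M)"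
    if k: "k \<in> I" "t \<in> T k" "s \<in> T k" for k t s
    using cross_moment[OF p q k mk[OF k]] unfolding u_def by blast+
  have mu: "(\<lambda>x. m t s x * u t s x) \<in> borel_measurable (inside k)" if k: "k \<in> I" "t \<in> T k" "s \<in> T k" for k t s
    using cm(3)[OF k] measurable_W_inside[OF k(1) mk(1)[OF k]] by simp
  have Yin: "Y k \<in> borel_measurable (inside k)" if "k \<in> I" for k
    unfolding Y_def[abs_def] case_prod_unfold by (intro borel_measurable_sum mu that) auto
  have Ym: "Y k \<in> borel_measurable M" if "k \<in> I" for k by (rule measurable_inside_M[OF that Yin[OF that]])
  have sq: "integrable M (\<lambda>x. (case ts of (t, s) \<Rightarrow> m t s x * u t s x)\<^sup>2)" if "k \<in> I" "ts \<in> T k \<times> T k" for k ts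
    using cm(5) that by (cases ts) auto
  have Yi: "integrable M (\<lambda>x. (Y k x)\<^sup>2)" if k: "k \<in> I" for k
    unfolding Y_def
  proof (intro square_integrable_sum)
    show "finite (T k \<times> T k)" using T_finite[OF k] by simp
    fix ts assume ts: "ts \<in> T k \<times> T k"
    show "(\<lambda>x. case ts of (t, s) \<Rightarrow> m t s x * u t s x) \<in> borel_measurable M"
      using measurable_inside_M[OF k mu[OF k]] ts by (cases ts) auto
  qed (rule sq[OF k])
  have Yb: "(\<integral>x. (Y k x)\<^sup>2 \<partial>M) \<le> (real L)\<^sup>2 * (8 * B) * (\<Sum>t\<in>T k. \<Sum>s=1..n. \<integral>x. (m t s x)\<^sup>2 \<partial>M)" if k: "k \<in> I" for k
  proof -
    have c: "card (T k \<times> T k) \<le> L * L" using T_card[OF k] by (simp add: card_cartesian_product mult_le_mono)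
    have "(\<integral>x. (Y k x)\<^sup>2 \<partial>M) \<le> (\<integral>x. real (L * L) * (\<Sum>ts\<in>T k \<times> T k. (case ts of (t, s) \<Rightarrow> m t s x * u t s x)\<^sup>2) \<partial>M)"
    proof (rule integral_mono[OF Yi[OF k]])
      show "integrable M (\<lambda>x. real (L * L) * (\<Sum>ts\<in>T k \<times> T k. (case ts of (t, s) \<Rightarrow> m t s x * u t s x)\<^sup>2))"
        by (intro integrable_mult_right Bochner_Integration.integrable_sum sq[OF k])
      show "(Y k x)\<^sup>2 \<le> real (L * L) * (\<Sum>ts\<in>T k \<times> T k. (case ts of (t, s) \<Rightarrow> m t s x * u t s x)\<^sup>2)" for x
        unfolding Y_def by (rule sum_squared_le[OF _ c]) (use T_finite[OF k] in simp)
    qed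
    also have "\<dots> = real (L * L) * (\<Sum>ts\<in>T k \<times> T k. \<integral>x. (case ts of (t, s) \<Rightarrow> m t s x * u t s x)\<^sup>2 \<partial>M)"
      by (simp only: integral_mult_right_zero Bochner_Integration.integral_sum[OF sq[OF k]])
    also have "\<dots> = real (L * L) * (\<Sum>t\<in>T k. \<Sum>s\<in>T k. \<integral>x. (m t s x * u t s x)\<^sup>2 \<partial>M)"
      by (simp add: sum.cartesian_product case_prod_unfold)
    also have "\<dots> \<le> real (L * L) * (\<Sum>t\<in>T k. \<Sum>s\<in>T k. 8 * B * (\<integral>x. (m t s x)\<^sup>2 \<partial>M))"
      using cm(6) k by (intro mult_left_mono sum_mono) auto
    also have "\<dots> \<le> real (L * L) * (\<Sum>t\<in>T k. \<Sum>s=1..n. 8 * B * (\<integral>x. (m t s x)\<^sup>2 \<partial>M))"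
      using B T_subset[OF k] by (intro mult_left_mono sum_mono sum_mono2) auto
    also have "\<dots> = (real L)\<^sup>2 * (8 * B) * (\<Sum>t\<in>T k. \<Sum>s=1..n. \<integral>x. (m t s x)\<^sup>2 \<partial>M)"
      by (simp add: sum_distrib_left power2_eq_square mult.assoc)
    finally show ?thesis .
  qed
  have zero: "(\<integral>x. P x * Y k x \<partial>M) = 0" if k: "k \<in> I" and P: "P \<in> borel_measurable (others k)" "integrable M (\<lambda>x. (P x)\<^sup>2)" for k P
  proof -
    have e: "P x * Y k x = (\<Sum>t\<in>T k. \<Sum>s\<in>T k. (P x * m t s x) * u t s x)" for x
      by (simp add: Y_def sum_distrib_left mult.assoc sum.cartesian_product case_prod_unfold)
    have i: "integrable M (\<lambda>x. (P x * m t s x) * u t s x)" if ts: "t \<in> T k" "s \<in> T k" for t s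
      unfolding mult.assoc
      by (rule square_integrable_product[OF measurable_others_M[OF P(1)] measurable_inside_M[OF k mu[OF k ts]] P(2) cm(5)[OF k ts]])
    have "(\<integral>x. P x * Y k x \<partial>M) = (\<Sum>t\<in>T k. \<Sum>s\<in>T k. \<integral>x. (P x * m t s x) * u t s x \<partial>M)"
      unfolding e using i by (simp add: Bochner_Integration.integral_sum)
    also have "\<dots> = 0"
    proof (intro sum.neutral ballI)
      fix t s assume ts: "t \<in> T k" "s \<in> T k"
      show "(\<integral>x. (P x * m t s x) * u t s x \<partial>M) = 0"
        by (rule orthogonal_to_others[OF k cm(2-4)[OF k ts] _ i[OF ts]])
          (use P(1) measurable_W_others[OF mk(1)[OF k ts]] in auto)
    qed
    finally show ?thesis .
  qed
  show "D \<in> borel_measurable M" unfolding D[abs_def] using Ym by auto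
  show "integrable M (\<lambda>x. (D x)\<^sup>2)" unfolding D by (intro square_integrable_sum finite_I Ym Yi)
  have "(\<integral>x. (D x)\<^sup>2 \<partial>M) = (\<Sum>k\<in>I. \<integral>x. (Y k x)\<^sup>2 \<partial>M)" unfolding D
  proof (rule integral_square_orthogonal_sum[OF finite_I Ym Yi])
    fix k l assume kl: "k \<in> I" "l \<in> I" "k \<noteq> l"
    show "(\<integral>x. Y k x * Y l x \<partial>M) = 0"
      by (rule zero[OF kl(2) measurable_inside_others[OF kl(1,3) Yin[OF kl(1)]] Yi[OF kl(1)]])
  qed
  also have "\<dots> \<le> (\<Sum>k\<in>I. (real L)\<^sup>2 * (8 * B) * (\<Sum>t\<in>T k. \<Sum>s=1..n. \<integral>x. (m t s x)\<^sup>2 \<partial>M))" by (intro sum_mono Yb)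
  also have "\<dots> = (real L)\<^sup>2 * (8 * B) * (\<Sum>t=1..n. \<Sum>s=1..n. \<integral>x. (m t s x)\<^sup>2 \<partial>M)"
    by (simp only: sum_over_clusters[of "\<lambda>t. \<Sum>s=1..n. \<integral>x. (m t s x)\<^sup>2 \<partial>M"] sum_distrib_left)
  finally show "(\<integral>x. (D x)\<^sup>2 \<partial>M) \<le> (real L)\<^sup>2 * (8 * B) * (\<Sum>t=1..n. \<Sum>s=1..n. \<integral>x. (m t s x)\<^sup>2 \<partial>M)" .
  assume A: "A \<in> sets W"
  have Ai: "integrable M (\<lambda>x. (indicator A x :: real)\<^sup>2)" and AM: "A \<in> sets M"
    using A sets_W by (auto simp: indicator_def[abs_def] power2_eq_square intro!: integrable_const_bound[where B = 1])
  have "(\<integral>x. indicator A x * D x \<partial>M) = (\<integral>x. (\<Sum>k\<in>I. indicator A x * Y k x) \<partial>M)"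
    by (simp add: D sum_distrib_left)
  also have "\<dots> = (\<Sum>k\<in>I. \<integral>x. indicator A x * Y k x \<partial>M)"
  proof (rule Bochner_Integration.integral_sum)
    fix k assume k: "k \<in> I"
    show "integrable M (\<lambda>x. indicator A x * Y k x)"
      using integrable_mult_indicator[OF AM square_integrable_imp_integrable[OF Ym[OF k] Yi[OF k]]] by simp
  qed
  also have "\<dots> = 0"
    by (intro sum.neutral ballI zero Ai measurable_W_others) (use A in auto)
  finally show "(\<integral>x. indicator A x * D x \<partial>M) = 0" .
qed

text \<open>
  Split the double sum into the pairs within a cluster and the two orders of pairs from different
  clusters.  All three parts have conditional mean zero after centring the first, so the centred form is
  exactly their sum \<open>R\<close>, and its second moment is bounded by a multiple of the sum of squares of the weights;
  for the weights of a projection that sum is at most \<open>n\<close> rather than \<open>n^2\<close>.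
\<close>

lemma quadratic_form_concentration:
  assumes p: "noise B p" and q: "noise B q"
    and m: "\<And>t s. t \<in> {1..n} \<Longrightarrow> s \<in> {1..n} \<Longrightarrow> m t s \<in> borel_measurable W"
      "\<And>t s x. t \<in> {1..n} \<Longrightarrow> s \<in> {1..n} \<Longrightarrow> \<bar>m t s x\<bar> \<le> 1"
    and msum: "(\<Sum>t=1..n. \<Sum>s=1..n. \<integral>x. (m t s x)\<^sup>2 \<partial>M) \<le> real n"
  defines "Q \<equiv> \<lambda>x. \<Sum>t=1..n. \<Sum>s=1..n. m t s x * (p t x * q s x)"
  shows "integrable M Q" "integrable M (\<lambda>x. (Q x - real_cond_exp M W Q x)\<^sup>2)"
    "(\<integral>x. (Q x - real_cond_exp M W Q x)\<^sup>2 \<partial>M) \<le> 30 * (real L * (1 + B))\<^sup>2 * real n"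
proof -
  have B: "B \<ge> 0" using p by (simp add: noise_def)
  let ?e = "\<lambda>t s. real_cond_exp M W (\<lambda>x. p t x * q s x)"
  define S where "S = (\<Sum>t=1..n. \<Sum>s=1..n. \<integral>x. (m t s x)\<^sup>2 \<partial>M)"
  \<comment> \<open>The transposed weights turn the pairs in the opposite order into a lower triangular form with the roles of \<open>p\<close> and \<open>q\<close> exchanged.\<close>
  define mt where "mt s t = m t s" for s t
  define O1 where "O1 x = (\<Sum>t=1..n. (\<Sum>s=1..n. earlier m t s x * q s x) * p t x)" for x
  define O2 where "O2 x = (\<Sum>s=1..n. (\<Sum>t=1..n. earlier mt s t x * p t x) * q s x)" for x
  define D where "D x = (\<Sum>k\<in>I. \<Sum>t\<in>T k. \<Sum>s\<in>T k. m t s x * (p t x * q s x - ?e t s x))" for x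
  define Z where "Z x = (\<Sum>k\<in>I. \<Sum>t\<in>T k. \<Sum>s\<in>T k. m t s x * ?e t s x)" for x
  note o1 = offdiagonal_form[where m = m, OF p q m, folded O1_def]
  have mt: "mt s t \<in> borel_measurable W" "\<bar>mt s t x\<bar> \<le> 1" if "s \<in> {1..n}" "t \<in> {1..n}" for s t x
    using m that by (auto simp: mt_def)
  note o2 = offdiagonal_form[where m = mt, OF q p mt, folded O2_def]
  note d = diagonal_form[where m = m, OF p q m, folded D_def]
  have mk: "m t s \<in> borel_measurable W" "\<bar>m t s x\<bar> \<le> 1" if "k \<in> I" "t \<in> T k" "s \<in> T k" for k t s x
    using m T_subset that by blast+
  have same: "(\<Sum>t=1..n. \<Sum>s=1..n. if cluster_of s = cluster_of t then f t s else 0) = (\<Sum>k\<in>I. \<Sum>t\<in>T k. \<Sum>s\<in>T k. f t s)"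
    for f :: "nat \<Rightarrow> nat \<Rightarrow> real"
  proof -
    have "(\<Sum>t=1..n. \<Sum>s=1..n. if cluster_of s = cluster_of t then f t s else 0)
      = (\<Sum>k\<in>I. \<Sum>t\<in>T k. \<Sum>s=1..n. if cluster_of s = cluster_of t then f t s else 0)"
      by (rule sum_over_clusters)
    also have "\<dots> = (\<Sum>k\<in>I. \<Sum>t\<in>T k. \<Sum>s\<in>T k. f t s)"
    proof (rule sum.cong[OF refl], rule sum.cong[OF refl])
      fix k t assume k: "k \<in> I" "t \<in> T k"
      have "{1..n} \<inter> {s. cluster_of s = cluster_of t} = T k"
      proof (intro equalityI subsetI)
        fix s assume "s \<in> {1..n} \<inter> {s. cluster_of s = cluster_of t}"
        thus "s \<in> T k" using cluster_of_mem[of s] cluster_of_eq[OF k] by simp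
      next
        fix s assume s: "s \<in> T k"
        show "s \<in> {1..n} \<inter> {s. cluster_of s = cluster_of t}"
          using T_subset[OF k(1) s] cluster_of_eq[OF k(1) s] cluster_of_eq[OF k] by simp
      qed
      thus "(\<Sum>s=1..n. if cluster_of s = cluster_of t then f t s else 0) = (\<Sum>s\<in>T k. f t s)"
        by (simp add: sum.If_cases)
    qed
    finally show ?thesis .
  qed
  have Qe: "Q x = Z x + (D x + O1 x + O2 x)" for x
  proof -
    have "m t s x * (p t x * q s x) = (if cluster_of s = cluster_of t then m t s x * (p t x * q s x) else 0)
      + earlier m t s x * q s x * p t x + earlier mt s t x * p t x * q s x" for t s
      by (auto simp: earlier_def mt_def)
    hence "Q x = (\<Sum>t=1..n. \<Sum>s=1..n. if cluster_of s = cluster_of t then m t s x * (p t x * q s x) else 0)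
      + (\<Sum>t=1..n. \<Sum>s=1..n. earlier m t s x * q s x * p t x) + (\<Sum>t=1..n. \<Sum>s=1..n. earlier mt s t x * p t x * q s x)"
      unfolding Q_def sum.distrib[symmetric] by (intro sum.cong refl)
    also have "(\<Sum>t=1..n. \<Sum>s=1..n. earlier m t s x * q s x * p t x) = O1 x"
      by (simp only: O1_def sum_distrib_right)
    also have "(\<Sum>t=1..n. \<Sum>s=1..n. earlier mt s t x * p t x * q s x) = O2 x"
      by (subst sum.swap) (simp only: O2_def sum_distrib_right)
    also have "(\<Sum>t=1..n. \<Sum>s=1..n. if cluster_of s = cluster_of t then m t s x * (p t x * q s x) else 0) = D x + Z x"
      unfolding same D_def Z_def sum.distrib[symmetric] by (simp add: algebra_simps)
    finally show ?thesis by simp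
  qed
  define R where "R x = D x + O1 x + O2 x" for x
  have Rm: "R \<in> borel_measurable M" unfolding R_def[abs_def] using d(1) o1(1) o2(1) by auto
  have Rle: "(R x)\<^sup>2 \<le> 3 * ((D x)\<^sup>2 + (O1 x)\<^sup>2 + (O2 x)\<^sup>2)" for x
  proof -
    have "0 \<le> (D x - O1 x)\<^sup>2 + (D x - O2 x)\<^sup>2 + (O1 x - O2 x)\<^sup>2" by simp
    thus ?thesis by (simp add: R_def power2_eq_square algebra_simps)
  qed
  have ib: "integrable M (\<lambda>x. 3 * ((D x)\<^sup>2 + (O1 x)\<^sup>2 + (O2 x)\<^sup>2))"
    by (intro integrable_mult_right Bochner_Integration.integrable_add d(2) o1(2) o2(2))
  have Ri2: "integrable M (\<lambda>x. (R x)\<^sup>2)"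
    by (rule Bochner_Integration.integrable_bound[OF ib])
      (use Rle Rm in \<open>auto intro!: AE_I2 intro: order_trans[OF _ abs_ge_self]\<close>)
  have Ri: "integrable M R" by (rule square_integrable_imp_integrable[OF Rm Ri2])
  have "(\<integral>x. (R x)\<^sup>2 \<partial>M) \<le> (\<integral>x. 3 * ((D x)\<^sup>2 + (O1 x)\<^sup>2 + (O2 x)\<^sup>2) \<partial>M)"
    by (rule integral_mono[OF Ri2 ib Rle])
  also have "\<dots> = 3 * ((\<integral>x. (D x)\<^sup>2 \<partial>M) + (\<integral>x. (O1 x)\<^sup>2 \<partial>M) + (\<integral>x. (O2 x)\<^sup>2 \<partial>M))"
    using d(2) o1(2) o2(2) by simp
  also have "\<dots> \<le> 3 * ((real L)\<^sup>2 * (8 * B) * S + (real L * (1 + B))\<^sup>2 * S + (real L * (1 + B))\<^sup>2 * S)"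
  proof (intro mult_left_mono add_mono)
    show "(\<integral>x. (D x)\<^sup>2 \<partial>M) \<le> (real L)\<^sup>2 * (8 * B) * S" unfolding S_def by (rule d(3))
    show "(\<integral>x. (O1 x)\<^sup>2 \<partial>M) \<le> (real L * (1 + B))\<^sup>2 * S" unfolding S_def by (rule o1(3))
    have "(\<integral>x. (O2 x)\<^sup>2 \<partial>M) \<le> (real L * (1 + B))\<^sup>2 * (\<Sum>s=1..n. \<Sum>t=1..n. \<integral>x. (mt s t x)\<^sup>2 \<partial>M)" by (rule o2(3))
    also have "(\<Sum>s=1..n. \<Sum>t=1..n. \<integral>x. (mt s t x)\<^sup>2 \<partial>M) = S" unfolding S_def mt_def by (rule sum.swap)
    finally show "(\<integral>x. (O2 x)\<^sup>2 \<partial>M) \<le> (real L * (1 + B))\<^sup>2 * S" .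
  qed simp
  also have "\<dots> \<le> 30 * (real L * (1 + B))\<^sup>2 * S"
  proof -
    have "S \<ge> 0" unfolding S_def by (intro sum_nonneg integral_nonneg_AE AE_I2) auto
    moreover have "(real L)\<^sup>2 * (8 * B) \<le> 8 * (real L * (1 + B))\<^sup>2"
    proof -
      have "B \<le> (1 + B)\<^sup>2" using B by (simp add: power2_eq_square distrib_left distrib_right)
      hence "8 * (real L)\<^sup>2 * B \<le> 8 * (real L)\<^sup>2 * (1 + B)\<^sup>2" by (intro mult_left_mono) auto
      thus ?thesis unfolding power_mult_distrib by linarith
    qed
    ultimately have "(real L)\<^sup>2 * (8 * B) * S \<le> 8 * (real L * (1 + B))\<^sup>2 * S" by (intro mult_right_mono)
    thus ?thesis by (simp add: mult_ac)
  qed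
  also have "\<dots> \<le> 30 * (real L * (1 + B))\<^sup>2 * real n"
    using msum unfolding S_def by (intro mult_left_mono) auto
  finally have Rb: "(\<integral>x. (R x)\<^sup>2 \<partial>M) \<le> 30 * (real L * (1 + B))\<^sup>2 * real n" .
  have Zi: "integrable M Z" unfolding Z_def[abs_def]
  proof (intro Bochner_Integration.integrable_sum)
    fix k t s assume k: "k \<in> I" "t \<in> T k" "s \<in> T k"
    have ei: "integrable M (?e t s)" by (rule W.real_cond_exp_int(1)[OF cross_moment(1)[OF p q k mk[OF k]]])
    show "integrable M (\<lambda>x. m t s x * ?e t s x)"
      by (rule Bochner_Integration.integrable_bound[OF ei])
        (use measurable_W_M[OF mk(1)[OF k]] mk(2)[OF k] in \<open>auto intro!: AE_I2 simp: abs_mult mult_left_le_one_le\<close>)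
  qed
  have Zm: "Z \<in> borel_measurable W" unfolding Z_def[abs_def] using mk(1)
    by (intro borel_measurable_sum borel_measurable_times) auto
  have QR: "Q x = Z x + R x" for x unfolding R_def by (rule Qe)
  show Qi: "integrable M Q" unfolding QR[abs_def] using Zi Ri by simp
  have QZ: "AE x in M. real_cond_exp M W Q x = Z x"
  proof (rule W.real_cond_exp_charact[OF _ Qi Zi Zm])
    fix A assume A: "A \<in> sets W"
    hence AM: "A \<in> sets M" using sets_W by auto
    have ind: "integrable M (\<lambda>x. indicator A x * f x)" if "integrable M f" for f :: "'a \<Rightarrow> real"
      using integrable_mult_indicator[OF AM that] by simp
    have i3: "integrable M D" "integrable M O1" "integrable M O2"
      using square_integrable_imp_integrable d(1,2) o1(1,2) o2(1,2) by blast+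
    have z: "(\<integral>x. indicator A x * D x \<partial>M) = 0" "(\<integral>x. indicator A x * O1 x \<partial>M) = 0" "(\<integral>x. indicator A x * O2 x \<partial>M) = 0"
      by (rule d(4) o1(4) o2(4); use A in simp)+
    have "(\<integral>x. indicator A x * R x \<partial>M) = (\<integral>x. indicator A x * D x + indicator A x * O1 x + indicator A x * O2 x \<partial>M)"
      by (simp add: R_def distrib_left)
    also have "\<dots> = 0"
      using ind[OF i3(1)] ind[OF i3(2)] ind[OF i3(3)] z by simp
    finally show "(\<integral>x\<in>A. Q x \<partial>M) = (\<integral>x\<in>A. Z x \<partial>M)"
      using ind[OF Zi] ind[OF Ri] by (simp add: set_lebesgue_integral_def QR distrib_left)
  qed
  have ae: "AE x in M. (Q x - real_cond_exp M W Q x)\<^sup>2 = (R x)\<^sup>2"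
    using QZ by eventually_elim (simp add: QR)
  have Qm: "(\<lambda>x. (Q x - real_cond_exp M W Q x)\<^sup>2) \<in> borel_measurable M" using Qi by auto
  show "integrable M (\<lambda>x. (Q x - real_cond_exp M W Q x)\<^sup>2)"
    using integrable_cong_AE[OF Qm _ ae] Ri2 Rm by auto
  have "(\<integral>x. (Q x - real_cond_exp M W Q x)\<^sup>2 \<partial>M) = (\<integral>x. (R x)\<^sup>2 \<partial>M)"
    by (rule integral_cong_AE[OF Qm _ ae]) (use Rm in auto)
  thus "(\<integral>x. (Q x - real_cond_exp M W Q x)\<^sup>2 \<partial>M) \<le> 30 * (real L * (1 + B))\<^sup>2 * real n" using Rb by simp
qed

end

section \<open>Projections, second moments and generated algebras\<close>

text \<open>
  For a symmetric idempotent matrix, \<open>\<Sum>j. (m i j)^2 = m i i\<close>; hence the diagonal entries lie between zero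
  and one, and the squares of all entries sum to the trace.
\<close>

lemma
  fixes m :: "nat \<Rightarrow> nat \<Rightarrow> real"
  assumes sym: "\<And>i j. i \<in> {1..n} \<Longrightarrow> j \<in> {1..n} \<Longrightarrow> m i j = m j i"
    and idem: "\<And>i k. i \<in> {1..n} \<Longrightarrow> k \<in> {1..n} \<Longrightarrow> (\<Sum>j=1..n. m i j * m j k) = m i k"
  shows projection_inner: "(\<Sum>i=1..n. (\<Sum>j=1..n. m i j * a j) * (\<Sum>j=1..n. m i j * b j)) = (\<Sum>i=1..n. a i * (\<Sum>j=1..n. m i j * b j))"
    and projection_contraction: "(\<Sum>i=1..n. (\<Sum>j=1..n. m i j * a j)\<^sup>2) \<le> (\<Sum>i=1..n. (a i)\<^sup>2)"
    and projection_entry: "i \<in> {1..n} \<Longrightarrow> j \<in> {1..n} \<Longrightarrow> \<bar>m i j\<bar> \<le> 1"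
    and projection_square_sum: "(\<Sum>i=1..n. \<Sum>j=1..n. (m i j)\<^sup>2) \<le> real n"
proof -
  have inner: "(\<Sum>i=1..n. (\<Sum>j=1..n. m i j * a j) * (\<Sum>j=1..n. m i j * b j)) = (\<Sum>i=1..n. a i * (\<Sum>j=1..n. m i j * b j))"
    for a b :: "nat \<Rightarrow> real"
  proof -
    have "(\<Sum>i=1..n. (\<Sum>j=1..n. m i j * a j) * (\<Sum>k=1..n. m i k * b k))
      = (\<Sum>i=1..n. \<Sum>j=1..n. \<Sum>k=1..n. a j * b k * (m j i * m i k))"
      unfolding sum_product by (intro sum.cong refl) (simp add: sym mult_ac)
    also have "\<dots> = (\<Sum>j=1..n. \<Sum>k=1..n. \<Sum>i=1..n. a j * b k * (m j i * m i k))"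
      by (rule trans[OF sum.swap sum.cong[OF refl sum.swap]])
    also have "\<dots> = (\<Sum>j=1..n. \<Sum>k=1..n. a j * b k * m j k)"
      by (intro sum.cong refl) (simp only: sum_distrib_left[symmetric] idem)
    also have "\<dots> = (\<Sum>j=1..n. a j * (\<Sum>k=1..n. m j k * b k))"
      by (simp add: sum_distrib_left mult_ac)
    finally show ?thesis .
  qed
  show "(\<Sum>i=1..n. (\<Sum>j=1..n. m i j * a j) * (\<Sum>j=1..n. m i j * b j)) = (\<Sum>i=1..n. a i * (\<Sum>j=1..n. m i j * b j))"
    by (rule inner)
  define c where "c i = (\<Sum>j=1..n. m i j * a j)" for i
  have cc: "(\<Sum>i=1..n. (c i)\<^sup>2) = (\<Sum>i=1..n. a i * c i)"
    using inner[of a a] unfolding c_def power2_eq_square .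
  have "0 \<le> (\<Sum>i=1..n. (a i - c i)\<^sup>2)" by (intro sum_nonneg) simp
  also have "\<dots> = (\<Sum>i=1..n. (a i)\<^sup>2) + (\<Sum>i=1..n. (c i)\<^sup>2) - 2 * (\<Sum>i=1..n. a i * c i)"
    by (simp add: power2_diff sum.distrib sum_subtractf sum_distrib_left mult.assoc)
  finally show "(\<Sum>i=1..n. (\<Sum>j=1..n. m i j * a j)\<^sup>2) \<le> (\<Sum>i=1..n. (a i)\<^sup>2)" using cc unfolding c_def by linarith
  have d: "(\<Sum>j=1..n. (m i j)\<^sup>2) = m i i" if "i \<in> {1..n}" for i
    using idem[OF that that] sym[OF that] by (simp add: power2_eq_square)
  have le: "(m i j)\<^sup>2 \<le> m i i" if "i \<in> {1..n}" "j \<in> {1..n}" for i j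
  proof -
    have "(m i j)\<^sup>2 \<le> (\<Sum>j=1..n. (m i j)\<^sup>2)" by (rule member_le_sum) (use that in auto)
    thus ?thesis using d that by simp
  qed
  have d1: "m i i \<le> 1" if "i \<in> {1..n}" for i
  proof (rule ccontr)
    assume "\<not> m i i \<le> 1"
    hence "m i i * 1 < m i i * m i i" by (intro mult_strict_left_mono) auto
    thus False using le[OF that that] by (simp add: power2_eq_square)
  qed
  show "i \<in> {1..n} \<Longrightarrow> j \<in> {1..n} \<Longrightarrow> \<bar>m i j\<bar> \<le> 1"
    using order_trans[OF le d1, of i j] by (simp add: abs_square_le_1)
  have "(\<Sum>i=1..n. \<Sum>j=1..n. (m i j)\<^sup>2) \<le> (\<Sum>i=1..n. (1::real))"
    by (intro sum_mono) (simp only: d d1)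
  thus "(\<Sum>i=1..n. \<Sum>j=1..n. (m i j)\<^sup>2) \<le> real n" by simp
qed

text \<open>
  Cauchy--Schwarz on the product of counting measure and \<open>M\<close>, obtained from
  \<open>2 l |X Y| \<le> l^2 X^2 + Y^2\<close> by choosing \<open>l\<close>.
\<close>

lemma Cauchy_Schwarz_sum_integral:
  fixes X Y :: "'i \<Rightarrow> 'a \<Rightarrow> real"
  assumes "finite A"
    and m: "\<And>i. i \<in> A \<Longrightarrow> X i \<in> borel_measurable M" "\<And>i. i \<in> A \<Longrightarrow> Y i \<in> borel_measurable M"
    and i: "\<And>i. i \<in> A \<Longrightarrow> integrable M (\<lambda>x. (X i x)\<^sup>2)" "\<And>i. i \<in> A \<Longrightarrow> integrable M (\<lambda>x. (Y i x)\<^sup>2)"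
  shows "integrable M (\<lambda>x. \<Sum>i\<in>A. X i x * Y i x)"
    "(\<integral>x. \<bar>\<Sum>i\<in>A. X i x * Y i x\<bar> \<partial>M) \<le> sqrt ((\<Sum>i\<in>A. \<integral>x. (X i x)\<^sup>2 \<partial>M) * (\<Sum>i\<in>A. \<integral>x. (Y i x)\<^sup>2 \<partial>M))"
proof -
  show int: "integrable M (\<lambda>x. \<Sum>i\<in>A. X i x * Y i x)"
    by (intro Bochner_Integration.integrable_sum square_integrable_product m i)
  define f where "f = (\<integral>x. \<bar>\<Sum>i\<in>A. X i x * Y i x\<bar> \<partial>M)"
  define a where "a = (\<Sum>i\<in>A. \<integral>x. (X i x)\<^sup>2 \<partial>M)"
  define b where "b = (\<Sum>i\<in>A. \<integral>x. (Y i x)\<^sup>2 \<partial>M)"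
  have f0: "f \<ge> 0" unfolding f_def by simp
  have a0: "a \<ge> 0" and b0: "b \<ge> 0" unfolding a_def b_def by (auto intro!: sum_nonneg)
  have key: "2 * l * f \<le> l\<^sup>2 * a + b" if l: "l \<ge> 0" for l
  proof -
    have p: "2 * l * \<bar>\<Sum>i\<in>A. X i x * Y i x\<bar> \<le> l\<^sup>2 * (\<Sum>i\<in>A. (X i x)\<^sup>2) + (\<Sum>i\<in>A. (Y i x)\<^sup>2)" for x
    proof -
      have "2 * l * \<bar>\<Sum>i\<in>A. X i x * Y i x\<bar> \<le> 2 * l * (\<Sum>i\<in>A. \<bar>X i x * Y i x\<bar>)"
        using l by (intro mult_left_mono sum_abs) auto
      also have "\<dots> \<le> (\<Sum>i\<in>A. l\<^sup>2 * (X i x)\<^sup>2 + (Y i x)\<^sup>2)" unfolding sum_distrib_left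
      proof (rule sum_mono)
        fix i
        have "0 \<le> (l * \<bar>X i x\<bar> - \<bar>Y i x\<bar>)\<^sup>2" by simp
        thus "2 * l * \<bar>X i x * Y i x\<bar> \<le> l\<^sup>2 * (X i x)\<^sup>2 + (Y i x)\<^sup>2"
          unfolding power2_diff power_mult_distrib power2_abs abs_mult by linarith
      qed
      also have "\<dots> = l\<^sup>2 * (\<Sum>i\<in>A. (X i x)\<^sup>2) + (\<Sum>i\<in>A. (Y i x)\<^sup>2)" by (simp add: sum.distrib sum_distrib_left)
      finally show ?thesis .
    qed
    have "(\<integral>x. 2 * l * \<bar>\<Sum>i\<in>A. X i x * Y i x\<bar> \<partial>M) \<le> (\<integral>x. l\<^sup>2 * (\<Sum>i\<in>A. (X i x)\<^sup>2) + (\<Sum>i\<in>A. (Y i x)\<^sup>2) \<partial>M)"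
      using int i by (intro integral_mono p) auto
    also have "\<dots> = l\<^sup>2 * a + b" using i by (simp add: a_def b_def Bochner_Integration.integral_sum)
    finally show ?thesis by (simp add: f_def)
  qed
  have "f\<^sup>2 \<le> a * b"
  proof (cases "a = 0")
    case True
    have "f = 0"
    proof (rule ccontr)
      assume "f \<noteq> 0"
      hence "f > 0" using f0 by simp
      have "2 * (b / f + 1) * f = 2 * b + 2 * f" using \<open>f > 0\<close> by (simp add: field_simps)
      thus False using key[of "b / f + 1"] True b0 \<open>f > 0\<close> by simp
    qed
    thus ?thesis using True by simp
  next
    case False
    hence "a > 0" using a0 by simp
    thus ?thesis using key[of "f / a"] f0 by (simp add: field_simps power2_eq_square)
  qed
  hence "f \<le> sqrt (a * b)" using f0 by (simp add: real_le_rsqrt)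
  thus "(\<integral>x. \<bar>\<Sum>i\<in>A. X i x * Y i x\<bar> \<partial>M) \<le> sqrt ((\<Sum>i\<in>A. \<integral>x. (X i x)\<^sup>2 \<partial>M) * (\<Sum>i\<in>A. \<integral>x. (Y i x)\<^sup>2 \<partial>M))"
    by (simp add: f_def a_def b_def)
qed

lemma (in prob_space) expectation_abs_le_sqrt:
  assumes "X \<in> borel_measurable M" "integrable M (\<lambda>x. (X x)\<^sup>2)"
  shows "(\<integral>x. \<bar>X x\<bar> \<partial>M) \<le> sqrt (\<integral>x. (X x)\<^sup>2 \<partial>M)"
  using Cauchy_Schwarz_sum_integral(2)[of "{0::nat}" "\<lambda>_. X" M "\<lambda>_ _. 1"] assms by (simp add: prob_space)

lemma sets_generated_algebra_subset:
  assumes "space G = space M" "\<And>f. f \<in> S \<Longrightarrow> f \<in> borel_measurable G"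
  shows "sets (generated_algebra M S) \<subseteq> sets G"
proof -
  have "sets (vimage_algebra (space M) f borel) \<subseteq> sets G" if "f \<in> S" for f
    using assms(2)[OF that] unfolding sets_vimage_algebra assms(1)[symmetric]
    by (intro sets.sigma_sets_subset) (auto intro: measurable_sets)
  hence "(\<Union>f\<in>S. sets (vimage_algebra (space M) f borel)) \<subseteq> sets G" by blast
  moreover from this have "(\<Union>f\<in>S. sets (vimage_algebra (space M) f borel)) \<subseteq> Pow (space M)"
    using sets.space_closed[of G] assms(1) by auto
  ultimately show ?thesis unfolding generated_algebra_def
    using sets.sigma_sets_subset[of "\<Union>f\<in>S. sets (vimage_algebra (space M) f borel)" G] assms(1)
    by (simp add: sets_measure_of)
qed

lemma space_generated_algebra [simp]: "space (generated_algebra M S) = space M"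
  by (simp add: generated_algebra_def space_measure_of_conv)

lemma measurable_generated_algebra:
  assumes "f \<in> S" shows "f \<in> borel_measurable (generated_algebra M S)"
proof -
  have p: "(\<Union>f\<in>S. sets (vimage_algebra (space M) f borel)) \<subseteq> Pow (space M)"
    using sets.space_closed[of "vimage_algebra (space M) f borel" for f] by (auto simp: subset_iff)
  have "sets (vimage_algebra (space M) f borel) \<subseteq> sets (generated_algebra M S)"
    unfolding generated_algebra_def using p assms by (auto simp: sets_measure_of)
  hence "subalgebra (generated_algebra M S) (vimage_algebra (space M) f borel)"
    by (simp add: subalgebra_def)
  moreover have "f \<in> borel_measurable (vimage_algebra (space M) f borel)" by (rule measurable_vimage_algebra1) simp
  ultimately show ?thesis by (rule measurable_from_subalg)
qed

lemma subalgebra_generated_algebra: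
  assumes "S \<subseteq> borel_measurable M" shows "subalgebra M (generated_algebra M S)"
  unfolding subalgebra_def using assms sets_generated_algebra_subset[of M M S] by auto

lemma borel_measurable_cond_exp_mat: "cond_exp_mat M F f \<in> borel_measurable F"
  unfolding cond_exp_mat_def[abs_def] by (intro borel_measurable_vec_components) simp

lemma cond_exp_mat_outer_sum_symmetric:
  assumes "\<And>x a b. f x $ a $ b = f x $ b $ a"
  shows "transpose (cond_exp_mat M F f x) = cond_exp_mat M F f x"
  by (intro transpose_eqI) (simp add: cond_exp_mat_def assms)

text \<open>
  The conditional expectation is the orthogonal projection in the space of square integrable variables.
\<close>

lemma (in prob_space) cond_exp_square:
  assumes F: "subalgebra M F" and f: "f \<in> borel_measurable M" "integrable M (\<lambda>x. (f x)\<^sup>2)"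
  shows "integrable M f" "integrable M (\<lambda>x. (real_cond_exp M F f x)\<^sup>2)"
    "(\<integral>x. (real_cond_exp M F f x)\<^sup>2 \<partial>M) \<le> (\<integral>x. (f x)\<^sup>2 \<partial>M)"
    "(\<integral>x. (f x - real_cond_exp M F f x)\<^sup>2 \<partial>M) = (\<integral>x. (f x)\<^sup>2 \<partial>M) - (\<integral>x. (real_cond_exp M F f x)\<^sup>2 \<partial>M)"
    "integrable M (\<lambda>x. (f x - real_cond_exp M F f x)\<^sup>2)"
proof -
  interpret F: sigma_finite_subalgebra M F by (rule subalgebra_sigma_finite[OF F])
  let ?e = "real_cond_exp M F f"
  show i: "integrable M f" by (rule square_integrable_imp_integrable[OF f])
  show e: "integrable M (\<lambda>x. (?e x)\<^sup>2)"
    by (rule F.integrable_convex_cond_exp[OF i _ _ f(2) convex_power2]) auto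
  have em: "?e \<in> borel_measurable M" by simp
  have fe: "integrable M (\<lambda>x. ?e x * f x)" by (rule square_integrable_product[OF em f(1) e f(2)])
  have "(\<integral>x. ?e x * f x \<partial>M) = (\<integral>x. ?e x * ?e x \<partial>M)"
    by (rule F.real_cond_exp_intg(2)[OF fe _ f(1), symmetric]) simp
  hence ee: "(\<integral>x. ?e x * f x \<partial>M) = (\<integral>x. (?e x)\<^sup>2 \<partial>M)" by (simp add: power2_eq_square)
  have x: "(f x - ?e x)\<^sup>2 = (f x)\<^sup>2 + (?e x)\<^sup>2 - 2 * (?e x * f x)" for x by (simp add: power2_diff mult_ac)
  show "integrable M (\<lambda>x. (f x - ?e x)\<^sup>2)" unfolding x using f e fe by simp
  show v: "(\<integral>x. (f x - ?e x)\<^sup>2 \<partial>M) = (\<integral>x. (f x)\<^sup>2 \<partial>M) - (\<integral>x. (?e x)\<^sup>2 \<partial>M)"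
    unfolding x using f e fe ee by simp
  have "(\<integral>x. (f x - ?e x)\<^sup>2 \<partial>M) \<ge> 0" by simp
  thus "(\<integral>x. (?e x)\<^sup>2 \<partial>M) \<le> (\<integral>x. (f x)\<^sup>2 \<partial>M)" using v by simp
qed

section \<open>The regression sample\<close>

text \<open>
  The hypotheses of the theorem that concern a single sample size, with a common bound \<open>L\<close> on the
  cluster sizes in place of its asymptotic version.  All bounds derived here are explicit in \<open>n\<close>.
\<close>

locale regression_sample = prob_space +
  fixes n K N L :: nat
    and x :: "nat \<Rightarrow> 'a \<Rightarrow> real ^ 'd" and y u :: "nat \<Rightarrow> 'a \<Rightarrow> real"
    and w :: "nat \<Rightarrow> 'a \<Rightarrow> real Matrix.vec" and \<beta> :: "real ^ 'd" and \<gamma> :: "real Matrix.vec"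
    and Ws :: "('a \<Rightarrow> real) set" and T :: "nat \<Rightarrow> nat set"
  assumes n1: "n \<ge> 1"
    and x_meas: "\<And>i. i \<in> {1..n} \<Longrightarrow> x i \<in> borel_measurable M"
    and u_meas: "\<And>i. i \<in> {1..n} \<Longrightarrow> u i \<in> borel_measurable M"
    and w_dim: "\<And>i \<omega>. i \<in> {1..n} \<Longrightarrow> \<omega> \<in> space M \<Longrightarrow> w i \<omega> \<in> carrier_vec K"
    and w_meas: "\<And>i k. i \<in> {1..n} \<Longrightarrow> k < K \<Longrightarrow> (\<lambda>\<omega>. vec_index (w i \<omega>) k) \<in> borel_measurable M"
    and gamma_dim: "\<gamma> \<in> carrier_vec K"
    and model: "\<And>i \<omega>. i \<in> {1..n} \<Longrightarrow> \<omega> \<in> space M \<Longrightarrow> y i \<omega> = \<beta> \<bullet> x i \<omega> + scalar_prod \<gamma> (w i \<omega>) + u i \<omega>"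
    and x_moment: "\<And>i. i \<in> {1..n} \<Longrightarrow> integrable M (\<lambda>\<omega>. (norm (x i \<omega>))\<^sup>2)"
    and w_moment: "\<And>i k. i \<in> {1..n} \<Longrightarrow> k < K \<Longrightarrow> integrable M (\<lambda>\<omega>. (vec_index (w i \<omega>) k)\<^sup>2)"
    and u_moment: "\<And>i. i \<in> {1..n} \<Longrightarrow> integrable M (\<lambda>\<omega>. (u i \<omega>)\<^sup>2)"
    and Ws_meas: "Ws \<subseteq> borel_measurable M"
    and Ws_w: "\<And>i k. i \<in> {1..n} \<Longrightarrow> k < K \<Longrightarrow>
          AE \<omega> in M. real_cond_exp M (W_algebra M Ws) (\<lambda>\<omega>. vec_index (w i \<omega>) k) \<omega> = vec_index (w i \<omega>) k"
    and sampling_cov: "\<And>i j. i \<in> {1..n} \<Longrightarrow> j \<in> {1..n} \<Longrightarrow> i \<noteq> j \<Longrightarrow>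
          AE \<omega> in M. cond_cov M (XW_algebra M Ws n x) (U_err M Ws n x y i) (U_err M Ws n x y j) \<omega> = 0"
    and T_partition: "partition_on {1..n} (T ` {1..N})" "inj_on T {1..N}"
    and sampling_indep: "cond_indep_sets M (W_algebra M Ws) (\<lambda>i. cluster_events M Ws n x y (T i)) {1..N}"
    and T_card: "\<And>i. i \<in> {1..N} \<Longrightarrow> card (T i) \<le> L"
begin

abbreviation Wa :: "'a measure" where "Wa \<equiv> W_algebra M Ws"
abbreviation Fa :: "'a measure" where "Fa \<equiv> XW_algebra M Ws n x"
abbreviation U :: "nat \<Rightarrow> 'a \<Rightarrow> real" where "U \<equiv> U_err M Ws n x y"
abbreviation V :: "nat \<Rightarrow> 'a \<Rightarrow> real ^ 'd" where "V \<equiv> V_err M Ws x"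
abbreviation R :: "nat \<Rightarrow> 'a \<Rightarrow> real" where "R i \<equiv> real_cond_exp M Fa (u i)"
abbreviation r :: "nat \<Rightarrow> 'a \<Rightarrow> real" where "r i \<equiv> real_cond_exp M Wa (u i)"

text \<open>
  The covariates are known given \<open>W\<close> only up to null sets.  This version of them is measurable with
  respect to the algebra of \<open>W\<close>, which carries no completion, and agrees with \<open>w\<close> almost everywhere.
\<close>

definition w' :: "nat \<Rightarrow> 'a \<Rightarrow> real Matrix.vec" where
  "w' i \<omega> = Matrix.vec K (\<lambda>k. real_cond_exp M Wa (\<lambda>\<omega>. vec_index (w i \<omega>) k) \<omega>)"

text \<open>
  The entries of the annihilator, in the version that is measurable with respect to the algebra of \<open>W\<close>.
\<close>

definition m :: "nat \<Rightarrow> nat \<Rightarrow> 'a \<Rightarrow> real" where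
  "m = annihilator n K w'"

definition v_hat :: "nat \<Rightarrow> 'a \<Rightarrow> real ^ 'd" where
  "v_hat = partial_out n K w' x"

lemma x_component: "i \<in> {1..n} \<Longrightarrow> (\<lambda>\<omega>. x i \<omega> $ a) \<in> borel_measurable M"
  by (intro borel_measurable_vec_nth x_meas)

lemma x_component_square: "i \<in> {1..n} \<Longrightarrow> integrable M (\<lambda>\<omega>. (x i \<omega> $ a)\<^sup>2)"
  by (rule Bochner_Integration.integrable_bound[OF x_moment])
    (use x_component component_le_norm_cart[of "x i _" a] in \<open>auto intro!: AE_I2 simp: abs_le_square_iff[symmetric]\<close>)

lemma subalgebra_Wa: "subalgebra M Wa"
  unfolding W_algebra_def by (rule subalgebra_generated_algebra[OF Ws_meas])

lemma subalgebra_Fa: "subalgebra M Fa"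
  unfolding XW_algebra_def using Ws_meas x_component by (intro subalgebra_generated_algebra) auto

lemma space_Wa [simp]: "space Wa = space M" and space_Fa [simp]: "space Fa = space M"
  by (simp_all add: W_algebra_def XW_algebra_def)

sublocale Wa: sigma_finite_subalgebra M Wa by (rule subalgebra_sigma_finite[OF subalgebra_Wa])
sublocale Fa: sigma_finite_subalgebra M Fa by (rule subalgebra_sigma_finite[OF subalgebra_Fa])

lemma subalgebra_Fa_Wa: "subalgebra Fa Wa"
  unfolding subalgebra_def
proof
  show "sets Wa \<subseteq> sets Fa" unfolding W_algebra_def
    by (rule sets_generated_algebra_subset) (auto simp: XW_algebra_def intro: measurable_generated_algebra)
qed simp

lemma Wa_Fa: "f \<in> borel_measurable Wa \<Longrightarrow> f \<in> borel_measurable Fa"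
  by (rule measurable_from_subalg[OF subalgebra_Fa_Wa])

lemma Fa_M: "f \<in> borel_measurable Fa \<Longrightarrow> f \<in> borel_measurable M"
  by (rule measurable_from_subalg[OF subalgebra_Fa])

lemma Wa_M: "f \<in> borel_measurable Wa \<Longrightarrow> f \<in> borel_measurable M"
  by (rule measurable_from_subalg[OF subalgebra_Wa])

lemma x_Fa: "i \<in> {1..n} \<Longrightarrow> (\<lambda>\<omega>. x i \<omega> $ a) \<in> borel_measurable Fa"
  unfolding XW_algebra_def by (rule measurable_generated_algebra) auto

lemma V_component: "V i \<omega> $ a = x i \<omega> $ a - real_cond_exp M Wa (\<lambda>\<omega>. x i \<omega> $ a) \<omega>"
  by (simp add: V_err_def cond_exp_vec_def)

lemma V_Fa: "i \<in> {1..n} \<Longrightarrow> (\<lambda>\<omega>. V i \<omega> $ a) \<in> borel_measurable Fa"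
  unfolding V_component using x_Fa[of i a] Wa_Fa[of "real_cond_exp M Wa (\<lambda>\<omega>. x i \<omega> $ a)"] by simp

lemma V_M: "i \<in> {1..n} \<Longrightarrow> (\<lambda>\<omega>. V i \<omega> $ a) \<in> borel_measurable M"
  by (rule Fa_M[OF V_Fa])

lemma V_vec_M: "i \<in> {1..n} \<Longrightarrow> V i \<in> borel_measurable M"
  by (intro borel_measurable_vec_components V_M)

lemma V_square: "i \<in> {1..n} \<Longrightarrow> integrable M (\<lambda>\<omega>. (V i \<omega> $ a)\<^sup>2)"
  unfolding V_component by (rule cond_exp_square(5)[OF subalgebra_Wa x_component x_component_square])

lemma V_mean_zero:
  assumes "i \<in> {1..n}" shows "AE \<omega> in M. real_cond_exp M Wa (\<lambda>\<omega>. V i \<omega> $ a) \<omega> = 0"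
proof -
  note i = cond_exp_square(1)[OF subalgebra_Wa x_component x_component_square, OF assms assms, of a]
  have "AE \<omega> in M. real_cond_exp M Wa (\<lambda>\<omega>. V i \<omega> $ a) \<omega> =
    real_cond_exp M Wa (\<lambda>\<omega>. x i \<omega> $ a) \<omega> - real_cond_exp M Wa (real_cond_exp M Wa (\<lambda>\<omega>. x i \<omega> $ a)) \<omega>"
    unfolding V_component by (rule Wa.real_cond_exp_diff[OF i Wa.real_cond_exp_int(1)[OF i]])
  moreover have "AE \<omega> in M. real_cond_exp M Wa (real_cond_exp M Wa (\<lambda>\<omega>. x i \<omega> $ a)) \<omega> = real_cond_exp M Wa (\<lambda>\<omega>. x i \<omega> $ a) \<omega>"
    by (rule Wa.real_cond_exp_F_meas[OF Wa.real_cond_exp_int(1)[OF i]]) simp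
  ultimately show ?thesis by auto
qed

lemma w'_dim: "w' i \<omega> \<in> carrier_vec K"
  by (simp add: w'_def)

lemma w'_Wa: "k < K \<Longrightarrow> (\<lambda>\<omega>. vec_index (w' i \<omega>) k) \<in> borel_measurable Wa"
  by (simp add: w'_def)

lemma AE_w': "AE \<omega> in M. \<forall>i\<in>{1..n}. w i \<omega> = w' i \<omega>"
proof (rule AE_finite_allI)
  fix i assume i: "i \<in> {1..n}"
  have "AE \<omega> in M. \<forall>k\<in>{..<K}. real_cond_exp M Wa (\<lambda>\<omega>. vec_index (w i \<omega>) k) \<omega> = vec_index (w i \<omega>) k"
    by (rule AE_finite_allI) (use Ws_w[OF i] in auto)
  thus "AE \<omega> in M. w i \<omega> = w' i \<omega>"
    using AE_space
  proof eventually_elim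
    case (elim \<omega>)
    thus ?case using w_dim[OF i elim(2)] by (intro eq_vecI) (auto simp: w'_def)
  qed
qed simp

lemma gram_cong: "(\<And>i. i \<in> {1..n} \<Longrightarrow> w i \<omega> = w' i \<omega>) \<Longrightarrow> gram n K w \<omega> = gram n K w' \<omega>"
  unfolding gram_def by (intro arg_cong[of _ _ "Matrix.mat K K"] ext) (auto intro!: sum.cong)

lemma annihilator_cong:
  "(\<And>i. i \<in> {1..n} \<Longrightarrow> w i \<omega> = w' i \<omega>) \<Longrightarrow> i \<in> {1..n} \<Longrightarrow> j \<in> {1..n} \<Longrightarrow> annihilator n K w i j \<omega> = m i j \<omega>"
  using gram_cong[of \<omega>] by (simp add: annihilator_def m_def)

lemma partial_out_cong:
  "(\<And>i. i \<in> {1..n} \<Longrightarrow> w i \<omega> = w' i \<omega>) \<Longrightarrow> i \<in> {1..n} \<Longrightarrow> partial_out n K w z i \<omega> = partial_out n K w' z i \<omega>"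
  using annihilator_cong[of \<omega> i] unfolding partial_out_def m_def by (intro sum.cong) auto

lemma m_Wa: "i \<in> {1..n} \<Longrightarrow> j \<in> {1..n} \<Longrightarrow> m i j \<in> borel_measurable Wa"
  unfolding m_def by (rule borel_measurable_annihilator[OF w'_dim w'_Wa])

lemma det_Wa: "(\<lambda>\<omega>. det (gram n K w' \<omega>)) \<in> borel_measurable Wa"
  by (rule borel_measurable_det_gram[OF w'_dim w'_Wa])

lemma m_sym: "i \<in> {1..n} \<Longrightarrow> j \<in> {1..n} \<Longrightarrow> m i j \<omega> = m j i \<omega>"
  unfolding m_def by (rule annihilator_symmetric[where w = w', OF w'_dim])

lemma m_idem: "i \<in> {1..n} \<Longrightarrow> k \<in> {1..n} \<Longrightarrow> (\<Sum>j=1..n. m i j \<omega> * m j k \<omega>) = m i k \<omega>"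
  unfolding m_def by (rule annihilator_idempotent[where w = w', OF w'_dim])

lemma m_covariates: "det (gram n K w' \<omega>) \<noteq> 0 \<Longrightarrow> i \<in> {1..n} \<Longrightarrow> b \<in> carrier_vec K \<Longrightarrow>
   (\<Sum>j=1..n. m i j \<omega> * scalar_prod b (w' j \<omega>)) = 0"
  unfolding m_def by (rule annihilator_covariates[where w = w', OF w'_dim])

lemma m_inner: "(\<Sum>i=1..n. (\<Sum>j=1..n. m i j \<omega> * a j) * (\<Sum>j=1..n. m i j \<omega> * b j)) = (\<Sum>i=1..n. a i * (\<Sum>j=1..n. m i j \<omega> * b j))"
  by (rule projection_inner[where m = "\<lambda>i j. m i j \<omega>"]) (rule m_sym m_idem; assumption)+

lemma m_contraction: "(\<Sum>i=1..n. (\<Sum>j=1..n. m i j \<omega> * a j)\<^sup>2) \<le> (\<Sum>i=1..n. (a i)\<^sup>2)"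
  by (rule projection_contraction[where m = "\<lambda>i j. m i j \<omega>"]) (rule m_sym m_idem; assumption)+

lemma m_entry: "i \<in> {1..n} \<Longrightarrow> j \<in> {1..n} \<Longrightarrow> \<bar>m i j \<omega>\<bar> \<le> 1"
  by (rule projection_entry[where m = "\<lambda>i j. m i j \<omega>" and n = n]) (rule m_sym m_idem | assumption)+

lemma m_square_sum: "(\<Sum>i=1..n. \<Sum>j=1..n. (m i j \<omega>)\<^sup>2) \<le> real n"
  by (rule projection_square_sum[where m = "\<lambda>i j. m i j \<omega>"]) (rule m_sym m_idem; assumption)+

lemma v_hat_component: "v_hat i \<omega> $ a = (\<Sum>j=1..n. m i j \<omega> * x j \<omega> $ a)"
  by (simp add: v_hat_def partial_out_def m_def)

lemma v_hat_Fa: "i \<in> {1..n} \<Longrightarrow> v_hat i \<in> borel_measurable Fa"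
  by (intro borel_measurable_vec_components, unfold v_hat_component)
    (intro borel_measurable_sum borel_measurable_times Wa_Fa[OF m_Wa] x_Fa)

lemma y_M: "i \<in> {1..n} \<Longrightarrow> y i \<in> borel_measurable M"
proof -
  assume i: "i \<in> {1..n}"
  have "(\<lambda>\<omega>. \<beta> \<bullet> x i \<omega> + (\<Sum>k\<in>{0..<K}. vec_index \<gamma> k * vec_index (w i \<omega>) k) + u i \<omega>) \<in> borel_measurable M"
    using w_meas[OF i]
    by (intro borel_measurable_add borel_measurable_sum borel_measurable_times borel_measurable_const
        borel_measurable_inner x_meas u_meas i) auto
  thus ?thesis
  proof (subst measurable_cong[of M _ "\<lambda>\<omega>. \<beta> \<bullet> x i \<omega> + (\<Sum>k\<in>{0..<K}. vec_index \<gamma> k * vec_index (w i \<omega>) k) + u i \<omega>"])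
    fix \<omega> assume sp: "\<omega> \<in> space M"
    have "dim_vec (w i \<omega>) = K" using w_dim[OF i sp] by simp
    thus "y i \<omega> = \<beta> \<bullet> x i \<omega> + (\<Sum>k\<in>{0..<K}. vec_index \<gamma> k * vec_index (w i \<omega>) k) + u i \<omega>"
      using model[OF i sp] by (simp add: scalar_prod_def)
  qed
qed

text \<open>
  The regression function \<open>\<beta> \<bullet> x + \<gamma> w\<close> is known given \<open>X\<close> and \<open>W\<close>, so passing from \<open>y\<close> to its error \<open>U\<close> is the same
  as centring \<open>u\<close>.
\<close>

lemma U_regression_error:
  assumes i: "i \<in> {1..n}"
  shows "U i \<in> borel_measurable M" "integrable M (\<lambda>\<omega>. (U i \<omega>)\<^sup>2)"
    "AE \<omega> in M. u i \<omega> = U i \<omega> + R i \<omega>" "AE \<omega> in M. real_cond_exp M Fa (U i) \<omega> = 0"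
proof -
  have wx: "(\<lambda>\<omega>. scalar_prod \<gamma> (w i \<omega>)) \<in> borel_measurable M \<and> integrable M (\<lambda>\<omega>. (scalar_prod \<gamma> (w i \<omega>))\<^sup>2)"
  proof -
    have e: "scalar_prod \<gamma> (w i \<omega>) = (\<Sum>k<K. vec_index \<gamma> k * vec_index (w i \<omega>) k)" if "\<omega> \<in> space M" for \<omega>
      using w_dim[OF i that] by (simp add: scalar_prod_def atLeast0LessThan)
    have "(\<lambda>\<omega>. \<Sum>k<K. vec_index \<gamma> k * vec_index (w i \<omega>) k) \<in> borel_measurable M"
      using w_meas[OF i] by (intro borel_measurable_sum borel_measurable_times) auto
    moreover have "integrable M (\<lambda>\<omega>. (\<Sum>k<K. vec_index \<gamma> k * vec_index (w i \<omega>) k)\<^sup>2)"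
      using w_meas[OF i] w_moment[OF i] by (intro square_integrable_sum) (auto simp: power_mult_distrib)
    ultimately show ?thesis using e by (auto simp: cong: measurable_cong Bochner_Integration.integrable_cong)
  qed
  have xb: "(\<lambda>\<omega>. \<beta> \<bullet> x i \<omega>) \<in> borel_measurable Fa \<and> integrable M (\<lambda>\<omega>. (\<beta> \<bullet> x i \<omega>)\<^sup>2)"
  proof
    show "(\<lambda>\<omega>. \<beta> \<bullet> x i \<omega>) \<in> borel_measurable Fa" unfolding inner_vec_def using x_Fa[OF i]
      by (intro borel_measurable_sum) auto
    show "integrable M (\<lambda>\<omega>. (\<beta> \<bullet> x i \<omega>)\<^sup>2)" unfolding inner_vec_def
      using x_component[OF i] x_component_square[OF i] by (intro square_integrable_sum) (auto simp: power_mult_distrib)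
  qed
  define z where "z \<omega> = \<beta> \<bullet> x i \<omega> + scalar_prod \<gamma> (w i \<omega>)" for \<omega>
  \<comment> \<open>The regression function in terms of \<open>w'\<close>, hence exactly measurable.\<close>
  define z' where "z' \<omega> = \<beta> \<bullet> x i \<omega> + (\<Sum>k<K. vec_index \<gamma> k * vec_index (w' i \<omega>) k)" for \<omega>
  have z'F: "z' \<in> borel_measurable Fa" unfolding z'_def[abs_def] using xb Wa_Fa[OF w'_Wa]
    by (intro borel_measurable_add borel_measurable_sum borel_measurable_times) auto
  have zz': "AE \<omega> in M. z \<omega> = z' \<omega>"
    using AE_w'
  proof eventually_elim
    case (elim \<omega>)
    hence "scalar_prod \<gamma> (w i \<omega>) = (\<Sum>k<K. vec_index \<gamma> k * vec_index (w' i \<omega>) k)"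
      using i w'_dim[of i \<omega>] by (simp add: scalar_prod_def atLeast0LessThan)
    thus ?case by (simp add: z_def z'_def)
  qed
  have xM: "(\<lambda>\<omega>. \<beta> \<bullet> x i \<omega>) \<in> borel_measurable M" using xb Fa_M by blast
  have zM: "z \<in> borel_measurable M" unfolding z_def[abs_def] using xM wx by auto
  have sq2: "integrable M (\<lambda>\<omega>. (f \<omega> + g \<omega>)\<^sup>2)"
    if "f \<in> borel_measurable M" "g \<in> borel_measurable M" "integrable M (\<lambda>\<omega>. (f \<omega>)\<^sup>2)" "integrable M (\<lambda>\<omega>. (g \<omega>)\<^sup>2)" for f g :: "'a \<Rightarrow> real"
    using square_integrable_product[OF that(1,2,3,4)] that by (simp add: power2_sum mult.assoc)
  have z2: "integrable M (\<lambda>\<omega>. (z \<omega>)\<^sup>2)" unfolding z_def by (rule sq2) (use xM wx xb in auto)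
  have zi: "integrable M z" by (rule square_integrable_imp_integrable[OF zM z2])
  have ui: "integrable M (u i)" by (rule square_integrable_imp_integrable[OF u_meas[OF i] u_moment[OF i]])
  have yz: "y i \<omega> = z \<omega> + u i \<omega>" if "\<omega> \<in> space M" for \<omega> using model[OF i that] by (simp add: z_def)
  note yM = y_M[OF i]
  have y2: "integrable M (\<lambda>\<omega>. (y i \<omega>)\<^sup>2)"
    using sq2[OF zM u_meas[OF i] z2 u_moment[OF i]] by (simp add: yz cong: Bochner_Integration.integrable_cong)
  note c = cond_exp_square[OF subalgebra_Fa yM y2]
  show "U i \<in> borel_measurable M" unfolding U_err_def[abs_def] using yM by simp
  show "integrable M (\<lambda>\<omega>. (U i \<omega>)\<^sup>2)" unfolding U_err_def by (rule c(5))
  have z'i: "integrable M z'" using integrable_cong_AE[OF zM Fa_M[OF z'F] zz'] zi by simp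
  have "AE \<omega> in M. real_cond_exp M Fa (y i) \<omega> = real_cond_exp M Fa (\<lambda>\<omega>. z' \<omega> + u i \<omega>) \<omega>"
  proof (rule Fa.real_cond_exp_cong)
    show "AE \<omega> in M. y i \<omega> = z' \<omega> + u i \<omega>" using zz' AE_space by eventually_elim (simp add: yz)
  qed (use yM Fa_M[OF z'F] u_meas[OF i] in auto)
  moreover have "AE \<omega> in M. real_cond_exp M Fa (\<lambda>\<omega>. z' \<omega> + u i \<omega>) \<omega> = real_cond_exp M Fa z' \<omega> + R i \<omega>"
    by (rule Fa.real_cond_exp_add[OF z'i ui])
  moreover have "AE \<omega> in M. real_cond_exp M Fa z' \<omega> = z' \<omega>" by (rule Fa.real_cond_exp_F_meas[OF z'i z'F])
  ultimately show "AE \<omega> in M. u i \<omega> = U i \<omega> + R i \<omega>"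
    using zz' AE_space by eventually_elim (simp add: U_err_def yz)
  have "AE \<omega> in M. real_cond_exp M Fa (U i) \<omega> = real_cond_exp M Fa (y i) \<omega> - real_cond_exp M Fa (real_cond_exp M Fa (y i)) \<omega>"
    unfolding U_err_def[abs_def] by (rule Fa.real_cond_exp_diff[OF c(1) Fa.real_cond_exp_int(1)[OF c(1)]])
  moreover have "AE \<omega> in M. real_cond_exp M Fa (real_cond_exp M Fa (y i)) \<omega> = real_cond_exp M Fa (y i) \<omega>"
    by (rule Fa.real_cond_exp_F_meas[OF Fa.real_cond_exp_int(1)[OF c(1)]]) simp
  ultimately show "AE \<omega> in M. real_cond_exp M Fa (U i) \<omega> = 0" by auto
qed

lemma U_uncorrelated:
  assumes ij: "i \<in> {1..n}" "j \<in> {1..n}" "i \<noteq> j"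
  shows "AE \<omega> in M. real_cond_exp M Fa (\<lambda>\<omega>. U i \<omega> * U j \<omega>) \<omega> = 0"
proof -
  note ui = U_regression_error[OF ij(1)] and uj = U_regression_error[OF ij(2)]
  have "AE \<omega> in M. real_cond_exp M Fa (\<lambda>\<omega>. (U i \<omega> - real_cond_exp M Fa (U i) \<omega>) * (U j \<omega> - real_cond_exp M Fa (U j) \<omega>)) \<omega>
     = real_cond_exp M Fa (\<lambda>\<omega>. U i \<omega> * U j \<omega>) \<omega>"
    by (rule Fa.real_cond_exp_cong) (use ui uj in auto)
  thus ?thesis using sampling_cov[OF ij] unfolding cond_cov_def by eventually_elim simp
qed

definition Cl :: "nat \<Rightarrow> 'a measure" where
  "Cl k = generated_algebra M ({U t | t. t \<in> T k} \<union> {\<lambda>\<omega>. V t \<omega> $ a | t a. t \<in> T k})"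

text \<open>
  The regressor part of the data of cluster \<open>k\<close>.
\<close>

definition VA :: "nat \<Rightarrow> 'a measure" where
  "VA k = generated_algebra M {\<lambda>\<omega>. V t \<omega> $ a | t a. t \<in> T k}"

lemma T_range: "k \<in> {1..N} \<Longrightarrow> t \<in> T k \<Longrightarrow> t \<in> {1..n}"
  using T_partition(1) by (auto simp: partition_on_def)

lemma subalgebra_Cl: "k \<in> {1..N} \<Longrightarrow> subalgebra M (Cl k)"
  unfolding Cl_def using U_regression_error(1) V_M T_range by (intro subalgebra_generated_algebra) blast

sublocale CN: clustered_noise M Wa "{1..N}" Cl T n L
proof unfold_locales
  show "subalgebra M Wa" by (rule subalgebra_Wa)
  show "finite {1..N}" by simp
  show "subalgebra M (Cl j)" if "j \<in> {1..N}" for j by (rule subalgebra_Cl[OF that])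
  show "cond_indep_sets M Wa (\<lambda>j. sets (Cl j)) {1..N}"
    using sampling_indep unfolding cluster_events_def Cl_def .
  show "(\<Union>k\<in>{1..N}. T k) = {1..n}" using T_partition(1) by (simp add: partition_on_def)
  show "T k \<inter> T l = {}" if "k \<in> {1..N}" "l \<in> {1..N}" "k \<noteq> l" for k l
    using T_partition that unfolding partition_on_def disjoint_def by (metis imageI inj_onD)
  show "card (T k) \<le> L" if "k \<in> {1..N}" for k using T_card[OF that] .
qed

lemma U_Cl: "t \<in> T k \<Longrightarrow> U t \<in> borel_measurable (Cl k)"
  unfolding Cl_def by (rule measurable_generated_algebra) blast

lemma V_Cl: "t \<in> T k \<Longrightarrow> (\<lambda>\<omega>. V t \<omega> $ a) \<in> borel_measurable (Cl k)"
  unfolding Cl_def by (rule measurable_generated_algebra) blast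

text \<open>
  What is known about cluster \<open>k\<close> given \<open>X\<close> and \<open>W\<close>: the covariates and the regressors of that cluster.
\<close>

definition S :: "nat \<Rightarrow> 'a measure" where
  "S k = sigma (space M) (meets (sets Wa) (sets (VA k)))"

text \<open>
  The algebra of \<open>X\<close> and \<open>W\<close> lies between \<open>S k\<close> and \<open>S k\<close> joined with the other clusters, as \<open>x\<close> is
  recovered from \<open>V\<close> and the conditional mean given \<open>W\<close>.  This places it in the scope of \<open>cond_exp_between\<close>.
\<close>

lemma S_between:
  assumes k: "k \<in> {1..N}"
  shows "subalgebra M (S k)" "sets Wa \<subseteq> sets (S k)" "sets (S k) \<subseteq> sets (CN.inside k)" "sets (S k) \<subseteq> sets Fa"
    "sets Fa \<subseteq> sets (CN.with_outside (S k) k)"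
proof -
  have VM: "sets (VA k) \<subseteq> sets M" unfolding VA_def
    by (rule sets_generated_algebra_subset) (use V_M T_range[OF k] in auto)
  have spV: "space (VA k) = space M" by (simp add: VA_def)
  show S: "subalgebra M (S k)" unfolding S_def by (intro subalgebra_sigma_meets CN.sets_W VM)
  have pw: "sets Wa \<subseteq> Pow (space M)" "sets (VA k) \<subseteq> Pow (space M)" "space M \<in> sets Wa" "space M \<in> sets (VA k)"
    using sets.space_closed[of Wa] sets.space_closed[of "VA k"] sets.top[of Wa] sets.top[of "VA k"] spV by auto
  note sup = sets_sigma_meets_superset[OF pw, folded S_def]
  show "sets Wa \<subseteq> sets (S k)" by (rule sup)
  have least: "sets (S k) \<subseteq> sets G" if "sets Wa \<subseteq> sets G" "sets (VA k) \<subseteq> sets G" "space G = space M" for G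
  proof -
    have mm: "meets (sets Wa) (sets (VA k)) \<subseteq> sets G" by (rule meets_sets[OF that(1,2)])
    thus ?thesis unfolding S_def using sets.sigma_sets_subset[OF mm] sets.space_closed[of G] that(3)
      by (subst sets_measure_of) auto
  qed
  have "sets (VA k) \<subseteq> sets (Cl k)" unfolding VA_def
    by (rule sets_generated_algebra_subset) (auto simp: Cl_def intro: measurable_generated_algebra V_Cl[unfolded Cl_def])
  thus "sets (S k) \<subseteq> sets (CN.inside k)"
    using CN.sets_inside_superset[OF k] by (intro least) auto
  show "sets (S k) \<subseteq> sets Fa"
  proof (rule least)
    show "sets Wa \<subseteq> sets Fa" using subalgebra_Fa_Wa by (simp add: subalgebra_def)
    show "sets (VA k) \<subseteq> sets Fa" unfolding VA_def
      by (rule sets_generated_algebra_subset) (use V_Fa T_range[OF k] in auto)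
  qed simp
  have WS: "f \<in> borel_measurable (CN.with_outside (S k) k)" if "f \<in> borel_measurable Wa" for f :: "'a \<Rightarrow> real"
  proof -
    have "subalgebra (S k) Wa" using S sup by (simp add: subalgebra_def)
    thus ?thesis by (rule CN.measurable_with_outside(1)[OF S measurable_from_subalg[OF _ that]])
  qed
  have VS: "(\<lambda>\<omega>. V t \<omega> $ a) \<in> borel_measurable (CN.with_outside (S k) k)" if t: "t \<in> {1..n}" for t a
  proof -
    obtain l where l: "l \<in> {1..N}" "t \<in> T l" using CN.cluster_of_mem[OF t] by blast
    show ?thesis
    proof (cases "l = k")
      case True
      have v: "(\<lambda>\<omega>. V t \<omega> $ a) \<in> borel_measurable (VA k)" unfolding VA_def
        by (rule measurable_generated_algebra) (use l True in blast)
      have "subalgebra (S k) (VA k)" using S sup spV by (simp add: subalgebra_def)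
      thus ?thesis by (rule CN.measurable_with_outside(1)[OF S measurable_from_subalg[OF _ v]])
    next
      case False
      show ?thesis by (rule CN.measurable_with_outside(2)[OF S l(1) False V_Cl[OF l(2)]])
    qed
  qed
  show "sets Fa \<subseteq> sets (CN.with_outside (S k) k)" unfolding XW_algebra_def
  proof (rule sets_generated_algebra_subset)
    fix f assume "f \<in> {\<lambda>\<omega>. x i \<omega> $ a | i a. i \<in> {1..n}} \<union> Ws"
    thus "f \<in> borel_measurable (CN.with_outside (S k) k)"
    proof
      assume "f \<in> {\<lambda>\<omega>. x i \<omega> $ a | i a. i \<in> {1..n}}"
      then obtain i a where f: "f = (\<lambda>\<omega>. x i \<omega> $ a)" and i: "i \<in> {1..n}" by blast
      have "f = (\<lambda>\<omega>. V i \<omega> $ a + real_cond_exp M Wa (\<lambda>\<omega>. x i \<omega> $ a) \<omega>)" by (simp add: f V_component)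
      thus ?thesis using VS[OF i, of a] WS[of "real_cond_exp M Wa (\<lambda>\<omega>. x i \<omega> $ a)"] by simp
    next
      assume "f \<in> Ws"
      thus ?thesis by (intro WS) (simp add: W_algebra_def measurable_generated_algebra)
    qed
  qed (rule CN.space_with_outside)
qed

text \<open>
  Moments of the errors in cluster \<open>k\<close> against factors known from \<open>S k\<close> and from the data of the other
  clusters, their errors included, may be computed given \<open>X\<close> and \<open>W\<close> alone.
\<close>

lemma integral_within_cluster:
  assumes k: "k \<in> {1..N}" and Y: "integrable M Y" "Y \<in> borel_measurable (CN.inside k)"
    and P: "P \<in> borel_measurable (CN.with_outside (S k) k)" "integrable M (\<lambda>x. P x * Y x)"
  shows "(\<integral>x. P x * Y x \<partial>M) = (\<integral>x. P x * real_cond_exp M Fa Y x \<partial>M)"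
proof -
  note s = S_between[OF k]
  have PM: "P \<in> borel_measurable M" by (rule measurable_from_subalg[OF CN.subalgebra_with_outside[OF s(1)] P(1)])
  have Sm: "real_cond_exp M (S k) Y \<in> borel_measurable M"
    by (rule measurable_from_subalg[OF s(1)]) simp
  have "(\<integral>x. P x * Y x \<partial>M) = (\<integral>x. P x * real_cond_exp M (S k) Y x \<partial>M)"
    by (rule CN.integral_mult_outside[OF k s(1-3) Y P])
  also have "\<dots> = (\<integral>x. P x * real_cond_exp M Fa Y x \<partial>M)"
    by (rule integral_cong_AE)
      (use CN.cond_exp_between[OF k s(1-3) subalgebra_Fa s(4,5) Y] PM Sm in auto)
  finally show ?thesis .
qed

end

section \<open>Concentration of the design matrix and the remainder\<close>

context regression_sample
begin

abbreviation Gt :: "'a \<Rightarrow> real ^ 'd ^ 'd" where "Gt \<equiv> Gamma_tilde M Ws n K w' x"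

text \<open>
  The error of approximating \<open>E[x i | W]\<close> by the population projection on the covariates.
\<close>

definition Q :: "nat \<Rightarrow> 'a \<Rightarrow> real ^ 'd" where
  "Q i = cond_exp_vec M Wa (pop_resid M n K w x i)"

abbreviation "chi \<equiv> chi_W M Ws n K w x"
abbreviation "rhoX \<equiv> rho_XW M Ws n x u"
abbreviation "rhoW \<equiv> rho_W M Ws n u"

text \<open>
  The part of the good event that is known given \<open>W\<close>.  Multiplying by its indicator turns conditional
  moment bounds that hold with high probability into bounds that hold almost everywhere, at no cost
  for conditional means given \<open>W\<close>.
\<close>

definition W_regular :: "real \<Rightarrow> 'a set" where
  "W_regular B = {\<omega> \<in> space M. det (gram n K w' \<omega>) \<noteq> 0 \<and>
     (\<forall>i\<in>{1..n}. nn_cond_exp M Wa (\<lambda>\<omega>. ennreal (norm (V i \<omega>) ^ 4)) \<omega> \<le> ennreal B) \<and>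
     1 / B \<le> lambda_min (cond_exp_mat M Wa Gt \<omega>)}"

lemma n_pos: "real n > 0" using n1 by simp

text \<open>
  Idempotence removes one of the two annihilators, which leaves a quadratic form in \<open>V\<close> with projection
  weights.
\<close>

lemma Gt_component: "Gt \<omega> $ a $ b = (\<Sum>t=1..n. \<Sum>s=1..n. m t s \<omega> * (V t \<omega> $ a * V s \<omega> $ b)) / real n"
proof -
  have "Gt \<omega> $ a $ b = (\<Sum>i=1..n. (\<Sum>j=1..n. m i j \<omega> * V j \<omega> $ a) * (\<Sum>j=1..n. m i j \<omega> * V j \<omega> $ b)) / real n"
    by (simp add: Gamma_tilde_def outer_def partial_out_def m_def sum_component)
  also have "(\<Sum>i=1..n. (\<Sum>j=1..n. m i j \<omega> * V j \<omega> $ a) * (\<Sum>j=1..n. m i j \<omega> * V j \<omega> $ b))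
      = (\<Sum>i=1..n. V i \<omega> $ a * (\<Sum>j=1..n. m i j \<omega> * V j \<omega> $ b))" by (rule m_inner)
  finally show ?thesis by (simp add: sum_distrib_left mult_ac)
qed

lemma Gt_symmetric: "Gt \<omega> $ a $ b = Gt \<omega> $ b $ a"
  by (simp add: Gamma_tilde_def outer_def sum_component mult.commute)

lemma Gt_M: "(\<lambda>\<omega>. Gt \<omega> $ a $ b) \<in> borel_measurable M"
  unfolding Gt_component
  by (intro borel_measurable_divide borel_measurable_sum borel_measurable_times borel_measurable_const Wa_M[OF m_Wa] V_M)

lemma W_regular_Wa: "W_regular B \<in> sets Wa"
proof -
  have lm: "(\<lambda>\<omega>. lambda_min (cond_exp_mat M Wa Gt \<omega>)) \<in> borel_measurable Wa"
    by (rule borel_measurable_lambda_min_symmetric[OF borel_measurable_cond_exp_mat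
      cond_exp_mat_outer_sum_symmetric[OF Gt_symmetric]])
  have "{\<omega> \<in> space Wa. det (gram n K w' \<omega>) \<noteq> 0 \<and>
     (\<forall>i\<in>{1..n}. nn_cond_exp M Wa (\<lambda>\<omega>. ennreal (norm (V i \<omega>) ^ 4)) \<omega> \<le> ennreal B) \<and>
     1 / B \<le> lambda_min (cond_exp_mat M Wa Gt \<omega>)} \<in> sets Wa"
  proof (intro sets.sets_Collect_conj sets.sets_Collect_finite_All')
    show "{\<omega> \<in> space Wa. det (gram n K w' \<omega>) \<noteq> 0} \<in> sets Wa"
      using det_Wa by (rule borel_measurable_neq) simp
    show "{\<omega> \<in> space Wa. 1 / B \<le> lambda_min (cond_exp_mat M Wa Gt \<omega>)} \<in> sets Wa"
      using lm by (intro borel_measurable_le) auto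
    show "{\<omega> \<in> space Wa. nn_cond_exp M Wa (\<lambda>\<omega>. ennreal (norm (V i \<omega>) ^ 4)) \<omega> \<le> ennreal B} \<in> sets Wa" for i
      by (intro borel_measurable_le) auto
  qed (use n1 in auto)
  thus ?thesis by (simp add: W_regular_def)
qed

lemma W_regular_M: "W_regular B \<in> sets M"
  using W_regular_Wa CN.sets_W by blast

text \<open>
  Regressor noise, switched off outside the regular event.
\<close>

definition q :: "real \<Rightarrow> 'd \<Rightarrow> nat \<Rightarrow> 'a \<Rightarrow> real" where
  "q B a t \<omega> = indicator (W_regular B) \<omega> * V t \<omega> $ a"

lemma noise_q:
  assumes B: "B > 0" shows "CN.noise B (q B a)"
  unfolding CN.noise_def
proof (intro conjI ballI)
  show "B \<ge> 0" using B by simp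
  fix k t assume k: "k \<in> {1..N}" "t \<in> T k"
  have t: "t \<in> {1..n}" by (rule T_range[OF k])
  have iW: "(indicator (W_regular B) :: 'a \<Rightarrow> real) \<in> borel_measurable Wa" using W_regular_Wa by simp
  have eq: "q B a t = (\<lambda>\<omega>. indicator (W_regular B) \<omega> * V t \<omega> $ a)" by (simp add: q_def[abs_def])
  show "q B a t \<in> borel_measurable (CN.inside k)"
    unfolding eq by (intro borel_measurable_times CN.measurable_W_inside[OF k(1) iW] CN.measurable_Cl_inside[OF k(1) V_Cl[OF k(2)]])
  have Vi: "integrable M (\<lambda>\<omega>. V t \<omega> $ a)" by (rule square_integrable_imp_integrable[OF V_M[OF t] V_square[OF t]])
  have qi: "integrable M (\<lambda>\<omega>. indicator (W_regular B) \<omega> * V t \<omega> $ a)" using integrable_mult_indicator[OF W_regular_M Vi] by simp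
  have "AE \<omega> in M. real_cond_exp M Wa (q B a t) \<omega> = indicator (W_regular B) \<omega> * real_cond_exp M Wa (\<lambda>\<omega>. V t \<omega> $ a) \<omega>"
    unfolding eq by (rule Wa.real_cond_exp_mult[OF iW V_M[OF t] qi])
  thus "AE \<omega> in M. real_cond_exp M Wa (q B a t) \<omega> = 0" using V_mean_zero[OF t, of a] by eventually_elim simp
  have iE: "(\<lambda>\<omega>. indicator (W_regular B) \<omega> :: ennreal) \<in> borel_measurable Wa" using W_regular_Wa by simp
  have nV: "(\<lambda>\<omega>. ennreal (norm (V t \<omega>) ^ 4)) \<in> borel_measurable M" using V_vec_M[OF t] by measurable
  have qM: "q B a t \<in> borel_measurable M" unfolding eq using W_regular_M V_M[OF t] by measurable
  have "AE \<omega> in M. nn_cond_exp M Wa (\<lambda>\<omega>. ennreal (q B a t \<omega> ^ 4)) \<omega>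
      \<le> nn_cond_exp M Wa (\<lambda>\<omega>. indicator (W_regular B) \<omega> * ennreal (norm (V t \<omega>) ^ 4)) \<omega>"
  proof (rule Wa.nn_cond_exp_mono)
    show "AE \<omega> in M. ennreal (q B a t \<omega> ^ 4) \<le> indicator (W_regular B) \<omega> * ennreal (norm (V t \<omega>) ^ 4)"
    proof (rule AE_I2)
      fix \<omega>
      have "(V t \<omega> $ a) ^ 4 = \<bar>V t \<omega> $ a\<bar> ^ 4" by (simp add: power_even_abs)
      also have "\<dots> \<le> norm (V t \<omega>) ^ 4" by (intro power_mono component_le_norm_cart) auto
      finally show "ennreal (q B a t \<omega> ^ 4) \<le> indicator (W_regular B) \<omega> * ennreal (norm (V t \<omega>) ^ 4)"
        by (auto simp: q_def indicator_def intro: ennreal_leI)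
    qed
    show "(\<lambda>\<omega>. ennreal (q B a t \<omega> ^ 4)) \<in> borel_measurable M" using qM by measurable
    show "(\<lambda>\<omega>. indicator (W_regular B) \<omega> * ennreal (norm (V t \<omega>) ^ 4)) \<in> borel_measurable M" using nV W_regular_M by measurable
  qed
  moreover have "AE \<omega> in M. indicator (W_regular B) \<omega> * nn_cond_exp M Wa (\<lambda>\<omega>. ennreal (norm (V t \<omega>) ^ 4)) \<omega>
     = nn_cond_exp M Wa (\<lambda>\<omega>. indicator (W_regular B) \<omega> * ennreal (norm (V t \<omega>) ^ 4)) \<omega>"
    by (rule Wa.nn_cond_exp_prod[OF iE nV])
  ultimately show "AE \<omega> in M. nn_cond_exp M Wa (\<lambda>\<omega>. ennreal (q B a t \<omega> ^ 4)) \<omega> \<le> ennreal B"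
  proof eventually_elim
    case (elim \<omega>)
    have "indicator (W_regular B) \<omega> * nn_cond_exp M Wa (\<lambda>\<omega>. ennreal (norm (V t \<omega>) ^ 4)) \<omega> \<le> ennreal B"
      using t by (cases "\<omega> \<in> W_regular B") (auto simp: W_regular_def)
    thus ?case using elim by simp
  qed
qed

lemma q_mean_square:
  assumes B: "B > 0" and t: "t \<in> {1..n}"
  shows "q B a t \<in> borel_measurable M" "integrable M (\<lambda>\<omega>. (q B a t \<omega>)\<^sup>2)" "(\<integral>\<omega>. (q B a t \<omega>)\<^sup>2 \<partial>M) \<le> 1 + B"
proof -
  obtain k where k: "k \<in> {1..N}" "t \<in> T k" using CN.cluster_of_mem[OF t] by blast
  note nq = noise_q[OF B, of a]
  show "q B a t \<in> borel_measurable M" by (rule CN.noiseD(2)[OF nq k])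
  show "integrable M (\<lambda>\<omega>. (q B a t \<omega>)\<^sup>2)" by (rule CN.noiseD(5)[OF nq k])
  show "(\<integral>\<omega>. (q B a t \<omega>)\<^sup>2 \<partial>M) \<le> 1 + B"
    using CN.noise_scaled_square(2)[OF nq k, of "\<lambda>_. 1"] by (simp add: prob_space)
qed

lemma m_mean_square_sum: "(\<Sum>t=1..n. \<Sum>s=1..n. \<integral>\<omega>. (m t s \<omega>)\<^sup>2 \<partial>M) \<le> real n"
proof -
  have i: "integrable M (\<lambda>\<omega>. (m t s \<omega>)\<^sup>2)" if "t \<in> {1..n}" "s \<in> {1..n}" for t s
    by (rule integrable_const_bound[where B = 1])
      (use m_entry that Wa_M[OF m_Wa[OF that]] in \<open>auto intro!: AE_I2 simp: abs_square_le_1\<close>)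
  have "(\<Sum>t=1..n. \<Sum>s=1..n. \<integral>\<omega>. (m t s \<omega>)\<^sup>2 \<partial>M) = (\<integral>\<omega>. (\<Sum>t=1..n. \<Sum>s=1..n. (m t s \<omega>)\<^sup>2) \<partial>M)"
    by (simp only: Bochner_Integration.integral_sum[OF Bochner_Integration.integrable_sum[OF i]]
        Bochner_Integration.integral_sum[OF i] cong: sum.cong)
  also have "\<dots> \<le> (\<integral>\<omega>. real n \<partial>M)"
    using i by (intro integral_mono m_square_sum Bochner_Integration.integrable_sum) auto
  finally show ?thesis by (simp add: prob_space)
qed

text \<open>
  Multiplication by an event known given \<open>W\<close> commutes with the conditional expectation, so the claim
  is \<open>quadratic_form_concentration\<close> for the noise \<open>q\<close>.
\<close>

lemma Gt_concentration:
  fixes a b :: 'd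
  assumes B: "B > 0"
  defines "D \<equiv> \<lambda>\<omega>. indicator (W_regular B) \<omega> * (Gt \<omega> $ a $ b - cond_exp_mat M Wa Gt \<omega> $ a $ b)"
  shows "integrable M (\<lambda>\<omega>. (D \<omega>)\<^sup>2)" "(\<integral>\<omega>. (D \<omega>)\<^sup>2 \<partial>M) \<le> 30 * (real L * (1 + B))\<^sup>2 / real n"
proof -
  define Z where "Z \<omega> = (\<Sum>t=1..n. \<Sum>s=1..n. m t s \<omega> * (q B a t \<omega> * q B b s \<omega>))" for \<omega>
  note qc = CN.quadratic_form_concentration[where m = m, OF noise_q[OF B, of a] noise_q[OF B, of b] m_Wa m_entry m_mean_square_sum, folded Z_def]
  have Zi: "integrable M Z" "integrable M (\<lambda>\<omega>. (Z \<omega> - real_cond_exp M Wa Z \<omega>)\<^sup>2)"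
    "(\<integral>\<omega>. (Z \<omega> - real_cond_exp M Wa Z \<omega>)\<^sup>2 \<partial>M) \<le> 30 * (real L * (1 + B))\<^sup>2 * real n"
    by (rule qc; assumption)+
  have ZG: "Z = (\<lambda>\<omega>. (real n * indicator (W_regular B) \<omega>) * Gt \<omega> $ a $ b)"
  proof
    fix \<omega>
    show "Z \<omega> = (real n * indicator (W_regular B) \<omega>) * Gt \<omega> $ a $ b"
      using n_pos by (cases "\<omega> \<in> W_regular B") (auto simp: Z_def q_def Gt_component)
  qed
  have iW: "(\<lambda>\<omega>. real n * indicator (W_regular B) \<omega>) \<in> borel_measurable Wa" using W_regular_Wa by simp
  have "AE \<omega> in M. real_cond_exp M Wa Z \<omega> = (real n * indicator (W_regular B) \<omega>) * real_cond_exp M Wa (\<lambda>\<omega>. Gt \<omega> $ a $ b) \<omega>"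
    unfolding ZG by (rule Wa.real_cond_exp_mult[OF iW Gt_M Zi(1)[unfolded ZG]])
  hence ae: "AE \<omega> in M. (D \<omega>)\<^sup>2 = (Z \<omega> - real_cond_exp M Wa Z \<omega>)\<^sup>2 / (real n)\<^sup>2"
  proof eventually_elim
    case (elim \<omega>)
    have "Z \<omega> - real_cond_exp M Wa Z \<omega> = real n * D \<omega>"
      unfolding elim by (simp add: ZG D_def cond_exp_mat_def algebra_simps)
    thus ?case using n_pos by (simp add: power_mult_distrib)
  qed
  have Dm: "(\<lambda>\<omega>. (D \<omega>)\<^sup>2) \<in> borel_measurable M"
    unfolding D_def cond_exp_mat_def using Gt_M[of a b] W_regular_M[of B] by simp
  have Zm: "(\<lambda>\<omega>. (Z \<omega> - real_cond_exp M Wa Z \<omega>)\<^sup>2 / (real n)\<^sup>2) \<in> borel_measurable M" using Zi(1) by auto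
  show "integrable M (\<lambda>\<omega>. (D \<omega>)\<^sup>2)" using integrable_cong_AE[OF Dm Zm ae] Zi(2) by simp
  have "(\<integral>\<omega>. (D \<omega>)\<^sup>2 \<partial>M) = (\<integral>\<omega>. (Z \<omega> - real_cond_exp M Wa Z \<omega>)\<^sup>2 \<partial>M) / (real n)\<^sup>2"
    using integral_cong_AE[OF Dm Zm ae] by simp
  also have "\<dots> \<le> (30 * (real L * (1 + B))\<^sup>2 * real n) / (real n)\<^sup>2"
    using Zi(3) by (intro divide_right_mono) auto
  also have "\<dots> = 30 * (real L * (1 + B))\<^sup>2 / real n" using n_pos by (simp add: power2_eq_square[of "real n"])
  finally show "(\<integral>\<omega>. (D \<omega>)\<^sup>2 \<partial>M) \<le> 30 * (real L * (1 + B))\<^sup>2 / real n" .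
qed

text \<open>
  The coefficient vector \<open>b\<close> is the same for all observations; this is what allows the annihilator to remove
  the linear part.
\<close>

lemma Q_residual:
  assumes i: "i \<in> {1..n}"
  shows "(\<lambda>\<omega>. Q i \<omega> $ a) \<in> borel_measurable Wa" "integrable M (\<lambda>\<omega>. (Q i \<omega> $ a)\<^sup>2)"
    "\<exists>b\<in>carrier_vec K. \<forall>i\<in>{1..n}. AE \<omega> in M. real_cond_exp M Wa (\<lambda>\<omega>. x i \<omega> $ a) \<omega> = Q i \<omega> $ a + scalar_prod b (w' i \<omega>)"
proof -
  let ?A = "mat_inv (pop_gram M n K w)" and ?c = "pop_cross M n K w x a"
  have A: "?A \<in> carrier_mat K K" by (rule mat_inv_cases(4)) (simp add: pop_gram_def)
  have c: "?c \<in> carrier_vec K" by (simp add: pop_cross_def)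
  define b where "b = transpose_mat ?A *\<^sub>v ?c"
  have b: "b \<in> carrier_vec K" using A c by (simp add: b_def)
  have bw: "scalar_prod ?c (?A *\<^sub>v v) = scalar_prod b v" if v: "v \<in> carrier_vec K" for v
    unfolding b_def by (rule transpose_vec_mult_scalar[OF A v c, symmetric])
  have main: "AE \<omega> in M. Q i \<omega> $ a = real_cond_exp M Wa (\<lambda>\<omega>. x i \<omega> $ a) \<omega> - scalar_prod b (w' i \<omega>)"
    and zW: "(\<lambda>\<omega>. scalar_prod b (w' i \<omega>)) \<in> borel_measurable Wa"
    and z2: "integrable M (\<lambda>\<omega>. (scalar_prod b (w' i \<omega>))\<^sup>2)" if i: "i \<in> {1..n}" for i
  proof -
    have e: "scalar_prod b (w' i \<omega>) = (\<Sum>k<K. vec_index b k * vec_index (w' i \<omega>) k)" for \<omega>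
      using w'_dim[of i \<omega>] by (simp add: scalar_prod_def atLeast0LessThan)
    show zW: "(\<lambda>\<omega>. scalar_prod b (w' i \<omega>)) \<in> borel_measurable Wa"
      unfolding e using w'_Wa by (intro borel_measurable_sum borel_measurable_times) auto
    show z2: "integrable M (\<lambda>\<omega>. (scalar_prod b (w' i \<omega>))\<^sup>2)"
      unfolding e
    proof (intro square_integrable_sum)
      fix k assume k: "k \<in> {..<K}"
      show "(\<lambda>\<omega>. vec_index b k * vec_index (w' i \<omega>) k) \<in> borel_measurable M" using Wa_M[OF w'_Wa] k by auto
      have "integrable M (\<lambda>\<omega>. (vec_index (w' i \<omega>) k)\<^sup>2)"
        using cond_exp_square(2)[OF subalgebra_Wa w_meas[OF i] w_moment[OF i]] k by (simp add: w'_def)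
      thus "integrable M (\<lambda>\<omega>. (vec_index b k * vec_index (w' i \<omega>) k)\<^sup>2)" by (simp add: power_mult_distrib)
    qed simp
    have zi: "integrable M (\<lambda>\<omega>. scalar_prod b (w' i \<omega>))" by (rule square_integrable_imp_integrable[OF Wa_M[OF zW] z2])
    have xi: "integrable M (\<lambda>\<omega>. x i \<omega> $ a)" by (rule square_integrable_imp_integrable[OF x_component[OF i] x_component_square[OF i]])
    have pr: "(\<lambda>\<omega>. pop_resid M n K w x i \<omega> $ a) = (\<lambda>\<omega>. x i \<omega> $ a - scalar_prod ?c (?A *\<^sub>v w i \<omega>))"
      by (simp add: pop_resid_def)
    have ae: "AE \<omega> in M. x i \<omega> $ a - scalar_prod ?c (?A *\<^sub>v w i \<omega>) = x i \<omega> $ a - scalar_prod b (w' i \<omega>)"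
      using AE_w' by eventually_elim (use i bw[OF w'_dim] in auto)
    have zM: "(\<lambda>\<omega>. scalar_prod ?c (?A *\<^sub>v w i \<omega>)) \<in> borel_measurable M"
    proof -
      have "scalar_prod ?c (?A *\<^sub>v w i \<omega>) = (\<Sum>k<K. vec_index b k * vec_index (w i \<omega>) k)" if "\<omega> \<in> space M" for \<omega>
        unfolding bw[OF w_dim[OF i that]] using w_dim[OF i that] by (simp add: scalar_prod_def atLeast0LessThan)
      moreover have "(\<lambda>\<omega>. \<Sum>k<K. vec_index b k * vec_index (w i \<omega>) k) \<in> borel_measurable M"
        using w_meas[OF i] by (intro borel_measurable_sum borel_measurable_times) auto
      ultimately show ?thesis by (subst measurable_cong) auto
    qed
    have "AE \<omega> in M. real_cond_exp M Wa (\<lambda>\<omega>. pop_resid M n K w x i \<omega> $ a) \<omega>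
        = real_cond_exp M Wa (\<lambda>\<omega>. x i \<omega> $ a - scalar_prod b (w' i \<omega>)) \<omega>"
      unfolding pr by (rule Wa.real_cond_exp_cong[OF ae]) (use zM x_component[OF i] Wa_M[OF zW] in auto)
    moreover have "AE \<omega> in M. real_cond_exp M Wa (\<lambda>\<omega>. x i \<omega> $ a - scalar_prod b (w' i \<omega>)) \<omega>
       = real_cond_exp M Wa (\<lambda>\<omega>. x i \<omega> $ a) \<omega> - real_cond_exp M Wa (\<lambda>\<omega>. scalar_prod b (w' i \<omega>)) \<omega>"
      by (rule Wa.real_cond_exp_diff[OF xi zi])
    moreover have "AE \<omega> in M. real_cond_exp M Wa (\<lambda>\<omega>. scalar_prod b (w' i \<omega>)) \<omega> = scalar_prod b (w' i \<omega>)"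
      by (rule Wa.real_cond_exp_F_meas[OF zi zW])
    ultimately show "AE \<omega> in M. Q i \<omega> $ a = real_cond_exp M Wa (\<lambda>\<omega>. x i \<omega> $ a) \<omega> - scalar_prod b (w' i \<omega>)"
      by eventually_elim (simp add: Q_def cond_exp_vec_def)
  qed
  show QW: "(\<lambda>\<omega>. Q i \<omega> $ a) \<in> borel_measurable Wa" by (simp add: Q_def cond_exp_vec_def)
  let ?f = "real_cond_exp M Wa (\<lambda>\<omega>. x i \<omega> $ a)" and ?g = "\<lambda>\<omega>. scalar_prod b (w' i \<omega>)"
  have f: "?f \<in> borel_measurable M" "integrable M (\<lambda>\<omega>. (?f \<omega>)\<^sup>2)"
    using cond_exp_square(2)[OF subalgebra_Wa x_component[OF i] x_component_square[OF i]] by auto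
  have g: "?g \<in> borel_measurable M" "integrable M (\<lambda>\<omega>. (?g \<omega>)\<^sup>2)" using Wa_M[OF zW[OF i]] z2[OF i] by auto
  have "integrable M (\<lambda>\<omega>. (?f \<omega> - ?g \<omega>)\<^sup>2)"
    using square_integrable_product[OF f(1) g(1) f(2) g(2)] f(2) g(2) by (simp add: power2_diff mult.assoc)
  moreover have "AE \<omega> in M. (Q i \<omega> $ a)\<^sup>2 = (?f \<omega> - ?g \<omega>)\<^sup>2" using main[OF i] by eventually_elim simp
  ultimately show "integrable M (\<lambda>\<omega>. (Q i \<omega> $ a)\<^sup>2)"
    using integrable_cong_AE[of "\<lambda>\<omega>. (Q i \<omega> $ a)\<^sup>2" M "\<lambda>\<omega>. (?f \<omega> - ?g \<omega>)\<^sup>2"] Wa_M[OF QW] f(1) g(1) by auto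
  show "\<exists>b\<in>carrier_vec K. \<forall>i\<in>{1..n}. AE \<omega> in M. real_cond_exp M Wa (\<lambda>\<omega>. x i \<omega> $ a) \<omega> = Q i \<omega> $ a + scalar_prod b (w' i \<omega>)"
  proof (intro bexI[OF _ b] ballI)
    fix i assume "i \<in> {1..n}"
    from main[OF this] show "AE \<omega> in M. real_cond_exp M Wa (\<lambda>\<omega>. x i \<omega> $ a) \<omega> = Q i \<omega> $ a + scalar_prod b (w' i \<omega>)"
      by eventually_elim simp
  qed
qed

definition Qt :: "nat \<Rightarrow> 'd \<Rightarrow> 'a \<Rightarrow> real" where
  "Qt i a \<omega> = (\<Sum>j=1..n. m i j \<omega> * Q j \<omega> $ a)"

definition Vt :: "nat \<Rightarrow> 'd \<Rightarrow> 'a \<Rightarrow> real" where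
  "Vt i a \<omega> = (\<Sum>j=1..n. m i j \<omega> * V j \<omega> $ a)"

text \<open>
  On the regular event the Gram matrix is invertible, and the annihilator removes the linear part of
  \<open>E[x i | W]\<close>.
\<close>

lemma v_hat_decomposition:
  "AE \<omega> in M. \<omega> \<in> W_regular B \<longrightarrow> (\<forall>i\<in>{1..n}. v_hat i \<omega> $ a = Vt i a \<omega> + Qt i a \<omega>)"
proof -
  obtain b where b: "b \<in> carrier_vec K"
    "\<And>i. i \<in> {1..n} \<Longrightarrow> AE \<omega> in M. real_cond_exp M Wa (\<lambda>\<omega>. x i \<omega> $ a) \<omega> = Q i \<omega> $ a + scalar_prod b (w' i \<omega>)"
    using Q_residual(3)[of 1 a] n1 by auto
  have "AE \<omega> in M. \<forall>i\<in>{1..n}. real_cond_exp M Wa (\<lambda>\<omega>. x i \<omega> $ a) \<omega> = Q i \<omega> $ a + scalar_prod b (w' i \<omega>)"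
    by (rule AE_finite_allI) (use b in auto)
  thus ?thesis
  proof eventually_elim
    case (elim \<omega>)
    show ?case
    proof (intro impI ballI)
      fix i assume H: "\<omega> \<in> W_regular B" and i: "i \<in> {1..n}"
      have xj: "x j \<omega> $ a = V j \<omega> $ a + Q j \<omega> $ a + scalar_prod b (w' j \<omega>)" if "j \<in> {1..n}" for j
        using elim that by (simp add: V_component)
      have "v_hat i \<omega> $ a = (\<Sum>j=1..n. m i j \<omega> * V j \<omega> $ a + m i j \<omega> * Q j \<omega> $ a + m i j \<omega> * scalar_prod b (w' j \<omega>))"
        unfolding v_hat_component using xj by (intro sum.cong refl) (simp add: distrib_left)
      also have "\<dots> = Vt i a \<omega> + Qt i a \<omega> + (\<Sum>j=1..n. m i j \<omega> * scalar_prod b (w' j \<omega>))"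
        by (simp only: sum.distrib Vt_def Qt_def)
      finally show "v_hat i \<omega> $ a = Vt i a \<omega> + Qt i a \<omega>"
        using m_covariates[of \<omega> i b] H i b by (simp add: W_regular_def)
    qed
  qed
qed

lemma Qt_Wa: "i \<in> {1..n} \<Longrightarrow> Qt i a \<in> borel_measurable Wa"
  unfolding Qt_def[abs_def] by (intro borel_measurable_sum borel_measurable_times m_Wa Q_residual(1))

lemma projected_square_sum:
  assumes f: "\<And>j. j \<in> {1..n} \<Longrightarrow> f j \<in> borel_measurable M" "\<And>j. j \<in> {1..n} \<Longrightarrow> integrable M (\<lambda>\<omega>. (f j \<omega>)\<^sup>2)"
  shows "i \<in> {1..n} \<Longrightarrow> integrable M (\<lambda>\<omega>. (\<Sum>j=1..n. m i j \<omega> * f j \<omega>)\<^sup>2)"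
    "(\<Sum>i=1..n. \<integral>\<omega>. (\<Sum>j=1..n. m i j \<omega> * f j \<omega>)\<^sup>2 \<partial>M) \<le> (\<Sum>j=1..n. \<integral>\<omega>. (f j \<omega>)\<^sup>2 \<partial>M)"
proof -
  have i: "integrable M (\<lambda>\<omega>. (\<Sum>j=1..n. m i j \<omega> * f j \<omega>)\<^sup>2)" if i: "i \<in> {1..n}" for i
  proof (intro square_integrable_sum)
    fix j assume j: "j \<in> {1..n}"
    show "(\<lambda>\<omega>. m i j \<omega> * f j \<omega>) \<in> borel_measurable M" using Wa_M[OF m_Wa[OF i j]] f(1)[OF j] by simp
    show "integrable M (\<lambda>\<omega>. (m i j \<omega> * f j \<omega>)\<^sup>2)"
    proof (rule Bochner_Integration.integrable_bound[OF f(2)[OF j]])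
      show "AE \<omega> in M. norm ((m i j \<omega> * f j \<omega>)\<^sup>2) \<le> norm ((f j \<omega>)\<^sup>2)"
        using m_entry[OF i j] by (intro AE_I2) (simp add: power_mult_distrib mult_left_le_one_le abs_square_le_1)
    qed (use Wa_M[OF m_Wa[OF i j]] f(1)[OF j] in simp)
  qed simp
  thus "i \<in> {1..n} \<Longrightarrow> integrable M (\<lambda>\<omega>. (\<Sum>j=1..n. m i j \<omega> * f j \<omega>)\<^sup>2)" .
  have "(\<Sum>i=1..n. \<integral>\<omega>. (\<Sum>j=1..n. m i j \<omega> * f j \<omega>)\<^sup>2 \<partial>M) = (\<integral>\<omega>. (\<Sum>i=1..n. (\<Sum>j=1..n. m i j \<omega> * f j \<omega>)\<^sup>2) \<partial>M)"
    using i by (simp add: Bochner_Integration.integral_sum)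
  also have "\<dots> \<le> (\<integral>\<omega>. (\<Sum>j=1..n. (f j \<omega>)\<^sup>2) \<partial>M)"
    using i f(2) by (intro integral_mono m_contraction Bochner_Integration.integrable_sum) auto
  also have "\<dots> = (\<Sum>j=1..n. \<integral>\<omega>. (f j \<omega>)\<^sup>2 \<partial>M)" using f(2) by (simp add: Bochner_Integration.integral_sum)
  finally show "(\<Sum>i=1..n. \<integral>\<omega>. (\<Sum>j=1..n. m i j \<omega> * f j \<omega>)\<^sup>2 \<partial>M) \<le> (\<Sum>j=1..n. \<integral>\<omega>. (f j \<omega>)\<^sup>2 \<partial>M)" .
qed

lemma Qt_square_sum:
  "i \<in> {1..n} \<Longrightarrow> integrable M (\<lambda>\<omega>. (Qt i a \<omega>)\<^sup>2)"
  "(\<Sum>i=1..n. \<integral>\<omega>. (Qt i a \<omega>)\<^sup>2 \<partial>M) \<le> real n * chi"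
proof -
  note p = projected_square_sum[of "\<lambda>j \<omega>. Q j \<omega> $ a", OF Wa_M[OF Q_residual(1)] Q_residual(2), folded Qt_def]
  show "i \<in> {1..n} \<Longrightarrow> integrable M (\<lambda>\<omega>. (Qt i a \<omega>)\<^sup>2)" by (rule p)
  have "(\<Sum>i=1..n. \<integral>\<omega>. (Qt i a \<omega>)\<^sup>2 \<partial>M) \<le> (\<Sum>j=1..n. \<integral>\<omega>. (Q j \<omega> $ a)\<^sup>2 \<partial>M)" by (rule p)
  also have "\<dots> \<le> (\<Sum>j=1..n. \<integral>\<omega>. (norm (Q j \<omega>))\<^sup>2 \<partial>M)"
  proof (intro sum_mono integral_mono Q_residual(2))
    fix j assume j: "j \<in> {1..n}"
    have "integrable M (\<lambda>\<omega>. \<Sum>a\<in>UNIV. (Q j \<omega> $ a)\<^sup>2)" by (intro Bochner_Integration.integrable_sum Q_residual(2)[OF j])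
    moreover have "(norm (Q j \<omega>))\<^sup>2 = (\<Sum>a\<in>UNIV. (Q j \<omega> $ a)\<^sup>2)" for \<omega>
      unfolding power2_norm_eq_inner inner_vec_def by (simp add: power2_eq_square)
    ultimately show "integrable M (\<lambda>\<omega>. (norm (Q j \<omega>))\<^sup>2)" by simp
    show "(Q j \<omega> $ a)\<^sup>2 \<le> (norm (Q j \<omega>))\<^sup>2" for \<omega>
      using component_le_norm_cart[of "Q j \<omega>" a] by (simp add: abs_le_square_iff[symmetric])
  qed
  also have "\<dots> = real n * chi" using n_pos by (simp add: chi_W_def Q_def)
  finally show "(\<Sum>i=1..n. \<integral>\<omega>. (Qt i a \<omega>)\<^sup>2 \<partial>M) \<le> real n * chi" .
qed

text \<open>
  Given \<open>W\<close>, the cross term is a linear form in the noise \<open>q\<close> with coefficients \<open>Qt\<close>, whose squares sum to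
  at most \<open>n chi\<close>.
\<close>

lemma cross_term_bound:
  fixes a b :: 'd
  assumes B: "B > 0"
  defines "C \<equiv> \<lambda>\<omega>. indicator (W_regular B) \<omega> * ((\<Sum>i=1..n. Vt i a \<omega> * Qt i b \<omega>) / real n)"
  shows "integrable M (\<lambda>\<omega>. (C \<omega>)\<^sup>2)" "(\<integral>\<omega>. (C \<omega>)\<^sup>2 \<partial>M) \<le> real L * (1 + B) * chi / real n"
proof -
  have e: "C \<omega> = (\<Sum>i=1..n. Qt i b \<omega> * q B a i \<omega>) / real n" for \<omega>
  proof -
    have "(\<Sum>i=1..n. Vt i a \<omega> * Qt i b \<omega>) = (\<Sum>i=1..n. V i \<omega> $ a * Qt i b \<omega>)"
      unfolding Vt_def Qt_def by (rule m_inner)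
    moreover have "(\<Sum>i=1..n. Qt i b \<omega> * q B a i \<omega>) = indicator (W_regular B) \<omega> * (\<Sum>i=1..n. V i \<omega> $ a * Qt i b \<omega>)"
      by (simp add: q_def sum_distrib_left mult_ac)
    ultimately show ?thesis by (simp only: C_def times_divide_eq_right)
  qed
  note l = CN.linear_square[of B "q B a" "\<lambda>i. Qt i b", OF noise_q[OF B] Qt_Wa Qt_square_sum(1)]
  have l1: "integrable M (\<lambda>\<omega>. (\<Sum>i=1..n. Qt i b \<omega> * q B a i \<omega>)\<^sup>2)"
    "(\<integral>\<omega>. (\<Sum>i=1..n. Qt i b \<omega> * q B a i \<omega>)\<^sup>2 \<partial>M) \<le> real L * (1 + B) * (\<Sum>i=1..n. \<integral>\<omega>. (Qt i b \<omega>)\<^sup>2 \<partial>M)"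
    by (rule l; assumption)+
  show "integrable M (\<lambda>\<omega>. (C \<omega>)\<^sup>2)" using l1(1) by (simp add: e power_divide)
  have "(\<integral>\<omega>. (C \<omega>)\<^sup>2 \<partial>M) = (\<integral>\<omega>. (\<Sum>i=1..n. Qt i b \<omega> * q B a i \<omega>)\<^sup>2 \<partial>M) / (real n)\<^sup>2"
    by (simp add: e power_divide)
  also have "\<dots> \<le> (real L * (1 + B) * (real n * chi)) / (real n)\<^sup>2"
    using B by (intro divide_right_mono order_trans[OF l1(2)] mult_left_mono Qt_square_sum(2)) auto
  also have "\<dots> = real L * (1 + B) * chi / real n" using n_pos by (simp add: power2_eq_square[of "real n"])
  finally show "(\<integral>\<omega>. (C \<omega>)\<^sup>2 \<partial>M) \<le> real L * (1 + B) * chi / real n" .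
qed

lemma R_square:
  assumes i: "i \<in> {1..n}"
  shows "R i \<in> borel_measurable M" "integrable M (\<lambda>\<omega>. (R i \<omega>)\<^sup>2)"
    "integrable M (\<lambda>\<omega>. (r i \<omega>)\<^sup>2)" "integrable M (\<lambda>\<omega>. (R i \<omega> - r i \<omega>)\<^sup>2)"
    "(\<integral>\<omega>. (R i \<omega> - r i \<omega>)\<^sup>2 \<partial>M) = (\<integral>\<omega>. (R i \<omega>)\<^sup>2 \<partial>M) - (\<integral>\<omega>. (r i \<omega>)\<^sup>2 \<partial>M)"
proof -
  show RM: "R i \<in> borel_measurable M" by simp
  show R2: "integrable M (\<lambda>\<omega>. (R i \<omega>)\<^sup>2)" by (rule cond_exp_square(2)[OF subalgebra_Fa u_meas[OF i] u_moment[OF i]])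
  show "integrable M (\<lambda>\<omega>. (r i \<omega>)\<^sup>2)" by (rule cond_exp_square(2)[OF subalgebra_Wa u_meas[OF i] u_moment[OF i]])
  have ui: "integrable M (u i)" by (rule square_integrable_imp_integrable[OF u_meas[OF i] u_moment[OF i]])
  have ae: "AE \<omega> in M. real_cond_exp M Wa (R i) \<omega> = r i \<omega>"
    by (rule Wa.real_cond_exp_nested_subalg[OF subalgebra_Fa subalgebra_Fa_Wa ui])
  note c = cond_exp_square(4,5)[OF subalgebra_Wa RM R2]
  have ae1: "AE \<omega> in M. (R i \<omega> - real_cond_exp M Wa (R i) \<omega>)\<^sup>2 = (R i \<omega> - r i \<omega>)\<^sup>2"
    and ae2: "AE \<omega> in M. (real_cond_exp M Wa (R i) \<omega>)\<^sup>2 = (r i \<omega>)\<^sup>2" using ae by (eventually_elim, simp)+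
  show "integrable M (\<lambda>\<omega>. (R i \<omega> - r i \<omega>)\<^sup>2)"
    using integrable_cong_AE[OF _ _ ae1] c(2) by simp
  have "(\<integral>\<omega>. (R i \<omega> - real_cond_exp M Wa (R i) \<omega>)\<^sup>2 \<partial>M) = (\<integral>\<omega>. (R i \<omega> - r i \<omega>)\<^sup>2 \<partial>M)"
    by (rule integral_cong_AE[OF _ _ ae1]) auto
  moreover have "(\<integral>\<omega>. (real_cond_exp M Wa (R i) \<omega>)\<^sup>2 \<partial>M) = (\<integral>\<omega>. (r i \<omega>)\<^sup>2 \<partial>M)"
    by (rule integral_cong_AE[OF _ _ ae2]) auto
  ultimately show "(\<integral>\<omega>. (R i \<omega> - r i \<omega>)\<^sup>2 \<partial>M) = (\<integral>\<omega>. (R i \<omega>)\<^sup>2 \<partial>M) - (\<integral>\<omega>. (r i \<omega>)\<^sup>2 \<partial>M)"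
    using c(1) by simp
qed

text \<open>
  The last identity is Pythagoras for the nested projections \<open>R\<close> and \<open>r\<close> of \<open>u\<close>.
\<close>

lemma rho_sums:
  "(\<Sum>i=1..n. \<integral>\<omega>. (R i \<omega>)\<^sup>2 \<partial>M) = real n * rhoX" "(\<Sum>i=1..n. \<integral>\<omega>. (r i \<omega>)\<^sup>2 \<partial>M) = real n * rhoW"
  "(\<Sum>i=1..n. \<integral>\<omega>. (R i \<omega> - r i \<omega>)\<^sup>2 \<partial>M) = real n * (rhoX - rhoW)"
proof -
  show a: "(\<Sum>i=1..n. \<integral>\<omega>. (R i \<omega>)\<^sup>2 \<partial>M) = real n * rhoX" using n_pos by (simp add: rho_XW_def)
  show b: "(\<Sum>i=1..n. \<integral>\<omega>. (r i \<omega>)\<^sup>2 \<partial>M) = real n * rhoW" using n_pos by (simp add: rho_W_def)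
  have "(\<Sum>i=1..n. \<integral>\<omega>. (R i \<omega> - r i \<omega>)\<^sup>2 \<partial>M) = (\<Sum>i=1..n. (\<integral>\<omega>. (R i \<omega>)\<^sup>2 \<partial>M) - (\<integral>\<omega>. (r i \<omega>)\<^sup>2 \<partial>M))"
    by (intro sum.cong refl R_square(5))
  also have "\<dots> = real n * rhoX - real n * rhoW" by (simp only: sum_subtractf a b)
  finally show "(\<Sum>i=1..n. \<integral>\<omega>. (R i \<omega> - r i \<omega>)\<^sup>2 \<partial>M) = real n * (rhoX - rhoW)" by (simp add: right_diff_distrib)
qed

lemma nonneg_parameters: "rhoW \<ge> 0" "rhoX \<ge> rhoW" "rhoX \<ge> 0" "chi \<ge> 0"
proof -
  show "rhoW \<ge> 0" unfolding rho_W_def by (auto intro!: divide_nonneg_nonneg mult_nonneg_nonneg sum_nonneg)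
  have "0 \<le> real n * (rhoX - rhoW)" unfolding rho_sums(3)[symmetric] by (intro sum_nonneg) simp
  thus "rhoX \<ge> rhoW" using n_pos by (simp add: zero_le_mult_iff)
  thus "rhoX \<ge> 0" using \<open>rhoW \<ge> 0\<close> by simp
  show "chi \<ge> 0" unfolding chi_W_def by (auto intro!: divide_nonneg_nonneg mult_nonneg_nonneg sum_nonneg)
qed

text \<open>
  The three parts of the remainder.  \<open>T1\<close> pairs the approximation errors of the two regressions; \<open>T2\<close>
  pairs the regressor noise with the part of \<open>R\<close> that \<open>W\<close> does not explain; both are bounded by
  Cauchy--Schwarz, where the annihilator only decreases sums of squares.  Cauchy--Schwarz would be too
  weak for \<open>T3\<close>, which pairs noise with \<open>r\<close>; but after moving the annihilator from the noise to \<open>r\<close> it is a linear form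
  in noise with coefficients known given \<open>W\<close>, whose second moment is smaller by the order of \<open>n\<close> than
  what Cauchy--Schwarz gives.
\<close>

lemma remainder_bound:
  fixes a :: 'd
  assumes B: "B > 0"
  defines "D \<equiv> \<lambda>\<omega>. indicator (W_regular B) \<omega> * ((\<Sum>i=1..n. v_hat i \<omega> $ a * R i \<omega>) / sqrt (real n))"
  shows "integrable M D"
    "(\<integral>\<omega>. \<bar>D \<omega>\<bar> \<partial>M) \<le> sqrt (real n * chi * rhoX) + sqrt ((1 + B) * (real n * (rhoX - rhoW))) + sqrt (real L * (1 + B) * rhoW)"
proof -
  define qt where "qt i \<omega> = (\<Sum>j=1..n. m i j \<omega> * q B a j \<omega>)" for i \<omega>
  define rt where "rt i \<omega> = (\<Sum>j=1..n. m i j \<omega> * r j \<omega>)" for i \<omega>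
  define T1 where "T1 \<omega> = (\<Sum>i=1..n. Qt i a \<omega> * R i \<omega>)" for \<omega>
  define T2 where "T2 \<omega> = (\<Sum>i=1..n. qt i \<omega> * (R i \<omega> - r i \<omega>))" for \<omega>
  define T3 where "T3 \<omega> = (\<Sum>i=1..n. rt i \<omega> * q B a i \<omega>)" for \<omega>
  have L1: "0 \<le> real L * (1 + B)" using B by simp
  have qtM: "qt i \<in> borel_measurable M" if "i \<in> {1..n}" for i
    unfolding qt_def[abs_def] using that q_mean_square(1)[OF B] Wa_M[OF m_Wa]
    by (intro borel_measurable_sum borel_measurable_times) auto
  note qs = projected_square_sum[of "q B a", OF q_mean_square(1)[OF B] q_mean_square(2)[OF B], folded qt_def]
  have rW: "r i \<in> borel_measurable Wa" for i by simp
  have rtW: "rt i \<in> borel_measurable Wa" if "i \<in> {1..n}" for i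
    unfolding rt_def[abs_def] using that m_Wa by (intro borel_measurable_sum borel_measurable_times) auto
  note rs = projected_square_sum[of "\<lambda>i. r i", OF Wa_M[OF rW] R_square(3), folded rt_def]
  have QtM: "Qt i a \<in> borel_measurable M" if "i \<in> {1..n}" for i by (rule Wa_M[OF Qt_Wa[OF that]])
  have c1: "integrable M T1"
    "(\<integral>\<omega>. \<bar>T1 \<omega>\<bar> \<partial>M) \<le> sqrt ((\<Sum>i=1..n. \<integral>\<omega>. (Qt i a \<omega>)\<^sup>2 \<partial>M) * (\<Sum>i=1..n. \<integral>\<omega>. (R i \<omega>)\<^sup>2 \<partial>M))"
    unfolding T1_def[abs_def]
    by (rule Cauchy_Schwarz_sum_integral[OF _ QtM _ Qt_square_sum(1) R_square(2)]; simp)+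
  have c2: "integrable M T2"
    "(\<integral>\<omega>. \<bar>T2 \<omega>\<bar> \<partial>M) \<le> sqrt ((\<Sum>i=1..n. \<integral>\<omega>. (qt i \<omega>)\<^sup>2 \<partial>M) * (\<Sum>i=1..n. \<integral>\<omega>. (R i \<omega> - r i \<omega>)\<^sup>2 \<partial>M))"
    unfolding T2_def[abs_def]
    by (rule Cauchy_Schwarz_sum_integral[OF _ qtM _ qs(1) R_square(4)]; simp)+
  have l3: "integrable M (\<lambda>\<omega>. (T3 \<omega>)\<^sup>2)" "(\<integral>\<omega>. (T3 \<omega>)\<^sup>2 \<partial>M) \<le> real L * (1 + B) * (\<Sum>i=1..n. \<integral>\<omega>. (rt i \<omega>)\<^sup>2 \<partial>M)"
    unfolding T3_def by (rule CN.linear_square[of B "q B a" rt, OF noise_q[OF B] rtW rs(1)]; assumption)+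
  have T3M: "T3 \<in> borel_measurable M" unfolding T3_def[abs_def]
    using Wa_M[OF rtW] q_mean_square(1)[OF B] by (intro borel_measurable_sum borel_measurable_times) auto
  have c3: "integrable M T3" by (rule square_integrable_imp_integrable[OF T3M l3(1)])
  have b1: "(\<integral>\<omega>. \<bar>T1 \<omega>\<bar> \<partial>M) \<le> sqrt (real n) * sqrt (real n * chi * rhoX)"
  proof -
    have "(\<Sum>i=1..n. \<integral>\<omega>. (Qt i a \<omega>)\<^sup>2 \<partial>M) * (\<Sum>i=1..n. \<integral>\<omega>. (R i \<omega>)\<^sup>2 \<partial>M) \<le> (real n * chi) * (real n * rhoX)"
      unfolding rho_sums(1) using nonneg_parameters by (intro mult_right_mono Qt_square_sum(2)) auto
    also have "\<dots> = real n * (real n * chi * rhoX)" by simp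
    finally have le: "(\<Sum>i=1..n. \<integral>\<omega>. (Qt i a \<omega>)\<^sup>2 \<partial>M) * (\<Sum>i=1..n. \<integral>\<omega>. (R i \<omega>)\<^sup>2 \<partial>M) \<le> real n * (real n * chi * rhoX)" .
    show ?thesis using order_trans[OF c1(2) real_sqrt_le_mono[OF le]]
      by (simp only: real_sqrt_mult[of "real n" "real n * chi * rhoX"])
  qed
  have b2: "(\<integral>\<omega>. \<bar>T2 \<omega>\<bar> \<partial>M) \<le> sqrt (real n) * sqrt ((1 + B) * (real n * (rhoX - rhoW)))"
  proof -
    have "(\<Sum>i=1..n. \<integral>\<omega>. (qt i \<omega>)\<^sup>2 \<partial>M) \<le> (\<Sum>i=1..n. \<integral>\<omega>. (q B a i \<omega>)\<^sup>2 \<partial>M)" by (rule qs)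
    also have "\<dots> \<le> (\<Sum>i=1..n. 1 + B)" by (intro sum_mono q_mean_square(3)[OF B])
    finally have "(\<Sum>i=1..n. \<integral>\<omega>. (qt i \<omega>)\<^sup>2 \<partial>M) * (\<Sum>i=1..n. \<integral>\<omega>. (R i \<omega> - r i \<omega>)\<^sup>2 \<partial>M) \<le> (real n * (1 + B)) * (real n * (rhoX - rhoW))"
      unfolding rho_sums(3) using nonneg_parameters by (intro mult_right_mono) auto
    also have "\<dots> = real n * ((1 + B) * (real n * (rhoX - rhoW)))" by simp
    finally have le: "(\<Sum>i=1..n. \<integral>\<omega>. (qt i \<omega>)\<^sup>2 \<partial>M) * (\<Sum>i=1..n. \<integral>\<omega>. (R i \<omega> - r i \<omega>)\<^sup>2 \<partial>M)
        \<le> real n * ((1 + B) * (real n * (rhoX - rhoW)))" .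
    show ?thesis using order_trans[OF c2(2) real_sqrt_le_mono[OF le]]
      by (simp only: real_sqrt_mult[of "real n" "(1 + B) * (real n * (rhoX - rhoW))"])
  qed
  have b3: "(\<integral>\<omega>. \<bar>T3 \<omega>\<bar> \<partial>M) \<le> sqrt (real n) * sqrt (real L * (1 + B) * rhoW)"
  proof -
    have "(\<integral>\<omega>. (T3 \<omega>)\<^sup>2 \<partial>M) \<le> real L * (1 + B) * (\<Sum>i=1..n. \<integral>\<omega>. (r i \<omega>)\<^sup>2 \<partial>M)"
      using L1 by (intro order_trans[OF l3(2)] mult_left_mono rs(2))
    hence le: "(\<integral>\<omega>. (T3 \<omega>)\<^sup>2 \<partial>M) \<le> real n * (real L * (1 + B) * rhoW)" unfolding rho_sums(2) by (simp add: mult_ac)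
    show ?thesis using order_trans[OF expectation_abs_le_sqrt[OF T3M l3(1)] real_sqrt_le_mono[OF le]]
      by (simp only: real_sqrt_mult[of "real n" "real L * (1 + B) * rhoW"])
  qed
  have T23: "(\<Sum>i=1..n. qt i \<omega> * r i \<omega>) = T3 \<omega>" for \<omega>
  proof -
    have "(\<Sum>i=1..n. qt i \<omega> * r i \<omega>) = (\<Sum>i=1..n. \<Sum>j=1..n. m i j \<omega> * q B a j \<omega> * r i \<omega>)"
      by (simp add: qt_def sum_distrib_right)
    also have "\<dots> = (\<Sum>j=1..n. \<Sum>i=1..n. m i j \<omega> * q B a j \<omega> * r i \<omega>)" by (rule sum.swap)
    also have "\<dots> = (\<Sum>j=1..n. \<Sum>i=1..n. m j i \<omega> * r i \<omega> * q B a j \<omega>)"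
      by (intro sum.cong refl) (simp add: m_sym mult_ac)
    finally show ?thesis by (simp add: T3_def rt_def sum_distrib_right)
  qed
  have ae: "AE \<omega> in M. D \<omega> = (indicator (W_regular B) \<omega> * T1 \<omega> + T2 \<omega> + T3 \<omega>) / sqrt (real n)"
    using v_hat_decomposition[of B a]
  proof eventually_elim
    case (elim \<omega>)
    have qV: "qt i \<omega> = indicator (W_regular B) \<omega> * Vt i a \<omega>" for i
      by (simp add: qt_def q_def Vt_def sum_distrib_left mult_ac)
    have "indicator (W_regular B) \<omega> * (\<Sum>i=1..n. v_hat i \<omega> $ a * R i \<omega>) = (\<Sum>i=1..n. indicator (W_regular B) \<omega> * (Qt i a \<omega> * R i \<omega>) + qt i \<omega> * R i \<omega>)"
      unfolding sum_distrib_left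
    proof (intro sum.cong refl)
      fix i assume "i \<in> {1..n}"
      thus "indicator (W_regular B) \<omega> * (v_hat i \<omega> $ a * R i \<omega>) = indicator (W_regular B) \<omega> * (Qt i a \<omega> * R i \<omega>) + qt i \<omega> * R i \<omega>"
        using elim by (cases "\<omega> \<in> W_regular B") (auto simp: qV algebra_simps)
    qed
    also have "\<dots> = indicator (W_regular B) \<omega> * T1 \<omega> + (\<Sum>i=1..n. qt i \<omega> * R i \<omega>)"
      by (simp only: sum.distrib T1_def sum_distrib_left)
    also have "(\<Sum>i=1..n. qt i \<omega> * R i \<omega>) = T2 \<omega> + (\<Sum>i=1..n. qt i \<omega> * r i \<omega>)"
      by (simp only: T2_def right_diff_distrib sum_subtractf)
    finally show ?case unfolding D_def T23 by simp
  qed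
  have i1: "integrable M (\<lambda>\<omega>. indicator (W_regular B) \<omega> * T1 \<omega>)" using integrable_mult_indicator[OF W_regular_M c1(1)] by simp
  have DM: "D \<in> borel_measurable M" unfolding D_def
    using W_regular_M borel_measurable_vec_nth[OF Fa_M[OF v_hat_Fa]]
    by (intro borel_measurable_times borel_measurable_divide borel_measurable_sum borel_measurable_const borel_measurable_indicator) auto
  have EM: "(\<lambda>\<omega>. (indicator (W_regular B) \<omega> * T1 \<omega> + T2 \<omega> + T3 \<omega>) / sqrt (real n)) \<in> borel_measurable M"
    using i1 c2(1) T3M by auto
  have iE: "integrable M (\<lambda>\<omega>. (indicator (W_regular B) \<omega> * T1 \<omega> + T2 \<omega> + T3 \<omega>) / sqrt (real n))" using i1 c2(1) c3 by simp
  show Di: "integrable M D" using integrable_cong_AE[OF DM EM ae] iE by simp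
  have "(\<integral>\<omega>. \<bar>D \<omega>\<bar> \<partial>M) \<le> (\<integral>\<omega>. (\<bar>T1 \<omega>\<bar> + \<bar>T2 \<omega>\<bar> + \<bar>T3 \<omega>\<bar>) / sqrt (real n) \<partial>M)"
  proof (rule integral_mono_AE)
    show "integrable M (\<lambda>\<omega>. (\<bar>T1 \<omega>\<bar> + \<bar>T2 \<omega>\<bar> + \<bar>T3 \<omega>\<bar>) / sqrt (real n))" using c1(1) c2(1) c3 by simp
    show "AE \<omega> in M. \<bar>D \<omega>\<bar> \<le> (\<bar>T1 \<omega>\<bar> + \<bar>T2 \<omega>\<bar> + \<bar>T3 \<omega>\<bar>) / sqrt (real n)"
      using ae
    proof eventually_elim
      case (elim \<omega>)
      have "\<bar>indicator (W_regular B) \<omega> * T1 \<omega> + T2 \<omega> + T3 \<omega>\<bar> \<le> \<bar>T1 \<omega>\<bar> + \<bar>T2 \<omega>\<bar> + \<bar>T3 \<omega>\<bar>" by (auto simp: indicator_def)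
      thus ?case using n_pos by (simp add: elim divide_right_mono)
    qed
  qed (use Di in simp)
  also have "\<dots> = ((\<integral>\<omega>. \<bar>T1 \<omega>\<bar> \<partial>M) + (\<integral>\<omega>. \<bar>T2 \<omega>\<bar> \<partial>M) + (\<integral>\<omega>. \<bar>T3 \<omega>\<bar> \<partial>M)) / sqrt (real n)"
    using c1(1) c2(1) c3 by simp
  also have "\<dots> \<le> (sqrt (real n) * sqrt (real n * chi * rhoX) + sqrt (real n) * sqrt ((1 + B) * (real n * (rhoX - rhoW)))
      + sqrt (real n) * sqrt (real L * (1 + B) * rhoW)) / sqrt (real n)"
    by (intro divide_right_mono add_mono b1 b2 b3) simp
  also have "\<dots> = sqrt (real n * chi * rhoX) + sqrt ((1 + B) * (real n * (rhoX - rhoW))) + sqrt (real L * (1 + B) * rhoW)"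
    using n_pos by (simp add: add_divide_distrib)
  finally show "(\<integral>\<omega>. \<bar>D \<omega>\<bar> \<partial>M) \<le> sqrt (real n * chi * rhoX) + sqrt ((1 + B) * (real n * (rhoX - rhoW))) + sqrt (real L * (1 + B) * rhoW)" .
qed

end

section \<open>Asymptotic normality of the score at a fixed sample size\<close>

lemma sum_fourth_le:
  fixes f :: "'i \<Rightarrow> real"
  assumes "finite A" "card A \<le> L"
  shows "(\<Sum>i\<in>A. f i) ^ 4 \<le> real L ^ 3 * (\<Sum>i\<in>A. f i ^ 4)"
proof -
  have "(\<Sum>i\<in>A. f i) ^ 4 = ((\<Sum>i\<in>A. f i)\<^sup>2)\<^sup>2" by simp
  also have "\<dots> \<le> (real L * (\<Sum>i\<in>A. (f i)\<^sup>2))\<^sup>2" by (intro power_mono sum_squared_le[OF assms]) simp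
  also have "\<dots> = (real L)\<^sup>2 * (\<Sum>i\<in>A. (f i)\<^sup>2)\<^sup>2" by (simp add: power_mult_distrib)
  also have "\<dots> \<le> (real L)\<^sup>2 * (real L * (\<Sum>i\<in>A. ((f i)\<^sup>2)\<^sup>2))" by (intro mult_left_mono sum_squared_le[OF assms]) simp
  also have "(\<Sum>i\<in>A. ((f i)\<^sup>2)\<^sup>2) = (\<Sum>i\<in>A. f i ^ 4)" by simp
  also have "(real L)\<^sup>2 * (real L * (\<Sum>i\<in>A. f i ^ 4)) = real L ^ 3 * (\<Sum>i\<in>A. f i ^ 4)"
    by (simp add: power2_eq_square power3_eq_cube)
  finally show ?thesis .
qed

context regression_sample
begin

definition sigma2 :: "nat \<Rightarrow> 'a \<Rightarrow> real" where
  "sigma2 t = real_cond_exp M Fa (\<lambda>\<omega>. (U t \<omega>)\<^sup>2)"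

text \<open>
  The part of the good event that concerns the errors, known given \<open>X\<close> and \<open>W\<close>.
\<close>

definition U_regular :: "real \<Rightarrow> 'a set" where
  "U_regular B = {\<omega> \<in> space M. \<forall>t\<in>{1..n}. nn_cond_exp M Fa (\<lambda>\<omega>. ennreal (U t \<omega> ^ 4)) \<omega> \<le> ennreal B
      \<and> 1 / B \<le> sigma2 t \<omega>}"

lemma U_regular_Fa: "U_regular B \<in> sets Fa"
proof -
  have "{\<omega> \<in> space Fa. \<forall>t\<in>{1..n}. nn_cond_exp M Fa (\<lambda>\<omega>. ennreal (U t \<omega> ^ 4)) \<omega> \<le> ennreal B
      \<and> 1 / B \<le> sigma2 t \<omega>} \<in> sets Fa"
    unfolding sigma2_def
    by (intro sets.sets_Collect_finite_All' sets.sets_Collect_conj borel_measurable_le) (use n1 in auto)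
  thus ?thesis by (simp add: U_regular_def)
qed

lemma sigma2_nonneg: "t \<in> {1..n} \<Longrightarrow> AE \<omega> in M. sigma2 t \<omega> \<ge> 0"
  unfolding sigma2_def using U_regression_error by (intro Fa.real_cond_exp_pos) auto

lemma sigma2_nn:
  "t \<in> {1..n} \<Longrightarrow> AE \<omega> in M. nn_cond_exp M Fa (\<lambda>\<omega>. ennreal ((U t \<omega>)\<^sup>2)) \<omega> = ennreal (sigma2 t \<omega>)"
  unfolding sigma2_def by (rule Fa.nn_cond_exp_eq_real_cond_exp[OF U_regression_error(2)]) auto

lemma sigma2_upper:
  assumes t: "t \<in> {1..n}" and B: "B > 0"
  shows "AE \<omega> in M. \<omega> \<in> U_regular B \<longrightarrow> sigma2 t \<omega> \<le> 1 + B"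
  using sigma2_nn[OF t] Fa.nn_cond_exp_square_le_fourth[OF U_regression_error(1)[OF t]]
proof eventually_elim
  case (elim \<omega>)
  show ?case
  proof
    assume "\<omega> \<in> U_regular B"
    hence "nn_cond_exp M Fa (\<lambda>\<omega>. ennreal (U t \<omega> ^ 4)) \<omega> \<le> ennreal B" using t by (simp add: U_regular_def)
    hence "ennreal (sigma2 t \<omega>) \<le> 1 + ennreal B" using elim by (metis add_left_mono order_trans)
    also have "1 + ennreal B = ennreal (1 + B)" using B by (subst ennreal_plus) auto
    finally show "sigma2 t \<omega> \<le> 1 + B" using B by (subst (asm) ennreal_le_iff) auto
  qed
qed

text \<open>
  Summing over clusters, \<open>\<xi> k\<close> is the contribution of cluster \<open>k\<close> and \<open>s k\<close> its conditional variance,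
  which is a sum over single observations since the errors are uncorrelated given \<open>X\<close> and \<open>W\<close>.  The
  telescoping bound applies with \<open>\<eta> = \<kappa>\<close>; every error term carries a factor \<open>\<kappa>\<close> because the fourth
  moments involve \<open>(c t)^4 \<le> \<kappa>^2 (c t)^2\<close> and \<open>\<Sum> (c t)^2\<close> is bounded by \<open>B * \<tau>\<close>.
\<close>

lemma conditional_clt:
  assumes G: "G \<in> sets Fa" "G \<subseteq> U_regular B" and B: "B > 0"
    and c: "\<And>t. t \<in> {1..n} \<Longrightarrow> c t \<in> borel_measurable Fa" "\<And>t \<omega>. t \<in> {1..n} \<Longrightarrow> \<bar>c t \<omega>\<bar> \<le> \<kappa>"
      "\<And>t \<omega>. \<omega> \<notin> G \<Longrightarrow> c t \<omega> = 0"
    and \<tau>: "\<And>\<omega>. \<omega> \<in> G \<Longrightarrow> (\<Sum>t=1..n. (c t \<omega>)\<^sup>2 * sigma2 t \<omega>) = \<tau>" "\<tau> \<ge> 0" and \<kappa>: "\<kappa> > 0"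
  shows "cmod (\<integral>\<omega>. iexp (\<Sum>t=1..n. c t \<omega> * U t \<omega>) - complex_of_real (exp (- (\<tau> * indicator G \<omega>) / 2)) \<partial>M)
    \<le> \<kappa> * \<tau> + real L ^ 3 * B\<^sup>2 * \<tau> * \<kappa> + real L * (1 + B) * \<tau> * \<kappa>\<^sup>2"
proof -
  \<comment> \<open>A version of the conditional variance that is nonnegative everywhere, as the telescoping bound demands.\<close>
  define s2 where "s2 t \<omega> = max 0 (sigma2 t \<omega>)" for t \<omega>
  have s2F: "s2 t \<in> borel_measurable Fa" for t unfolding s2_def[abs_def] sigma2_def by simp
  have s20: "s2 t \<omega> \<ge> 0" for t \<omega> by (simp add: s2_def)
  have s2eq: "AE \<omega> in M. s2 t \<omega> = sigma2 t \<omega>" if "t \<in> {1..n}" for t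
    using sigma2_nonneg[OF that] by eventually_elim (simp add: s2_def)
  have GM: "G \<in> sets M" using G(1) subalgebra_Fa by (auto simp: subalgebra_def)
  define \<xi> where "\<xi> k \<omega> = (\<Sum>t\<in>T k. c t \<omega> * U t \<omega>)" for k \<omega>
  define s where "s k \<omega> = (\<Sum>t\<in>T k. (c t \<omega>)\<^sup>2 * s2 t \<omega>)" for k \<omega>
  have cM: "c t \<in> borel_measurable M" if "t \<in> {1..n}" for t by (rule Fa_M[OF c(1)[OF that]])
  note UM = U_regression_error(1)
  have c2: "(c t \<omega>)\<^sup>2 \<le> \<kappa>\<^sup>2" if "t \<in> {1..n}" for t \<omega>
    using c(2)[OF that, of \<omega>] \<kappa> by (simp add: abs_le_square_iff[symmetric])
  have c2i: "integrable M (\<lambda>\<omega>. (c t \<omega>)\<^sup>2)" if "t \<in> {1..n}" for t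
    by (rule integrable_const_bound[where B = "\<kappa>\<^sup>2"]) (use c2[OF that] cM[OF that] in auto)
  have FG: "f \<in> borel_measurable (CN.with_outside (S k) k)" if "f \<in> borel_measurable Fa" "k \<in> {1..N}" for f :: "'a \<Rightarrow> real" and k
  proof -
    have "subalgebra (CN.with_outside (S k) k) Fa"
      using S_between(5)[OF that(2)] unfolding subalgebra_def CN.space_with_outside space_Fa by blast
    thus ?thesis using that(1) by (rule measurable_from_subalg)
  qed
  have scaled: "integrable M (\<lambda>\<omega>. f \<omega> * g \<omega>)" if "integrable M g" "f \<in> borel_measurable M" "\<And>\<omega>. \<bar>f \<omega>\<bar> \<le> b" for f g :: "'a \<Rightarrow> real" and b
  proof (rule Bochner_Integration.integrable_bound)
    show "integrable M (\<lambda>\<omega>. b * g \<omega>)" using that by simp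
    show "AE \<omega> in M. norm (f \<omega> * g \<omega>) \<le> norm (b * g \<omega>)"
    proof (rule AE_I2)
      fix \<omega>
      have "\<bar>f \<omega>\<bar> \<le> \<bar>b\<bar>" using that(3)[of \<omega>] by linarith
      thus "norm (f \<omega> * g \<omega>) \<le> norm (b * g \<omega>)" by (simp add: abs_mult mult_right_mono)
    qed
  qed (use that in auto)
  \<comment> \<open>On \<open>G\<close> the conditional fourth moment of \<open>U t\<close> is at most \<open>B\<close>, and \<open>c t\<close> vanishes off \<open>G\<close>.\<close>
  have f4: "integrable M (\<lambda>\<omega>. (c t \<omega> * U t \<omega>) ^ 4) \<and> (\<integral>\<omega>. (c t \<omega> * U t \<omega>) ^ 4 \<partial>M) \<le> B * \<kappa>\<^sup>2 * (\<integral>\<omega>. (c t \<omega>)\<^sup>2 \<partial>M)"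
    if t: "t \<in> {1..n}" for t
  proof -
    have m4: "(\<lambda>\<omega>. (c t \<omega> * U t \<omega>) ^ 4) \<in> borel_measurable M" using cM[OF t] UM[OF t] by simp
    have "(\<integral>\<^sup>+\<omega>. ennreal ((c t \<omega> * U t \<omega>) ^ 4) \<partial>M) = (\<integral>\<^sup>+\<omega>. ennreal (c t \<omega> ^ 4) * ennreal (U t \<omega> ^ 4) \<partial>M)"
      by (simp add: power_mult_distrib ennreal_mult)
    also have "\<dots> = (\<integral>\<^sup>+\<omega>. ennreal (c t \<omega> ^ 4) * nn_cond_exp M Fa (\<lambda>\<omega>. ennreal (U t \<omega> ^ 4)) \<omega> \<partial>M)"
      by (rule Fa.nn_cond_exp_intg[symmetric]) (use c(1)[OF t] UM[OF t] in auto)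
    also have "\<dots> \<le> (\<integral>\<^sup>+\<omega>. ennreal (B * \<kappa>\<^sup>2 * (c t \<omega>)\<^sup>2) \<partial>M)"
    proof (rule nn_integral_mono)
      fix \<omega>
      show "ennreal (c t \<omega> ^ 4) * nn_cond_exp M Fa (\<lambda>\<omega>. ennreal (U t \<omega> ^ 4)) \<omega> \<le> ennreal (B * \<kappa>\<^sup>2 * (c t \<omega>)\<^sup>2)"
      proof (cases "\<omega> \<in> G")
        case True
        hence "nn_cond_exp M Fa (\<lambda>\<omega>. ennreal (U t \<omega> ^ 4)) \<omega> \<le> ennreal B" using G(2) t by (auto simp: U_regular_def)
        hence "ennreal (c t \<omega> ^ 4) * nn_cond_exp M Fa (\<lambda>\<omega>. ennreal (U t \<omega> ^ 4)) \<omega> \<le> ennreal (c t \<omega> ^ 4) * ennreal B"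
          by (intro mult_left_mono) auto
        also have "\<dots> = ennreal (c t \<omega> ^ 4 * B)" using B by (simp add: ennreal_mult)
        also have "\<dots> \<le> ennreal (B * \<kappa>\<^sup>2 * (c t \<omega>)\<^sup>2)"
        proof (rule ennreal_leI)
          have "(c t \<omega>)\<^sup>2 * (c t \<omega>)\<^sup>2 \<le> \<kappa>\<^sup>2 * (c t \<omega>)\<^sup>2" using c2[OF t] by (intro mult_right_mono) auto
          hence "B * ((c t \<omega>)\<^sup>2 * (c t \<omega>)\<^sup>2) \<le> B * (\<kappa>\<^sup>2 * (c t \<omega>)\<^sup>2)" using B by (intro mult_left_mono) auto
          thus "c t \<omega> ^ 4 * B \<le> B * \<kappa>\<^sup>2 * (c t \<omega>)\<^sup>2" by (simp add: power2_eq_square power4_eq_xxxx mult_ac)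
        qed
        finally show ?thesis .
      qed (simp add: c(3))
    qed
    also have "\<dots> = ennreal (B * \<kappa>\<^sup>2 * (\<integral>\<omega>. (c t \<omega>)\<^sup>2 \<partial>M))"
      using c2i[OF t] B by (subst nn_integral_eq_integral) auto
    finally have "(\<integral>\<^sup>+\<omega>. ennreal ((c t \<omega> * U t \<omega>) ^ 4) \<partial>M) \<le> ennreal (B * \<kappa>\<^sup>2 * (\<integral>\<omega>. (c t \<omega>)\<^sup>2 \<partial>M))" .
    from integrable_of_nn_integral_le[OF m4 _ this] show ?thesis using B by auto
  qed
  have cs: "integrable M (\<lambda>\<omega>. (c t \<omega>)\<^sup>2 * s2 t \<omega>)"
    and csq: "AE \<omega> in M. ((c t \<omega>)\<^sup>2 * s2 t \<omega>)\<^sup>2 \<le> \<kappa>\<^sup>2 * (1 + B) * ((c t \<omega>)\<^sup>2 * s2 t \<omega>)"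
    and cle: "AE \<omega> in M. (c t \<omega>)\<^sup>2 \<le> B * ((c t \<omega>)\<^sup>2 * s2 t \<omega>)" if t: "t \<in> {1..n}" for t
  proof -
    have si: "integrable M (s2 t)"
    proof -
      have "integrable M (sigma2 t)" unfolding sigma2_def by (rule Fa.real_cond_exp_int(1)[OF U_regression_error(2)[OF t]])
      thus ?thesis unfolding s2_def[abs_def] by simp
    qed
    show "integrable M (\<lambda>\<omega>. (c t \<omega>)\<^sup>2 * s2 t \<omega>)"
      by (rule scaled[OF si]) (use cM[OF t] c2[OF t] in \<open>auto intro: order_trans\<close>)
    show "AE \<omega> in M. ((c t \<omega>)\<^sup>2 * s2 t \<omega>)\<^sup>2 \<le> \<kappa>\<^sup>2 * (1 + B) * ((c t \<omega>)\<^sup>2 * s2 t \<omega>)"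
      using sigma2_upper[OF t B]
    proof eventually_elim
      case (elim \<omega>)
      show ?case
      proof (cases "\<omega> \<in> G")
        case True
        hence "s2 t \<omega> \<le> 1 + B" using elim G(2) B by (auto simp: s2_def)
        hence "(c t \<omega>)\<^sup>2 * s2 t \<omega> \<le> \<kappa>\<^sup>2 * (1 + B)" using c2[OF t] s20 by (intro mult_mono) auto
        hence "((c t \<omega>)\<^sup>2 * s2 t \<omega>) * ((c t \<omega>)\<^sup>2 * s2 t \<omega>) \<le> \<kappa>\<^sup>2 * (1 + B) * ((c t \<omega>)\<^sup>2 * s2 t \<omega>)"
          using s20 by (intro mult_right_mono) auto
        thus ?thesis by (simp only: power2_eq_square)
      qed (simp add: c(3))
    qed
    show "AE \<omega> in M. (c t \<omega>)\<^sup>2 \<le> B * ((c t \<omega>)\<^sup>2 * s2 t \<omega>)"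
    proof (rule AE_I2)
      fix \<omega>
      show "(c t \<omega>)\<^sup>2 \<le> B * ((c t \<omega>)\<^sup>2 * s2 t \<omega>)"
      proof (cases "\<omega> \<in> G")
        case True
        hence "1 / B \<le> sigma2 t \<omega>" using G(2) t by (auto simp: U_regular_def)
        hence "1 / B \<le> s2 t \<omega>" by (simp add: s2_def)
        hence "1 \<le> B * s2 t \<omega>" using B by (simp add: field_simps)
        hence "(c t \<omega>)\<^sup>2 * 1 \<le> (c t \<omega>)\<^sup>2 * (B * s2 t \<omega>)" by (intro mult_left_mono) auto
        thus ?thesis by (simp add: mult_ac)
      qed (simp add: c(3))
    qed
  qed
  have total: "AE \<omega> in M. (\<Sum>t=1..n. (c t \<omega>)\<^sup>2 * s2 t \<omega>) = \<tau> * indicator G \<omega>"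
  proof -
    have "AE \<omega> in M. \<forall>t\<in>{1..n}. s2 t \<omega> = sigma2 t \<omega>" by (rule AE_finite_allI) (use s2eq in auto)
    thus ?thesis
    proof eventually_elim
      case (elim \<omega>)
      thus ?case using \<tau>(1)[of \<omega>] by (cases "\<omega> \<in> G") (auto simp: c(3))
    qed
  qed
  have var_sum: "(\<Sum>t=1..n. \<integral>\<omega>. (c t \<omega>)\<^sup>2 * s2 t \<omega> \<partial>M) \<le> \<tau>"
  proof -
    have "(\<Sum>t=1..n. \<integral>\<omega>. (c t \<omega>)\<^sup>2 * s2 t \<omega> \<partial>M) = (\<integral>\<omega>. (\<Sum>t=1..n. (c t \<omega>)\<^sup>2 * s2 t \<omega>) \<partial>M)"
      by (rule Bochner_Integration.integral_sum[symmetric, OF cs])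
    also have "\<dots> = (\<integral>\<omega>. \<tau> * indicator G \<omega> \<partial>M)"
      by (rule integral_cong_AE[OF _ _ total]) (use cs GM in auto)
    also have "\<dots> = \<tau> * prob G" using GM by simp
    also have "\<dots> \<le> \<tau> * 1" using \<tau>(2) by (intro mult_left_mono) auto
    finally show ?thesis by simp
  qed
  have weight_sum: "(\<Sum>t=1..n. \<integral>\<omega>. (c t \<omega>)\<^sup>2 \<partial>M) \<le> B * \<tau>"
  proof -
    have "(\<Sum>t=1..n. \<integral>\<omega>. (c t \<omega>)\<^sup>2 \<partial>M) \<le> (\<Sum>t=1..n. \<integral>\<omega>. B * ((c t \<omega>)\<^sup>2 * s2 t \<omega>) \<partial>M)"
      by (intro sum_mono integral_mono_AE c2i cle) (use cs in auto)
    also have "\<dots> = B * (\<Sum>t=1..n. \<integral>\<omega>. (c t \<omega>)\<^sup>2 * s2 t \<omega> \<partial>M)" by (simp add: sum_distrib_left)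
    also have "\<dots> \<le> B * \<tau>" using B by (intro mult_left_mono var_sum) auto
    finally show ?thesis .
  qed
  have Tn: "t \<in> {1..n}" if "k \<in> {1..N}" "t \<in> T k" for k t by (rule T_range[OF that])
  have \<xi>M: "\<xi> k \<in> borel_measurable M" if k: "k \<in> {1..N}" for k
    unfolding \<xi>_def[abs_def] using cM UM Tn[OF k] by (intro borel_measurable_sum borel_measurable_times) auto
  have sF: "s k \<in> borel_measurable Fa" if k: "k \<in> {1..N}" for k
    unfolding s_def[abs_def] using c(1) s2F Tn[OF k] by (intro borel_measurable_sum borel_measurable_times borel_measurable_power) auto
  have s0: "s k \<omega> \<ge> 0" for k \<omega> unfolding s_def by (intro sum_nonneg mult_nonneg_nonneg s20) simp
  have \<xi>4: "integrable M (\<lambda>\<omega>. \<xi> k \<omega> ^ 4)"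
    and \<xi>4b: "(\<integral>\<omega>. \<xi> k \<omega> ^ 4 \<partial>M) \<le> real L ^ 3 * (\<Sum>t\<in>T k. B * \<kappa>\<^sup>2 * (\<integral>\<omega>. (c t \<omega>)\<^sup>2 \<partial>M))" if k: "k \<in> {1..N}" for k
  proof -
    have le: "\<xi> k \<omega> ^ 4 \<le> real L ^ 3 * (\<Sum>t\<in>T k. (c t \<omega> * U t \<omega>) ^ 4)" for \<omega>
      unfolding \<xi>_def by (rule sum_fourth_le[OF CN.T_finite[OF k] CN.T_card[OF k]])
    have ib: "integrable M (\<lambda>\<omega>. real L ^ 3 * (\<Sum>t\<in>T k. (c t \<omega> * U t \<omega>) ^ 4))"
      using f4 Tn[OF k] by (intro integrable_mult_right Bochner_Integration.integrable_sum) auto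
    show i: "integrable M (\<lambda>\<omega>. \<xi> k \<omega> ^ 4)"
      by (rule Bochner_Integration.integrable_bound[OF ib])
        (use le \<xi>M[OF k] in \<open>auto intro!: AE_I2 intro: order_trans[OF _ abs_ge_self]\<close>)
    have "(\<integral>\<omega>. \<xi> k \<omega> ^ 4 \<partial>M) \<le> (\<integral>\<omega>. real L ^ 3 * (\<Sum>t\<in>T k. (c t \<omega> * U t \<omega>) ^ 4) \<partial>M)"
      by (rule integral_mono[OF i ib le])
    also have "\<dots> = real L ^ 3 * (\<Sum>t\<in>T k. \<integral>\<omega>. (c t \<omega> * U t \<omega>) ^ 4 \<partial>M)"
      using f4 Tn[OF k] by (simp only: integral_mult_right_zero) (subst Bochner_Integration.integral_sum, auto)
    also have "\<dots> \<le> real L ^ 3 * (\<Sum>t\<in>T k. B * \<kappa>\<^sup>2 * (\<integral>\<omega>. (c t \<omega>)\<^sup>2 \<partial>M))"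
      using f4 Tn[OF k] by (intro mult_left_mono sum_mono) auto
    finally show "(\<integral>\<omega>. \<xi> k \<omega> ^ 4 \<partial>M) \<le> real L ^ 3 * (\<Sum>t\<in>T k. B * \<kappa>\<^sup>2 * (\<integral>\<omega>. (c t \<omega>)\<^sup>2 \<partial>M))" .
  qed
  have si2: "integrable M (\<lambda>\<omega>. (s k \<omega>)\<^sup>2)"
    and s2b: "(\<integral>\<omega>. (s k \<omega>)\<^sup>2 \<partial>M) \<le> real L * (\<Sum>t\<in>T k. \<kappa>\<^sup>2 * (1 + B) * (\<integral>\<omega>. (c t \<omega>)\<^sup>2 * s2 t \<omega> \<partial>M))" if k: "k \<in> {1..N}" for k
  proof -
    have "AE \<omega> in M. \<forall>t\<in>T k. ((c t \<omega>)\<^sup>2 * s2 t \<omega>)\<^sup>2 \<le> \<kappa>\<^sup>2 * (1 + B) * ((c t \<omega>)\<^sup>2 * s2 t \<omega>)"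
      by (rule AE_finite_allI[OF CN.T_finite[OF k] csq[OF Tn[OF k]]])
    hence le: "AE \<omega> in M. (s k \<omega>)\<^sup>2 \<le> real L * (\<Sum>t\<in>T k. \<kappa>\<^sup>2 * (1 + B) * ((c t \<omega>)\<^sup>2 * s2 t \<omega>))"
    proof eventually_elim
      case (elim \<omega>)
      have "(s k \<omega>)\<^sup>2 \<le> real L * (\<Sum>t\<in>T k. ((c t \<omega>)\<^sup>2 * s2 t \<omega>)\<^sup>2)"
        unfolding s_def by (rule sum_squared_le[OF CN.T_finite[OF k] CN.T_card[OF k]])
      also have "\<dots> \<le> real L * (\<Sum>t\<in>T k. \<kappa>\<^sup>2 * (1 + B) * ((c t \<omega>)\<^sup>2 * s2 t \<omega>))"
        using elim by (intro mult_left_mono sum_mono) auto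
      finally show ?case .
    qed
    have ib: "integrable M (\<lambda>\<omega>. real L * (\<Sum>t\<in>T k. \<kappa>\<^sup>2 * (1 + B) * ((c t \<omega>)\<^sup>2 * s2 t \<omega>)))"
      using cs Tn[OF k] by (intro integrable_mult_right Bochner_Integration.integrable_sum) auto
    show i: "integrable M (\<lambda>\<omega>. (s k \<omega>)\<^sup>2)"
    proof (rule Bochner_Integration.integrable_bound[OF ib])
      show "AE \<omega> in M. norm ((s k \<omega>)\<^sup>2) \<le> norm (real L * (\<Sum>t\<in>T k. \<kappa>\<^sup>2 * (1 + B) * ((c t \<omega>)\<^sup>2 * s2 t \<omega>)))"
        using le by eventually_elim (simp add: order_trans[OF _ abs_ge_self])
    qed (use Fa_M[OF sF[OF k]] in auto)
    have "(\<integral>\<omega>. (s k \<omega>)\<^sup>2 \<partial>M) \<le> (\<integral>\<omega>. real L * (\<Sum>t\<in>T k. \<kappa>\<^sup>2 * (1 + B) * ((c t \<omega>)\<^sup>2 * s2 t \<omega>)) \<partial>M)"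
      by (rule integral_mono_AE[OF i ib le])
    also have "\<dots> = real L * (\<Sum>t\<in>T k. \<kappa>\<^sup>2 * (1 + B) * (\<integral>\<omega>. (c t \<omega>)\<^sup>2 * s2 t \<omega> \<partial>M))"
      using cs Tn[OF k] by (simp only: integral_mult_right_zero) (subst Bochner_Integration.integral_sum, auto)
    finally show "(\<integral>\<omega>. (s k \<omega>)\<^sup>2 \<partial>M) \<le> real L * (\<Sum>t\<in>T k. \<kappa>\<^sup>2 * (1 + B) * (\<integral>\<omega>. (c t \<omega>)\<^sup>2 * s2 t \<omega> \<partial>M))" .
  qed
  have orth: "(\<integral>\<omega>. p \<omega> * \<xi> k \<omega> \<partial>M) = 0 \<and> (\<integral>\<omega>. p \<omega> * (\<xi> k \<omega>)\<^sup>2 \<partial>M) = (\<integral>\<omega>. p \<omega> * s k \<omega> \<partial>M)"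
    if k: "k \<in> {1..N}" and p: "p \<in> borel_measurable (CN.with_outside (S k) k)" "\<And>\<omega>. \<bar>p \<omega>\<bar> \<le> 1" for k p
  proof
    have pM: "p \<in> borel_measurable M"
      by (rule measurable_from_subalg[OF CN.subalgebra_with_outside[OF S_between(1)[OF k]] p(1)])
    have Uin: "U t \<in> borel_measurable (CN.inside k)" if "t \<in> T k" for t
      by (rule CN.measurable_Cl_inside[OF k U_Cl[OF that]])
    have U1: "integrable M (U t)" if "t \<in> T k" for t
      by (rule square_integrable_imp_integrable[OF UM[OF Tn[OF k that]] U_regression_error(2)[OF Tn[OF k that]]])
    have U2: "integrable M (\<lambda>\<omega>. U t \<omega> * U v \<omega>)" if "t \<in> T k" "v \<in> T k" for t v
      using UM U_regression_error(2) Tn[OF k] that by (intro square_integrable_product) auto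
    have pc: "\<bar>p \<omega> * c t \<omega>\<bar> \<le> \<kappa>" if "t \<in> T k" for t \<omega>
      using mult_mono[OF p(2) c(2)[OF Tn[OF k that]], of \<omega> \<omega>] by (simp add: abs_mult)
    have pcc: "\<bar>p \<omega> * c t \<omega> * c v \<omega>\<bar> \<le> \<kappa> * \<kappa>" if "t \<in> T k" "v \<in> T k" for t v \<omega>
      using mult_mono[OF pc[OF that(1)] c(2)[OF Tn[OF k that(2)]], of \<omega> \<omega>] \<kappa> by (simp add: abs_mult)
    have i1: "integrable M (\<lambda>\<omega>. (p \<omega> * c t \<omega>) * U t \<omega>)" if "t \<in> T k" for t
      by (rule scaled[OF U1[OF that] _ pc[OF that]]) (use pM cM[OF Tn[OF k that]] in auto)
    have i2: "integrable M (\<lambda>\<omega>. (p \<omega> * c t \<omega> * c v \<omega>) * (U t \<omega> * U v \<omega>))" if "t \<in> T k" "v \<in> T k" for t v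
      by (rule scaled[OF U2[OF that] _ pcc[OF that]]) (use pM cM[OF Tn[OF k that(1)]] cM[OF Tn[OF k that(2)]] in auto)
    have z: "(\<integral>\<omega>. (p \<omega> * c t \<omega>) * U t \<omega> \<partial>M) = 0" if t: "t \<in> T k" for t
    proof -
      have "(\<integral>\<omega>. (p \<omega> * c t \<omega>) * U t \<omega> \<partial>M) = (\<integral>\<omega>. (p \<omega> * c t \<omega>) * real_cond_exp M Fa (U t) \<omega> \<partial>M)"
        by (rule integral_within_cluster[OF k U1[OF t] Uin[OF t] _ i1[OF t]])
          (intro borel_measurable_times p(1) FG[OF c(1) k] Tn[OF k t])
      also have "\<dots> = (\<integral>\<omega>. 0 \<partial>M)"
        by (rule integral_cong_AE) (use U_regression_error(4)[OF Tn[OF k t]] pM cM[OF Tn[OF k t]] in auto)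
      finally show ?thesis by simp
    qed
    have e1: "p \<omega> * \<xi> k \<omega> = (\<Sum>t\<in>T k. (p \<omega> * c t \<omega>) * U t \<omega>)" for \<omega> by (simp add: \<xi>_def sum_distrib_left mult.assoc)
    show "(\<integral>\<omega>. p \<omega> * \<xi> k \<omega> \<partial>M) = 0"
    proof -
      have "(\<integral>\<omega>. (\<Sum>t\<in>T k. (p \<omega> * c t \<omega>) * U t \<omega>) \<partial>M) = (\<Sum>t\<in>T k. \<integral>\<omega>. (p \<omega> * c t \<omega>) * U t \<omega> \<partial>M)"
        by (rule Bochner_Integration.integral_sum) (rule i1)
      also have "\<dots> = 0" by (intro sum.neutral ballI z)
      finally show ?thesis unfolding e1 .
    qed
    have zz: "(\<integral>\<omega>. (p \<omega> * c t \<omega> * c v \<omega>) * (U t \<omega> * U v \<omega>) \<partial>M) = (if v = t then (\<integral>\<omega>. p \<omega> * ((c t \<omega>)\<^sup>2 * s2 t \<omega>) \<partial>M) else 0)"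
      if t: "t \<in> T k" and v: "v \<in> T k" for t v
    proof -
      note tn = Tn[OF k t] and vn = Tn[OF k v]
      have "(\<integral>\<omega>. (p \<omega> * c t \<omega> * c v \<omega>) * (U t \<omega> * U v \<omega>) \<partial>M)
          = (\<integral>\<omega>. (p \<omega> * c t \<omega> * c v \<omega>) * real_cond_exp M Fa (\<lambda>\<omega>. U t \<omega> * U v \<omega>) \<omega> \<partial>M)"
        by (rule integral_within_cluster[OF k U2[OF t v] _ _ i2[OF t v]])
          (intro borel_measurable_times p(1) FG[OF c(1) k] tn vn Uin t v)+
      also have "\<dots> = (if v = t then (\<integral>\<omega>. p \<omega> * ((c t \<omega>)\<^sup>2 * s2 t \<omega>) \<partial>M) else 0)"
      proof (cases "v = t")
        case True
        have "(\<integral>\<omega>. (p \<omega> * c t \<omega> * c t \<omega>) * real_cond_exp M Fa (\<lambda>\<omega>. U t \<omega> * U t \<omega>) \<omega> \<partial>M) = (\<integral>\<omega>. p \<omega> * ((c t \<omega>)\<^sup>2 * s2 t \<omega>) \<partial>M)"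
        proof (rule integral_cong_AE)
          show "AE \<omega> in M. (p \<omega> * c t \<omega> * c t \<omega>) * real_cond_exp M Fa (\<lambda>\<omega>. U t \<omega> * U t \<omega>) \<omega> = p \<omega> * ((c t \<omega>)\<^sup>2 * s2 t \<omega>)"
            using s2eq[OF tn] by eventually_elim (simp add: sigma2_def power2_eq_square)
        qed (use pM cM[OF tn] Fa_M[OF s2F] in auto)
        thus ?thesis using True by simp
      next
        case False
        have "(\<integral>\<omega>. (p \<omega> * c t \<omega> * c v \<omega>) * real_cond_exp M Fa (\<lambda>\<omega>. U t \<omega> * U v \<omega>) \<omega> \<partial>M) = (\<integral>\<omega>. 0 \<partial>M)"
        proof (rule integral_cong_AE)
          show "AE \<omega> in M. (p \<omega> * c t \<omega> * c v \<omega>) * real_cond_exp M Fa (\<lambda>\<omega>. U t \<omega> * U v \<omega>) \<omega> = 0"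
            using U_uncorrelated[OF tn vn] False by (auto elim!: eventually_mono)
        qed (use pM cM[OF tn] cM[OF vn] in auto)
        thus ?thesis using False by simp
      qed
      finally show ?thesis .
    qed
    have e2: "p \<omega> * (\<xi> k \<omega>)\<^sup>2 = (\<Sum>t\<in>T k. \<Sum>v\<in>T k. (p \<omega> * c t \<omega> * c v \<omega>) * (U t \<omega> * U v \<omega>))" for \<omega>
      by (simp add: \<xi>_def power2_eq_square sum_product sum_distrib_left mult_ac)
    have "(\<integral>\<omega>. p \<omega> * (\<xi> k \<omega>)\<^sup>2 \<partial>M) = (\<Sum>t\<in>T k. \<Sum>v\<in>T k. \<integral>\<omega>. (p \<omega> * c t \<omega> * c v \<omega>) * (U t \<omega> * U v \<omega>) \<partial>M)"
      unfolding e2 by (subst Bochner_Integration.integral_sum) (auto intro!: Bochner_Integration.integrable_sum i2 sum.cong Bochner_Integration.integral_sum)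
    also have "\<dots> = (\<Sum>t\<in>T k. \<Sum>v\<in>T k. if v = t then (\<integral>\<omega>. p \<omega> * ((c t \<omega>)\<^sup>2 * s2 t \<omega>) \<partial>M) else 0)"
      by (rule sum.cong[OF refl], rule sum.cong[OF refl], rule zz)
    also have "\<dots> = (\<Sum>t\<in>T k. \<integral>\<omega>. p \<omega> * ((c t \<omega>)\<^sup>2 * s2 t \<omega>) \<partial>M)" using CN.T_finite[OF k] by simp
    also have "\<dots> = (\<integral>\<omega>. (\<Sum>t\<in>T k. p \<omega> * ((c t \<omega>)\<^sup>2 * s2 t \<omega>)) \<partial>M)"
      by (rule Bochner_Integration.integral_sum[symmetric], rule scaled[OF cs pM p(2)]) (rule Tn[OF k])
    also have "\<dots> = (\<integral>\<omega>. p \<omega> * s k \<omega> \<partial>M)" by (simp add: s_def sum_distrib_left)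
    finally show "(\<integral>\<omega>. p \<omega> * (\<xi> k \<omega>)\<^sup>2 \<partial>M) = (\<integral>\<omega>. p \<omega> * s k \<omega> \<partial>M)" .
  qed
  have \<xi>G: "\<xi> l \<in> borel_measurable (CN.with_outside (S k) k)" if k: "k \<in> {1..N}" and l: "l \<in> {1..N}" "l \<noteq> k" for k l
    unfolding \<xi>_def[abs_def]
  proof (intro borel_measurable_sum borel_measurable_times)
    fix t assume t: "t \<in> T l"
    show "c t \<in> borel_measurable (CN.with_outside (S k) k)" by (rule FG[OF c(1)[OF Tn[OF l(1) t]] k])
    show "U t \<in> borel_measurable (CN.with_outside (S k) k)"
      by (rule CN.measurable_with_outside(2)[OF S_between(1)[OF k] l U_Cl[OF t]])
  qed
  have \<xi>2: "(\<Sum>k=1..N. \<integral>\<omega>. (\<xi> k \<omega>)\<^sup>2 \<partial>M) \<le> \<tau>"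
  proof -
    have "(\<integral>\<omega>. (\<xi> k \<omega>)\<^sup>2 \<partial>M) = (\<Sum>t\<in>T k. \<integral>\<omega>. (c t \<omega>)\<^sup>2 * s2 t \<omega> \<partial>M)" if k: "k \<in> {1..N}" for k
    proof -
      have "(\<integral>\<omega>. (\<xi> k \<omega>)\<^sup>2 \<partial>M) = (\<integral>\<omega>. s k \<omega> \<partial>M)" using orth[OF k, of "\<lambda>_. 1"] by simp
      also have "\<dots> = (\<Sum>t\<in>T k. \<integral>\<omega>. (c t \<omega>)\<^sup>2 * s2 t \<omega> \<partial>M)"
        unfolding s_def by (rule Bochner_Integration.integral_sum[OF cs]) (rule Tn[OF k])
      finally show ?thesis .
    qed
    hence "(\<Sum>k=1..N. \<integral>\<omega>. (\<xi> k \<omega>)\<^sup>2 \<partial>M) = (\<Sum>t=1..n. \<integral>\<omega>. (c t \<omega>)\<^sup>2 * s2 t \<omega> \<partial>M)"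
      unfolding CN.sum_over_clusters by (intro sum.cong refl)
    thus ?thesis using var_sum by simp
  qed
  have \<xi>4s: "(\<Sum>k=1..N. \<integral>\<omega>. \<xi> k \<omega> ^ 4 \<partial>M) \<le> real L ^ 3 * B\<^sup>2 * \<tau> * \<kappa>\<^sup>2"
  proof -
    have "(\<Sum>k=1..N. \<integral>\<omega>. \<xi> k \<omega> ^ 4 \<partial>M) \<le> (\<Sum>k=1..N. real L ^ 3 * (\<Sum>t\<in>T k. B * \<kappa>\<^sup>2 * (\<integral>\<omega>. (c t \<omega>)\<^sup>2 \<partial>M)))"
      by (intro sum_mono \<xi>4b)
    also have "\<dots> = real L ^ 3 * (B * \<kappa>\<^sup>2 * (\<Sum>t=1..n. \<integral>\<omega>. (c t \<omega>)\<^sup>2 \<partial>M))"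
      by (simp only: CN.sum_over_clusters sum_distrib_left)
    also have "\<dots> \<le> real L ^ 3 * (B * \<kappa>\<^sup>2 * (B * \<tau>))"
      using B by (intro mult_left_mono weight_sum) auto
    finally show ?thesis by (simp add: power2_eq_square mult_ac)
  qed
  have s2s: "(\<Sum>k=1..N. \<integral>\<omega>. (s k \<omega>)\<^sup>2 \<partial>M) \<le> real L * (1 + B) * \<tau> * \<kappa>\<^sup>2"
  proof -
    have "(\<Sum>k=1..N. \<integral>\<omega>. (s k \<omega>)\<^sup>2 \<partial>M) \<le> (\<Sum>k=1..N. real L * (\<Sum>t\<in>T k. \<kappa>\<^sup>2 * (1 + B) * (\<integral>\<omega>. (c t \<omega>)\<^sup>2 * s2 t \<omega> \<partial>M)))"
      by (intro sum_mono s2b)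
    also have "\<dots> = real L * (\<kappa>\<^sup>2 * (1 + B) * (\<Sum>t=1..n. \<integral>\<omega>. (c t \<omega>)\<^sup>2 * s2 t \<omega> \<partial>M))"
      by (simp only: CN.sum_over_clusters sum_distrib_left)
    also have "\<dots> \<le> real L * (\<kappa>\<^sup>2 * (1 + B) * \<tau>)" using B by (intro mult_left_mono var_sum) auto
    finally show ?thesis by (simp add: mult_ac)
  qed
  have "cmod (\<integral>\<omega>. iexp (\<Sum>k=1..N. \<xi> k \<omega>) - exp (- (\<Sum>k=1..N. s k \<omega>) / 2) \<partial>M)
     \<le> (\<Sum>k=1..N. \<kappa> * (\<integral>\<omega>. (\<xi> k \<omega>)\<^sup>2 \<partial>M) + (\<integral>\<omega>. \<xi> k \<omega> ^ 4 \<partial>M) / \<kappa> + (\<integral>\<omega>. (s k \<omega>)\<^sup>2 \<partial>M))"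
  proof (rule conditional_char_telescoping[where G = "\<lambda>k. CN.with_outside (S k) k"])
    show "subalgebra M (CN.with_outside (S k) k)" if "k \<in> {1..N}" for k
      by (rule CN.subalgebra_with_outside[OF S_between(1)[OF that]])
    show "s l \<in> borel_measurable (CN.with_outside (S k) k)" if "k \<in> {1..N}" "l \<in> {1..N}" for k l
      by (rule FG[OF sF[OF that(2)] that(1)])
  qed (use \<xi>G \<xi>M \<xi>4 si2 s0 orth \<kappa> in auto)
  also have "\<dots> = \<kappa> * (\<Sum>k=1..N. \<integral>\<omega>. (\<xi> k \<omega>)\<^sup>2 \<partial>M) + (\<Sum>k=1..N. \<integral>\<omega>. \<xi> k \<omega> ^ 4 \<partial>M) / \<kappa> + (\<Sum>k=1..N. \<integral>\<omega>. (s k \<omega>)\<^sup>2 \<partial>M)"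
    by (simp only: sum.distrib sum_distrib_left sum_divide_distrib)
  also have "\<dots> \<le> \<kappa> * \<tau> + (real L ^ 3 * B\<^sup>2 * \<tau> * \<kappa>\<^sup>2) / \<kappa> + real L * (1 + B) * \<tau> * \<kappa>\<^sup>2"
    using \<kappa> by (intro add_mono mult_left_mono divide_right_mono \<xi>2 \<xi>4s s2s) auto
  also have "(real L ^ 3 * B\<^sup>2 * \<tau> * \<kappa>\<^sup>2) / \<kappa> = real L ^ 3 * B\<^sup>2 * \<tau> * \<kappa>" using \<kappa> by (simp add: power2_eq_square)
  finally have main: "cmod (\<integral>\<omega>. iexp (\<Sum>k=1..N. \<xi> k \<omega>) - exp (- (\<Sum>k=1..N. s k \<omega>) / 2) \<partial>M)
    \<le> \<kappa> * \<tau> + real L ^ 3 * B\<^sup>2 * \<tau> * \<kappa> + real L * (1 + B) * \<tau> * \<kappa>\<^sup>2" .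
  have x1: "(\<Sum>k=1..N. \<xi> k \<omega>) = (\<Sum>t=1..n. c t \<omega> * U t \<omega>)" for \<omega>
    unfolding \<xi>_def by (rule CN.sum_over_clusters[symmetric])
  have x2: "(\<Sum>k=1..N. s k \<omega>) = (\<Sum>t=1..n. (c t \<omega>)\<^sup>2 * s2 t \<omega>)" for \<omega>
    unfolding s_def by (rule CN.sum_over_clusters[symmetric])
  have cuM: "(\<lambda>\<omega>. \<Sum>t=1..n. c t \<omega> * U t \<omega>) \<in> borel_measurable M"
    using cM UM by (intro borel_measurable_sum borel_measurable_times) auto
  have csM: "(\<lambda>\<omega>. \<Sum>t=1..n. (c t \<omega>)\<^sup>2 * s2 t \<omega>) \<in> borel_measurable M"
    using cs by (intro borel_measurable_sum) auto
  have "(\<integral>\<omega>. iexp (\<Sum>k=1..N. \<xi> k \<omega>) - exp (- (\<Sum>k=1..N. s k \<omega>) / 2) \<partial>M)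
     = (\<integral>\<omega>. iexp (\<Sum>t=1..n. c t \<omega> * U t \<omega>) - complex_of_real (exp (- (\<tau> * indicator G \<omega>) / 2)) \<partial>M)"
    unfolding x1 x2
  proof (rule integral_cong_AE)
    show "AE \<omega> in M. iexp (\<Sum>t=1..n. c t \<omega> * U t \<omega>) - complex_of_real (exp (- (\<Sum>t=1..n. (c t \<omega>)\<^sup>2 * s2 t \<omega>) / 2))
       = iexp (\<Sum>t=1..n. c t \<omega> * U t \<omega>) - complex_of_real (exp (- (\<tau> * indicator G \<omega>) / 2))"
      using total by eventually_elim simp
    note [measurable] = cuM csM GM
    show "(\<lambda>\<omega>. iexp (\<Sum>t=1..n. c t \<omega> * U t \<omega>) - complex_of_real (exp (- (\<Sum>t=1..n. (c t \<omega>)\<^sup>2 * s2 t \<omega>) / 2))) \<in> borel_measurable M"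
      by measurable
    show "(\<lambda>\<omega>. iexp (\<Sum>t=1..n. c t \<omega> * U t \<omega>) - complex_of_real (exp (- (\<tau> * indicator G \<omega>) / 2))) \<in> borel_measurable M"
      by measurable
  qed
  thus ?thesis using main by simp
qed

end

section \<open>The event on which the design is well behaved\<close>

lemma sum_matrix_vector_mult:
  fixes f :: "'i \<Rightarrow> real ^ 'n ^ 'n"
  shows "(\<Sum>i\<in>A. f i) *v v = (\<Sum>i\<in>A. f i *v v)"
  by (induction A rule: infinite_finite_induct) (simp_all add: matrix_vector_mult_add_rdistrib)

lemma outer_mult: "outer a *v v = (a \<bullet> v) *\<^sub>R a"
  by (simp add: outer_def matrix_vector_mult_def Finite_Cartesian_Product.vec_eq_iff inner_vec_def sum_distrib_right sum_distrib_left mult_ac)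

lemma weighted_outer_form:
  "v \<bullet> ((c *\<^sub>R (\<Sum>i\<in>A. s i *\<^sub>R outer (a i))) *v v) = c * (\<Sum>i\<in>A. s i * (v \<bullet> a i)\<^sup>2)"
proof -
  have "(c *\<^sub>R (\<Sum>i\<in>A. s i *\<^sub>R outer (a i))) *v v = c *\<^sub>R (\<Sum>i\<in>A. s i *\<^sub>R ((a i \<bullet> v) *\<^sub>R a i))"
    by (simp add: scaleR_matrix_vector_assoc[symmetric] sum_matrix_vector_mult outer_mult)
  thus ?thesis by (simp add: inner_sum_right power2_eq_square inner_commute mult_ac)
qed

lemma transpose_weighted_outer:
  "transpose (c *\<^sub>R (\<Sum>i\<in>A. s i *\<^sub>R outer (a i))) = c *\<^sub>R (\<Sum>i\<in>A. s i *\<^sub>R outer (a i))"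
  by (intro transpose_eqI) (simp add: sum_component outer_def mult_ac)

lemma borel_measurable_outer:
  assumes "f \<in> borel_measurable M" shows "(\<lambda>x. outer (f x)) \<in> borel_measurable M"
  unfolding outer_def using borel_measurable_vec_nth[OF assms]
  by (intro borel_measurable_vec_components) auto

lemma matrix_inv_scaled:
  fixes A :: "real ^ 'n ^ 'n"
  assumes A: "invertible A" and c: "c \<noteq> 0"
  shows "matrix_inv (c *\<^sub>R A) = (1 / c) *\<^sub>R matrix_inv A" "invertible (c *\<^sub>R A)"
proof -
  have 1: "(c *\<^sub>R A) ** ((1 / c) *\<^sub>R matrix_inv A) = mat 1"
    "((1 / c) *\<^sub>R matrix_inv A) ** (c *\<^sub>R A) = mat 1"
    using c matrix_inv_right[OF A] matrix_inv_left[OF A]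
    by (simp_all add: scalar_matrix_assoc[symmetric] matrix_scalar_ac)
  thus i: "invertible (c *\<^sub>R A)" unfolding invertible_def by blast
  have "matrix_inv (c *\<^sub>R A) = matrix_inv (c *\<^sub>R A) ** ((c *\<^sub>R A) ** ((1 / c) *\<^sub>R matrix_inv A))" by (simp only: 1 matrix_mul_rid)
  also have "\<dots> = (1 / c) *\<^sub>R matrix_inv A" by (simp only: matrix_mul_assoc matrix_inv_left[OF i] matrix_mul_lid)
  finally show "matrix_inv (c *\<^sub>R A) = (1 / c) *\<^sub>R matrix_inv A" .
qed

lemma small_bilinear_form:
  fixes v :: "real ^ 'n" and e :: "'n \<Rightarrow> 'n \<Rightarrow> real"
  assumes "\<And>a b. \<bar>e a b\<bar> \<le> \<theta>"
  shows "\<bar>\<Sum>a\<in>UNIV. \<Sum>b\<in>UNIV. v $ a * v $ b * e a b\<bar> \<le> \<theta> * real CARD('n) * (v \<bullet> v)"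
proof -
  have \<theta>: "\<theta> \<ge> 0" using assms[of undefined undefined] by linarith
  have "\<bar>\<Sum>a\<in>UNIV. \<Sum>b\<in>UNIV. v $ a * v $ b * e a b\<bar> \<le> (\<Sum>a\<in>UNIV. \<Sum>b\<in>UNIV. \<bar>v $ a * v $ b * e a b\<bar>)"
    by (rule order_trans[OF sum_abs sum_mono[OF sum_abs]])
  also have "\<dots> \<le> (\<Sum>a\<in>UNIV. \<Sum>b\<in>UNIV. \<bar>v $ a\<bar> * \<bar>v $ b\<bar> * \<theta>)"
    using assms by (intro sum_mono) (simp add: abs_mult mult_left_mono)
  also have "\<dots> = \<theta> * (\<Sum>a\<in>UNIV. \<bar>v $ a\<bar>)\<^sup>2"
    by (simp add: power2_eq_square sum_product sum_distrib_left mult_ac)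
  also have "\<dots> \<le> \<theta> * (real CARD('n) * (\<Sum>a\<in>UNIV. \<bar>v $ a\<bar>\<^sup>2))"
    using \<theta> by (intro mult_left_mono sum_squared_le) auto
  also have "(\<Sum>a\<in>UNIV. \<bar>v $ a\<bar>\<^sup>2) = v \<bullet> v" by (simp add: inner_vec_def power2_eq_square)
  finally show ?thesis by (simp add: mult.assoc)
qed

lemma (in prob_space) prob_abs_greater_le:
  assumes [measurable]: "X \<in> borel_measurable M" and i: "integrable M (\<lambda>x. (X x)\<^sup>2)" and \<theta>: "\<theta> > 0"
  shows "prob {x \<in> space M. \<bar>X x\<bar> > \<theta>} \<le> (\<integral>x. (X x)\<^sup>2 \<partial>M) / \<theta>\<^sup>2"
proof -
  let ?A = "{x \<in> space M. \<bar>X x\<bar> > \<theta>}"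
  have A: "?A \<in> sets M" by measurable
  have "prob ?A = (\<integral>x. indicator ?A x \<partial>M)" using A by simp
  also have "\<dots> \<le> (\<integral>x. (X x)\<^sup>2 / \<theta>\<^sup>2 \<partial>M)"
  proof (rule integral_mono)
    show "integrable M (indicator ?A :: 'a \<Rightarrow> real)" using A by (intro integrable_real_indicator) (auto simp: emeasure_eq_measure)
    show "integrable M (\<lambda>x. (X x)\<^sup>2 / \<theta>\<^sup>2)" using i by simp
    show "indicator ?A x \<le> (X x)\<^sup>2 / \<theta>\<^sup>2" for x
    proof (cases "x \<in> ?A")
      case True
      hence "\<theta>\<^sup>2 \<le> \<bar>X x\<bar>\<^sup>2" using \<theta> by (intro power_mono) auto
      thus ?thesis using True \<theta> by simp
    qed simp
  qed
  finally show ?thesis by simp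
qed

text \<open>
  The bound \<open>C_bound\<close> controls reciprocals in extended arithmetic, where the reciprocal of zero is infinite.
\<close>

lemma inverse_ennreal_le:
  assumes "inverse x \<le> ennreal B" "B > 0"
  shows "ennreal (1 / B) \<le> x"
proof (cases x)
  case (real r)
  show ?thesis
  proof (cases "r = 0")
    case True
    thus ?thesis using assms real by (simp add: top_unique)
  next
    case False
    hence r: "r > 0" using real by simp
    hence "inverse r \<le> B" using assms real by (simp add: inverse_ennreal)
    hence "1 / B \<le> r" using r assms(2) by (simp add: field_simps)
    thus ?thesis using real by (simp add: ennreal_leI)
  qed
qed simp

context regression_sample
begin

abbreviation Gh :: "'a \<Rightarrow> real ^ 'd ^ 'd" where "Gh \<equiv> Gamma_hat n K w' x"
abbreviation Sg :: "'a \<Rightarrow> real ^ 'd ^ 'd" where "Sg \<equiv> Sigma_n M Ws n K w' x y"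

lemma Gh_eq: "Gh \<omega> = (1 / real n) *\<^sub>R (\<Sum>i=1..n. 1 *\<^sub>R outer (v_hat i \<omega>))"
  by (simp add: Gamma_hat_def v_hat_def)

lemma Sg_eq: "Sg \<omega> = (1 / real n) *\<^sub>R (\<Sum>i=1..n. sigma2 i \<omega> *\<^sub>R outer (v_hat i \<omega>))"
  by (simp add: Sigma_n_def v_hat_def sigma2_def)

lemma Gh_form: "v \<bullet> (Gh \<omega> *v v) = (\<Sum>i=1..n. (v \<bullet> v_hat i \<omega>)\<^sup>2) / real n"
  unfolding Gh_eq weighted_outer_form by simp

lemma Sg_form: "v \<bullet> (Sg \<omega> *v v) = (\<Sum>i=1..n. sigma2 i \<omega> * (v \<bullet> v_hat i \<omega>)\<^sup>2) / real n"
  unfolding Sg_eq weighted_outer_form by simp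

lemma Gh_symmetric: "transpose (Gh \<omega>) = Gh \<omega>"
  unfolding Gh_eq by (rule transpose_weighted_outer)

lemma Sg_symmetric: "transpose (Sg \<omega>) = Sg \<omega>"
  unfolding Sg_eq by (rule transpose_weighted_outer)

lemma Gh_Fa: "Gh \<in> borel_measurable Fa"
  unfolding Gh_eq[abs_def] using borel_measurable_outer[OF v_hat_Fa]
  by (intro borel_measurable_scaleR borel_measurable_const borel_measurable_sum) auto

lemma Sg_Fa: "Sg \<in> borel_measurable Fa"
  unfolding Sg_eq[abs_def] sigma2_def using borel_measurable_outer[OF v_hat_Fa]
  by (intro borel_measurable_scaleR borel_measurable_const borel_measurable_sum) auto

lemma lambda_Gh_Fa: "(\<lambda>\<omega>. lambda_min (Gh \<omega>)) \<in> borel_measurable Fa"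
  by (rule borel_measurable_lambda_min_symmetric[OF Gh_Fa Gh_symmetric])

text \<open>
  On the regular event \<open>E[Gt | W]\<close> is at least \<open>1 / B\<close>.  Expanding \<open>v_hat = Vt + Qt\<close>, the deviation of \<open>Gt\<close>
  costs \<open>1 / (6 * B)\<close>, the cross term twice that, and the square of \<open>Qt\<close> helps.
\<close>

lemma Gh_lower_bound:
  assumes H: "\<omega> \<in> W_regular B" and B: "B > 0"
    and dec: "\<And>a. \<forall>i\<in>{1..n}. v_hat i \<omega> $ a = Vt i a \<omega> + Qt i a \<omega>"
    and D: "\<And>a b. \<bar>Gt \<omega> $ a $ b - cond_exp_mat M Wa Gt \<omega> $ a $ b\<bar> \<le> 1 / (6 * B * real CARD('d))"
    and C: "\<And>a b. \<bar>(\<Sum>i=1..n. Vt i a \<omega> * Qt i b \<omega>) / real n\<bar> \<le> 1 / (6 * B * real CARD('d))"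
  shows "1 / (2 * B) \<le> lambda_min (Gh \<omega>)"
  unfolding lambda_min_ge_iff[OF Gh_symmetric]
proof
  fix v :: "real ^ 'd"
  let ?E = "cond_exp_mat M Wa Gt \<omega>" and ?\<theta> = "1 / (6 * B * real CARD('d))"
  have symE: "transpose ?E = ?E" by (rule cond_exp_mat_outer_sum_symmetric[OF Gt_symmetric])
  have form: "v \<bullet> (A *v v) = (\<Sum>a\<in>UNIV. \<Sum>b\<in>UNIV. v $ a * v $ b * A $ a $ b)" for A :: "real ^ 'd ^ 'd"
    by (simp add: inner_vec_def matrix_vector_mult_def sum_distrib_left mult_ac)
  define P where "P i = (\<Sum>a\<in>UNIV. v $ a * Vt i a \<omega>)" for i
  define S where "S i = (\<Sum>a\<in>UNIV. v $ a * Qt i a \<omega>)" for i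
  have vv: "v \<bullet> v_hat i \<omega> = P i + S i" if "i \<in> {1..n}" for i
    using dec that by (simp add: inner_vec_def P_def S_def sum.distrib distrib_left)
  have swap3: "(\<Sum>i=1..n. (\<Sum>a\<in>UNIV. v $ a * f i a) * (\<Sum>b\<in>UNIV. v $ b * g i b)) / real n
     = (\<Sum>a\<in>UNIV. \<Sum>b\<in>UNIV. v $ a * v $ b * ((\<Sum>i=1..n. f i a * g i b) / real n))" for f g :: "nat \<Rightarrow> 'd \<Rightarrow> real"
  proof -
    have "(\<Sum>i=1..n. (\<Sum>a\<in>UNIV. v $ a * f i a) * (\<Sum>b\<in>UNIV. v $ b * g i b))
       = (\<Sum>i=1..n. \<Sum>a\<in>UNIV. \<Sum>b\<in>UNIV. v $ a * v $ b * (f i a * g i b))"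
      by (simp add: sum_product mult_ac)
    also have "\<dots> = (\<Sum>a\<in>UNIV. \<Sum>b\<in>UNIV. \<Sum>i=1..n. v $ a * v $ b * (f i a * g i b))"
      by (rule trans[OF sum.swap sum.cong[OF refl sum.swap]])
    finally show ?thesis by (simp add: sum_distrib_left sum_divide_distrib)
  qed
  have PP: "(\<Sum>i=1..n. (P i)\<^sup>2) / real n = v \<bullet> (Gt \<omega> *v v)"
  proof -
    have "(\<Sum>i=1..n. Vt i a \<omega> * Vt i b \<omega>) / real n = Gt \<omega> $ a $ b" for a b
      by (simp add: Gamma_tilde_def outer_def partial_out_def m_def Vt_def sum_component)
    thus ?thesis unfolding power2_eq_square P_def swap3 form by simp
  qed
  have PS: "\<bar>(\<Sum>i=1..n. P i * S i) / real n\<bar> \<le> ?\<theta> * real CARD('d) * (v \<bullet> v)"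
    unfolding P_def S_def swap3 by (rule small_bilinear_form[OF C])
  have "v \<bullet> (Gt \<omega> *v v) - v \<bullet> (?E *v v) = (\<Sum>a\<in>UNIV. \<Sum>b\<in>UNIV. v $ a * v $ b * (Gt \<omega> $ a $ b - ?E $ a $ b))"
    unfolding form by (simp add: right_diff_distrib sum_subtractf)
  hence good: "\<bar>v \<bullet> (Gt \<omega> *v v) - v \<bullet> (?E *v v)\<bar> \<le> ?\<theta> * real CARD('d) * (v \<bullet> v)"
    using small_bilinear_form[of "\<lambda>a b. Gt \<omega> $ a $ b - ?E $ a $ b", OF D, of v] by simp
  have "1 / B \<le> lambda_min ?E" using H by (simp add: W_regular_def)
  hence E: "1 / B * (v \<bullet> v) \<le> v \<bullet> (?E *v v)" using lambda_min_ge_iff[OF symE] by blast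
  have "(\<Sum>i=1..n. (v \<bullet> v_hat i \<omega>)\<^sup>2) = (\<Sum>i=1..n. (P i)\<^sup>2 + 2 * (P i * S i) + (S i)\<^sup>2)"
    by (intro sum.cong refl) (simp add: vv power2_sum mult_ac)
  also have "\<dots> \<ge> (\<Sum>i=1..n. (P i)\<^sup>2) + 2 * (\<Sum>i=1..n. P i * S i)"
    by (simp add: sum.distrib sum_distrib_left[symmetric] sum_nonneg)
  finally have "(\<Sum>i=1..n. (P i)\<^sup>2) + 2 * (\<Sum>i=1..n. P i * S i) \<le> (\<Sum>i=1..n. (v \<bullet> v_hat i \<omega>)\<^sup>2)" .
  hence "((\<Sum>i=1..n. (P i)\<^sup>2) + 2 * (\<Sum>i=1..n. P i * S i)) / real n \<le> v \<bullet> (Gh \<omega> *v v)"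
    unfolding Gh_form by (intro divide_right_mono) auto
  hence "(\<Sum>i=1..n. (P i)\<^sup>2) / real n + 2 * ((\<Sum>i=1..n. P i * S i) / real n) \<le> v \<bullet> (Gh \<omega> *v v)"
    by (simp add: add_divide_distrib)
  hence "1 / B * (v \<bullet> v) - 3 * (?\<theta> * real CARD('d) * (v \<bullet> v)) \<le> v \<bullet> (Gh \<omega> *v v)"
    using PP PS good E by linarith
  moreover have "1 / B * (v \<bullet> v) - 3 * (?\<theta> * real CARD('d) * (v \<bullet> v)) = 1 / (2 * B) * (v \<bullet> v)"
    using B by (simp add: field_simps)
  ultimately show "1 / (2 * B) * (v \<bullet> v) \<le> v \<bullet> (Gh \<omega> *v v)" by simp
qed

text \<open>
  Chebyshev's bound, over all pairs of coordinates, for the two deviations in \<open>Gh_lower_bound\<close>.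
\<close>

definition gamma_fail :: "real \<Rightarrow> real" where
  "gamma_fail B = (real CARD('d))\<^sup>2 * ((30 * (real L * (1 + B))\<^sup>2 + real L * (1 + B) * chi) * (6 * B * real CARD('d))\<^sup>2) / real n"

lemma prob_Gh_degenerate:
  assumes B: "B > 0"
  shows "prob {\<omega> \<in> space M. \<omega> \<in> W_regular B \<and> lambda_min (Gh \<omega>) < 1 / (2 * B)} \<le> gamma_fail B"
proof -
  let ?\<theta> = "1 / (6 * B * real CARD('d))"
  define X where "X a b \<omega> = indicator (W_regular B) \<omega> * (Gt \<omega> $ a $ b - cond_exp_mat M Wa Gt \<omega> $ a $ b)" for a b \<omega>
  define Y where "Y a b \<omega> = indicator (W_regular B) \<omega> * ((\<Sum>i=1..n. Vt i a \<omega> * Qt i b \<omega>) / real n)" for a b \<omega>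
  note Xb = Gt_concentration[OF B, folded X_def] and Yb = cross_term_bound[OF B, folded Y_def]
  have \<theta>: "?\<theta> > 0" using B by simp
  have XM: "X a b \<in> borel_measurable M" for a b
    unfolding X_def[abs_def] cond_exp_mat_def using Gt_M[of a b] W_regular_M[of B] by simp
  have VtM: "Vt i a \<in> borel_measurable M" if "i \<in> {1..n}" for i a
    unfolding Vt_def[abs_def] using that Wa_M[OF m_Wa] V_M by (intro borel_measurable_sum borel_measurable_times) auto
  have YM: "Y a b \<in> borel_measurable M" for a b
    unfolding Y_def[abs_def] using W_regular_M[of B] VtM Wa_M[OF Qt_Wa]
    by (intro borel_measurable_times borel_measurable_divide borel_measurable_sum borel_measurable_const borel_measurable_indicator) auto
  define AX where "AX ab = {\<omega> \<in> space M. \<bar>X (fst ab) (snd ab) \<omega>\<bar> > ?\<theta>}" for ab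
  define AY where "AY ab = {\<omega> \<in> space M. \<bar>Y (fst ab) (snd ab) \<omega>\<bar> > ?\<theta>}" for ab
  have AXm: "AX ab \<in> sets M" and AYm: "AY ab \<in> sets M" for ab
    unfolding AX_def AY_def using XM[of "fst ab" "snd ab"] YM[of "fst ab" "snd ab"] by measurable
  let ?I = "UNIV :: ('d \<times> 'd) set"
  have "AE \<omega> in M. \<forall>a\<in>(UNIV :: 'd set). \<omega> \<in> W_regular B \<longrightarrow> (\<forall>i\<in>{1..n}. v_hat i \<omega> $ a = Vt i a \<omega> + Qt i a \<omega>)"
    by (rule AE_finite_allI) (use v_hat_decomposition in auto)
  hence incl: "AE \<omega> in M. \<omega> \<in> {\<omega> \<in> space M. \<omega> \<in> W_regular B \<and> lambda_min (Gh \<omega>) < 1 / (2 * B)} \<longrightarrow> \<omega> \<in> (\<Union>ab\<in>?I. AX ab) \<union> (\<Union>ab\<in>?I. AY ab)"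
  proof eventually_elim
    case (elim \<omega>)
    show ?case
    proof (rule impI, rule ccontr)
      assume bad: "\<omega> \<in> {\<omega> \<in> space M. \<omega> \<in> W_regular B \<and> lambda_min (Gh \<omega>) < 1 / (2 * B)}"
        and n: "\<omega> \<notin> (\<Union>ab\<in>?I. AX ab) \<union> (\<Union>ab\<in>?I. AY ab)"
      have x: "\<bar>X a b \<omega>\<bar> \<le> ?\<theta>" and y: "\<bar>Y a b \<omega>\<bar> \<le> ?\<theta>" for a b
        using n bad by (auto simp: AX_def AY_def not_less)
      have "1 / (2 * B) \<le> lambda_min (Gh \<omega>)"
      proof (rule Gh_lower_bound[OF _ B])
        show "\<bar>Gt \<omega> $ a $ b - cond_exp_mat M Wa Gt \<omega> $ a $ b\<bar> \<le> ?\<theta>" for a b using x[of a b] bad by (simp add: X_def)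
        show "\<bar>(\<Sum>i=1..n. Vt i a \<omega> * Qt i b \<omega>) / real n\<bar> \<le> ?\<theta>" for a b using y[of a b] bad by (simp add: Y_def)
      qed (use bad elim in auto)
      thus False using bad by auto
    qed
  qed
  have "prob {\<omega> \<in> space M. \<omega> \<in> W_regular B \<and> lambda_min (Gh \<omega>) < 1 / (2 * B)} \<le> prob ((\<Union>ab\<in>?I. AX ab) \<union> (\<Union>ab\<in>?I. AY ab))"
    by (rule finite_measure_mono_AE[OF incl]) (use AXm AYm in auto)
  also have "\<dots> \<le> prob (\<Union>ab\<in>?I. AX ab) + prob (\<Union>ab\<in>?I. AY ab)"
    by (rule measure_Un_le) (use AXm AYm in auto)
  also have "\<dots> \<le> (\<Sum>ab\<in>?I. prob (AX ab)) + (\<Sum>ab\<in>?I. prob (AY ab))"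
    by (intro add_mono measure_UNION_le) (use AXm AYm in auto)
  also have "\<dots> \<le> (\<Sum>ab\<in>?I. (30 * (real L * (1 + B))\<^sup>2 / real n) / ?\<theta>\<^sup>2) + (\<Sum>ab\<in>?I. (real L * (1 + B) * chi / real n) / ?\<theta>\<^sup>2)"
  proof (intro add_mono sum_mono)
    fix ab :: "'d \<times> 'd"
    show "prob (AX ab) \<le> (30 * (real L * (1 + B))\<^sup>2 / real n) / ?\<theta>\<^sup>2"
      unfolding AX_def by (rule order_trans[OF prob_abs_greater_le[OF XM Xb(1) \<theta>] divide_right_mono[OF Xb(2)]]) simp
    show "prob (AY ab) \<le> (real L * (1 + B) * chi / real n) / ?\<theta>\<^sup>2"
      unfolding AY_def by (rule order_trans[OF prob_abs_greater_le[OF YM Yb(1) \<theta>] divide_right_mono[OF Yb(2)]]) simp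
  qed
  also have "\<dots> = gamma_fail B"
    using B n_pos by (simp add: gamma_fail_def power_divide power2_eq_square[of "real CARD('d)"] card_cartesian_product add_divide_distrib[symmetric] ring_distribs)
  finally show ?thesis .
qed

text \<open>
  All requirements on the design in one event known given \<open>X\<close> and \<open>W\<close>, so that its indicator may be
  absorbed into the weights of the score.
\<close>

definition good :: "real \<Rightarrow> real \<Rightarrow> 'a set" where
  "good B \<epsilon> = W_regular B \<inter> U_regular B \<inter> {\<omega> \<in> space M. \<forall>i\<in>{1..n}. norm (v_hat i \<omega>) \<le> \<epsilon> * sqrt (real n)}
     \<inter> {\<omega> \<in> space M. 1 / (2 * B) \<le> lambda_min (Gh \<omega>)}"

lemma good_Fa: "good B \<epsilon> \<in> sets Fa"
proof -
  have "{\<omega> \<in> space Fa. \<forall>i\<in>{1..n}. norm (v_hat i \<omega>) \<le> \<epsilon> * sqrt (real n)} \<in> sets Fa"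
    using v_hat_Fa n1 by (intro sets.sets_Collect_finite_All' borel_measurable_le borel_measurable_norm) auto
  moreover have "{\<omega> \<in> space Fa. 1 / (2 * B) \<le> lambda_min (Gh \<omega>)} \<in> sets Fa"
    by (intro borel_measurable_le borel_measurable_const lambda_Gh_Fa)
  moreover have "W_regular B \<in> sets Fa" using W_regular_Wa[of B] subalgebra_Fa_Wa unfolding subalgebra_def by blast
  ultimately show ?thesis unfolding good_def space_Fa using U_regular_Fa by (intro sets.Int)
qed

lemma partial_out_M:
  assumes z: "\<And>j. j \<in> {1..n} \<Longrightarrow> z j \<in> borel_measurable M" and i: "i \<in> {1..n}"
  shows "partial_out n K w z i \<in> borel_measurable M"
  unfolding partial_out_def[abs_def]
  by (intro borel_measurable_sum borel_measurable_scaleR borel_measurable_annihilator[OF w_dim w_meas] i z)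

text \<open>
  The quantities of the theorem are built from \<open>w\<close>, those of the proof from \<open>w'\<close>; they agree almost everywhere.
\<close>

lemma Gamma_tilde_w:
  "AE \<omega> in M. cond_exp_mat M Wa (Gamma_tilde M Ws n K w x) \<omega> = cond_exp_mat M Wa Gt \<omega>"
proof -
  have eq: "AE \<omega> in M. Gamma_tilde M Ws n K w x \<omega> = Gt \<omega>"
    using AE_w' unfolding Gamma_tilde_def
    by eventually_elim (intro arg_cong[of _ _ "scaleR _"] sum.cong refl arg_cong[of _ _ outer] partial_out_cong, auto)
  have m: "Gamma_tilde M Ws n K w x \<in> borel_measurable M"
    unfolding Gamma_tilde_def[abs_def]
    by (intro borel_measurable_scaleR borel_measurable_const borel_measurable_sum borel_measurable_outer partial_out_M V_vec_M)
  have "AE \<omega> in M. \<forall>ab\<in>(UNIV :: ('d \<times> 'd) set). real_cond_exp M Wa (\<lambda>\<omega>. Gamma_tilde M Ws n K w x \<omega> $ fst ab $ snd ab) \<omega>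
      = real_cond_exp M Wa (\<lambda>\<omega>. Gt \<omega> $ fst ab $ snd ab) \<omega>"
  proof (rule AE_finite_allI)
    fix ab :: "'d \<times> 'd"
    show "AE \<omega> in M. real_cond_exp M Wa (\<lambda>\<omega>. Gamma_tilde M Ws n K w x \<omega> $ fst ab $ snd ab) \<omega>
      = real_cond_exp M Wa (\<lambda>\<omega>. Gt \<omega> $ fst ab $ snd ab) \<omega>"
      by (rule Wa.real_cond_exp_cong) (use eq Gt_M borel_measurable_vec_nth[OF borel_measurable_vec_nth[OF m]] in \<open>auto elim: eventually_mono\<close>)
  qed simp
  thus ?thesis by eventually_elim (simp add: cond_exp_mat_def Finite_Cartesian_Product.vec_eq_iff)
qed

lemma C_bound_M: "C_bound M Ws n K w x y \<in> borel_measurable M"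
proof -
  have m: "Gamma_tilde M Ws n K w x \<omega> $ a $ b = Gamma_tilde M Ws n K w x \<omega> $ b $ a" for \<omega> a b
    by (simp add: Gamma_tilde_def outer_def sum_component mult.commute)
  have "(\<lambda>\<omega>. lambda_min (cond_exp_mat M Wa (Gamma_tilde M Ws n K w x) \<omega>)) \<in> borel_measurable Wa"
    by (rule borel_measurable_lambda_min_symmetric[OF borel_measurable_cond_exp_mat cond_exp_mat_outer_sum_symmetric[OF m]])
  hence [measurable]: "(\<lambda>\<omega>. lambda_min (cond_exp_mat M Wa (Gamma_tilde M Ws n K w x) \<omega>)) \<in> borel_measurable M"
    by (rule Wa_M)
  show ?thesis unfolding C_bound_def[abs_def]
    by (intro borel_measurable_add borel_measurable_Max borel_measurable_inverse_ennreal measurable_compose[OF _ measurable_ennreal] borel_measurable_nn_cond_exp2) auto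
qed

text \<open>
  Each requirement of the good event is controlled by one hypothesis: the bounded conditional moments, the
  rank of the Gram matrix, the uniform negligibility of the residuals; the last term is the failure of
  concentration.
\<close>

lemma prob_not_good:
  assumes B: "B > 0" and \<epsilon>: "\<epsilon> > 0"
  shows "prob (space M - good B \<epsilon>) \<le> prob {\<omega> \<in> space M. C_bound M Ws n K w x y \<omega> > ennreal B}
    + prob {\<omega> \<in> space M. det (gram n K w \<omega>) = 0}
    + prob {\<omega> \<in> space M. \<bar>(MAX i\<in>{1..n}. norm (partial_out n K w x i \<omega>)) / sqrt (real n)\<bar> > \<epsilon>}
    + gamma_fail B"
proof -
  define E1 where "E1 = {\<omega> \<in> space M. C_bound M Ws n K w x y \<omega> > ennreal B}"
  define E2 where "E2 = {\<omega> \<in> space M. det (gram n K w \<omega>) = 0}"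
  define E3 where "E3 = {\<omega> \<in> space M. \<bar>(MAX i\<in>{1..n}. norm (partial_out n K w x i \<omega>)) / sqrt (real n)\<bar> > \<epsilon>}"
  define E4 where "E4 = {\<omega> \<in> space M. \<omega> \<in> W_regular B \<and> lambda_min (Gh \<omega>) < 1 / (2 * B)}"
  have m1: "E1 \<in> sets M" unfolding E1_def using C_bound_M by (intro borel_measurable_less) auto
  have m2: "E2 \<in> sets M" unfolding E2_def using borel_measurable_det_gram[OF w_dim w_meas] by (intro borel_measurable_eq) auto
  have m3: "E3 \<in> sets M" unfolding E3_def
    using partial_out_M[OF x_meas]
    by (intro borel_measurable_less borel_measurable_const borel_measurable_abs borel_measurable_divide borel_measurable_Max borel_measurable_norm) auto
  have m4: "E4 \<in> sets M"
  proof -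
    have "{\<omega> \<in> space M. lambda_min (Gh \<omega>) < 1 / (2 * B)} \<in> sets M" using Fa_M[OF lambda_Gh_Fa] by (intro borel_measurable_less) auto
    moreover have "E4 = W_regular B \<inter> {\<omega> \<in> space M. lambda_min (Gh \<omega>) < 1 / (2 * B)}" by (auto simp: E4_def W_regular_def)
    ultimately show ?thesis using W_regular_M by simp
  qed
  have s2: "AE \<omega> in M. \<forall>t\<in>{1..n}. nn_cond_exp M Fa (\<lambda>\<omega>. ennreal ((U t \<omega>)\<^sup>2)) \<omega> = ennreal (sigma2 t \<omega>)"
    by (rule AE_finite_allI) (use sigma2_nn in auto)
  have incl: "AE \<omega> in M. \<omega> \<in> space M - good B \<epsilon> \<longrightarrow> \<omega> \<in> E1 \<union> E2 \<union> E3 \<union> E4"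
    using AE_w' Gamma_tilde_w s2
  proof eventually_elim
    case (elim \<omega>)
    note ww = elim(1) and gt = elim(2) and s2 = elim(3)
    show ?case
    proof (rule impI, rule ccontr)
      assume g: "\<omega> \<in> space M - good B \<epsilon>" and n: "\<omega> \<notin> E1 \<union> E2 \<union> E3 \<union> E4"
      have sp: "\<omega> \<in> space M" using g by simp
      let ?f = "\<lambda>i. nn_cond_exp M Fa (\<lambda>\<omega>. ennreal (U i \<omega> ^ 4)) \<omega> + nn_cond_exp M Wa (\<lambda>\<omega>. ennreal (norm (V i \<omega>) ^ 4)) \<omega>
          + inverse (nn_cond_exp M Fa (\<lambda>\<omega>. ennreal ((U i \<omega>)\<^sup>2)) \<omega>)"
      have C: "C_bound M Ws n K w x y \<omega> \<le> ennreal B" using n sp by (auto simp: E1_def not_less)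
      have Cm: "(MAX i\<in>{1..n}. ?f i) \<le> ennreal B" and Cl: "inverse (ennreal (lambda_min (cond_exp_mat M Wa Gt \<omega>))) \<le> ennreal B"
        using C unfolding C_bound_def gt by (auto intro: order_trans[rotated])
      have fi: "?f i \<le> ennreal B" if "i \<in> {1..n}" for i
        by (rule order_trans[OF Max_ge Cm]) (use that in auto)
      have fparts: "nn_cond_exp M Fa (\<lambda>\<omega>. ennreal (U i \<omega> ^ 4)) \<omega> \<le> ennreal B"
        "nn_cond_exp M Wa (\<lambda>\<omega>. ennreal (norm (V i \<omega>) ^ 4)) \<omega> \<le> ennreal B"
        "inverse (nn_cond_exp M Fa (\<lambda>\<omega>. ennreal ((U i \<omega>)\<^sup>2)) \<omega>) \<le> ennreal B" if "i \<in> {1..n}" for i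
        using fi[OF that] by (auto intro: order_trans[rotated] simp: add_increasing add_increasing2)
      have sig: "1 / B \<le> sigma2 i \<omega>" if "i \<in> {1..n}" for i
      proof -
        have "ennreal (1 / B) \<le> ennreal (sigma2 i \<omega>)"
          using inverse_ennreal_le[OF fparts(3)[OF that] B] s2 that by simp
        thus ?thesis using B by (simp add: ennreal_le_iff2)
      qed
      have lam: "1 / B \<le> lambda_min (cond_exp_mat M Wa Gt \<omega>)"
      proof -
        have "ennreal (1 / B) \<le> ennreal (lambda_min (cond_exp_mat M Wa Gt \<omega>))" by (rule inverse_ennreal_le[OF Cl B])
        thus ?thesis using B by (simp add: ennreal_le_iff2)
      qed
      have det: "det (gram n K w' \<omega>) \<noteq> 0" using n sp gram_cong[of \<omega>] ww by (auto simp: E2_def)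
      have H: "\<omega> \<in> W_regular B" unfolding W_regular_def using sp det fparts(2) lam by auto
      have UR: "\<omega> \<in> U_regular B" unfolding U_regular_def using sp fparts(1) sig by auto
      have "\<not> \<epsilon> < \<bar>(MAX i\<in>{1..n}. norm (partial_out n K w x i \<omega>)) / sqrt (real n)\<bar>"
        using n sp unfolding E3_def by blast
      hence mx: "(MAX i\<in>{1..n}. norm (partial_out n K w x i \<omega>)) / sqrt (real n) \<le> \<epsilon>" by linarith
      have vb: "norm (v_hat i \<omega>) \<le> \<epsilon> * sqrt (real n)" if i: "i \<in> {1..n}" for i
      proof -
        have "norm (v_hat i \<omega>) = norm (partial_out n K w x i \<omega>)"
          using partial_out_cong[of \<omega> i x] ww i by (simp add: v_hat_def)
        also have "\<dots> \<le> (MAX i\<in>{1..n}. norm (partial_out n K w x i \<omega>))" by (rule Max_ge) (use i in auto)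
        also have "\<dots> \<le> \<epsilon> * sqrt (real n)" using mx n_pos by (simp add: divide_le_eq)
        finally show ?thesis .
      qed
      have "1 / (2 * B) \<le> lambda_min (Gh \<omega>)" using n sp H by (auto simp: E4_def not_less)
      hence "\<omega> \<in> good B \<epsilon>" unfolding good_def using H UR vb sp by auto
      thus False using g by simp
    qed
  qed
  have "prob (space M - good B \<epsilon>) \<le> prob (E1 \<union> E2 \<union> E3 \<union> E4)"
    by (rule finite_measure_mono_AE[OF incl]) (use m1 m2 m3 m4 in auto)
  also have "\<dots> \<le> prob (E1 \<union> E2 \<union> E3) + prob E4" by (rule measure_Un_le) (use m1 m2 m3 m4 in auto)
  also have "prob (E1 \<union> E2 \<union> E3) \<le> prob (E1 \<union> E2) + prob E3" by (rule measure_Un_le) (use m1 m2 m3 m4 in auto)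
  also have "prob (E1 \<union> E2) \<le> prob E1 + prob E2" by (rule measure_Un_le) (use m1 m2 m3 m4 in auto)
  also have "prob E4 \<le> gamma_fail B" unfolding E4_def by (rule prob_Gh_degenerate[OF B])
  finally show ?thesis unfolding E1_def E2_def E3_def by simp
qed

end

section \<open>The studentized estimator\<close>

lemma cmod_iexp_diff_le: "cmod (iexp a - iexp b) \<le> \<bar>a - b\<bar>"
proof -
  have "iexp a - iexp b = iexp b * (iexp (a - b) - 1)"
    by (simp add: right_diff_distrib exp_add[symmetric] algebra_simps)
  hence "cmod (iexp a - iexp b) = cmod (iexp (a - b) - 1)" by (simp add: norm_mult)
  also have "\<dots> \<le> \<bar>a - b\<bar>" using iexp_approx1[of "a - b" 0] by simp
  finally show ?thesis .
qed

lemma borel_measurable_vec_mat_mult: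
  fixes f :: "'a \<Rightarrow> real ^ 'n ^ 'n"
  assumes "f \<in> borel_measurable M"
  shows "(\<lambda>x. t v* f x) \<in> borel_measurable M"
  using assms unfolding vector_matrix_mult_def
  by (intro borel_measurable_vec_components) (auto intro!: borel_measurable_sum borel_measurable_times borel_measurable_vec_nth)

context regression_sample
begin

definition studentizer :: "'a \<Rightarrow> real ^ 'd ^ 'd" where
  "studentizer \<omega> = inv_sqrt (matrix_inv (Gh \<omega>) ** Sg \<omega> ** matrix_inv (Gh \<omega>)) ** matrix_inv (Gh \<omega>)"

text \<open>
  The coefficient of \<open>U i\<close> in \<open>t \<bullet> statistic\<close> on the good event.  Setting it to zero elsewhere makes it
  bounded everywhere.
\<close>

definition weight :: "real \<Rightarrow> real \<Rightarrow> real ^ 'd \<Rightarrow> nat \<Rightarrow> 'a \<Rightarrow> real" where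
  "weight B \<epsilon> t i \<omega> = indicator (good B \<epsilon>) \<omega> * ((t v* studentizer \<omega>) \<bullet> v_hat i \<omega> / sqrt (real n))"

definition statistic :: "'a \<Rightarrow> real ^ 'd" where
  "statistic \<omega> = inv_sqrt (Omega_n M Ws n K w x y \<omega>) *v (sqrt (real n) *\<^sub>R (beta_hat n K w x y \<omega> - \<beta>))"

lemma studentizer_Fa: "studentizer \<in> borel_measurable Fa"
  unfolding studentizer_def[abs_def]
  by (intro borel_measurable_mat_mult borel_measurable_inv_sqrt borel_measurable_matrix_inv Gh_Fa Sg_Fa)

lemma weight_Fa: "i \<in> {1..n} \<Longrightarrow> weight B \<epsilon> t i \<in> borel_measurable Fa"
  unfolding weight_def[abs_def]
  by (intro borel_measurable_times borel_measurable_indicator good_Fa borel_measurable_divide borel_measurable_const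
      borel_measurable_inner borel_measurable_vec_mat_mult studentizer_Fa v_hat_Fa)

text \<open>
  On the good event \<open>Sigma_n\<close> is at least \<open>1 / B\<close> times \<open>Gamma_hat\<close>, since each conditional error variance
  is at least \<open>1 / B\<close>.
\<close>

lemma studentizer_on_good:
  assumes \<omega>: "\<omega> \<in> good B \<epsilon>" and B: "B > 0"
  shows "invertible (Gh \<omega>)"
    and "(t v* studentizer \<omega>) \<bullet> (Sg \<omega> *v (t v* studentizer \<omega>)) = t \<bullet> t"
    and "norm (t v* studentizer \<omega>) \<le> 2 * B * norm t"
proof -
  have G: "1 / (2 * B) * (v \<bullet> v) \<le> v \<bullet> (Gh \<omega> *v v)" for v
    using \<omega> lambda_min_ge_iff[OF Gh_symmetric] unfolding good_def by blast
  show inv: "invertible (Gh \<omega>)" using B by (intro pos_def_invertible[where d = "1 / (2 * B)", OF G]) simp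
  have s: "1 / B \<le> sigma2 i \<omega>" if "i \<in> {1..n}" for i using \<omega> that by (auto simp: good_def U_regular_def)
  have S: "1 / (2 * B\<^sup>2) * (v \<bullet> v) \<le> v \<bullet> (Sg \<omega> *v v)" for v
  proof -
    have "1 / (2 * B\<^sup>2) * (v \<bullet> v) = 1 / B * (1 / (2 * B) * (v \<bullet> v))" by (simp add: power2_eq_square)
    also have "\<dots> \<le> 1 / B * (v \<bullet> (Gh \<omega> *v v))" using B by (intro mult_left_mono G) simp
    also have "\<dots> = (\<Sum>i=1..n. 1 / B * (v \<bullet> v_hat i \<omega>)\<^sup>2) / real n" unfolding Gh_form by (simp add: sum_distrib_left)
    also have "\<dots> \<le> v \<bullet> (Sg \<omega> *v v)" unfolding Sg_form using s
      by (intro divide_right_mono sum_mono mult_right_mono) auto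
    finally show ?thesis .
  qed
  have s0: "1 / (2 * B\<^sup>2) > 0" using B by simp
  note sw = inv_sqrt_sandwich[OF Gh_symmetric inv Sg_symmetric S s0, of t, folded studentizer_def]
  show "(t v* studentizer \<omega>) \<bullet> (Sg \<omega> *v (t v* studentizer \<omega>)) = t \<bullet> t" by (rule sw(1))
  let ?a = "t v* studentizer \<omega>"
  have "z = 2 * B\<^sup>2 * (1 / (2 * B\<^sup>2) * z)" for z :: real using B by simp
  hence "?a \<bullet> ?a = 2 * B\<^sup>2 * (1 / (2 * B\<^sup>2) * (?a \<bullet> ?a))" .
  also have "\<dots> \<le> 2 * B\<^sup>2 * (t \<bullet> t)" by (rule mult_left_mono[OF sw(2)]) simp
  finally have "(norm ?a)\<^sup>2 \<le> 2 * B\<^sup>2 * (norm t)\<^sup>2" unfolding power2_norm_eq_inner .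
  also have "\<dots> \<le> (2 * B * norm t)\<^sup>2" by (simp add: power_mult_distrib mult_right_mono)
  finally show "norm (t v* studentizer \<omega>) \<le> 2 * B * norm t" by (rule power2_le_imp_le) (use B in simp)
qed

lemma weight_bound:
  assumes B: "B > 0" and \<epsilon>: "\<epsilon> > 0" and i: "i \<in> {1..n}"
  shows "\<bar>weight B \<epsilon> t i \<omega>\<bar> \<le> 2 * B * (norm t + 1) * \<epsilon>"
proof (cases "\<omega> \<in> good B \<epsilon>")
  case True
  have "\<bar>(t v* studentizer \<omega>) \<bullet> v_hat i \<omega>\<bar> \<le> norm (t v* studentizer \<omega>) * norm (v_hat i \<omega>)" by (rule Cauchy_Schwarz_ineq2)
  also have "\<dots> \<le> (2 * B * norm t) * (\<epsilon> * sqrt (real n))"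
    using studentizer_on_good(3)[OF True B] True i B by (intro mult_mono) (auto simp: good_def)
  also have "\<dots> \<le> (2 * B * (norm t + 1)) * (\<epsilon> * sqrt (real n))"
    using B \<epsilon> by (intro mult_right_mono mult_left_mono) auto
  finally show ?thesis using True n_pos by (simp add: weight_def divide_le_eq mult.assoc)
qed (use B \<epsilon> in \<open>simp add: weight_def\<close>)

lemma weight_variance:
  assumes "\<omega> \<in> good B \<epsilon>" and B: "B > 0"
  shows "(\<Sum>i=1..n. (weight B \<epsilon> t i \<omega>)\<^sup>2 * sigma2 i \<omega>) = t \<bullet> t"
proof -
  have "(\<Sum>i=1..n. (weight B \<epsilon> t i \<omega>)\<^sup>2 * sigma2 i \<omega>)
      = (\<Sum>i=1..n. sigma2 i \<omega> * ((t v* studentizer \<omega>) \<bullet> v_hat i \<omega>)\<^sup>2 / real n)"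
    using assms(1) n_pos by (intro sum.cong refl) (simp add: weight_def power_divide mult.commute)
  thus ?thesis using studentizer_on_good(2)[OF assms, of t] unfolding Sg_form by (simp add: sum_divide_distrib)
qed

text \<open>
  The normal equations: on the good event the covariates drop out, \<open>\<beta>\<close> is reproduced exactly, and the
  estimation error is linear in \<open>u = U + R\<close>.
\<close>

lemma statistic_eq:
  assumes B: "B > 0"
  shows "AE \<omega> in M. \<omega> \<in> good B \<epsilon> \<longrightarrow> t \<bullet> statistic \<omega> = (\<Sum>i=1..n. weight B \<epsilon> t i \<omega> * (U i \<omega> + R i \<omega>))"
proof -
  have "AE \<omega> in M. \<forall>i\<in>{1..n}. u i \<omega> = U i \<omega> + R i \<omega>"
    by (rule AE_finite_allI) (use U_regression_error(3) in auto)
  thus ?thesis using AE_w' AE_space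
  proof eventually_elim
    case (elim \<omega>)
    note u = elim(1) and ww = elim(2) and sp = elim(3)
    show ?case
    proof
      assume \<omega>: "\<omega> \<in> good B \<epsilon>"
      note inv = studentizer_on_good(1)[OF \<omega> B]
      let ?v = "\<lambda>i. v_hat i \<omega>"
      have vh: "partial_out n K w x i \<omega> = ?v i" if "i \<in> {1..n}" for i
        using partial_out_cong[of \<omega> i x] ww that by (simp only: v_hat_def)
      have det: "det (gram n K w' \<omega>) \<noteq> 0" using \<omega> by (simp add: good_def W_regular_def)
      have G: "Gamma_hat n K w x \<omega> = Gh \<omega>" and S: "Sigma_n M Ws n K w x y \<omega> = Sg \<omega>"
        and P: "(\<Sum>i=1..n. outer (partial_out n K w x i \<omega>)) = real n *\<^sub>R Gh \<omega>"
        unfolding Gh_eq Sg_eq unfolding Gamma_hat_def Sigma_n_def sigma2_def using vh n_pos by simp_all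
      have Y: "(\<Sum>i=1..n. y i \<omega> *\<^sub>R partial_out n K w x i \<omega>) = (real n *\<^sub>R Gh \<omega>) *v \<beta> + (\<Sum>i=1..n. u i \<omega> *\<^sub>R ?v i)"
      proof -
        have "(\<Sum>i=1..n. scalar_prod \<gamma> (w' i \<omega>) *\<^sub>R ?v i) $ a = 0" for a
        proof -
          have "(\<Sum>i=1..n. scalar_prod \<gamma> (w' i \<omega>) *\<^sub>R ?v i) $ a
              = (\<Sum>i=1..n. \<Sum>j=1..n. scalar_prod \<gamma> (w' i \<omega>) * (m i j \<omega> * x j \<omega> $ a))"
            by (simp add: sum_component v_hat_component sum_distrib_left)
          also have "\<dots> = (\<Sum>j=1..n. x j \<omega> $ a * (\<Sum>i=1..n. m j i \<omega> * scalar_prod \<gamma> (w' i \<omega>)))"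
            unfolding sum_distrib_left by (subst sum.swap) (intro sum.cong refl, simp add: m_sym)
          also have "\<dots> = 0" by (intro sum.neutral ballI) (simp only: m_covariates[OF det _ gamma_dim] mult_zero_right)
          finally show ?thesis .
        qed
        hence c: "(\<Sum>i=1..n. scalar_prod \<gamma> (w' i \<omega>) *\<^sub>R ?v i) = 0" by (simp add: Finite_Cartesian_Product.vec_eq_iff)
        have xv: "\<beta> \<bullet> ?v i = (\<Sum>j=1..n. m i j \<omega> * (\<beta> \<bullet> x j \<omega>))" for i
          by (simp add: v_hat_def partial_out_def m_def inner_sum_right)
        have "(\<Sum>i=1..n. (\<beta> \<bullet> x i \<omega>) *\<^sub>R ?v i) $ a = ((real n *\<^sub>R Gh \<omega>) *v \<beta>) $ a" for a
        proof -
          have "((real n *\<^sub>R Gh \<omega>) *v \<beta>) $ a = (\<Sum>i=1..n. (\<beta> \<bullet> ?v i) * ?v i $ a)"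
            unfolding Gh_eq using n_pos
            by (simp add: sum_matrix_vector_mult outer_mult sum_component inner_commute)
          also have "\<dots> = (\<Sum>i=1..n. (\<beta> \<bullet> x i \<omega>) * ?v i $ a)"
            unfolding xv unfolding v_hat_component by (rule m_inner)
          finally show ?thesis by (simp add: sum_component)
        qed
        hence b: "(\<Sum>i=1..n. (\<beta> \<bullet> x i \<omega>) *\<^sub>R ?v i) = (real n *\<^sub>R Gh \<omega>) *v \<beta>" by (simp add: Finite_Cartesian_Product.vec_eq_iff)
        have "(\<Sum>i=1..n. y i \<omega> *\<^sub>R partial_out n K w x i \<omega>)
            = (\<Sum>i=1..n. (\<beta> \<bullet> x i \<omega>) *\<^sub>R ?v i + scalar_prod \<gamma> (w' i \<omega>) *\<^sub>R ?v i + u i \<omega> *\<^sub>R ?v i)"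
        proof (rule sum.cong[OF refl])
          fix i assume i: "i \<in> {1..n}"
          have "y i \<omega> = \<beta> \<bullet> x i \<omega> + scalar_prod \<gamma> (w' i \<omega>) + u i \<omega>" using model[OF i sp] ww i by simp
          thus "y i \<omega> *\<^sub>R partial_out n K w x i \<omega>
              = (\<beta> \<bullet> x i \<omega>) *\<^sub>R ?v i + scalar_prod \<gamma> (w' i \<omega>) *\<^sub>R ?v i + u i \<omega> *\<^sub>R ?v i"
            unfolding vh[OF i] by (simp only: scaleR_add_left)
        qed
        thus ?thesis by (simp only: sum.distrib b c add_0_right)
      qed
      have Pinv: "matrix_inv (real n *\<^sub>R Gh \<omega>) = (1 / real n) *\<^sub>R matrix_inv (Gh \<omega>)" "invertible (real n *\<^sub>R Gh \<omega>)"
        using matrix_inv_scaled[OF inv] n_pos by auto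
      have "beta_hat n K w x y \<omega> = \<beta> + (1 / real n) *\<^sub>R (matrix_inv (Gh \<omega>) *v (\<Sum>i=1..n. u i \<omega> *\<^sub>R ?v i))"
        unfolding beta_hat_def P Y matrix_vector_right_distrib
        by (simp only: matrix_vector_mul_assoc matrix_inv_left[OF Pinv(2)] matrix_vector_mul_lid)
          (simp only: Pinv(1) scaleR_matrix_vector_assoc)
      hence "sqrt (real n) *\<^sub>R (beta_hat n K w x y \<omega> - \<beta>)
          = (1 / sqrt (real n)) *\<^sub>R (matrix_inv (Gh \<omega>) *v (\<Sum>i=1..n. u i \<omega> *\<^sub>R ?v i))"
        using n_pos by (simp add: field_simps real_sqrt_mult_self)
      hence "statistic \<omega> = (1 / sqrt (real n)) *\<^sub>R (studentizer \<omega> *v (\<Sum>i=1..n. u i \<omega> *\<^sub>R ?v i))"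
        unfolding statistic_def Omega_n_def G S studentizer_def
        by (simp only: matrix_vector_mult_scaleR matrix_vector_mul_assoc)
      hence "t \<bullet> statistic \<omega> = (1 / sqrt (real n)) * ((t v* studentizer \<omega>) \<bullet> (\<Sum>i=1..n. u i \<omega> *\<^sub>R ?v i))"
        by (simp add: dot_lmul_matrix)
      also have "\<dots> = (\<Sum>i=1..n. weight B \<epsilon> t i \<omega> * u i \<omega>)"
        using \<omega> by (simp add: inner_sum_right weight_def sum_distrib_left sum_divide_distrib mult_ac)
      also have "\<dots> = (\<Sum>i=1..n. weight B \<epsilon> t i \<omega> * (U i \<omega> + R i \<omega>))"
        using u by (intro sum.cong refl) auto
      finally show "t \<bullet> statistic \<omega> = (\<Sum>i=1..n. weight B \<epsilon> t i \<omega> * (U i \<omega> + R i \<omega>))" .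
    qed
  qed
qed

lemma statistic_M: "statistic \<in> borel_measurable M"
proof -
  have p: "(\<lambda>\<omega>. partial_out n K w x i \<omega>) \<in> borel_measurable M" if "i \<in> {1..n}" for i
    by (rule partial_out_M[OF x_meas that])
  have b: "beta_hat n K w x y \<in> borel_measurable M"
    unfolding beta_hat_def[abs_def]
    by (intro borel_measurable_mat_vec_mult borel_measurable_matrix_inv borel_measurable_sum borel_measurable_outer
        borel_measurable_scaleR p y_M)
  have G: "Gamma_hat n K w x \<in> borel_measurable M"
    unfolding Gamma_hat_def[abs_def] by (intro borel_measurable_sum borel_measurable_outer borel_measurable_scaleR borel_measurable_const p)
  have S: "Sigma_n M Ws n K w x y \<in> borel_measurable M"
    unfolding Sigma_n_def[abs_def]
    by (intro borel_measurable_sum borel_measurable_outer borel_measurable_scaleR borel_measurable_const p borel_measurable_cond_exp2)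
  show ?thesis unfolding statistic_def[abs_def] Omega_n_def[abs_def]
    by (intro borel_measurable_mat_vec_mult borel_measurable_inv_sqrt borel_measurable_mat_mult borel_measurable_matrix_inv
        borel_measurable_scaleR borel_measurable_diff borel_measurable_const b G S)
qed

definition remainder_rate :: "real \<Rightarrow> real" where
  "remainder_rate B = sqrt (real n * chi * rhoX) + sqrt ((1 + B) * (real n * (rhoX - rhoW))) + sqrt (real L * (1 + B) * rhoW)"

text \<open>
  The studentizer is random, but bounded on the good event, so the remainder is dominated coordinate by
  coordinate.
\<close>

lemma weighted_R_bound:
  assumes B: "B > 0"
  shows "integrable M (\<lambda>\<omega>. \<Sum>i=1..n. weight B \<epsilon> t i \<omega> * R i \<omega>)"
    and "(\<integral>\<omega>. \<bar>\<Sum>i=1..n. weight B \<epsilon> t i \<omega> * R i \<omega>\<bar> \<partial>M) \<le> 2 * B * norm t * (real CARD('d) * remainder_rate B)"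
proof -
  define D where "D a \<omega> = indicator (W_regular B) \<omega> * ((\<Sum>i=1..n. v_hat i \<omega> $ a * R i \<omega>) / sqrt (real n))" for a \<omega>
  note Db = remainder_bound[OF B, folded D_def remainder_rate_def]
  have le: "\<bar>\<Sum>i=1..n. weight B \<epsilon> t i \<omega> * R i \<omega>\<bar> \<le> 2 * B * norm t * (\<Sum>a\<in>UNIV. \<bar>D a \<omega>\<bar>)" for \<omega>
  proof (cases "\<omega> \<in> good B \<epsilon>")
    case True
    let ?a = "t v* studentizer \<omega>"
    have H: "\<omega> \<in> W_regular B" using True by (simp add: good_def)
    have "(\<Sum>i=1..n. weight B \<epsilon> t i \<omega> * R i \<omega>) = (\<Sum>i=1..n. \<Sum>a\<in>UNIV. ?a $ a * (v_hat i \<omega> $ a * R i \<omega>) / sqrt (real n))"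
      using True by (simp add: weight_def inner_vec_def sum_distrib_right sum_distrib_left sum_divide_distrib mult_ac)
    also have "\<dots> = (\<Sum>a\<in>UNIV. ?a $ a * D a \<omega>)"
      using H by (subst sum.swap) (simp add: D_def sum_distrib_left sum_divide_distrib)
    finally have "\<bar>\<Sum>i=1..n. weight B \<epsilon> t i \<omega> * R i \<omega>\<bar> \<le> (\<Sum>a\<in>UNIV. \<bar>?a $ a\<bar> * \<bar>D a \<omega>\<bar>)"
      by (simp add: abs_mult[symmetric] sum_abs)
    also have "\<dots> \<le> (\<Sum>a\<in>UNIV. 2 * B * norm t * \<bar>D a \<omega>\<bar>)"
      by (intro sum_mono mult_right_mono order_trans[OF component_le_norm_cart studentizer_on_good(3)[OF True B]]) auto
    finally show ?thesis by (simp add: sum_distrib_left)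
  qed (use B in \<open>simp add: weight_def sum_nonneg\<close>)
  have iD: "integrable M (\<lambda>\<omega>. 2 * B * norm t * (\<Sum>a\<in>UNIV. \<bar>D a \<omega>\<bar>))"
    by (intro integrable_mult_right Bochner_Integration.integrable_sum integrable_abs Db(1))
  have RM: "(\<lambda>\<omega>. \<Sum>i=1..n. weight B \<epsilon> t i \<omega> * R i \<omega>) \<in> borel_measurable M"
    by (intro borel_measurable_sum borel_measurable_times Fa_M[OF weight_Fa] borel_measurable_cond_exp2)
  show i: "integrable M (\<lambda>\<omega>. \<Sum>i=1..n. weight B \<epsilon> t i \<omega> * R i \<omega>)"
    by (rule Bochner_Integration.integrable_bound[OF iD RM])
      (use le in \<open>auto intro!: AE_I2 intro: order_trans[OF _ abs_ge_self]\<close>)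
  have "(\<integral>\<omega>. \<bar>\<Sum>i=1..n. weight B \<epsilon> t i \<omega> * R i \<omega>\<bar> \<partial>M) \<le> (\<integral>\<omega>. 2 * B * norm t * (\<Sum>a\<in>UNIV. \<bar>D a \<omega>\<bar>) \<partial>M)"
    by (rule integral_mono[OF integrable_abs[OF i] iD le])
  also have "\<dots> = 2 * B * norm t * (\<Sum>a\<in>UNIV. \<integral>\<omega>. \<bar>D a \<omega>\<bar> \<partial>M)"
  proof -
    have "(\<integral>\<omega>. (\<Sum>a\<in>UNIV. \<bar>D a \<omega>\<bar>) \<partial>M) = (\<Sum>a\<in>UNIV. \<integral>\<omega>. \<bar>D a \<omega>\<bar> \<partial>M)"
      by (rule Bochner_Integration.integral_sum) (intro integrable_abs Db(1))
    thus ?thesis by simp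
  qed
  also have "\<dots> \<le> 2 * B * norm t * (\<Sum>a\<in>(UNIV :: 'd set). remainder_rate B)"
    using B by (intro mult_left_mono sum_mono Db(2)) auto
  finally show "(\<integral>\<omega>. \<bar>\<Sum>i=1..n. weight B \<epsilon> t i \<omega> * R i \<omega>\<bar> \<partial>M) \<le> 2 * B * norm t * (real CARD('d) * remainder_rate B)"
    by simp
qed

text \<open>
  Three comparisons: the statistic with its leading part \<open>X\<close>, the leading part with a Gaussian whose
  variance is \<open>t \<bullet> t\<close> on the good event and zero elsewhere, and the latter with the standard normal.  The
  first costs the remainder and twice the probability of the bad event, the last that probability once.
\<close>

lemma char_statistic_bound:
  fixes t :: "real ^ 'd"
  assumes B: "B > 0" and \<epsilon>: "\<epsilon> > 0"
  defines "\<kappa> \<equiv> 2 * B * (norm t + 1) * \<epsilon>" and "\<tau> \<equiv> t \<bullet> t"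
  shows "cmod ((\<integral>\<omega>. iexp (t \<bullet> statistic \<omega>) \<partial>M) - complex_of_real (exp (- (t \<bullet> t) / 2)))
    \<le> 3 * prob (space M - good B \<epsilon>)
      + (\<kappa> * \<tau> + real L ^ 3 * B\<^sup>2 * \<tau> * \<kappa> + real L * (1 + B) * \<tau> * \<kappa>\<^sup>2)
      + 2 * B * norm t * (real CARD('d) * remainder_rate B)"
proof -
  let ?G = "good B \<epsilon>" and ?c = "weight B \<epsilon> t"
  define X where "X \<omega> = (\<Sum>i=1..n. ?c i \<omega> * U i \<omega>)" for \<omega>
  define Y where "Y \<omega> = (\<Sum>i=1..n. ?c i \<omega> * R i \<omega>)" for \<omega>
  have \<kappa>: "\<kappa> > 0" unfolding \<kappa>_def using B \<epsilon> by (intro mult_pos_pos add_nonneg_pos) auto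
  have GM [measurable]: "?G \<in> sets M" using good_Fa subalgebra_Fa by (auto simp: subalgebra_def)
  have XM [measurable]: "X \<in> borel_measurable M" unfolding X_def[abs_def]
    by (intro borel_measurable_sum borel_measurable_times Fa_M[OF weight_Fa] U_regression_error(1))
  note [measurable] = statistic_M
  note Yb = weighted_R_bound[OF B, of \<epsilon> t, folded Y_def]
  have clt: "cmod (\<integral>\<omega>. iexp (X \<omega>) - complex_of_real (exp (- (\<tau> * indicator ?G \<omega>) / 2)) \<partial>M)
    \<le> \<kappa> * \<tau> + real L ^ 3 * B\<^sup>2 * \<tau> * \<kappa> + real L * (1 + B) * \<tau> * \<kappa>\<^sup>2"
    unfolding X_def
  proof (rule conditional_clt[OF good_Fa _ B weight_Fa])
    show "?G \<subseteq> U_regular B" by (auto simp: good_def)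
    show "\<bar>?c i \<omega>\<bar> \<le> \<kappa>" if "i \<in> {1..n}" for i \<omega> unfolding \<kappa>_def by (rule weight_bound[OF B \<epsilon> that])
    show "?c i \<omega> = 0" if "\<omega> \<notin> ?G" for i \<omega> using that by (simp add: weight_def)
    show "(\<Sum>i=1..n. (?c i \<omega>)\<^sup>2 * sigma2 i \<omega>) = \<tau>" if "\<omega> \<in> ?G" for \<omega> unfolding \<tau>_def by (rule weight_variance[OF that B])
  qed (use \<kappa> in \<open>auto simp: \<tau>_def\<close>)
  have i1: "integrable M (\<lambda>\<omega>. iexp (t \<bullet> statistic \<omega>))" and i2: "integrable M (\<lambda>\<omega>. iexp (X \<omega>))"
    by (rule integrable_const_bound[where B = 1]; simp)+
  have i3: "integrable M (\<lambda>\<omega>. complex_of_real (exp (- (\<tau> * indicator ?G \<omega>) / 2)))"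
    by (rule integrable_const_bound[where B = 1]) (auto simp: \<tau>_def indicator_def)
  have iG: "integrable M (\<lambda>\<omega>. indicator (space M - ?G) \<omega> :: real)"
    by (rule integrable_const_bound[where B = 1]) (auto simp: indicator_def)
  have "cmod (\<integral>\<omega>. iexp (t \<bullet> statistic \<omega>) - iexp (X \<omega>) \<partial>M) \<le> (\<integral>\<omega>. cmod (iexp (t \<bullet> statistic \<omega>) - iexp (X \<omega>)) \<partial>M)"
    by (rule integral_norm_bound)
  also have "\<dots> \<le> (\<integral>\<omega>. 2 * indicator (space M - ?G) \<omega> + \<bar>Y \<omega>\<bar> \<partial>M)"
  proof (rule integral_mono_AE)
    show "AE \<omega> in M. cmod (iexp (t \<bullet> statistic \<omega>) - iexp (X \<omega>)) \<le> 2 * indicator (space M - ?G) \<omega> + \<bar>Y \<omega>\<bar>"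
      using statistic_eq[OF B, of \<epsilon> t] AE_space
    proof eventually_elim
      case (elim \<omega>)
      show ?case
      proof (cases "\<omega> \<in> ?G")
        case True
        have "t \<bullet> statistic \<omega> - X \<omega> = Y \<omega>"
          using elim True by (simp add: X_def Y_def sum.distrib distrib_left)
        thus ?thesis using cmod_iexp_diff_le[of "t \<bullet> statistic \<omega>" "X \<omega>"] True by simp
      next
        case False
        have "cmod (iexp (t \<bullet> statistic \<omega>) - iexp (X \<omega>)) \<le> 1 + 1"
          by (rule order_trans[OF norm_triangle_ineq4]) simp
        thus ?thesis using False elim(2) by simp
      qed
    qed
  qed (use i1 i2 iG Yb(1) in auto)
  also have "\<dots> = 2 * prob (space M - ?G) + (\<integral>\<omega>. \<bar>Y \<omega>\<bar> \<partial>M)" using iG Yb(1) by simp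
  also have "\<dots> \<le> 2 * prob (space M - ?G) + 2 * B * norm t * (real CARD('d) * remainder_rate B)" using Yb(2) by simp
  finally have d1: "cmod (\<integral>\<omega>. iexp (t \<bullet> statistic \<omega>) - iexp (X \<omega>) \<partial>M)
    \<le> 2 * prob (space M - ?G) + 2 * B * norm t * (real CARD('d) * remainder_rate B)" .
  let ?e = "complex_of_real (exp (- (t \<bullet> t) / 2))"
  have "cmod (\<integral>\<omega>. complex_of_real (exp (- (\<tau> * indicator ?G \<omega>) / 2)) - ?e \<partial>M)
     \<le> (\<integral>\<omega>. cmod (complex_of_real (exp (- (\<tau> * indicator ?G \<omega>) / 2)) - ?e) \<partial>M)" by (rule integral_norm_bound)
  also have "\<dots> \<le> (\<integral>\<omega>. indicator (space M - ?G) \<omega> \<partial>M)"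
  proof (rule integral_mono)
    fix \<omega> assume "\<omega> \<in> space M"
    have "1 - ?e = complex_of_real (1 - exp (- (t \<bullet> t) / 2))" by simp
    hence "cmod (1 - ?e) = \<bar>1 - exp (- (t \<bullet> t) / 2)\<bar>" by (simp only: norm_of_real)
    also have "\<dots> \<le> 1" by simp
    finally have "cmod (1 - ?e) \<le> 1" .
    thus "cmod (complex_of_real (exp (- (\<tau> * indicator ?G \<omega>) / 2)) - ?e) \<le> indicator (space M - ?G) \<omega>"
      using \<open>\<omega> \<in> space M\<close> by (cases "\<omega> \<in> ?G") (simp_all add: \<tau>_def)
  qed (use i3 iG in auto)
  also have "\<dots> = prob (space M - ?G)" by simp
  finally have d3: "cmod (\<integral>\<omega>. complex_of_real (exp (- (\<tau> * indicator ?G \<omega>) / 2)) - ?e \<partial>M) \<le> prob (space M - ?G)" .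
  have "(\<integral>\<omega>. iexp (t \<bullet> statistic \<omega>) \<partial>M) - ?e = (\<integral>\<omega>. iexp (t \<bullet> statistic \<omega>) - iexp (X \<omega>) \<partial>M)
      + (\<integral>\<omega>. iexp (X \<omega>) - complex_of_real (exp (- (\<tau> * indicator ?G \<omega>) / 2)) \<partial>M)
      + (\<integral>\<omega>. complex_of_real (exp (- (\<tau> * indicator ?G \<omega>) / 2)) - ?e \<partial>M)"
    using i1 i2 i3 by (simp add: prob_space)
  hence "cmod ((\<integral>\<omega>. iexp (t \<bullet> statistic \<omega>) \<partial>M) - ?e) \<le> cmod (\<integral>\<omega>. iexp (t \<bullet> statistic \<omega>) - iexp (X \<omega>) \<partial>M)
      + cmod (\<integral>\<omega>. iexp (X \<omega>) - complex_of_real (exp (- (\<tau> * indicator ?G \<omega>) / 2)) \<partial>M)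
      + cmod (\<integral>\<omega>. complex_of_real (exp (- (\<tau> * indicator ?G \<omega>) / 2)) - ?e \<partial>M)"
    by (metis (no_types, lifting) norm_triangle_ineq norm_triangle_mono order_refl)
  thus ?thesis using d1 clt d3 by linarith
qed

end

context regression_sample
begin

text \<open>
  The event with positive least eigenvalue need not be known to be measurable: an inclusion into a
  measurable event suffices for the inequality.
\<close>

lemma prob_singular_gram:
  "prob {\<omega> \<in> space M. det (gram n K w \<omega>) = 0} \<le> 1 - prob {\<omega> \<in> space M. 0 < lambda_min_mat (gram n K w \<omega>)}"
proof -
  let ?D = "{\<omega> \<in> space M. det (gram n K w \<omega>) = 0}"
  have D: "?D \<in> sets M" using borel_measurable_det_gram[OF w_dim w_meas] by (intro borel_measurable_eq) auto
  have "{\<omega> \<in> space M. 0 < lambda_min_mat (gram n K w \<omega>)} \<subseteq> space M - ?D"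
  proof
    fix \<omega> assume "\<omega> \<in> {\<omega> \<in> space M. 0 < lambda_min_mat (gram n K w \<omega>)}"
    thus "\<omega> \<in> space M - ?D"
      using det_gram_nonzero[of n K w \<omega>] det_gram_zero_dim[of n w \<omega>] by (cases "K = 0") auto
  qed
  hence "prob {\<omega> \<in> space M. 0 < lambda_min_mat (gram n K w \<omega>)} \<le> prob (space M - ?D)"
    by (rule finite_measure_mono) (use D in auto)
  thus ?thesis using prob_compl[OF D] by simp
qed

lemma characteristic_function_error:
  fixes t :: "real ^ 'd"
  assumes B: "B > 0" and \<epsilon>: "\<epsilon> > 0"
  shows "cmod ((\<integral>\<omega>. iexp (t \<bullet> (inv_sqrt (Omega_n M Ws n K w x y \<omega>) *v (sqrt (real n) *\<^sub>R (beta_hat n K w x y \<omega> - \<beta>)))) \<partial>M)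
        - complex_of_real (exp (- (t \<bullet> t) / 2)))
    \<le> 3 * (prob {\<omega> \<in> space M. C_bound M Ws n K w x y \<omega> > ennreal B}
        + (1 - prob {\<omega> \<in> space M. 0 < lambda_min_mat (gram n K w \<omega>)})
        + prob {\<omega> \<in> space M. \<bar>(MAX i\<in>{1..n}. norm (partial_out n K w x i \<omega>)) / sqrt (real n)\<bar> > \<epsilon>}
        + gamma_fail B)
      + ((2 * B * (norm t + 1) * \<epsilon>) * (t \<bullet> t) + real L ^ 3 * B\<^sup>2 * (t \<bullet> t) * (2 * B * (norm t + 1) * \<epsilon>)
        + real L * (1 + B) * (t \<bullet> t) * (2 * B * (norm t + 1) * \<epsilon>)\<^sup>2)
      + 2 * B * norm t * (real CARD('d) * remainder_rate B)"
  by (rule order_trans[OF char_statistic_bound[OF B \<epsilon>, of t, unfolded statistic_def]],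
      intro add_right_mono mult_left_mono order_trans[OF prob_not_good[OF B \<epsilon>]] add_left_mono prob_singular_gram) simp

end

section \<open>The limit\<close>

lemma null_sequence_between:
  fixes f s :: "nat \<Rightarrow> real"
  assumes "s \<longlonglongrightarrow> 0" "eventually (\<lambda>n. 0 \<le> f n \<and> f n \<le> s n) sequentially"
  shows "f \<longlonglongrightarrow> 0"
  by (rule tendsto_sandwich[OF _ _ tendsto_const assms(1)]) (use assms(2) in \<open>auto elim: eventually_mono\<close>)

theorem theorem1:
  fixes M :: "nat \<Rightarrow> 'a measure"
    and K :: "nat \<Rightarrow> nat"
    and y u :: "nat \<Rightarrow> nat \<Rightarrow> 'a \<Rightarrow> real"
    and x :: "nat \<Rightarrow> nat \<Rightarrow> 'a \<Rightarrow> real ^ 'd"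
    and w :: "nat \<Rightarrow> nat \<Rightarrow> 'a \<Rightarrow> real Matrix.vec"
    and \<beta> :: "real ^ 'd"
    and \<gamma> :: "nat \<Rightarrow> real Matrix.vec"
    and Ws :: "nat \<Rightarrow> ('a \<Rightarrow> real) set"
    and N :: "nat \<Rightarrow> nat"
    and T :: "nat \<Rightarrow> nat \<Rightarrow> nat set"
  assumes prob: "\<And>n. prob_space (M n)"
    and x_meas: "\<And>n i. i \<in> {1..n} \<Longrightarrow> x n i \<in> borel_measurable (M n)"
    and u_meas: "\<And>n i. i \<in> {1..n} \<Longrightarrow> u n i \<in> borel_measurable (M n)"
    and w_dim: "\<And>n i \<omega>. i \<in> {1..n} \<Longrightarrow> \<omega> \<in> space (M n) \<Longrightarrow> w n i \<omega> \<in> carrier_vec (K n)"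
    and w_meas: "\<And>n i k. i \<in> {1..n} \<Longrightarrow> k < K n \<Longrightarrow>
          (\<lambda>\<omega>. vec_index (w n i \<omega>) k) \<in> borel_measurable (M n)"
    and gamma_dim: "\<And>n. \<gamma> n \<in> carrier_vec (K n)"
    and model: "\<And>n i \<omega>. i \<in> {1..n} \<Longrightarrow> \<omega> \<in> space (M n) \<Longrightarrow>
          y n i \<omega> = \<beta> \<bullet> x n i \<omega> + scalar_prod (\<gamma> n) (w n i \<omega>) + u n i \<omega>"
    and x_moment: "\<And>n i. i \<in> {1..n} \<Longrightarrow> integrable (M n) (\<lambda>\<omega>. (norm (x n i \<omega>))\<^sup>2)"
    and w_moment: "\<And>n i k. i \<in> {1..n} \<Longrightarrow> k < K n \<Longrightarrow>
          integrable (M n) (\<lambda>\<omega>. (vec_index (w n i \<omega>) k)\<^sup>2)"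
    and u_moment: "\<And>n i. i \<in> {1..n} \<Longrightarrow> integrable (M n) (\<lambda>\<omega>. (u n i \<omega>)\<^sup>2)"
    and pop_inv: "\<And>n. n \<ge> 1 \<Longrightarrow> invertible_mat (pop_gram (M n) n (K n) (w n))"
    and Ws_meas: "\<And>n. Ws n \<subseteq> borel_measurable (M n)"
    and Ws_w: "\<And>n i k. i \<in> {1..n} \<Longrightarrow> k < K n \<Longrightarrow>
          AE \<omega> in M n. real_cond_exp (M n) (W_algebra (M n) (Ws n))
                         (\<lambda>\<omega>. vec_index (w n i \<omega>) k) \<omega> = vec_index (w n i \<omega>) k"
    and sampling_cov: "\<And>n i j. i \<in> {1..n} \<Longrightarrow> j \<in> {1..n} \<Longrightarrow> i \<noteq> j \<Longrightarrow>
          AE \<omega> in M n. cond_cov (M n) (XW_algebra (M n) (Ws n) n (x n))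
             (U_err (M n) (Ws n) n (x n) (y n) i) (U_err (M n) (Ws n) n (x n) (y n) j) \<omega> = 0"
    and sampling_partition: "\<And>n. n \<ge> 1 \<Longrightarrow>
          partition_on {1..n} (T n ` {1..N n}) \<and> inj_on (T n) {1..N n}"
    and sampling_indep: "\<And>n. n \<ge> 1 \<Longrightarrow>
          cond_indep_sets (M n) (W_algebra (M n) (Ws n))
            (\<lambda>i. cluster_events (M n) (Ws n) n (x n) (y n) (T n i)) {1..N n}"
    and sampling_size: "(\<lambda>n. real (MAX i\<in>{1..N n}. card (T n i))) \<in> O(\<lambda>_. 1)"
    and design_rank:
          "(\<lambda>n. measure (M n) {\<omega> \<in> space (M n). 0 < lambda_min_mat (gram n (K n) (w n) \<omega>)})
             \<longlonglongrightarrow> 1"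
    and design_dim: "limsup (\<lambda>n. ereal (real (K n) / real n)) < 1"
    and design_C: "bounded_in_prob M (\<lambda>n. C_bound (M n) (Ws n) n (K n) (w n) (x n) (y n))"
    and approx_chi: "(\<lambda>n. chi_W (M n) (Ws n) n (K n) (w n) (x n)) \<in> O(\<lambda>_. 1)"
    and approx_rho:
          "(\<lambda>n. rho_XW (M n) (Ws n) n (x n) (u n)
              + real n * (rho_XW (M n) (Ws n) n (x n) (u n) - rho_W (M n) (Ws n) n (u n))
              + real n * chi_W (M n) (Ws n) n (K n) (w n) (x n)
                       * rho_XW (M n) (Ws n) n (x n) (u n)) \<in> o(\<lambda>_. 1)"
    and approx_max: "vanishes_in_prob M
          (\<lambda>n \<omega>. (MAX i\<in>{1..n}. norm (partial_out n (K n) (w n) (x n) i \<omega>)) / sqrt (real n))"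
  shows "weak_conv_vec
           (\<lambda>n. distr (M n) borel
              (\<lambda>\<omega>. inv_sqrt (Omega_n (M n) (Ws n) n (K n) (w n) (x n) (y n) \<omega>) *v
                 (sqrt (real n) *\<^sub>R (beta_hat n (K n) (w n) (x n) (y n) \<omega> - \<beta>))))
           std_normal_vec"
proof -
  define Z where "Z n \<omega> = inv_sqrt (Omega_n (M n) (Ws n) n (K n) (w n) (x n) (y n) \<omega>) *v
      (sqrt (real n) *\<^sub>R (beta_hat n (K n) (w n) (x n) (y n) \<omega> - \<beta>))" for n \<omega>
  have sample: "regression_sample (M n) n (K n) (N n) L (x n) (y n) (u n) (w n) \<beta> (\<gamma> n) (Ws n) (T n)"
    if "n \<ge> 1" "(MAX i\<in>{1..N n}. card (T n i)) \<le> L" for n L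
  proof -
    interpret prob_space "M n" by (rule prob)
    show ?thesis
    proof unfold_locales
      show "partition_on {1..n} (T n ` {1..N n})" "inj_on (T n) {1..N n}"
        using sampling_partition[OF that(1)] by blast+
      show "card (T n i) \<le> L" if "i \<in> {1..N n}" for i
        by (rule order_trans[OF Max_ge \<open>(MAX i\<in>{1..N n}. card (T n i)) \<le> L\<close>]) (use that in auto)
    qed (fact that(1) x_meas u_meas w_dim w_meas gamma_dim model x_moment w_moment u_moment Ws_meas Ws_w sampling_cov
        sampling_indep[OF that(1)])+
  qed
  have ZM: "Z n \<in> borel_measurable (M n)" for n
  proof (cases "n \<ge> 1")
    case True
    interpret regression_sample "M n" n "K n" "N n" "MAX i\<in>{1..N n}. card (T n i)" "x n" "y n" "u n" "w n" \<beta> "\<gamma> n" "Ws n" "T n"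
      by (rule sample[OF True]) simp
    show ?thesis using statistic_M unfolding statistic_def[abs_def] Z_def[abs_def] .
  next
    case False
    \<comment> \<open>The factor \<open>sqrt n\<close> annihilates everything.\<close>
    hence "n = 0" by simp
    thus ?thesis unfolding Z_def[abs_def] by simp
  qed
  obtain C where C: "eventually (\<lambda>n. norm (real (MAX i\<in>{1..N n}. card (T n i))) \<le> C * norm (1::real)) sequentially"
    using sampling_size by (auto elim: landau_o.bigE)
  define L where "L = nat \<lceil>C\<rceil>"
  have good: "eventually (\<lambda>n. regression_sample (M n) n (K n) (N n) L (x n) (y n) (u n) (w n) \<beta> (\<gamma> n) (Ws n) (T n)) sequentially"
    using C eventually_ge_at_top[of 1]
  proof eventually_elim
    case (elim n)
    hence "real (MAX i\<in>{1..N n}. card (T n i)) \<le> C" by simp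
    hence "(MAX i\<in>{1..N n}. card (T n i)) \<le> L" unfolding L_def by linarith
    thus ?case by (rule sample[OF elim(2)])
  qed
  define chi where "chi n = chi_W (M n) (Ws n) n (K n) (w n) (x n)" for n
  define rX where "rX n = rho_XW (M n) (Ws n) n (x n) (u n)" for n
  define rW where "rW n = rho_W (M n) (Ws n) n (u n)" for n
  have nonneg: "eventually (\<lambda>n. 0 \<le> rW n \<and> rW n \<le> rX n \<and> 0 \<le> chi n) sequentially"
    using good
  proof eventually_elim
    case (elim n)
    then interpret regression_sample "M n" n "K n" "N n" L "x n" "y n" "u n" "w n" \<beta> "\<gamma> n" "Ws n" "T n" .
    show ?case using nonneg_parameters by (simp add: chi_def rX_def rW_def)
  qed
  let ?s = "\<lambda>n. rX n + real n * (rX n - rW n) + real n * chi n * rX n"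
  have s: "?s \<longlonglongrightarrow> 0" using smalloD_tendsto[OF approx_rho] by (simp add: chi_def rX_def rW_def)
  have parts: "eventually (\<lambda>n. 0 \<le> real n * (rX n - rW n) \<and> 0 \<le> real n * chi n * rX n) sequentially"
    using nonneg by eventually_elim auto
  have rX0: "rX \<longlonglongrightarrow> 0"
    by (rule null_sequence_between[OF s]) (use nonneg parts in eventually_elim, auto)
  have rW0: "rW \<longlonglongrightarrow> 0"
    by (rule null_sequence_between[OF rX0]) (use nonneg in eventually_elim, auto)
  have rd0: "(\<lambda>n. real n * (rX n - rW n)) \<longlonglongrightarrow> 0"
    by (rule null_sequence_between[OF s]) (use nonneg parts in eventually_elim, auto)
  have rc0: "(\<lambda>n. real n * chi n * rX n) \<longlonglongrightarrow> 0"
    by (rule null_sequence_between[OF s]) (use nonneg parts in eventually_elim, auto)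
  have chi0: "(\<lambda>n. chi n / real n) \<longlonglongrightarrow> 0"
  proof -
    obtain c where c: "eventually (\<lambda>n. norm (chi n) \<le> c * norm (1::real)) sequentially"
      using approx_chi by (auto simp: chi_def elim: landau_o.bigE)
    have "(\<lambda>n. c * (1 / real n)) \<longlonglongrightarrow> c * 0" by (intro tendsto_mult tendsto_const lim_1_over_n)
    hence c0: "(\<lambda>n. c / real n) \<longlonglongrightarrow> 0" by simp
    show ?thesis
      by (rule null_sequence_between[OF c0]) (use c nonneg in eventually_elim, auto intro: divide_right_mono)
  qed
  have cf: "(\<lambda>n. \<integral>\<omega>. iexp (t \<bullet> Z n \<omega>) \<partial>M n) \<longlonglongrightarrow> complex_of_real (exp (- (t \<bullet> t) / 2))" for t
  proof (rule tendstoI)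
    fix e :: real assume e: "e > 0"
    define \<phi> where "\<phi> B \<epsilon> = (2 * B * (norm t + 1) * \<epsilon>) * (t \<bullet> t) + real L ^ 3 * B\<^sup>2 * (t \<bullet> t) * (2 * B * (norm t + 1) * \<epsilon>)
        + real L * (1 + B) * (t \<bullet> t) * (2 * B * (norm t + 1) * \<epsilon>)\<^sup>2" for B \<epsilon>
    obtain B0 where B0: "eventually (\<lambda>n. measure (M n) {\<omega> \<in> space (M n). C_bound (M n) (Ws n) n (K n) (w n) (x n) (y n) \<omega> > ennreal B0} < e / 12) sequentially"
      using design_C[unfolded bounded_in_prob_def, rule_format, of "e / 12"] e by auto
    \<comment> \<open>The bounds require a positive constant; enlarging \<open>B0\<close> only shrinks the event.\<close>
    define B where "B = max B0 1"
    have B: "B > 0" by (simp add: B_def)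
    have "(\<phi> B \<longlongrightarrow> \<phi> B 0) (at_right 0)"
      unfolding \<phi>_def by (intro tendsto_intros)
    hence "(\<phi> B \<longlongrightarrow> 0) (at_right 0)" by (simp add: \<phi>_def)
    hence "eventually (\<lambda>\<epsilon>. \<phi> B \<epsilon> < e / 4) (at_right 0)" using e by (intro order_tendstoD) auto
    then obtain b where b: "b > 0" "\<And>\<epsilon>. 0 < \<epsilon> \<Longrightarrow> \<epsilon> < b \<Longrightarrow> \<phi> B \<epsilon> < e / 4"
      unfolding eventually_at_right_field by auto
    \<comment> \<open>With \<open>B\<close> fixed, the tolerance for the residuals is chosen to make the error of the central limit bound small.\<close>
    define \<epsilon> where "\<epsilon> = b / 2"
    have \<epsilon>: "\<epsilon> > 0" "\<phi> B \<epsilon> < e / 4" using b by (auto simp: \<epsilon>_def)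
    define d where "d = real CARD('d)"
    define p where "p n = 1 - measure (M n) {\<omega> \<in> space (M n). 0 < lambda_min_mat (gram n (K n) (w n) \<omega>)}" for n
    define h where "h n = measure (M n) {\<omega> \<in> space (M n).
      \<bar>(MAX i\<in>{1..n}. norm (partial_out n (K n) (w n) (x n) i \<omega>)) / sqrt (real n)\<bar> > \<epsilon>}" for n
    define g where "g n = d\<^sup>2 * ((30 * (real L * (1 + B))\<^sup>2 + real L * (1 + B) * chi n) * (6 * B * d)\<^sup>2) / real n" for n
    define f where "f n = sqrt (real n * chi n * rX n) + sqrt ((1 + B) * (real n * (rX n - rW n))) + sqrt (real L * (1 + B) * rW n)" for n
    have p0: "p \<longlonglongrightarrow> 0" unfolding p_def using tendsto_diff[OF tendsto_const design_rank, of 1] by simp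
    have h0: "h \<longlonglongrightarrow> 0" using approx_max \<epsilon> unfolding h_def vanishes_in_prob_def by blast
    have g0: "g \<longlonglongrightarrow> 0"
    proof -
      have "g = (\<lambda>n. d\<^sup>2 * (6 * B * d)\<^sup>2 * (30 * (real L * (1 + B))\<^sup>2) * (1 / real n) + d\<^sup>2 * (6 * B * d)\<^sup>2 * (real L * (1 + B)) * (chi n / real n))"
        unfolding g_def by (intro ext) (simp add: distrib_left distrib_right add_divide_distrib mult_ac)
      moreover have "\<dots> \<longlonglongrightarrow> d\<^sup>2 * (6 * B * d)\<^sup>2 * (30 * (real L * (1 + B))\<^sup>2) * 0 + d\<^sup>2 * (6 * B * d)\<^sup>2 * (real L * (1 + B)) * 0"
        by (intro tendsto_intros lim_1_over_n chi0)
      ultimately show ?thesis by simp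
    qed
    have f0: "f \<longlonglongrightarrow> 0"
    proof -
      have "f \<longlonglongrightarrow> sqrt 0 + sqrt ((1 + B) * 0) + sqrt (real L * (1 + B) * 0)"
        unfolding f_def by (intro tendsto_add tendsto_real_sqrt tendsto_mult tendsto_const rc0 rd0 rW0)
      thus ?thesis by simp
    qed
    have "(\<lambda>n. 3 * (p n + h n + g n) + 2 * B * norm t * (d * f n)) \<longlonglongrightarrow> 3 * (0 + 0 + 0) + 2 * B * norm t * (d * 0)"
      by (intro tendsto_intros p0 h0 g0 f0)
    hence "(\<lambda>n. 3 * (p n + h n + g n) + 2 * B * norm t * (d * f n)) \<longlonglongrightarrow> 0" by simp
    hence "eventually (\<lambda>n. 3 * (p n + h n + g n) + 2 * B * norm t * (d * f n) < e / 4) sequentially"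
      using e by (intro order_tendstoD) auto
    thus "eventually (\<lambda>n. dist (\<integral>\<omega>. iexp (t \<bullet> Z n \<omega>) \<partial>M n) (complex_of_real (exp (- (t \<bullet> t) / 2))) < e) sequentially"
      using good B0
    proof eventually_elim
      case (elim n)
      interpret regression_sample "M n" n "K n" "N n" L "x n" "y n" "u n" "w n" \<beta> "\<gamma> n" "Ws n" "T n" by (rule elim(2))
      have "prob {\<omega> \<in> space (M n). C_bound (M n) (Ws n) n (K n) (w n) (x n) (y n) \<omega> > ennreal B}
          \<le> prob {\<omega> \<in> space (M n). C_bound (M n) (Ws n) n (K n) (w n) (x n) (y n) \<omega> > ennreal B0}"
      proof (rule finite_measure_mono)
        show "{\<omega> \<in> space (M n). C_bound (M n) (Ws n) n (K n) (w n) (x n) (y n) \<omega> > ennreal B}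
            \<subseteq> {\<omega> \<in> space (M n). C_bound (M n) (Ws n) n (K n) (w n) (x n) (y n) \<omega> > ennreal B0}"
          by (auto intro: le_less_trans[OF ennreal_leI[of B0 B]] simp: B_def)
      qed (use C_bound_M in \<open>intro borel_measurable_less, auto\<close>)
      hence C: "prob {\<omega> \<in> space (M n). C_bound (M n) (Ws n) n (K n) (w n) (x n) (y n) \<omega> > ennreal B} < e / 12"
        using elim(3) by linarith
      have gf: "gamma_fail B = g n" by (simp add: gamma_fail_def g_def d_def chi_def)
      have rr: "remainder_rate B = f n" by (simp add: remainder_rate_def f_def chi_def rX_def rW_def)
      have arith: "c < e" if "c \<le> 3 * (P + p1 + h1 + g1) + q + r" "P < e / 12" "3 * (p1 + h1 + g1) + r < e / 4" "q < e / 4"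
        for c P p1 h1 g1 q r :: real
        using that e by (simp add: distrib_left)
      have "cmod ((\<integral>\<omega>. iexp (t \<bullet> Z n \<omega>) \<partial>M n) - complex_of_real (exp (- (t \<bullet> t) / 2))) < e"
        using characteristic_function_error[OF B \<epsilon>(1), of t, folded Z_def p_def h_def d_def \<phi>_def, unfolded gf rr]
          C elim(1) \<epsilon>(2) by (rule arith)
      thus ?case by (simp only: dist_norm)
    qed
  qed
  have "weak_conv_vec (\<lambda>n. distr (M n) borel (Z n)) std_normal_vec"
  proof (rule levy_continuity_vec)
    show "prob_space (distr (M n) borel (Z n))" for n
      by (rule prob_space.prob_space_distr[OF prob ZM])
    show "(\<lambda>n. CLINT z|distr (M n) borel (Z n). iexp (t \<bullet> z)) \<longlonglongrightarrow> (CLINT z|std_normal_vec. iexp (t \<bullet> z))" for t :: "real ^ 'd"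
    proof -
      have "(CLINT z|distr (M n) borel (Z n). iexp (t \<bullet> z)) = (\<integral>\<omega>. iexp (t \<bullet> Z n \<omega>) \<partial>M n)" for n
        by (rule integral_distr[OF ZM]) measurable
      thus ?thesis using cf[of t] unfolding char_std_normal_vec by simp
    qed
  qed (use prob_space_std_normal_vec in auto)
  thus ?thesis unfolding Z_def .
qed

end
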